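(* Suppose $\mathbf u_0\in J(D)$, and let $\{\mathbf w,q\}$ be a weak solution of the incompressible problem (S) with initial velocity $\mathbf w_0=\mathbf u_0$ such that $\mathbf w\in L^2(0,T;H_0^1(D)^d)$ with $\mathbf w_t\in L^2(0,T;H^{-1}(D)^d)$, $q\in W^{1,2}(0,T;L^2(D))$, and $$\int_Dq(t)\,dx=\int_Dp_0\,dx\quad\text{for a.e. }t\in[0,T].$$ Let $\{\mathbf u_\alpha,p_\alpha\}$ ($0<\alpha<1$) be the weak solutions of the compressible problem (C$_\alpha$). Then $p_\alpha\overset{*}{\rightharpoonup}q$ weakly-* in $L^\infty(0,T;L^2(D))$ as $\alpha\to0$.
   Context: $D\subset\mathbb R^d$ ($d\ge2$) is a bounded domain with piecewise smooth boundary, $T>0$, $Q_T=D\times(0,T)$. Constants $\rho_0>0$, $\mu>0$, $\eta\ge0$ fixed; $\alpha>0$ is the compressibility factor. Data: $\mathbf f\in L^\infty(Q_T)^d$, $\mathbf u_0\in L^2(D)^d$, $p_0\in L^2(D)$. $J(D)$ is the closure in $L^2(D)^d$ of $\{\mathbf u\in C_0^\infty(D)^d:\operatorname{div}\mathbf u=0\}$, $V(D)$ its closure in $H_0^1(D)^d$. $H^{-1}(D)^d$ is the dual of $H_0^1(D)^d$. Notation: $(\cdot,\cdot)$ the $L^2(D)$ inner product, $((\mathbf u,\mathbf v))=\int_D\partial_iu_k\partial_iv_k\,dx$. Weak solution of (C$_\alpha$): a pair $\{\mathbf u,p\}\in L^2(0,T;H_0^1(D)^d)\times L^2(0,T;L^2(D))$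 such that for all $\varphi\in C_0^\infty([0,T))$, $\mathbf v\in H_0^1(D)^d$, $r\in L^2(D)$: $-\int_0^T(\alpha p,r)\varphi_t\,dt-(\alpha p_0,r)\varphi(0)+\int_0^T(\rho_0\operatorname{div}\mathbf u,r)\varphi\,dt=0$ and $-\int_0^T\rho_0(\mathbf u,\mathbf v)\varphi_t\,dt-\rho_0(\mathbf u_0,\mathbf v)\varphi(0)-\int_0^T(p,\operatorname{div}\mathbf v)\varphi\,dt=-\mu\int_0^T((\mathbf u,\mathbf v))\varphi\,dt-\eta\int_0^T(\operatorname{div}\mathbf u,\operatorname{div}\mathbf v)\varphi\,dt+\int_0^T((\rho_0+\alpha p)\mathbf f,\mathbf v)\varphi\,dt$ (this is the weak form of $\alpha p_t+\rho_0\operatorname{div}\mathbf u=0$, $\rho_0\mathbf u_t+\nabla p=\mu\Delta\mathbf u+\eta\nabla\operatorname{div}\mathbf u+(\rho_0+\alpha p)\mathbf f$, $\mathbf u|_{\partial D}=0$, $\mathbf u(0)=\mathbf u_0$, $p(0)=p_0$); it exists and is unique. Weak solution of (S) with initial velocity $\mathbf w_0\in J(D)$: a pair $\{\mathbf w,q\}\in L^2(0,T;V(D))\times\mathcal D'(Q_T)$ such that $\operatorname{div}\mathbf w=0$ and $\rho_0\mathbf w_t+\nabla q=\mu\Delta\mathbf w+\rho_0\mathbf f$ hold in $\mathcal D'(Q_T)$ and for all $\varphi\in C_0^\infty([0,T))$, $\mathbf v\in V(D)$: $-\int_0^T\rho_0(\mathbf w,\mathbf v)\varphi_t\,dt-\rho_0(\mathbf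 w_0,\mathbf v)\varphi(0)=-\mu\int_0^T((\mathbf w,\mathbf v))\varphi\,dt+\int_0^T(\rho_0\mathbf f,\mathbf v)\varphi\,dt$. *)

theory Defs
  imports "HOL-Analysis.Analysis"
begin

definition dd :: "'a::euclidean_space \<Rightarrow> ('a \<Rightarrow> 'b::real_normed_vector) \<Rightarrow> 'a \<Rightarrow> 'b" where
  "dd e f = (\<lambda>z. frechet_derivative f (at z) e)"

fun Ck :: "nat \<Rightarrow> ('a::euclidean_space \<Rightarrow> 'b::real_normed_vector) \<Rightarrow> bool" where
  "Ck 0 f = continuous_on UNIV f"
| "Ck (Suc k) f = (continuous_on UNIV f \<and> (\<forall>z. f differentiable (at z)) \<and>
                   (\<forall>b\<in>Basis. Ck k (dd b f)))"

definition smooth :: "('a::euclidean_space \<Rightarrow> 'b::real_normed_vector) \<Rightarrow> bool" where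
  "smooth f = (\<forall>k. Ck k f)"

definition test_on :: "'a::euclidean_space set \<Rightarrow> ('a \<Rightarrow> 'b::real_normed_vector) \<Rightarrow> bool" where
  "test_on U \<phi> = (smooth \<phi> \<and> compact (closure {z. \<phi> z \<noteq> 0}) \<and> closure {z. \<phi> z \<noteq> 0} \<subseteq> U)"

text \<open>C_0^infinity([0,T)): smooth functions (restricted to [0,T]) vanishing near T.\<close>
definition test0T :: "real \<Rightarrow> (real \<Rightarrow> real) \<Rightarrow> bool" where
  "test0T T \<phi> = (smooth \<phi> \<and> (\<exists>\<epsilon>>0. \<forall>t\<ge>T - \<epsilon>. \<phi> t = 0))"

definition pdx :: "'n::finite \<Rightarrow> (real^'n \<Rightarrow> 'b::real_normed_vector) \<Rightarrow> real^'n \<Rightarrow> 'b" where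
  "pdx i f = dd (axis i 1) f"

definition gradv :: "(real^'n::finite \<Rightarrow> real^'n) \<Rightarrow> real^'n \<Rightarrow> real^'n^'n" where
  "gradv u x = (\<chi> k i. pdx i u x $ k)"

definition divv :: "(real^'n::finite \<Rightarrow> real^'n) \<Rightarrow> real^'n \<Rightarrow> real" where
  "divv u x = (\<Sum>i\<in>UNIV. pdx i u x $ i)"

text \<open>Divergence read off a gradient matrix (trace).\<close>
definition trG :: "real^'n::finite^'n \<Rightarrow> real" where
  "trG G = (\<Sum>i\<in>UNIV. G $ i $ i)"

definition L2D :: "(real^'n::finite) set \<Rightarrow> (real^'n \<Rightarrow> 'b::real_normed_vector) \<Rightarrow> bool" where
  "L2D D u = (u \<in> borel_measurable lborel \<and> set_integrable lborel D (\<lambda>x. (norm (u x))^2))"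

definition ipD :: "(real^'n::finite) set \<Rightarrow> (real^'n \<Rightarrow> 'b::real_inner) \<Rightarrow> (real^'n \<Rightarrow> 'b) \<Rightarrow> real" where
  "ipD D u v = (LINT x:D|lborel. inner (u x) (v x))"

definition distD :: "(real^'n::finite) set \<Rightarrow> (real^'n \<Rightarrow> 'b::real_normed_vector) \<Rightarrow> (real^'n \<Rightarrow> 'b) \<Rightarrow> real" where
  "distD D u v = (LINT x:D|lborel. (norm (u x - v x))^2)"

definition H01 :: "(real^'n::finite) set \<Rightarrow> (real^'n \<Rightarrow> real^'n) \<Rightarrow> (real^'n \<Rightarrow> real^'n^'n) \<Rightarrow> bool" where
  "H01 D u G = (L2D D u \<and> L2D D G \<and>
     (\<exists>\<phi>::nat \<Rightarrow> real^'n \<Rightarrow> real^'n. (\<forall>k. test_on D (\<phi> k)) \<and>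
        (\<lambda>k. distD D (\<phi> k) u) \<longlonglongrightarrow> 0 \<and> (\<lambda>k. distD D (gradv (\<phi> k)) G) \<longlonglongrightarrow> 0))"

definition Vsp :: "(real^'n::finite) set \<Rightarrow> (real^'n \<Rightarrow> real^'n) \<Rightarrow> (real^'n \<Rightarrow> real^'n^'n) \<Rightarrow> bool" where
  "Vsp D u G = (L2D D u \<and> L2D D G \<and>
     (\<exists>\<phi>::nat \<Rightarrow> real^'n \<Rightarrow> real^'n. (\<forall>k. test_on D (\<phi> k) \<and> (\<forall>x. divv (\<phi> k) x = 0)) \<and>
        (\<lambda>k. distD D (\<phi> k) u) \<longlonglongrightarrow> 0 \<and> (\<lambda>k. distD D (gradv (\<phi> k)) G) \<longlonglongrightarrow> 0))"

definition Jsp :: "(real^'n::finite) set \<Rightarrow> (real^'n \<Rightarrow> real^'n) \<Rightarrow> bool" where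
  "Jsp D u = (L2D D u \<and>
     (\<exists>\<phi>::nat \<Rightarrow> real^'n \<Rightarrow> real^'n. (\<forall>k. test_on D (\<phi> k) \<and> (\<forall>x. divv (\<phi> k) x = 0)) \<and>
        (\<lambda>k. distD D (\<phi> k) u) \<longlonglongrightarrow> 0))"

abbreviation QT :: "(real^'n::finite) set \<Rightarrow> real \<Rightarrow> ((real^'n) \<times> real) set" where
  "QT D T \<equiv> D \<times> {0<..<T}"

abbreviation mQ :: "((real^'n::finite) \<times> real) measure" where
  "mQ \<equiv> lborel \<Otimes>\<^sub>M lborel"

definition intQ :: "(real^'n::finite) set \<Rightarrow> real \<Rightarrow> (real^'n \<Rightarrow> real \<Rightarrow> real) \<Rightarrow> real" where
  "intQ D T g = set_lebesgue_integral mQ (QT D T) (\<lambda>(x,t). g x t)"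

definition L2Q :: "(real^'n::finite) set \<Rightarrow> real \<Rightarrow> (real^'n \<Rightarrow> real \<Rightarrow> 'b::real_normed_vector) \<Rightarrow> bool" where
  "L2Q D T u = ((\<lambda>(x,t). u x t) \<in> borel_measurable mQ \<and>
                set_integrable mQ (QT D T) (\<lambda>(x,t). (norm (u x t))^2))"

definition LinfQ :: "(real^'n::finite) set \<Rightarrow> real \<Rightarrow> (real^'n \<Rightarrow> real \<Rightarrow> 'b::real_normed_vector) \<Rightarrow> bool" where
  "LinfQ D T u = ((\<lambda>(x,t). u x t) \<in> borel_measurable mQ \<and>
                (\<exists>M. AE z in mQ. z \<in> QT D T \<longrightarrow> norm (case_prod u z) \<le> M))"

definition L2H01 :: "(real^'n::finite) set \<Rightarrow> real \<Rightarrow> (real^'n \<Rightarrow> real \<Rightarrow> real^'n) \<Rightarrow> (real^'n \<Rightarrow> real \<Rightarrow> real^'n^'n) \<Rightarrow> bool" where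
  "L2H01 D T u G = (L2Q D T u \<and> L2Q D T G \<and>
     (AE t in lborel. t \<in> {0<..<T} \<longrightarrow> H01 D (\<lambda>x. u x t) (\<lambda>x. G x t)))"

definition L2V :: "(real^'n::finite) set \<Rightarrow> real \<Rightarrow> (real^'n \<Rightarrow> real \<Rightarrow> real^'n) \<Rightarrow> (real^'n \<Rightarrow> real \<Rightarrow> real^'n^'n) \<Rightarrow> bool" where
  "L2V D T u G = (L2Q D T u \<and> L2Q D T G \<and>
     (AE t in lborel. t \<in> {0<..<T} \<longrightarrow> Vsp D (\<lambda>x. u x t) (\<lambda>x. G x t)))"

definition LinfL2 :: "(real^'n::finite) set \<Rightarrow> real \<Rightarrow> (real^'n \<Rightarrow> real \<Rightarrow> real) \<Rightarrow> bool" where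
  "LinfL2 D T g = ((\<lambda>(x,t). g x t) \<in> borel_measurable mQ \<and>
     (\<exists>M. AE t in lborel. t \<in> {0<..<T} \<longrightarrow> L2D D (\<lambda>x. g x t) \<and> (LINT x:D|lborel. (g x t)^2) \<le> M))"

definition L1L2 :: "(real^'n::finite) set \<Rightarrow> real \<Rightarrow> (real^'n \<Rightarrow> real \<Rightarrow> real) \<Rightarrow> bool" where
  "L1L2 D T g = ((\<lambda>(x,t). g x t) \<in> borel_measurable mQ \<and>
     (AE t in lborel. t \<in> {0<..<T} \<longrightarrow> L2D D (\<lambda>x. g x t)) \<and>
     set_integrable lborel {0<..<T} (\<lambda>t. sqrt (LINT x:D|lborel. (g x t)^2)))"

definition pairT :: "(real^'n::finite) set \<Rightarrow> real \<Rightarrow> (real^'n \<Rightarrow> real \<Rightarrow> real) \<Rightarrow> (real^'n \<Rightarrow> real \<Rightarrow> real) \<Rightarrow> real" where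
  "pairT D T p g = (LINT t:{0<..<T}|lborel. ipD D (\<lambda>x. p x t) (\<lambda>x. g x t))"

definition weak_star_LinfL2 ::
  "(real^'n::finite) set \<Rightarrow> real \<Rightarrow> ('i \<Rightarrow> real^'n \<Rightarrow> real \<Rightarrow> real) \<Rightarrow> (real^'n \<Rightarrow> real \<Rightarrow> real) \<Rightarrow> 'i filter \<Rightarrow> bool" where
  "weak_star_LinfL2 D T p q F = ((\<forall>\<^sub>F a in F. LinfL2 D T (p a)) \<and> LinfL2 D T q \<and>
     (\<forall>g. L1L2 D T g \<longrightarrow> ((\<lambda>a. pairT D T (p a) g) \<longlongrightarrow> pairT D T q g) F))"

text \<open>Bounded domain (open, connected, nonempty) with piecewise smooth boundary: D is
  regular open and its boundary is covered by finitely many smooth regular hypersurfaces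
  (zero sets of smooth functions with non-vanishing differential).\<close>
definition pw_smooth_domain :: "(real^'n::finite) set \<Rightarrow> bool" where
  "pw_smooth_domain D = (open D \<and> connected D \<and> D \<noteq> {} \<and> bounded D \<and>
     interior (closure D) = D \<and>
     (\<exists>N::nat. \<exists>g::nat \<Rightarrow> real^'n \<Rightarrow> real. (\<forall>j<N. smooth (g j)) \<and>
        frontier D \<subseteq> (\<Union>j<N. {x. g j x = 0 \<and> (\<exists>v. frechet_derivative (g j) (at x) v \<noteq> 0)})))"

definition C_weak ::
  "(real^'n::finite) set \<Rightarrow> real \<Rightarrow> real \<Rightarrow> real \<Rightarrow> real \<Rightarrow> (real^'n \<Rightarrow> real \<Rightarrow> real^'n) \<Rightarrow>
   (real^'n \<Rightarrow> real^'n) \<Rightarrow> (real^'n \<Rightarrow> real) \<Rightarrow> real \<Rightarrow>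
   (real^'n \<Rightarrow> real \<Rightarrow> real^'n) \<Rightarrow> (real^'n \<Rightarrow> real \<Rightarrow> real) \<Rightarrow> bool" where
  "C_weak D T \<rho>0 \<mu> \<eta> f u0 p0 \<alpha> u p = (\<exists>Gu. L2H01 D T u Gu \<and> L2Q D T p \<and>
    (\<forall>\<phi> r. test0T T \<phi> \<longrightarrow> L2D D r \<longrightarrow>
       - (LINT t:{0<..<T}|lborel. ipD D (\<lambda>x. \<alpha> * p x t) r * deriv \<phi> t)
       - ipD D (\<lambda>x. \<alpha> * p0 x) r * \<phi> 0
       + (LINT t:{0<..<T}|lborel. ipD D (\<lambda>x. \<rho>0 * trG (Gu x t)) r * \<phi> t) = 0) \<and>
    (\<forall>\<phi> v Gv. test0T T \<phi> \<longrightarrow> H01 D v Gv \<longrightarrow>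
       - (LINT t:{0<..<T}|lborel. \<rho>0 * ipD D (\<lambda>x. u x t) v * deriv \<phi> t)
       - \<rho>0 * ipD D u0 v * \<phi> 0
       - (LINT t:{0<..<T}|lborel. ipD D (\<lambda>x. p x t) (\<lambda>x. trG (Gv x)) * \<phi> t)
     = - \<mu> * (LINT t:{0<..<T}|lborel. ipD D (\<lambda>x. Gu x t) Gv * \<phi> t)
       - \<eta> * (LINT t:{0<..<T}|lborel. ipD D (\<lambda>x. trG (Gu x t)) (\<lambda>x. trG (Gv x)) * \<phi> t)
       + (LINT t:{0<..<T}|lborel. ipD D (\<lambda>x. (\<rho>0 + \<alpha> * p x t) *\<^sub>R f x t) v * \<phi> t)))"

text \<open>Weak solution {w,q} of (S) with initial velocity w0 (q a locally integrable function
  on Q_T, paired with test functions as a distribution).\<close>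
definition S_weak ::
  "(real^'n::finite) set \<Rightarrow> real \<Rightarrow> real \<Rightarrow> real \<Rightarrow> (real^'n \<Rightarrow> real \<Rightarrow> real^'n) \<Rightarrow>
   (real^'n \<Rightarrow> real^'n) \<Rightarrow> (real^'n \<Rightarrow> real \<Rightarrow> real^'n) \<Rightarrow> (real^'n \<Rightarrow> real \<Rightarrow> real) \<Rightarrow> bool" where
  "S_weak D T \<rho>0 \<mu> f w0 w q = (\<exists>Gw. L2V D T w Gw \<and>
    \<comment> \<open>div w = 0 in D'(Q_T)\<close>
    (\<forall>\<psi>::(real^'n) \<times> real \<Rightarrow> real. test_on (QT D T) \<psi> \<longrightarrow>
       intQ D T (\<lambda>x t. \<Sum>i\<in>UNIV. w x t $ i * dd (axis i 1, 0) \<psi> (x,t)) = 0) \<and>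
    \<comment> \<open>rho0 w_t + grad q = mu Delta w + rho0 f in D'(Q_T)\<close>
    (\<forall>\<Phi>::(real^'n) \<times> real \<Rightarrow> real^'n. test_on (QT D T) \<Phi> \<longrightarrow>
       intQ D T (\<lambda>x t. - \<rho>0 * inner (w x t) (dd (0,1) \<Phi> (x,t))
                       - q x t * (\<Sum>i\<in>UNIV. dd (axis i 1, 0) \<Phi> (x,t) $ i))
     = intQ D T (\<lambda>x t. \<mu> * inner (w x t) (\<Sum>i\<in>UNIV. dd (axis i 1, 0) (dd (axis i 1, 0) \<Phi>) (x,t))
                       + \<rho>0 * inner (f x t) (\<Phi> (x,t)))) \<and>
    (\<forall>\<phi> v Gv. test0T T \<phi> \<longrightarrow> Vsp D v Gv \<longrightarrow>
       - (LINT t:{0<..<T}|lborel. \<rho>0 * ipD D (\<lambda>x. w x t) v * deriv \<phi> t)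
       - \<rho>0 * ipD D w0 v * \<phi> 0
     = - \<mu> * (LINT t:{0<..<T}|lborel. ipD D (\<lambda>x. Gw x t) Gv * \<phi> t)
       + (LINT t:{0<..<T}|lborel. ipD D (\<lambda>x. \<rho>0 *\<^sub>R f x t) v * \<phi> t)))"

text \<open>w_t in L^2(0,T;H^{-1}(D)^d): using the standard representation of H^{-1}(D)^d as
  F0 + sum_i d_i F_i with F0, F_i in L^2, the distributional time derivative of w (tested
  against v in H_0^1(D)^d and psi in C_0^infinity((0,T))) is given by such F0, F with
  F0, F in L^2(Q_T).\<close>
definition dt_L2Hm1 :: "(real^'n::finite) set \<Rightarrow> real \<Rightarrow> (real^'n \<Rightarrow> real \<Rightarrow> real^'n) \<Rightarrow> bool" where
  "dt_L2Hm1 D T w = (\<exists>(F0::real^'n \<Rightarrow> real \<Rightarrow> real^'n) (F::real^'n \<Rightarrow> real \<Rightarrow> real^'n^'n).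
     L2Q D T F0 \<and> L2Q D T F \<and>
     (\<forall>\<psi> v Gv. test_on {0<..<T} \<psi> \<longrightarrow> H01 D v Gv \<longrightarrow>
        - (LINT t:{0<..<T}|lborel. ipD D (\<lambda>x. w x t) v * deriv \<psi> t)
      = (LINT t:{0<..<T}|lborel. (ipD D (\<lambda>x. F0 x t) v - ipD D (\<lambda>x. F x t) Gv) * \<psi> t)))"

definition W12L2 :: "(real^'n::finite) set \<Rightarrow> real \<Rightarrow> (real^'n \<Rightarrow> real \<Rightarrow> real) \<Rightarrow> bool" where
  "W12L2 D T q = (L2Q D T q \<and> (\<exists>qt. L2Q D T qt \<and>
     (\<forall>\<psi> r. test_on {0<..<T} \<psi> \<longrightarrow> L2D D r \<longrightarrow>
        (LINT t:{0<..<T}|lborel. ipD D (\<lambda>x. q x t) r * deriv \<psi> t)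
      = - (LINT t:{0<..<T}|lborel. ipD D (\<lambda>x. qt x t) r * \<psi> t))))"

end

(* Put z = u - w and pi = p - q, where (u, p) solves the compressible problem with parameter alpha.
   Testing the difference of the two problems with (z, pi / rho0) cancels the pressure-divergence
   terms, and as q has a time derivative in L^2, Gronwall's lemma gives |z|^2 = O(alpha),
   grad z = O(sqrt alpha) in L^2 of the cylinder, and a bound on pi in L^infinity(0,T; L^2)
   independent of alpha.  The momentum equations then give (pi, div v) = O(sqrt alpha) as a
   distribution in time for every test field v.  A bounded family whose gradient tends to zero
   in this sense tends weakly to constants on the connected set D, and the constants are zero
   because the mean of the pressure is conserved and agrees with the mean of q.

   The weak solutions are only square integrable in time, so the energy inequality is derived
   by pairing the equation at time t with the solution at a nearby time t + delta. *)

theory Submission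
  imports Defs "HOL-Computational_Algebra.Polynomial"
begin

text \<open>Every weak equation is used as an integrated identity: for almost every t, a scalar
  product equals a constant plus a primitive. The energy inequality is proved once for such
  identities, with the gradient carried along as additional data. The constants in these identities
  are the delicate point. Problem (S) prescribes u0 only against divergence-free fields, whereas z
  is not divergence free, so the difference of the problems has to be tested with all of H_0^1,
  where the distributional momentum equation says nothing about t = 0. The missing initial identity
  is recovered from the strong convergence of w(t) to u0, and this is where u0 in J(D) enters. The
  pressure q has a trace q0 at t = 0 that is not assumed to be p0; this costs only the initial
  energy (\<alpha> / \<rho>0) |p0 - q0|^2, of the same order \<alpha> as all other terms. Since the
  pressure part of the energy itself carries the factor \<alpha>, the energy yields boundedness of
  pi but no smallness.\<close>

abbreviation (input) "prim k t \<equiv> (\<integral>r. indicator {0<..<t} r * k r \<partial>lborel)"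

section \<open>Square-integrable functions over an arbitrary measure\<close>

definition L2 :: "'a measure \<Rightarrow> ('a \<Rightarrow> 'b::euclidean_space) \<Rightarrow> bool" where
  "L2 M f \<longleftrightarrow> f \<in> borel_measurable M \<and> integrable M (\<lambda>x. (norm (f x))\<^sup>2)"

definition nsq :: "'a measure \<Rightarrow> ('a \<Rightarrow> 'b::euclidean_space) \<Rightarrow> real" where
  "nsq M f = (\<integral>x. (norm (f x))\<^sup>2 \<partial>M)"

lemma L2_meas: "L2 M f \<Longrightarrow> f \<in> borel_measurable M"
  by (simp add: L2_def)

lemma L2_int: "L2 M f \<Longrightarrow> integrable M (\<lambda>x. (norm (f x))\<^sup>2)"
  by (simp add: L2_def)

lemma L2I_bound:
  assumes "f \<in> borel_measurable M" "integrable M g" "AE x in M. (norm (f x))\<^sup>2 \<le> g x"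
  shows "L2 M f"
  unfolding L2_def
  using assms by (auto intro!: Bochner_Integration.integrable_bound[OF assms(2)])

lemma norm_add_sq_le: "(norm (a + b :: 'a::real_normed_vector))\<^sup>2 \<le> 2 * (norm a)\<^sup>2 + 2 * (norm b)\<^sup>2"
proof -
  have "(norm (a + b))\<^sup>2 \<le> (norm a + norm b)\<^sup>2" by (intro power_mono norm_triangle_ineq) auto
  also have "\<dots> \<le> 2 * (norm a)\<^sup>2 + 2 * (norm b)\<^sup>2"
    using sum_squares_bound[of "norm a" "norm b"] by (simp add: power2_sum)
  finally show ?thesis .
qed

lemma L2_add: assumes "L2 M f" "L2 M g" shows "L2 M (\<lambda>x. f x + g x)"
  by (rule L2I_bound[where g="\<lambda>x. 2 * (norm (f x))\<^sup>2 + 2 * (norm (g x))\<^sup>2"])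
     (use assms in \<open>auto simp: L2_def intro!: norm_add_sq_le\<close>)

lemma L2_bounded_linear:
  fixes f :: "'a \<Rightarrow> 'b::euclidean_space" and h :: "'b \<Rightarrow> 'c::euclidean_space"
  assumes "bounded_linear h" "L2 M f" shows "L2 M (\<lambda>x. h (f x))"
proof -
  obtain K where K: "\<And>x. norm (h x) \<le> norm x * K"
    using bounded_linear.bounded[OF assms(1)] by auto
  have "(norm (h x))\<^sup>2 \<le> K\<^sup>2 * (norm x)\<^sup>2" for x
    using power_mono[OF K[of x], of 2] by (simp add: power_mult_distrib mult.commute)
  moreover have "h \<in> borel_measurable borel"
    using assms(1) by (intro borel_measurable_continuous_onI linear_continuous_on)
  ultimately show ?thesis
    by (intro L2I_bound[where g="\<lambda>x. K\<^sup>2 * (norm (f x))\<^sup>2"])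
       (use assms(2) in \<open>auto simp: L2_def\<close>)
qed

lemma L2_scaleR: "L2 M f \<Longrightarrow> L2 M (\<lambda>x. c *\<^sub>R f x)"
  by (rule L2_bounded_linear[OF bounded_linear_scaleR_right])

lemma L2_uminus: "L2 M f \<Longrightarrow> L2 M (\<lambda>x. - f x)"
  using L2_scaleR[of M f "-1"] by simp

lemma L2_diff: "L2 M f \<Longrightarrow> L2 M g \<Longrightarrow> L2 M (\<lambda>x. f x - g x)"
  using L2_add[of M f "\<lambda>x. - g x"] L2_uminus[of M g] by simp

lemma L2_zero: "L2 M (\<lambda>x. 0)"
  by (simp add: L2_def)

lemma L2_mult_bounded:
  assumes "L2 M f" "m \<in> borel_measurable M" "AE x in M. \<bar>m x\<bar> \<le> B"
  shows "L2 M (\<lambda>x. m x *\<^sub>R f x)"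
proof (rule L2I_bound[where g="\<lambda>x. B\<^sup>2 * (norm (f x))\<^sup>2"])
  show "AE x in M. (norm (m x *\<^sub>R f x))\<^sup>2 \<le> B\<^sup>2 * (norm (f x))\<^sup>2"
    using assms(3)
  proof eventually_elim
    case (elim x)
    from power_mono[OF this, of 2] have "(m x)\<^sup>2 \<le> B\<^sup>2" by simp
    then show ?case by (simp add: power_mult_distrib mult_right_mono)
  qed
qed (use assms in \<open>auto simp: L2_def\<close>)

lemma L2_indicator: "L2 M f \<Longrightarrow> A \<in> sets M \<Longrightarrow> L2 M (\<lambda>x. indicator A x *\<^sub>R f x)"
  by (rule L2_mult_bounded[where B=1]) (auto split: split_indicator)

lemma L2_const_indicator:
  "A \<in> sets M \<Longrightarrow> emeasure M A < \<infinity> \<Longrightarrow> L2 M (\<lambda>x. indicator A x *\<^sub>R c)"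
  by (rule L2I_bound[where g="\<lambda>x. (norm c)\<^sup>2 * indicator A x"])
     (auto split: split_indicator intro!: integrable_mult_right integrable_real_indicator)

lemma L2_inner_integrable:
  assumes "L2 M f" "L2 M g" shows "integrable M (\<lambda>x. f x \<bullet> g x)"
proof (rule Bochner_Integration.integrable_bound[where f="\<lambda>x. (norm (f x))\<^sup>2 + (norm (g x))\<^sup>2"])
  show "AE x in M. norm (f x \<bullet> g x) \<le> norm ((norm (f x))\<^sup>2 + (norm (g x))\<^sup>2)"
  proof (intro AE_I2)
    fix x
    have "\<bar>f x \<bullet> g x\<bar> \<le> norm (f x) * norm (g x)" by (rule Cauchy_Schwarz_ineq2)
    also have "\<dots> \<le> (norm (f x))\<^sup>2 + (norm (g x))\<^sup>2"
      using sum_squares_bound[of "norm (f x)" "norm (g x)"]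
        mult_nonneg_nonneg[OF norm_ge_zero[of "f x"] norm_ge_zero[of "g x"]] by linarith
    finally show "norm (f x \<bullet> g x) \<le> norm ((norm (f x))\<^sup>2 + (norm (g x))\<^sup>2)" by simp
  qed
qed (use assms in \<open>auto simp: L2_def\<close>)

lemma nsq_nonneg: "0 \<le> nsq M f" by (simp add: nsq_def)

lemma nsq_inner: "nsq M f = (\<integral>x. f x \<bullet> f x \<partial>M)"
  by (simp add: nsq_def power2_norm_eq_inner)

lemma nsq_scaleR: "nsq M (\<lambda>x. c *\<^sub>R f x) = c\<^sup>2 * nsq M f"
  by (simp add: nsq_def power_mult_distrib)

lemma nsq_uminus: "nsq M (\<lambda>x. - f x) = nsq M f"
  by (simp add: nsq_def)

lemma nsq_commute: "nsq M (\<lambda>x. f x - g x) = nsq M (\<lambda>x. g x - f x)"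
  by (simp add: nsq_def norm_minus_commute)

lemma nsq_add:
  assumes "L2 M f" "L2 M g"
  shows "nsq M (\<lambda>x. f x + g x) = nsq M f + 2 * (\<integral>x. f x \<bullet> g x \<partial>M) + nsq M g"
proof -
  have i: "integrable M (\<lambda>x. f x \<bullet> f x)" "integrable M (\<lambda>x. f x \<bullet> g x)" "integrable M (\<lambda>x. g x \<bullet> g x)"
    using assms by (auto intro: L2_inner_integrable)
  have "nsq M (\<lambda>x. f x + g x) = (\<integral>x. f x \<bullet> f x + 2 * (f x \<bullet> g x) + g x \<bullet> g x \<partial>M)"
    by (simp add: nsq_inner inner_add_left inner_add_right inner_commute algebra_simps)
  also have "\<dots> = nsq M f + 2 * (\<integral>x. f x \<bullet> g x \<partial>M) + nsq M g"
    using i by (simp add: nsq_inner)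
  finally show ?thesis .
qed

lemma nsq_diff:
  assumes "L2 M f" "L2 M g"
  shows "nsq M (\<lambda>x. f x - g x) = nsq M f - 2 * (\<integral>x. f x \<bullet> g x \<partial>M) + nsq M g"
  using nsq_add[OF assms(1) L2_uminus[OF assms(2)]] by (simp add: nsq_uminus)

text \<open>The polynomial l -> |f + l g|^2 is nonnegative on the whole line; evaluating it at its
  minimiser gives the inequality.\<close>

lemma L2_Cauchy_Schwarz:
  assumes "L2 M f" "L2 M g"
  shows "\<bar>\<integral>x. f x \<bullet> g x \<partial>M\<bar> \<le> sqrt (nsq M f) * sqrt (nsq M g)"
proof -
  let ?a = "nsq M f" and ?c = "nsq M g" and ?b = "\<integral>x. f x \<bullet> g x \<partial>M"
  have *: "0 \<le> ?a + 2 * (l * ?b) + l\<^sup>2 * ?c" for l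
    using nsq_add[OF assms(1) L2_scaleR[OF assms(2), of l]] nsq_nonneg[of M "\<lambda>x. f x + l *\<^sub>R g x"]
    by (simp add: nsq_scaleR)
  have "?b\<^sup>2 \<le> ?a * ?c"
  proof (cases "?c = 0")
    case True
    have "?b = 0"
    proof (rule ccontr)
      assume "?b \<noteq> 0"
      \<comment> \<open>Without a quadratic term the polynomial is affine, and this value of l makes
        it equal to -1.\<close>
      then have "2 * ((- (?a + 1) / (2 * ?b)) * ?b) = - (?a + 1)" by simp
      then show False using *[of "- (?a + 1) / (2 * ?b)"] True by simp
    qed
    then show ?thesis using True by simp
  next
    case False
    then have c: "?c > 0" using nsq_nonneg[of M g] by simp
    have "0 \<le> ?a + 2 * ((- ?b / ?c) * ?b) + (- ?b / ?c)\<^sup>2 * ?c" by (rule *)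
    also have "\<dots> = ?a - ?b\<^sup>2 / ?c" using c by (simp add: power2_eq_square field_simps)
    finally show ?thesis using c by (simp add: field_simps)
  qed
  then have "sqrt (?b\<^sup>2) \<le> sqrt (?a * ?c)" by (rule real_sqrt_le_mono)
  then show ?thesis by (simp add: real_sqrt_mult)
qed

lemma nsq_add_le:
  assumes "L2 M f" "L2 M g"
  shows "nsq M (\<lambda>x. f x + g x) \<le> 2 * nsq M f + 2 * nsq M g"
proof -
  have "nsq M (\<lambda>x. f x + g x) \<le> (\<integral>x. 2 * (norm (f x))\<^sup>2 + 2 * (norm (g x))\<^sup>2 \<partial>M)"
    unfolding nsq_def
    by (rule integral_mono) (use assms L2_add[OF assms] in \<open>auto simp: L2_def intro!: norm_add_sq_le\<close>)
  also have "\<dots> = 2 * nsq M f + 2 * nsq M g"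
    using assms by (simp add: nsq_def L2_def)
  finally show ?thesis .
qed

lemma L2_inner_tendsto:
  assumes "L2 M f" "\<And>i. L2 M (f' i)" "L2 M g" "((\<lambda>i. nsq M (\<lambda>x. f' i x - f x)) \<longlongrightarrow> 0) F"
  shows "((\<lambda>i. \<integral>x. f' i x \<bullet> g x \<partial>M) \<longlongrightarrow> (\<integral>x. f x \<bullet> g x \<partial>M)) F"
proof (rule LIM_zero_cancel, rule Lim_null_comparison)
  show "\<forall>\<^sub>F i in F. norm ((\<integral>x. f' i x \<bullet> g x \<partial>M) - (\<integral>x. f x \<bullet> g x \<partial>M))
      \<le> sqrt (nsq M (\<lambda>x. f' i x - f x)) * sqrt (nsq M g)"
  proof (intro always_eventually allI)
    fix i
    have "(\<integral>x. f' i x \<bullet> g x \<partial>M) - (\<integral>x. f x \<bullet> g x \<partial>M) = (\<integral>x. (f' i x - f x) \<bullet> g x \<partial>M)"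
      using assms by (simp add: inner_diff_left L2_inner_integrable)
    then show "norm ((\<integral>x. f' i x \<bullet> g x \<partial>M) - (\<integral>x. f x \<bullet> g x \<partial>M))
      \<le> sqrt (nsq M (\<lambda>x. f' i x - f x)) * sqrt (nsq M g)"
      using L2_Cauchy_Schwarz[OF L2_diff[OF assms(2)[of i] assms(1)] assms(3)] by simp
  qed
  show "((\<lambda>i. sqrt (nsq M (\<lambda>x. f' i x - f x)) * sqrt (nsq M g)) \<longlongrightarrow> 0) F"
    using tendsto_mult_left_zero[OF tendsto_real_sqrt[OF assms(4), simplified]] by simp
qed

text \<open>Density of simple functions, phrased as an induction rule. It reduces translation
  continuity and weak convergence to indicators of sets of finite measure.\<close>

lemma L2_induct [consumes 1, case_names ind add lim]:
  fixes f :: "'a \<Rightarrow> 'b::euclidean_space"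
  assumes f: "L2 M f"
    and ind: "\<And>A c. A \<in> sets M \<Longrightarrow> emeasure M A < \<infinity> \<Longrightarrow> P (\<lambda>x. indicator A x *\<^sub>R c)"
    and add: "\<And>f g. L2 M f \<Longrightarrow> L2 M g \<Longrightarrow> P f \<Longrightarrow> P g \<Longrightarrow> P (\<lambda>x. f x + g x)"
    and lim: "\<And>f s. L2 M f \<Longrightarrow> (\<And>i. L2 M (s i)) \<Longrightarrow> (\<And>i. P (s i)) \<Longrightarrow>
        (\<lambda>i::nat. nsq M (\<lambda>x. s i x - f x)) \<longlonglongrightarrow> 0 \<Longrightarrow> P f"
  shows "P f"
proof -
  have fm[measurable]: "f \<in> borel_measurable M" using f by (rule L2_meas)
  obtain s where s: "\<And>i. simple_function M (s i)"
      "\<And>x. x \<in> space M \<Longrightarrow> (\<lambda>i. s i x) \<longlonglongrightarrow> f x"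
      and b: "\<And>i x. x \<in> space M \<Longrightarrow> norm (s i x) \<le> 2 * norm (f x)"
    using borel_measurable_implies_sequence_metric[OF fm, of 0] by simp metis
  have [measurable]: "s i \<in> borel_measurable M" for i
    using s(1) by (rule borel_measurable_simple_function)
  have b2: "(norm (s i x))\<^sup>2 \<le> 4 * (norm (f x))\<^sup>2" if "x \<in> space M" for i x
    using power_mono[OF b[OF that, of i], of 2] by simp
  have L2s: "L2 M (s i)" for i
    by (rule L2I_bound[where g="\<lambda>x. 4 * (norm (f x))\<^sup>2"]) (use f b2 in \<open>auto simp: L2_def\<close>)
  have P0: "P (\<lambda>x. 0)" using ind[of "{}" 0] by simp
  have Ps: "P (s i)" for i
  proof -
    define S where "S = s i ` space M - {0}"
    have fin: "finite S" using s(1)[of i] by (auto simp: S_def simple_function_def)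
    define A where "A y = s i -` {y} \<inter> space M" for y
    have A: "A y \<in> sets M" for y unfolding A_def by measurable
    have emA: "emeasure M (A y) < \<infinity>" if "y \<in> S" for y
    proof -
      have y: "y \<noteq> 0" using that by (auto simp: S_def)
      \<comment> \<open>Chebyshev: \<open>s i\<close> equals y on this level set, so the indicator
        is at most |s i|^2 / |y|^2.\<close>
      have "integrable M (indicator (A y) :: _ \<Rightarrow> real)"
      proof (rule Bochner_Integration.integrable_bound[where f="\<lambda>x. (1 / (norm y)\<^sup>2) * (norm (s i x))\<^sup>2"])
        show "integrable M (\<lambda>x. (1 / (norm y)\<^sup>2) * (norm (s i x))\<^sup>2)"
          using L2_int[OF L2s[of i]] by simp
      qed (use A y in \<open>auto simp: A_def split: split_indicator\<close>)
      then show ?thesis using A by (simp add: integrable_indicator_iff)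
    qed
    have P_sum: "L2 M (\<lambda>x. \<Sum>y\<in>S'. indicator (A y) x *\<^sub>R y) \<and> P (\<lambda>x. \<Sum>y\<in>S'. indicator (A y) x *\<^sub>R y)"
      if "S' \<subseteq> S" for S'
      using finite_subset[OF that fin] that
    proof (induction S' rule: finite_induct)
      case empty then show ?case using P0 L2_zero by simp
    next
      case (insert y S')
      then have y: "y \<in> S" and *: "L2 M (\<lambda>x. \<Sum>y\<in>S'. indicator (A y) x *\<^sub>R y)"
          "P (\<lambda>x. \<Sum>y\<in>S'. indicator (A y) x *\<^sub>R y)" by auto
      have "L2 M (\<lambda>x. indicator (A y) x *\<^sub>R y)" "P (\<lambda>x. indicator (A y) x *\<^sub>R y)"
        using L2_const_indicator[OF A emA] ind[OF A emA] y by auto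
      from L2_add[OF this(1) *(1)] add[OF this(1) *(1) this(2) *(2)] show ?case
        by (simp only: sum.insert[OF insert(1,2)])
    qed
    define g where "g x = (\<Sum>y\<in>S. indicator (A y) x *\<^sub>R y)" for x
    have g: "L2 M g" "P g" using P_sum[of S] by (auto simp: g_def[abs_def])
    have eq: "g x = s i x" if "x \<in> space M" for x
    proof (cases "s i x = 0")
      case True
      then show ?thesis by (auto simp: g_def A_def S_def indicator_def intro!: sum.neutral)
    next
      case False
      then have "s i x \<in> S" using that by (auto simp: S_def)
      have "g x = (\<Sum>y\<in>S. if y = s i x then y else 0)"
        unfolding g_def using that by (intro sum.cong) (auto simp: A_def indicator_def)
      then show ?thesis using \<open>s i x \<in> S\<close> fin by simp
    qed
    have "nsq M (\<lambda>x. g x - s i x) = 0"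
      unfolding nsq_def by (simp add: eq cong: Bochner_Integration.integral_cong)
    \<comment> \<open>The finite sum agrees with \<open>s i\<close> only on \<open>space M\<close>;
      the limit clause for a constant sequence bridges the difference.\<close>
    then show ?thesis using lim[OF L2s[of i], of "\<lambda>_. g"] g by simp
  qed
  have "(\<lambda>i. nsq M (\<lambda>x. s i x - f x)) \<longlonglongrightarrow> (\<integral>x. 0 \<partial>M)"
    unfolding nsq_def
  proof (rule integral_dominated_convergence[where w="\<lambda>x. 9 * (norm (f x))\<^sup>2"])
    show "integrable M (\<lambda>x. 9 * (norm (f x))\<^sup>2)" using L2_int[OF f] by simp
    show "AE x in M. (\<lambda>i. (norm (s i x - f x))\<^sup>2) \<longlonglongrightarrow> 0"
    proof (intro AE_I2)
      fix x assume "x \<in> space M"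
      then have "(\<lambda>i. (norm (s i x - f x))\<^sup>2) \<longlonglongrightarrow> (norm (f x - f x))\<^sup>2"
        by (intro tendsto_intros s)
      then show "(\<lambda>i. (norm (s i x - f x))\<^sup>2) \<longlonglongrightarrow> 0" by simp
    qed
    show "AE x in M. norm ((norm (s i x - f x))\<^sup>2) \<le> 9 * (norm (f x))\<^sup>2" for i
    proof (intro AE_I2)
      fix x assume "x \<in> space M"
      then have "norm (s i x - f x) \<le> 3 * norm (f x)"
        using norm_triangle_ineq4[of "s i x" "f x"] b[of x i] by simp
      from power_mono[OF this, of 2] show "norm ((norm (s i x - f x))\<^sup>2) \<le> 9 * (norm (f x))\<^sup>2" by simp
    qed
  qed auto
  then show ?thesis using lim[OF f L2s Ps] by simp
qed

subsection \<open>Translations\<close>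

lemma integral_lborel_shift:
  fixes f :: "'a::euclidean_space \<Rightarrow> 'b::euclidean_space"
  assumes [measurable]: "f \<in> borel_measurable borel"
  shows "(LBINT x. f (x + d)) = (LBINT x. f x)"
proof -
  have "(LBINT x. f x) = (\<integral>x. f x \<partial>distr lborel borel ((+) d))"
    by (simp add: lborel_distr_plus)
  also have "\<dots> = (LBINT x. f (d + x))" by (rule integral_distr) auto
  finally show ?thesis by (simp add: add.commute)
qed

lemma nn_integral_lborel_shift:
  fixes f :: "'a::euclidean_space \<Rightarrow> ennreal"
  assumes [measurable]: "f \<in> borel_measurable borel"
  shows "(\<integral>\<^sup>+x. f (x + d) \<partial>lborel) = (\<integral>\<^sup>+x. f x \<partial>lborel)"
proof -
  have "(\<integral>\<^sup>+x. f x \<partial>lborel) = (\<integral>\<^sup>+x. f x \<partial>distr lborel borel ((+) d))"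
    by (simp add: lborel_distr_plus)
  also have "\<dots> = (\<integral>\<^sup>+x. f (d + x) \<partial>lborel)" by (rule nn_integral_distr) auto
  finally show ?thesis by (simp add: add.commute)
qed

lemma integrable_lborel_shift:
  fixes f :: "'a::euclidean_space \<Rightarrow> 'b::euclidean_space"
  assumes "integrable lborel f"
  shows "integrable lborel (\<lambda>x. f (x + d))"
proof -
  have "integrable (distr lborel borel ((+) d)) f" using assms by (simp add: lborel_distr_plus)
  then have "integrable lborel (\<lambda>x. f (d + x))"
    using assms by (subst (asm) integrable_distr_eq) auto
  then show ?thesis by (simp add: add.commute)
qed

lemma L2_shift:
  fixes f :: "'a::euclidean_space \<Rightarrow> 'b::euclidean_space"
  assumes "L2 lborel f" shows "L2 lborel (\<lambda>x. f (x + d))"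
  using assms integrable_lborel_shift[of "\<lambda>x. (norm (f x))\<^sup>2" d] by (auto simp: L2_def)

lemma nsq_shift:
  fixes f :: "'a::euclidean_space \<Rightarrow> 'b::euclidean_space"
  assumes "L2 lborel f" shows "nsq lborel (\<lambda>x. f (x + d)) = nsq lborel f"
  using assms integral_lborel_shift[of "\<lambda>x. (norm (f x))\<^sup>2" d] by (auto simp: L2_def nsq_def)

text \<open>Translations are isometries, so the error made by replacing f with \<open>s i\<close> is
  the same before and after the shift and does not depend on k.\<close>

lemma L2_shift_tendsto_limit:
  fixes f :: "'a::euclidean_space \<Rightarrow> 'b::euclidean_space" and d :: "nat \<Rightarrow> 'a"
  assumes "L2 lborel f" "\<And>i::nat. L2 lborel (s i)"
    "\<And>i. (\<lambda>k. nsq lborel (\<lambda>x. s i (x + d k) - s i x)) \<longlonglongrightarrow> 0"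
    "(\<lambda>i. nsq lborel (\<lambda>x. s i x - f x)) \<longlonglongrightarrow> 0"
  shows "(\<lambda>k. nsq lborel (\<lambda>x. f (x + d k) - f x)) \<longlonglongrightarrow> 0"
proof (rule tendstoI)
  fix e :: real assume "e > 0"
  then have "\<forall>\<^sub>F i in sequentially. nsq lborel (\<lambda>x. s i x - f x) < e / 16"
    using order_tendstoD(2)[OF assms(4), of "e/16"] by simp
  then obtain i where i: "nsq lborel (\<lambda>x. s i x - f x) < e / 16"
    by (auto simp: eventually_sequentially)
  have "\<forall>\<^sub>F k in sequentially. nsq lborel (\<lambda>x. s i (x + d k) - s i x) < e / 16"
    using order_tendstoD(2)[OF assms(3)[of i], of "e/16"] \<open>e > 0\<close> by simp
  then show "\<forall>\<^sub>F k in sequentially. dist (nsq lborel (\<lambda>x. f (x + d k) - f x)) 0 < e"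
  proof eventually_elim
    case (elim k)
    define g where "g x = s i x - f x" for x
    have g: "L2 lborel g" unfolding g_def by (intro L2_diff assms)
    have "8 * nsq lborel (\<lambda>x. s i x - f x) < e / 2" "2 * nsq lborel (\<lambda>x. s i (x + d k) - s i x) < e / 2"
      using i elim nsq_nonneg[of lborel "\<lambda>x. s i (x + d k) - s i x"] by linarith+
    have "nsq lborel (\<lambda>x. f (x + d k) - f x) =
        nsq lborel (\<lambda>x. (s i (x + d k) - s i x) + (g x - g (x + d k)))"
      by (simp add: g_def)
    also have "\<dots> \<le> 2 * nsq lborel (\<lambda>x. s i (x + d k) - s i x) + 2 * nsq lborel (\<lambda>x. g x - g (x + d k))"
      by (intro nsq_add_le L2_diff L2_shift assms g)
    also have "nsq lborel (\<lambda>x. g x - g (x + d k)) \<le> 2 * nsq lborel g + 2 * nsq lborel (\<lambda>x. g (x + d k))"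
      using nsq_add_le[OF g L2_uminus[OF L2_shift[OF g, of "d k"]]]
      by (simp add: nsq_uminus)
    also have "\<dots> = 4 * nsq lborel g" by (simp add: nsq_shift[OF g])
    finally have "nsq lborel (\<lambda>x. f (x + d k) - f x) < e"
      using \<open>8 * nsq lborel _ < e / 2\<close> \<open>2 * nsq lborel _ < e / 2\<close> by (simp add: g_def[abs_def])
    then show ?case using nsq_nonneg[of lborel "\<lambda>x. f (x + d k) - f x"] by simp
  qed
qed

text \<open>Expanding the square leaves the product of the function with its translate. At a point
  of U this product is eventually constant because U is open; off U it is zero. Openness is what
  makes the pointwise limit available.\<close>

lemma L2_shift_tendsto_open:
  fixes d :: "nat \<Rightarrow> 'a::euclidean_space" and c :: "'b::euclidean_space"
  assumes "open U" "emeasure lborel U < \<infinity>" "d \<longlonglongrightarrow> 0"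
  shows "(\<lambda>k. nsq lborel (\<lambda>x. indicator U (x + d k) *\<^sub>R c - indicator U x *\<^sub>R c)) \<longlonglongrightarrow> 0"
proof -
  let ?f = "\<lambda>x. indicator U x *\<^sub>R c"
  have [measurable]: "U \<in> sets borel" using assms by simp
  have f: "L2 lborel ?f" using assms by (intro L2_const_indicator) auto
  have fi: "integrable lborel (\<lambda>x. (norm c)\<^sup>2 * indicator U x)"
    using assms by (intro integrable_mult_right integrable_real_indicator) auto
  have "(\<lambda>k. LBINT x. ?f x \<bullet> ?f (x + d k)) \<longlonglongrightarrow> (LBINT x. ?f x \<bullet> ?f x)"
  proof (rule integral_dominated_convergence[where w="\<lambda>x. (norm c)\<^sup>2 * indicator U x"])
    show "AE x in lborel. (\<lambda>k. ?f x \<bullet> ?f (x + d k)) \<longlonglongrightarrow> ?f x \<bullet> ?f x"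
    proof (intro AE_I2)
      fix x
      show "(\<lambda>k. ?f x \<bullet> ?f (x + d k)) \<longlonglongrightarrow> ?f x \<bullet> ?f x"
      proof (cases "x \<in> U")
        case True
        have "(\<lambda>k. x + d k) \<longlonglongrightarrow> x" using tendsto_add[OF tendsto_const assms(3), of x] by simp
        then have "\<forall>\<^sub>F k in sequentially. x + d k \<in> U"
          using True assms(1) by (auto simp: tendsto_def)
        then have "\<forall>\<^sub>F k in sequentially. ?f x \<bullet> ?f (x + d k) = ?f x \<bullet> ?f x"
          by eventually_elim (use True in auto)
        then show ?thesis by (rule tendsto_eventually)
      qed auto
    qed
    show "AE x in lborel. norm (?f x \<bullet> ?f (x + d k)) \<le> (norm c)\<^sup>2 * indicator U x" for k
      by (auto simp: power2_norm_eq_inner split: split_indicator)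
  qed (use fi in auto)
  then have "(\<lambda>k. nsq lborel ?f - 2 * (LBINT x. ?f x \<bullet> ?f (x + d k)) + nsq lborel ?f)
      \<longlonglongrightarrow> nsq lborel ?f - 2 * (LBINT x. ?f x \<bullet> ?f x) + nsq lborel ?f"
    by (intro tendsto_intros)
  moreover have "nsq lborel (\<lambda>x. ?f (x + d k) - ?f x) =
     nsq lborel ?f - 2 * (LBINT x. ?f x \<bullet> ?f (x + d k)) + nsq lborel ?f" for k
    unfolding nsq_diff[OF L2_shift[OF f, of "d k"] f] nsq_shift[OF f] by (simp only: inner_commute)
  ultimately show ?thesis by (simp add: nsq_inner)
qed

text \<open>By density only indicators of sets of finite measure matter, and outer regularity
  replaces such a set by open ones.\<close>

lemma L2_shift_tendsto:
  fixes f :: "'a::euclidean_space \<Rightarrow> 'b::euclidean_space" and d :: "nat \<Rightarrow> 'a"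
  assumes "L2 lborel f" "d \<longlonglongrightarrow> 0"
  shows "(\<lambda>k. nsq lborel (\<lambda>x. f (x + d k) - f x)) \<longlonglongrightarrow> 0"
  using assms(1)
proof (induction f rule: L2_induct)
  case (ind A c)
  have A: "A \<in> sets borel" using ind by simp
  have "\<exists>U. open U \<and> A \<subseteq> U \<and> emeasure lborel (U - A) < ennreal (1 / Suc i)" for i :: nat
  proof -
    have "0 < 1 / real (Suc i)" by simp
    from outer_regular_lborel[OF A this] show ?thesis by metis
  qed
  then obtain U where U: "\<And>i. open (U i)" "\<And>i. A \<subseteq> U i"
      "\<And>i. emeasure lborel (U i - A) < ennreal (1 / Suc i)"
    by metis
  have fin: "emeasure lborel (U i) < \<infinity>" for i
  proof -
    have "emeasure lborel (U i) \<le> emeasure lborel A + emeasure lborel (U i - A)"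
      using emeasure_subadditive[of A lborel "U i - A"] ind U(1,2)[of i]
      by (simp add: Un_absorb1)
    also have "\<dots> < \<infinity>" using ind U(3)[of i] by (auto simp: less_top[symmetric] top_unique)
    finally show ?thesis .
  qed
  show ?case
  proof (rule L2_shift_tendsto_limit[where s="\<lambda>i x. indicator (U i) x *\<^sub>R c"])
    have [measurable]: "U i \<in> sets borel" for i using U by simp
    show "(\<lambda>i. nsq lborel (\<lambda>x. indicator (U i) x *\<^sub>R c - indicator A x *\<^sub>R c)) \<longlonglongrightarrow> 0"
    proof (rule Lim_null_comparison[where g="\<lambda>i. (norm c)\<^sup>2 * (1 / Suc i)"])
      show "\<forall>\<^sub>F i in sequentially. norm (nsq lborel (\<lambda>x. indicator (U i) x *\<^sub>R c - indicator A x *\<^sub>R c))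
           \<le> (norm c)\<^sup>2 * (1 / Suc i)"
      proof (intro always_eventually allI)
        fix i
        have "nsq lborel (\<lambda>x. indicator (U i) x *\<^sub>R c - indicator A x *\<^sub>R c) =
            (LBINT x. (norm c)\<^sup>2 * indicator (U i - A) x)"
          unfolding nsq_def using U(2)[of i]
          by (intro Bochner_Integration.integral_cong) (auto split: split_indicator)
        also have "\<dots> = (norm c)\<^sup>2 * measure lborel (U i - A)" by simp
        also have "measure lborel (U i - A) \<le> 1 / Suc i"
          using U(3)[of i] by (simp add: measure_def enn2real_leI order_less_imp_le)
        finally show "norm (nsq lborel (\<lambda>x. indicator (U i) x *\<^sub>R c - indicator A x *\<^sub>R c))
           \<le> (norm c)\<^sup>2 * (1 / Suc i)" by (simp add: nsq_nonneg mult_left_mono)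
      qed
      show "(\<lambda>i. (norm c)\<^sup>2 * (1 / real (Suc i))) \<longlonglongrightarrow> 0"
        using tendsto_mult_right_zero[OF LIMSEQ_inverse_real_of_nat] by (simp add: inverse_eq_divide)
    qed
  qed (use ind U fin assms(2) in \<open>auto intro!: L2_const_indicator L2_shift_tendsto_open\<close>)
next
  case (add f g)
  show ?case
  proof (rule Lim_null_comparison)
    show "\<forall>\<^sub>F k in sequentially. norm (nsq lborel (\<lambda>x. f (x + d k) + g (x + d k) - (f x + g x)))
      \<le> 2 * nsq lborel (\<lambda>x. f (x + d k) - f x) + 2 * nsq lborel (\<lambda>x. g (x + d k) - g x)"
    proof (intro always_eventually allI)
      fix k
      show "norm (nsq lborel (\<lambda>x. f (x + d k) + g (x + d k) - (f x + g x)))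
      \<le> 2 * nsq lborel (\<lambda>x. f (x + d k) - f x) + 2 * nsq lborel (\<lambda>x. g (x + d k) - g x)"
        using nsq_add_le[OF L2_diff[OF L2_shift[OF add(1), of "d k"] add(1)]
              L2_diff[OF L2_shift[OF add(2), of "d k"] add(2)]]
        by (simp add: nsq_nonneg algebra_simps)
    qed
    show "(\<lambda>k. 2 * nsq lborel (\<lambda>x. f (x + d k) - f x) + 2 * nsq lborel (\<lambda>x. g (x + d k) - g x)) \<longlonglongrightarrow> 0"
      using tendsto_add[OF tendsto_mult_right_zero[OF add(3), of 2] tendsto_mult_right_zero[OF add(4), of 2]] by simp
  qed
next
  case (lim f s)
  show ?case by (rule L2_shift_tendsto_limit[OF lim(1,2,4,3)])
qed

subsection \<open>Fubini on products of Euclidean spaces\<close>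

context
  fixes f :: "'a::euclidean_space \<times> 'b::euclidean_space \<Rightarrow> 'c::euclidean_space"
  assumes f: "integrable lborel f"
begin

lemma lborel_Fubini_snd: "(LBINT t. (LBINT x. f (x, t))) = (LBINT z. f z)"
  using lborel_pair.integral_snd[of "\<lambda>x t. f (x, t)"] f by (simp add: lborel_prod)

lemma lborel_Fubini_fst: "(LBINT x. (LBINT t. f (x, t))) = (LBINT z. f z)"
  using lborel_pair.integral_fst[of "\<lambda>x t. f (x, t)"] f by (simp add: lborel_prod)

lemma lborel_AE_integrable_snd: "AE t in lborel. integrable lborel (\<lambda>x. f (x, t))"
  using lborel_pair.AE_integrable_snd[of "\<lambda>x t. f (x, t)"] f by (simp add: lborel_prod)

lemma lborel_AE_integrable_fst: "AE x in lborel. integrable lborel (\<lambda>t. f (x, t))"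
  using lborel_pair.AE_integrable_fst[of "\<lambda>x t. f (x, t)"] f by (simp add: lborel_prod)

lemma lborel_integrable_snd: "integrable lborel (\<lambda>t. LBINT x. f (x, t))"
  using lborel_pair.integrable_snd[of "\<lambda>x t. f (x, t)"] f by (simp add: lborel_prod)

lemma lborel_integrable_fst: "integrable lborel (\<lambda>x. LBINT t. f (x, t))"
  using lborel_pair.integrable_fst[of "\<lambda>x t. f (x, t)"] f by (simp add: lborel_prod)

end

lemma lborel_integral_swap:
  fixes f :: "'a::euclidean_space \<times> 'b::euclidean_space \<Rightarrow> 'c::euclidean_space"
  assumes "integrable lborel f"
  shows "(LBINT t. (LBINT x. f (x, t))) = (LBINT x. (LBINT t. f (x, t)))"
  by (simp only: lborel_Fubini_snd[OF assms] lborel_Fubini_fst[OF assms])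

lemma lborel_integrable_Fubini:
  fixes f :: "'a::euclidean_space \<times> 'b::euclidean_space \<Rightarrow> 'c::euclidean_space"
  assumes [measurable]: "f \<in> borel_measurable borel"
    and "AE t in lborel. integrable lborel (\<lambda>x. f (x, t))"
    and "integrable lborel (\<lambda>t. LBINT x. norm (f (x, t)))"
  shows "integrable lborel f"
proof -
  have "integrable (lborel \<Otimes>\<^sub>M lborel) (\<lambda>(t, x). f (x, t))"
    by (rule lborel_pair.Fubini_integrable) (use assms in auto)
  then have "integrable (lborel \<Otimes>\<^sub>M lborel) f"
    using lborel_pair.integrable_product_swap_iff[of f] by simp
  then show ?thesis by (simp add: lborel_prod)
qed

lemma integrable_lborel_tensor:
  fixes f :: "'a::euclidean_space \<Rightarrow> real" and g :: "'b::euclidean_space \<Rightarrow> real"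
  assumes "integrable lborel f" "integrable lborel g"
  shows "integrable lborel (\<lambda>z. f (fst z) * g (snd z))"
proof (rule lborel_integrable_Fubini)
  have [measurable]: "f \<in> borel_measurable borel" "g \<in> borel_measurable borel" using assms by auto
  show "(\<lambda>z. f (fst z) * g (snd z)) \<in> borel_measurable borel"
    by (intro borel_measurable_times measurable_compose[OF _ \<open>f \<in> _\<close>] measurable_compose[OF _ \<open>g \<in> _\<close>])
       (auto intro!: borel_measurable_continuous_onI continuous_intros)
  show "AE t in lborel. integrable lborel (\<lambda>x. f (fst (x, t)) * g (snd (x, t)))"
    using assms by (auto intro!: integrable_mult_left)
  have "integrable lborel (\<lambda>t. (LBINT x. \<bar>f x\<bar>) * \<bar>g t\<bar>)"
    using assms by (intro integrable_mult_right integrable_abs)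
  then show "integrable lborel (\<lambda>t. LBINT x. norm (f (fst (x, t)) * g (snd (x, t))))"
    by (simp add: abs_mult)
qed

lemma AE_lborel_shift:
  fixes d :: "'a::euclidean_space"
  assumes "AE x in lborel. Q x"
  shows "AE x in lborel. Q (x + d)"
proof -
  obtain N where N: "{x \<in> space lborel. \<not> Q x} \<subseteq> N" "emeasure lborel N = 0" "N \<in> sets lborel"
    using assms by (auto elim!: AE_E)
  then have [measurable]: "N \<in> sets borel" by simp
  have "(\<integral>\<^sup>+x. indicator N (x + d) \<partial>lborel) = (\<integral>\<^sup>+x. indicator N x \<partial>lborel)"
    by (rule nn_integral_lborel_shift) simp
  then have "(\<integral>\<^sup>+x. indicator N (x + d) \<partial>lborel) = 0"
    using N by (simp add: nn_integral_indicator)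
  then have "AE x in lborel. indicator N (x + d) = (0::ennreal)"
    by (subst (asm) nn_integral_0_iff_AE) auto
  then show ?thesis
    by eventually_elim (use N(1) in \<open>auto simp: indicator_eq_0_iff\<close>)
qed

lemma AE_lborel_ex_interval:
  assumes "AE x in lborel. Q (x::real)" "a < b"
  shows "\<exists>x. a < x \<and> x < b \<and> Q x"
proof (rule ccontr)
  assume "\<not> ?thesis"
  then have "x \<notin> {a<..<b}" if "Q x" for x using that by auto
  with assms(1) have "AE x in lborel. x \<notin> {a<..<b}" by (rule eventually_mono)
  then have "emeasure lborel {a<..<b} = 0"
    using AE_iff_measurable[of "{a<..<b}" lborel "\<lambda>x. x \<notin> {a<..<b}"] by (simp add: greaterThanLessThan_def set_eq_iff)
  then show False using assms(2) by simp
qed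

lemma nsq_slice_integrable:
  fixes f :: "'a::euclidean_space \<times> 'b::euclidean_space \<Rightarrow> 'c::euclidean_space"
  assumes "L2 lborel f"
  shows "AE t in lborel. L2 lborel (\<lambda>x. f (x, t))"
    and "integrable lborel (\<lambda>t. nsq lborel (\<lambda>x. f (x, t)))"
    and "(LBINT t. nsq lborel (\<lambda>x. f (x, t))) = nsq lborel f"
proof -
  have [measurable]: "f \<in> borel_measurable borel" using L2_meas[OF assms] by simp
  have i: "integrable lborel (\<lambda>z. (norm (f z))\<^sup>2)" by (rule L2_int[OF assms])
  show "AE t in lborel. L2 lborel (\<lambda>x. f (x, t))"
    using lborel_AE_integrable_snd[OF i] by eventually_elim (simp add: L2_def)
  show "integrable lborel (\<lambda>t. nsq lborel (\<lambda>x. f (x, t)))"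
    using lborel_integrable_snd[OF i] by (simp add: nsq_def)
  show "(LBINT t. nsq lborel (\<lambda>x. f (x, t))) = nsq lborel f"
    using lborel_Fubini_snd[OF i] by (simp add: nsq_def)
qed

lemma slice_inner_integrable:
  fixes f g :: "'a::euclidean_space \<times> 'b::euclidean_space \<Rightarrow> 'c::euclidean_space"
  assumes "L2 lborel f" "L2 lborel g"
  shows "integrable lborel (\<lambda>t. LBINT x. f (x, t) \<bullet> g (x, t))"
    and "(LBINT t. (LBINT x. f (x, t) \<bullet> g (x, t))) = (LBINT z. f z \<bullet> g z)"
  using lborel_integrable_snd[OF L2_inner_integrable[OF assms]]
    lborel_Fubini_snd[OF L2_inner_integrable[OF assms]] by simp_all

lemma L2_Pair:
  assumes "L2 M f" "L2 M g" shows "L2 M (\<lambda>x. (f x, g x))"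
  using assms by (auto simp: L2_def norm_Pair)

subsection \<open>Testing with the solution itself\<close>

text \<open>The test time \<open>s\<close> may not be set equal to \<open>t\<close> on a null set; instead set \<open>s = t + \<delta>\<close> for almost
  every \<open>\<delta>\<close> and let \<open>\<delta> \<rightarrow> 0\<close> by continuity of translations in \<open>L\<^sup>2\<close>.\<close>

lemma integral_inner_diagonal:
  fixes P R :: "'a::euclidean_space \<times> real \<Rightarrow> 'e::euclidean_space"
  assumes P: "L2 lborel P" and R: "L2 lborel R"
    and zero: "AE s in lborel. AE t in lborel. (LBINT x. P (x, t) \<bullet> R (x, s)) = 0"
  shows "(LBINT z. P z \<bullet> R z) = 0"
proof -
  have [measurable]: "P \<in> borel_measurable borel" "R \<in> borel_measurable borel"
    using L2_meas[OF P] L2_meas[OF R] by auto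
  define c where "c t s = (LBINT x. P (x, t) \<bullet> R (x, s))" for t s
  have c_meas: "(\<lambda>p. c (f p) (g p)) \<in> borel_measurable M"
    if [measurable]: "f \<in> borel_measurable M" "g \<in> borel_measurable M"
    for f g and M :: "(real \<times> real) measure"
    unfolding c_def by measurable
  have neq0: "{p \<in> space M. f p \<noteq> 0} \<in> sets M"
    if [measurable]: "f \<in> borel_measurable M" for f :: "_ \<Rightarrow> real" and M :: "(real \<times> real) measure"
    by measurable
  \<comment> \<open>The exceptional pairs (t, s) form a null set. The shear s = t + d preserves
    Lebesgue measure, so for almost every d the set of exceptional t is null as well; the two
    exchanges of integrals below carry this out.\<close>
  have "(\<integral>\<^sup>+d. (\<integral>\<^sup>+t. indicator {t. c t (t + d) \<noteq> 0} t \<partial>lborel) \<partial>lborel) =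
      (\<integral>\<^sup>+t. (\<integral>\<^sup>+d. indicator {d. c t (t + d) \<noteq> 0} d \<partial>lborel) \<partial>lborel)"
  proof -
    have "(\<lambda>p. indicator {p. c (snd p) (snd p + fst p) \<noteq> 0} p :: ennreal) \<in> borel_measurable (lborel \<Otimes>\<^sub>M lborel)"
      by (intro borel_measurable_indicator) (use neq0[OF c_meas[of snd "lborel \<Otimes>\<^sub>M lborel" "\<lambda>p. snd p + fst p"]] in \<open>simp add: space_pair_measure\<close>)
    from lborel_pair.Fubini'[of "\<lambda>d t. indicator {p. c (snd p) (snd p + fst p) \<noteq> 0} (d, t)", simplified, OF this]
    show ?thesis by (simp add: indicator_def)
  qed
  also have "\<dots> = (\<integral>\<^sup>+t. (\<integral>\<^sup>+s. indicator {s. c t s \<noteq> 0} s \<partial>lborel) \<partial>lborel)"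
  proof (rule nn_integral_cong)
    fix t
    have "(\<lambda>s. c t s) \<in> borel_measurable borel" unfolding c_def by measurable
    then show "(\<integral>\<^sup>+d. indicator {d. c t (t + d) \<noteq> 0} d \<partial>lborel) = (\<integral>\<^sup>+s. indicator {s. c t s \<noteq> 0} s \<partial>lborel)"
      using nn_integral_lborel_shift[of "indicator {s. c t s \<noteq> 0}" t]
      by (simp add: indicator_def add.commute)
  qed
  also have "\<dots> = (\<integral>\<^sup>+s. (\<integral>\<^sup>+t. indicator {t. c t s \<noteq> 0} t \<partial>lborel) \<partial>lborel)"
  proof -
    have "(\<lambda>p. indicator {p. c (snd p) (fst p) \<noteq> 0} p :: ennreal) \<in> borel_measurable (lborel \<Otimes>\<^sub>M lborel)"
      by (intro borel_measurable_indicator) (use neq0[OF c_meas[of snd "lborel \<Otimes>\<^sub>M lborel" "fst"]] in \<open>simp add: space_pair_measure\<close>)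
    from lborel_pair.Fubini'[of "\<lambda>s t. indicator {p. c (snd p) (fst p) \<noteq> 0} (s, t)", simplified, OF this]
    show ?thesis by (simp add: indicator_def)
  qed
  also have "\<dots> = (\<integral>\<^sup>+s. 0 \<partial>(lborel::real measure))"
  proof (rule nn_integral_cong_AE)
    show "AE s in lborel. (\<integral>\<^sup>+t. indicator {t. c t s \<noteq> 0} t \<partial>lborel) = 0"
      using zero
    proof eventually_elim
      case (elim s)
      then have "AE t in lborel. indicator {t. c t s \<noteq> 0} t = (0::ennreal)"
        by eventually_elim (simp add: c_def)
      then have "(\<integral>\<^sup>+t. indicator {t. c t s \<noteq> 0} t \<partial>lborel) = (\<integral>\<^sup>+t. 0 \<partial>(lborel::real measure))"
        by (rule nn_integral_cong_AE)
      then show ?case by simp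
    qed
  qed
  finally have "(\<integral>\<^sup>+d. (\<integral>\<^sup>+t. indicator {t. c t (t + d) \<noteq> 0} t \<partial>lborel) \<partial>lborel) = 0" by simp
  moreover have "(\<lambda>d. \<integral>\<^sup>+t. indicator {t. c t (t + d) \<noteq> 0} t \<partial>lborel) \<in> borel_measurable lborel"
  proof (rule lborel.borel_measurable_nn_integral)
    have "(\<lambda>p. indicator {p. c (snd p) (snd p + fst p) \<noteq> 0} p :: ennreal) \<in> borel_measurable (lborel \<Otimes>\<^sub>M lborel)"
      by (intro borel_measurable_indicator) (use neq0[OF c_meas[of snd "lborel \<Otimes>\<^sub>M lborel" "\<lambda>p. snd p + fst p"]] in \<open>simp add: space_pair_measure\<close>)
    then show "(\<lambda>(d, t). indicator {t. c t (t + d) \<noteq> 0} t :: ennreal) \<in> borel_measurable (lborel \<Otimes>\<^sub>M lborel)"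
      by (simp add: indicator_def case_prod_beta)
  qed
  ultimately have AEd: "AE d in lborel. (\<integral>\<^sup>+t. indicator {t. c t (t + d) \<noteq> 0} t \<partial>lborel) = 0"
    by (subst (asm) nn_integral_0_iff_AE) auto
  have zero_d: "(LBINT z. P z \<bullet> R (z + (0, d))) = 0"
    if "(\<integral>\<^sup>+t. indicator {t. c t (t + d) \<noteq> 0} t \<partial>lborel) = 0" for d
  proof -
    have "(\<lambda>t. c t (t + d)) \<in> borel_measurable borel" unfolding c_def by measurable
    then have "AE t in lborel. c t (t + d) = 0"
      using that by (subst (asm) nn_integral_0_iff_AE) (auto simp: indicator_def split: if_splits)
    then have "(LBINT t. c t (t + d)) = (\<integral>t. 0 \<partial>(lborel::real measure))"
      unfolding c_def by (intro integral_cong_AE) auto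
    then show ?thesis
      using slice_inner_integrable(2)[OF P L2_shift[OF R, of "(0,d)"]] by (simp add: c_def)
  qed
  \<comment> \<open>Almost every shift is good, hence good shifts exist arbitrarily close to
    0.\<close>
  have "\<exists>d. 0 < d \<and> d < 1 / Suc k \<and> (LBINT z. P z \<bullet> R (z + (0, d))) = 0" for k :: nat
    using AE_lborel_ex_interval[OF AEd, of 0 "1 / Suc k"] zero_d by auto
  then obtain d where d: "\<And>k. 0 < d k" "\<And>k::nat. d k < 1 / Suc k"
      "\<And>k. (LBINT z. P z \<bullet> R (z + (0, d k))) = 0" by metis
  have d0: "d \<longlonglongrightarrow> 0"
  proof (rule Lim_null_comparison)
    show "\<forall>\<^sub>F k in sequentially. norm (d k) \<le> inverse (real (Suc k))"
    proof (intro always_eventually allI)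
      fix k show "norm (d k) \<le> inverse (real (Suc k))"
        using d(1)[of k] d(2)[of k] by (simp add: inverse_eq_divide)
    qed
  qed (rule LIMSEQ_inverse_real_of_nat)
  then have "(\<lambda>k. (0::'a, d k)) \<longlonglongrightarrow> (0, 0)" by (intro tendsto_Pair tendsto_const)
  then have "(\<lambda>k. (0::'a, d k)) \<longlonglongrightarrow> 0" by (simp add: zero_prod_def)
  from L2_inner_tendsto[OF R L2_shift[OF R] P L2_shift_tendsto[OF R this]]
  have "(\<lambda>k. LBINT z. R (z + (0, d k)) \<bullet> P z) \<longlonglongrightarrow> (LBINT z. R z \<bullet> P z)" .
  then have "(\<lambda>k. 0::real) \<longlonglongrightarrow> (LBINT z. P z \<bullet> R z)"
    using d(3) by (simp add: inner_commute)
  then show ?thesis by (simp add: LIMSEQ_const_iff)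
qed

subsection \<open>Backward time averages\<close>

text \<open>Cauchy-Schwarz against the indicator of (0, h), whose squared norm is h.\<close>

lemma norm_integral_sq_le:
  fixes J :: "real \<Rightarrow> 'e::euclidean_space"
  assumes J: "L2 lborel J" and h: "h > 0" and z: "\<And>s. s \<notin> {0<..<h} \<Longrightarrow> J s = 0"
  shows "integrable lborel J" "(norm (LBINT s. J s))\<^sup>2 \<le> h * nsq lborel J"
proof -
  have L: "L2 lborel (\<lambda>s. norm (J s))" using J by (auto simp: L2_def)
  have I: "L2 lborel (\<lambda>s. indicator {0<..<h} s *\<^sub>R (1::real))" by (rule L2_const_indicator) (use h in auto)
  have eq: "(\<lambda>s. norm (J s) \<bullet> (indicator {0<..<h} s *\<^sub>R 1)) = (\<lambda>s. norm (J s))"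
    using z by (fastforce split: split_indicator)
  have i: "integrable lborel (\<lambda>s. norm (J s))" using L2_inner_integrable[OF L I] unfolding eq .
  then show ij: "integrable lborel J" using L2_meas[OF J] by (rule integrable_norm_cancel)
  have "norm (LBINT s. J s) \<le> (LBINT s. norm (J s))" by (rule integral_norm_bound)
  also have "\<dots> \<le> sqrt (nsq lborel (\<lambda>s. norm (J s))) * sqrt (nsq lborel (\<lambda>s. indicator {0<..<h} s *\<^sub>R (1::real)))"
    using L2_Cauchy_Schwarz[OF L I] unfolding eq by linarith
  also have "nsq lborel (\<lambda>s. indicator {0<..<h} s *\<^sub>R (1::real)) = (LBINT s. indicator {0<..<h} s)"
    unfolding nsq_def by (intro Bochner_Integration.integral_cong) (auto split: split_indicator)
  also have "\<dots> = h" using h by simp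
  finally have "norm (LBINT s. J s) \<le> sqrt (nsq lborel J) * sqrt h" by (simp add: nsq_def)
  from power_mono[OF this, of 2] show "(norm (LBINT s. J s))\<^sup>2 \<le> h * nsq lborel J"
    using h by (simp add: power_mult_distrib nsq_nonneg mult.commute)
qed

locale time_average =
  fixes F :: "'a::euclidean_space \<times> real \<Rightarrow> 'e::euclidean_space" and h :: real
  assumes F: "L2 lborel F" and h: "h > 0"
begin

text \<open>The average over the preceding time span h, deliberately not divided by h: in this form
  it is the increment of a primitive of F between t - h and t.\<close>

definition Fh where "Fh z = (LBINT s. indicator {0<..<h} s *\<^sub>R F (z - (0, s)))"

text \<open>The integrand of \<open>Fh\<close> as a function on the product with the delay variable,
  which is where Fubini is applied.\<close>

definition JJ where "JJ p = indicator {0<..<h} (snd p) *\<^sub>R F (fst p - (0, snd p))"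

lemma F_meas[measurable]: "F \<in> borel_measurable borel"
  using L2_meas[OF F] by simp

lemma JJ_meas[measurable]: "JJ \<in> borel_measurable borel"
proof -
  have [measurable]: "(fst :: ('a \<times> real) \<times> real \<Rightarrow> _) \<in> borel_measurable borel"
    "(snd :: ('a \<times> real) \<times> real \<Rightarrow> _) \<in> borel_measurable borel"
    by (auto intro!: borel_measurable_continuous_onI continuous_intros)
  show ?thesis unfolding JJ_def by measurable
qed

lemma JJ_L2: "L2 lborel JJ"
  unfolding L2_def
proof
  show "integrable lborel (\<lambda>p. (norm (JJ p))\<^sup>2)"
  proof (rule lborel_integrable_Fubini)
    have sh: "integrable lborel (\<lambda>z. (norm (F (z - (0, s))))\<^sup>2)"
        "(LBINT z. (norm (F (z - (0, s))))\<^sup>2) = nsq lborel F" for s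
      using L2_int[OF L2_shift[OF F, of "- (0,s)"]] nsq_shift[OF F, of "- (0,s)"] by (simp_all add: nsq_def diff_conv_add_uminus del: add_uminus_conv_diff)
    have eq: "(norm (JJ (z, s)))\<^sup>2 = indicator {0<..<h} s * (norm (F (z - (0, s))))\<^sup>2" for z s
      by (simp add: JJ_def split: split_indicator)
    show "AE s in lborel. integrable lborel (\<lambda>z. (norm (JJ (z, s)))\<^sup>2)"
      unfolding eq using sh(1) by (auto intro!: integrable_mult_right)
    have "integrable lborel (\<lambda>s. indicator {0<..<h} s * nsq lborel F)"
      using h by (intro integrable_mult_left integrable_real_indicator) auto
    then show "integrable lborel (\<lambda>s. LBINT z. norm ((norm (JJ (z, s)))\<^sup>2))"
      by (simp add: eq sh(2) abs_mult)
  qed measurable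
qed simp

lemma Fh_meas[measurable]: "Fh \<in> borel_measurable borel"
  unfolding Fh_def by measurable

lemma Fh_L2: "L2 lborel Fh"
proof (rule L2I_bound[where g="\<lambda>z. h * (LBINT s. (norm (JJ (z, s)))\<^sup>2)"])
  show "integrable lborel (\<lambda>z. h * (LBINT s. (norm (JJ (z, s)))\<^sup>2))"
    by (intro integrable_mult_right lborel_integrable_fst L2_int[OF JJ_L2])
  show "AE z in lborel. (norm (Fh z))\<^sup>2 \<le> h * (LBINT s. (norm (JJ (z, s)))\<^sup>2)"
    using lborel_AE_integrable_fst[OF L2_int[OF JJ_L2]]
  proof eventually_elim
    case (elim z)
    have "L2 lborel (\<lambda>s. JJ (z, s))" using elim by (simp add: L2_def)
    from norm_integral_sq_le(2)[OF this h] show ?case by (simp add: JJ_def Fh_def nsq_def)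
  qed
qed simp

text \<open>The fixed time t forces Fubini on the slice, so integrability has to be established for
  almost every t separately; a null set of points (x, t) is turned into one of times for that
  purpose.\<close>

lemma Fh_inner_slice:
  fixes g :: "'a \<Rightarrow> 'e"
  assumes g: "L2 lborel g" and Ft: "integrable lborel (\<lambda>t. nsq lborel (\<lambda>x. F (x, t)))"
  shows "AE t in lborel. (LBINT x. Fh (x, t) \<bullet> g x) =
     (LBINT s. indicator {0<..<h} s * (LBINT x. F (x, t - s) \<bullet> g x))"
proof -
  have [measurable]: "g \<in> borel_measurable borel" using L2_meas[OF g] by simp
  have 1: "AE t in lborel. AE x in lborel. integrable lborel (\<lambda>s. JJ ((x, t), s))"
  proof -
    have "AE z in lborel. integrable lborel (\<lambda>s. JJ (z, s))"
      using lborel_AE_integrable_fst[OF L2_int[OF JJ_L2]]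
    proof eventually_elim
      case (elim z)
      have "L2 lborel (\<lambda>s. JJ (z, s))" using elim by (simp add: L2_def)
      from norm_integral_sq_le(1)[OF this h] show ?case by (simp add: JJ_def)
    qed
    then have "AE z in lborel \<Otimes>\<^sub>M lborel. integrable lborel (\<lambda>s. JJ (z, s))" by (subst lborel_prod)
    then have "AE x in lborel. AE t in lborel. integrable lborel (\<lambda>s. JJ ((x, t), s))"
      by (rule lborel_pair.AE_pair)
    moreover have "Measurable.pred (lborel \<Otimes>\<^sub>M lborel) (\<lambda>p. integrable lborel (\<lambda>s. JJ ((fst p, snd p), s)))"
      by measurable
    ultimately show ?thesis by (subst (asm) lborel_pair.AE_commute) (simp_all add: pred_def)
  qed
  have 2: "AE t in lborel. L2 lborel (\<lambda>x. F (x, t))" by (rule nsq_slice_integrable(1)[OF F])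
  show ?thesis
    using 1
  proof eventually_elim
    case (elim t)
    define H where "H p = JJ ((fst p, t), snd p) \<bullet> g (fst p)" for p :: "'a \<times> real"
    have [measurable]: "(fst :: 'a \<times> real \<Rightarrow> _) \<in> borel_measurable borel"
      "(snd :: 'a \<times> real \<Rightarrow> _) \<in> borel_measurable borel"
      by (auto intro!: borel_measurable_continuous_onI continuous_intros)
    have Hm[measurable]: "H \<in> borel_measurable borel" unfolding H_def by measurable
    \<comment> \<open>The reflection s -> t - s preserves null sets.\<close>
    have s2: "AE s in lborel. L2 lborel (\<lambda>x. F (x, t - s))"
    proof -
      have "AE s in distr lborel borel uminus. L2 lborel (\<lambda>x. F (x, s))"
        using 2 by (subst lborel_distr_uminus)
      then have "AE s in lborel. L2 lborel (\<lambda>x. F (x, - s))"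
        by (subst (asm) AE_distr_iff) (auto simp: L2_def)
      from AE_lborel_shift[OF this, of "-t"] show ?thesis by simp
    qed
    have Hi: "integrable lborel H"
    proof (rule lborel_integrable_Fubini[OF Hm])
      show "AE s in lborel. integrable lborel (\<lambda>x. H (x, s))"
        using s2
      proof eventually_elim
        case (elim s)
        show ?case using L2_inner_integrable[OF elim g] unfolding H_def JJ_def
          by (auto intro!: integrable_mult_right)
      qed
      show "integrable lborel (\<lambda>s. LBINT x. norm (H (x, s)))"
      proof (rule Bochner_Integration.integrable_bound)
        have "integrable lborel (\<lambda>s. nsq lborel (\<lambda>x. F (x, t - s)))"
          using lborel_integrable_real_affine[OF Ft, of "-1" t] by simp
        then show "integrable lborel (\<lambda>s. nsq lborel (\<lambda>x. F (x, t - s)) + indicator {0<..<h} s * nsq lborel g)"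
          using h by (intro Bochner_Integration.integrable_add integrable_mult_left integrable_real_indicator) auto
        show "AE s in lborel. norm (LBINT x. norm (H (x, s)))
          \<le> norm (nsq lborel (\<lambda>x. F (x, t - s)) + indicator {0<..<h} s * nsq lborel g)"
          using s2
        proof eventually_elim
          case (elim s)
          have "(LBINT x. norm (H (x, s))) \<le>
             (LBINT x. (norm (F (x, t - s)))\<^sup>2 + indicator {0<..<h} s * (norm (g x))\<^sup>2)"
          proof (rule integral_mono')
            show "integrable lborel (\<lambda>x. (norm (F (x, t - s)))\<^sup>2 + indicator {0<..<h} s * (norm (g x))\<^sup>2)"
              using L2_int[OF elim] L2_int[OF g] by auto
            fix x
            have "\<bar>F (x, t - s) \<bullet> g x\<bar> \<le> norm (F (x, t - s)) * norm (g x)" by (rule Cauchy_Schwarz_ineq2)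
            also have "\<dots> \<le> (norm (F (x, t - s)))\<^sup>2 + (norm (g x))\<^sup>2"
              using sum_squares_bound[of "norm (F (x, t - s))" "norm (g x)"]
                mult_nonneg_nonneg[OF norm_ge_zero[of "F (x, t - s)"] norm_ge_zero[of "g x"]] by linarith
            finally show "norm (H (x, s)) \<le> (norm (F (x, t - s)))\<^sup>2 + indicator {0<..<h} s * (norm (g x))\<^sup>2"
              by (auto simp: H_def JJ_def split: split_indicator)
          qed auto
          also have "\<dots> = nsq lborel (\<lambda>x. F (x, t - s)) + indicator {0<..<h} s * nsq lborel g"
            using L2_int[OF elim] L2_int[OF g] by (simp add: nsq_def)
          finally show ?case by simp
        qed
      qed measurable
    qed
    have "(LBINT x. Fh (x, t) \<bullet> g x) = (LBINT x. (LBINT s. H (x, s)))"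
    proof (rule integral_cong_AE)
      show "AE x in lborel. Fh (x, t) \<bullet> g x = (LBINT s. H (x, s))"
        using elim
      proof eventually_elim
        case (elim x)
        from integral_inner_left[OF elim, of "g x"] show ?case unfolding H_def by (simp add: Fh_def JJ_def)
      qed
    qed measurable
    also have "\<dots> = (LBINT s. (LBINT x. H (x, s)))"
      by (rule lborel_integral_swap[OF Hi, symmetric])
    also have "\<dots> = (LBINT s. indicator {0<..<h} s * (LBINT x. F (x, t - s) \<bullet> g x))"
      by (simp add: H_def JJ_def)
    finally show ?case .
  qed
qed

lemma Fh_inner:
  assumes g: "L2 lborel g"
  shows "(LBINT z. Fh z \<bullet> g z) =
     (LBINT s. indicator {0<..<h} s * (LBINT z. F (z - (0, s)) \<bullet> g z))"
    and "integrable lborel (\<lambda>s. indicator {0<..<h} s * (LBINT z. F (z - (0, s)) \<bullet> g z))"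
proof -
  have [measurable]: "g \<in> borel_measurable borel" using L2_meas[OF g] by simp
  define G where "G p = (indicator {0<..<h} (snd p) :: real) *\<^sub>R g (fst p)" for p :: "('a \<times> real) \<times> real"
  have [measurable]: "(fst :: ('a \<times> real) \<times> real \<Rightarrow> _) \<in> borel_measurable borel"
      "(snd :: ('a \<times> real) \<times> real \<Rightarrow> _) \<in> borel_measurable borel"
    by (auto intro!: borel_measurable_continuous_onI continuous_intros)
  have G: "L2 lborel G"
    unfolding L2_def
  proof
    show "G \<in> borel_measurable lborel" unfolding G_def by measurable
    have "integrable lborel (\<lambda>p::('a \<times> real) \<times> real. (norm (g (fst p)))\<^sup>2 * indicator {0<..<h} (snd p))"
      using h by (intro integrable_lborel_tensor L2_int[OF g]) auto
    then show "integrable lborel (\<lambda>p. (norm (G p))\<^sup>2)"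
      by (rule Bochner_Integration.integrable_cong[THEN iffD1, rotated 2])
         (auto simp: G_def split: split_indicator)
  qed
  have i: "integrable lborel (\<lambda>p. JJ p \<bullet> G p)" by (rule L2_inner_integrable[OF JJ_L2 G])
  have eq: "JJ (z, s) \<bullet> G (z, s) = indicator {0<..<h} s * (F (z - (0, s)) \<bullet> g z)" for z s
    by (auto simp: JJ_def G_def split: split_indicator)
  have "(LBINT z. Fh z \<bullet> g z) = (LBINT z. (LBINT s. JJ (z, s) \<bullet> G (z, s)))"
  proof (rule integral_cong_AE)
    show "AE z in lborel. Fh z \<bullet> g z = (LBINT s. JJ (z, s) \<bullet> G (z, s))"
      using lborel_AE_integrable_fst[OF L2_int[OF JJ_L2]]
    proof eventually_elim
      case (elim z)
      have "L2 lborel (\<lambda>s. JJ (z, s))" using elim by (simp add: L2_def)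
      from norm_integral_sq_le(1)[OF this h] have "integrable lborel (\<lambda>s. JJ (z, s))"
        by (simp add: JJ_def)
      from integral_inner_left[OF this, of "g z"] have "Fh z \<bullet> g z = (LBINT s. JJ (z, s) \<bullet> g z)"
        by (simp add: Fh_def JJ_def)
      then show ?case unfolding eq by (simp add: JJ_def)
    qed
    have "(\<lambda>z. LBINT s. indicator {0<..<h} s * (F (z - (0, s)) \<bullet> g z)) \<in> borel_measurable lborel"
      by measurable
    then show "(\<lambda>z. LBINT s. JJ (z, s) \<bullet> G (z, s)) \<in> borel_measurable lborel"
      by (simp add: eq)
  qed measurable
  also have "\<dots> = (LBINT s. (LBINT z. JJ (z, s) \<bullet> G (z, s)))"
    by (rule lborel_integral_swap[OF i, symmetric])
  finally show "(LBINT z. Fh z \<bullet> g z) =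
     (LBINT s. indicator {0<..<h} s * (LBINT z. F (z - (0, s)) \<bullet> g z))" by (simp add: eq)
  show "integrable lborel (\<lambda>s. indicator {0<..<h} s * (LBINT z. F (z - (0, s)) \<bullet> g z))"
    using lborel_integrable_snd[OF i] by (simp add: eq)
qed

end

lemma L2_shift_minus:
  fixes f :: "'a::euclidean_space \<Rightarrow> 'b::euclidean_space"
  assumes "L2 lborel f"
  shows "L2 lborel (\<lambda>x. f (x - d))" "nsq lborel (\<lambda>x. f (x - d)) = nsq lborel f"
  using L2_shift[OF assms, of "- d"] nsq_shift[OF assms, of "- d"] by (simp_all only: add_uminus_conv_diff)

lemma nsq_tendsto:
  assumes "L2 M f" "\<And>i. L2 M (f' i)" "((\<lambda>i. nsq M (\<lambda>x. f' i x - f x)) \<longlongrightarrow> 0) F"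
  shows "((\<lambda>i. nsq M (f' i)) \<longlongrightarrow> nsq M f) F"
proof -
  have "((\<lambda>i. 2 * (\<integral>x. f' i x \<bullet> f x \<partial>M) + nsq M (\<lambda>x. f' i x - f x) - nsq M f) \<longlongrightarrow>
     2 * (\<integral>x. f x \<bullet> f x \<partial>M) + 0 - nsq M f) F"
    by (intro tendsto_intros L2_inner_tendsto[OF assms(1,2,1,3)] assms(3))
  moreover have "2 * (\<integral>x. f' i x \<bullet> f x \<partial>M) + nsq M (\<lambda>x. f' i x - f x) - nsq M f = nsq M (f' i)" for i
    using nsq_diff[OF assms(2)[of i] assms(1)] by simp
  ultimately show ?thesis by (simp add: nsq_inner)
qed

text \<open>If the limit were positive, d would exceed half of it on some interval (0, 1/(n+1)), and
  so would its averages there. The restriction h < 1 matches the length of time by which solutions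
  are extended to negative times.\<close>

lemma nonpos_of_averages:
  fixes d :: "real \<Rightarrow> real"
  assumes int: "\<And>h. 0 < h \<Longrightarrow> h < 1 \<Longrightarrow> integrable lborel (\<lambda>s. indicator {0<..<h} s * d s)"
    and le: "\<And>h. 0 < h \<Longrightarrow> h < 1 \<Longrightarrow> (prim d h) \<le> 0"
    and lim: "\<And>s::nat \<Rightarrow> real. s \<longlonglongrightarrow> 0 \<Longrightarrow> (\<lambda>k. d (s k)) \<longlonglongrightarrow> d0"
  shows "d0 \<le> 0"
proof (rule ccontr)
  assume "\<not> d0 \<le> 0"
  then have d0: "d0 > 0" by simp
  have "\<exists>n::nat. \<forall>s. 0 < s \<and> s < 1 / Suc n \<longrightarrow> d s > d0 / 2"
  proof (rule ccontr)
    assume "\<not> ?thesis"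
    then obtain s where s: "\<And>n::nat. 0 < s n" "\<And>n. s n < 1 / Suc n" "\<And>n. d (s n) \<le> d0 / 2"
      by (metis not_less)
    have "s \<longlonglongrightarrow> 0"
    proof (rule Lim_null_comparison)
      show "\<forall>\<^sub>F k in sequentially. norm (s k) \<le> inverse (real (Suc k))"
      proof (intro always_eventually allI)
        fix k show "norm (s k) \<le> inverse (real (Suc k))"
          using s(1)[of k] s(2)[of k] by (simp add: inverse_eq_divide)
      qed
    qed (rule LIMSEQ_inverse_real_of_nat)
    from lim[OF this] have "d0 \<le> d0 / 2" by (rule LIMSEQ_le_const2) (use s in auto)
    then show False using d0 by simp
  qed
  then obtain n :: nat where n: "\<And>s. 0 < s \<Longrightarrow> s < 1 / Suc n \<Longrightarrow> d s > d0 / 2" by auto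
  define h where "h = 1 / (Suc n + 1 :: real)"
  have h: "0 < h" "h < 1" "h < 1 / Suc n" by (auto simp: h_def field_simps)
  have "0 < h * (d0 / 2)" using h d0 by simp
  also have "\<dots> = (LBINT s. indicator {0<..<h} s * (d0 / 2))" using h by simp
  also have "\<dots> \<le> (prim d h)"
  proof (rule integral_mono)
    show "integrable lborel (\<lambda>s. indicator {0<..<h} s * (d0 / 2))"
      using h by (intro integrable_mult_left integrable_real_indicator) auto
    show "integrable lborel (\<lambda>s. indicator {0<..<h} s * d s)" by (rule int[OF h(1,2)])
    show "indicator {0<..<h} s * (d0 / 2) \<le> indicator {0<..<h} s * d s" for s
      using n[of s] h by (auto split: split_indicator)
  qed
  also have "\<dots> \<le> 0" by (rule le[OF h(1,2)])
  finally show False by simp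
qed

text \<open>It suffices to test with the part of S on which g is positive.\<close>

lemma AE_nonpos_of_set_integrals:
  fixes g :: "'a \<Rightarrow> real"
  assumes g: "integrable M g" and S: "S \<in> sets M"
    and le: "\<And>A. A \<in> sets M \<Longrightarrow> A \<subseteq> S \<Longrightarrow> (\<integral>x. indicator A x * g x \<partial>M) \<le> 0"
  shows "AE x in M. x \<in> S \<longrightarrow> g x \<le> 0"
proof -
  have [measurable]: "g \<in> borel_measurable M" "S \<in> sets M" using g S by auto
  define A where "A = {x \<in> space M. x \<in> S \<and> g x > 0}"
  have A[measurable]: "A \<in> sets M" unfolding A_def by measurable
  have nn: "0 \<le> indicator A x * g x" for x by (auto simp: A_def split: split_indicator)
  have i: "integrable M (\<lambda>x. indicator A x * g x)"
    using integrable_mult_indicator[OF A g] by simp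
  have "(\<integral>x. indicator A x * g x \<partial>M) = 0"
  proof (rule antisym)
    show "(\<integral>x. indicator A x * g x \<partial>M) \<le> 0" using A by (rule le) (auto simp: A_def)
    show "0 \<le> (\<integral>x. indicator A x * g x \<partial>M)" using nn by (intro integral_nonneg_AE) simp
  qed
  then have "AE x in M. indicator A x * g x = 0"
    using integral_nonneg_eq_0_iff_AE[OF i] nn by simp
  then show ?thesis
    using AE_space by eventually_elim (auto simp: A_def split: split_indicator_asm)
qed

text \<open>The convexity inequality that replaces the product rule for |z|^2: a is the current and
  b the delayed value, and the increment is paired with the current one.\<close>

lemma norm_sq_diff_le: "(norm a)\<^sup>2 - (norm b)\<^sup>2 \<le> 2 * ((a - b) \<bullet> (a::'a::real_inner))"
proof -
  have "0 \<le> (a - b) \<bullet> (a - b)" by simp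
  then show ?thesis by (simp add: power2_norm_eq_inner inner_diff_left inner_diff_right inner_commute)
qed

lemma L2_tensor:
  fixes g :: "'a::euclidean_space \<Rightarrow> 'e::euclidean_space"
  assumes g: "L2 lborel g" and A: "A \<in> sets borel" "emeasure lborel A < \<infinity>"
  shows "L2 lborel (\<lambda>p :: 'a \<times> real. indicator A (snd p) *\<^sub>R g (fst p))"
  unfolding L2_def
proof
  have [measurable]: "g \<in> borel_measurable borel" "A \<in> sets borel" using L2_meas[OF g] A by auto
  have [measurable]: "(fst :: ('a \<times> real) \<Rightarrow> _) \<in> borel_measurable borel"
      "(snd :: ('a \<times> real) \<Rightarrow> _) \<in> borel_measurable borel"
    by (auto intro!: borel_measurable_continuous_onI continuous_intros)
  show "(\<lambda>p. indicator A (snd p) *\<^sub>R g (fst p)) \<in> borel_measurable lborel" by measurable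
  have "integrable lborel (\<lambda>p::'a \<times> real. (norm (g (fst p)))\<^sup>2 * indicator A (snd p))"
    using A by (intro integrable_lborel_tensor L2_int[OF g] integrable_real_indicator) auto
  then show "integrable lborel (\<lambda>p::'a\<times>real. (norm (indicator A (snd p) *\<^sub>R g (fst p)))\<^sup>2)"
    by (rule Bochner_Integration.integrable_cong[THEN iffD1, rotated 2]) (auto split: split_indicator)
qed

text \<open>The tail measure t -> |A \<inter> (t, \<infinity>)| is the weight of the energy
  argument. Its decrease over a step h is the average of the indicator of A, the discrete form of m'
  = -1 on A.\<close>

lemma measure_tail_diff:
  fixes A :: "real set"
  assumes [measurable]: "A \<in> sets borel" and fin: "emeasure lborel A < \<infinity>" and h: "h > 0"
  shows "measure lborel (A \<inter> {t<..}) - measure lborel (A \<inter> {t + h<..})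
     = (LBINT s. indicator {0<..<h} s * indicator A (t + s))"
proof -
  have finA: "A \<inter> S \<in> fmeasurable lborel" if "S \<in> sets borel" for S
  proof (rule fmeasurableI)
    show "A \<inter> S \<in> sets lborel" using that assms(1) by auto
    have "emeasure lborel (A \<inter> S) \<le> emeasure lborel A" by (rule emeasure_mono) auto
    then show "emeasure lborel (A \<inter> S) < \<infinity>" using fin by (rule le_less_trans)
  qed
  have "measure lborel (A \<inter> {t<..}) - measure lborel (A \<inter> {t + h<..}) =
      measure lborel (A \<inter> {t<..} - A \<inter> {t + h<..})"
    by (rule measurable_measure_Diff[symmetric]) (use finA h in auto)
  also have "A \<inter> {t<..} - A \<inter> {t + h<..} = A \<inter> {t<..t+h}" by auto
  also have "measure lborel (A \<inter> {t<..t+h}) = (LBINT r. indicator (A \<inter> {t<..t+h}) r)" by simp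
  also have "\<dots> = (LBINT r. indicator (A \<inter> {t<..<t+h}) r)"
  proof (rule integral_cong_AE)
    show "AE r in lborel. indicator (A \<inter> {t<..t+h}) r = (indicator (A \<inter> {t<..<t+h}) r :: real)"
      using AE_lborel_singleton[of "t + h"] by eventually_elim (auto split: split_indicator)
  qed auto
  also have "\<dots> = (LBINT s. indicator (A \<inter> {t<..<t+h}) (s + t))"
    using integral_lborel_shift[of "indicator (A \<inter> {t<..<t+h}) :: real \<Rightarrow> real" t] by simp
  also have "\<dots> = (LBINT s. indicator {0<..<h} s * indicator A (t + s))"
    by (intro Bochner_Integration.integral_cong) (auto simp: add.commute split: split_indicator)
  finally show ?thesis .
qed

section \<open>The energy inequality for an abstract evolution equation\<close>

locale evolution =
  fixes T :: real and z :: "'a::euclidean_space \<times> real \<Rightarrow> 'e::euclidean_space"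
    and zz F :: "'a \<times> real \<Rightarrow> 'g::euclidean_space" and z0 :: "'a \<Rightarrow> 'e"
  assumes T: "T > 0" and z: "L2 lborel z" and zz: "L2 lborel zz" and F: "L2 lborel F" and z0: "L2 lborel z0"
    and supp: "\<And>x t. t \<notin> {0<..<T} \<Longrightarrow> z (x, t) = 0" "\<And>x t. t \<notin> {0<..<T} \<Longrightarrow> zz (x, t) = 0"
      "\<And>x t. t \<notin> {0<..<T} \<Longrightarrow> F (x, t) = 0"
    and weak: "AE s in lborel. AE t\<in>{0<..<T} in lborel.
      (LBINT x. z (x, t) \<bullet> z (x, s)) = (LBINT x. z0 x \<bullet> z (x, s)) +
        (LBINT r. indicator {0<..<t} r * (LBINT x. F (x, r) \<bullet> zz (x, s)))"
begin

lemma meas[measurable]: "z \<in> borel_measurable borel" "zz \<in> borel_measurable borel" "F \<in> borel_measurable borel"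
  "z0 \<in> borel_measurable borel"
  using z zz F z0 by (auto dest: L2_meas)

lemma fst_snd_meas[measurable]: "(fst :: ('a \<times> real) \<Rightarrow> _) \<in> borel_measurable borel"
      "(snd :: ('a \<times> real) \<Rightarrow> _) \<in> borel_measurable borel"
  by (auto intro!: borel_measurable_continuous_onI continuous_intros)

text \<open>Extension by the initial value to one unit of negative time. A backward difference at
  small t then sees z0 automatically, and the extension stays square integrable.\<close>

definition zt where "zt p = z p + indicator {-1<..0} (snd p) *\<^sub>R z0 (fst p)"

lemma zt: "L2 lborel zt"
  unfolding zt_def by (intro L2_add z L2_tensor z0) auto

lemma zt_pos: "t > 0 \<Longrightarrow> zt (x, t) = z (x, t)"
  by (simp add: zt_def)

lemma kernel_integrable:
  assumes "L2 lborel (\<lambda>x. zz (x, s))"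
  shows "integrable lborel (\<lambda>r. LBINT x. F (x, r) \<bullet> zz (x, s))"
proof -
  have g: "L2 lborel (\<lambda>p. indicator {0<..<T} (snd p) *\<^sub>R zz (fst p, s))"
    by (rule L2_tensor[OF assms]) (use T in auto)
  have "(LBINT x. F (x, r) \<bullet> (indicator {0<..<T} r *\<^sub>R zz (x, s))) = (LBINT x. F (x, r) \<bullet> zz (x, s))" for r
    using supp(3)[of r] by (cases "r \<in> {0<..<T}") auto
  from slice_inner_integrable(1)[OF F g] this show ?thesis by (simp only: fst_conv snd_conv)
qed

text \<open>Subtracting the integrated identities at t and t - h, both tested with z(s), leaves the
  increment of the primitive, which is the backward average of F paired with zz(s). The diagonal s =
  t is then permitted, and the weight \<open>mu\<close> is carried along. The difference is not
  divided by h.\<close>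

lemma difference_quotient:
  assumes h: "0 < h" "h < 1" and mu[measurable]: "mu \<in> borel_measurable borel"
    and mu0: "\<And>t. t \<notin> {0<..<T} \<Longrightarrow> mu t = 0" and B: "\<And>t. \<bar>mu t\<bar> \<le> B"
  shows "(LBINT p. mu (snd p) * ((zt p - zt (p - (0, h))) \<bullet> z p)) =
    (LBINT s. indicator {0<..<h} s * (LBINT p. F (p - (0, s)) \<bullet> (mu (snd p) *\<^sub>R zz p)))"
    and "integrable lborel (\<lambda>s. indicator {0<..<h} s * (LBINT p. F (p - (0, s)) \<bullet> (mu (snd p) *\<^sub>R zz p)))"
proof -
  interpret time_average F h by unfold_locales (use F h in auto)
  have [measurable]: "zt \<in> borel_measurable borel" using L2_meas[OF zt] by simp
  have dz: "L2 lborel (\<lambda>p. zt p - zt (p - (0, h)))"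
    by (rule L2_diff[OF zt L2_shift_minus(1)[OF zt]])
  have m: "(\<lambda>p::'a\<times>real. mu (snd p)) \<in> borel_measurable lborel" by measurable
  have mb: "AE p in lborel. \<bar>mu (snd p)\<bar> \<le> B" for p :: "'a \<times> real" using B by auto
  have mzz: "L2 lborel (\<lambda>p. mu (snd p) *\<^sub>R zz p)"
    by (rule L2_mult_bounded[OF zz m]) (use B in auto)
  have mdz: "L2 lborel (\<lambda>p. mu (snd p) *\<^sub>R (zt p - zt (p - (0, h))))"
    by (rule L2_mult_bounded[OF dz m]) (use B in auto)
  have mF: "L2 lborel (\<lambda>p. mu (snd p) *\<^sub>R (- Fh p))"
    by (rule L2_mult_bounded[OF L2_uminus[OF Fh_L2] m]) (use B in auto)
  \<comment> \<open>Both sides of the identity are packed into one inner product, so that the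
    diagonal argument is applied to the whole equation, with z and zz evaluated at the same time
    s.\<close>
  define P where "P p = (mu (snd p) *\<^sub>R (zt p - zt (p - (0, h))), mu (snd p) *\<^sub>R (- Fh p))" for p
  have P: "L2 lborel P" unfolding P_def by (rule L2_Pair[OF mdz mF])
  define R where "R p = (z p, zz p)" for p
  have R: "L2 lborel R" unfolding R_def by (rule L2_Pair[OF z zz])
  have "(LBINT p. P p \<bullet> R p) = 0"
  proof (rule integral_inner_diagonal[OF P R])
    show "AE s in lborel. AE t in lborel. (LBINT x. P (x, t) \<bullet> R (x, s)) = 0"
      using weak nsq_slice_integrable(1)[OF z] nsq_slice_integrable(1)[OF zz]
    proof eventually_elim
      case (elim s)
      define k where "k r = (LBINT x. F (x, r) \<bullet> zz (x, s))" for r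
      have k: "integrable lborel k" unfolding k_def[abs_def] by (rule kernel_integrable[OF elim(3)])
      have k0: "k r = 0" if "r \<notin> {0<..<T}" for r using supp(3)[OF that] by (simp add: k_def)
      have [measurable]: "k \<in> borel_measurable borel" using k by auto
      define b where "b = (LBINT x. z0 x \<bullet> z (x, s))"
      define K where "K t = (prim k t)" for t
      have ki: "integrable lborel (\<lambda>r. indicator A r * k r)" if "A \<in> sets borel" for A
        using integrable_mult_indicator[OF _ k, of A] that by simp
      have K_diff: "K t - K (t - h) = (LBINT s. indicator {0<..<h} s * k (t - s))" for t
      proof -
        have "K t - K (t - h) = (LBINT r. indicator {0<..<t} r * k r - indicator {0<..<t-h} r * k r)"
          unfolding K_def by (rule Bochner_Integration.integral_diff[symmetric]) (auto intro!: ki)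
        also have "\<dots> = (LBINT r. indicator {t-h<..<t} r * k r)"
        proof (rule integral_cong_AE)
          show "AE r in lborel. indicator {0<..<t} r * k r - indicator {0<..<t-h} r * k r = indicator {t-h<..<t} r * k r"
            using AE_lborel_singleton[of "t - h"]
          proof eventually_elim
            case (elim r)
            then show ?case using k0[of r] h by (auto split: split_indicator)
          qed
        qed auto
        also have "\<dots> = (LBINT s. indicator {t-h<..<t} (t - s) * k (t - s))"
          using lborel_integral_real_affine[of "-1" "\<lambda>r. indicator {t-h<..<t} r * k r" t] by simp
        also have "\<dots> = (LBINT s. indicator {0<..<h} s * k (t - s))"
          by (intro Bochner_Integration.integral_cong) (auto split: split_indicator)
        finally show ?thesis .
      qed
      show ?case
        using elim(1) AE_lborel_shift[OF elim(1), of "- h"]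
          nsq_slice_integrable(1)[OF dz] nsq_slice_integrable(1)[OF Fh_L2]
          Fh_inner_slice[OF elim(3) nsq_slice_integrable(2)[OF F]]
          nsq_slice_integrable(1)[OF zt] nsq_slice_integrable(1)[OF L2_shift_minus(1)[OF zt, of "(0, h)"]]
      proof eventually_elim
        case good: (elim t)
        show ?case
        proof (cases "t \<in> {0<..<T}")
          case False
          then show ?thesis using mu0[OF False] by (simp add: P_def zero_prod_def[symmetric])
        next
          case True
          have i0: "integrable lborel (\<lambda>x. zt (x, t) \<bullet> z (x, s))"
            "integrable lborel (\<lambda>x. zt (x, t - h) \<bullet> z (x, s))"
            using L2_inner_integrable[OF good(6) elim(2)] L2_inner_integrable[OF good(7) elim(2)] by simp_all
          have "(LBINT x. zt (x, t) \<bullet> z (x, s)) = b + K t"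
            using good(1) True by (simp add: zt_pos b_def K_def k_def)
          moreover have "(LBINT x. zt (x, t - h) \<bullet> z (x, s)) = b + K (t - h)"
          proof (cases "t - h > 0")
            case True
            then show ?thesis using good(2) \<open>t \<in> {0<..<T}\<close> h by (simp add: zt_pos b_def K_def k_def)
          next
            case False
            \<comment> \<open>Here -1 < t - h \<le> 0, so the extension supplies the initial value
              and the primitive vanishes: the identity persists across t = 0.\<close>
            then have "zt (x, t - h) = z0 x" for x
              using supp(1)[of "t - h" x] True assms(2) False by (simp add: zt_def indicator_def)
            moreover have "K (t - h) = 0" using False by (simp add: K_def)
            ultimately show ?thesis by (simp add: b_def)
          qed
          ultimately have "(LBINT x. (zt (x, t) - zt (x, t - h)) \<bullet> z (x, s)) = K t - K (t - h)"
            using i0 by (simp add: inner_diff_left)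
          then have *: "(LBINT x. (zt (x, t) - zt (x, t - h)) \<bullet> z (x, s)) = (LBINT x. Fh (x, t) \<bullet> zz (x, s))"
            unfolding K_diff good(5) k_def .
          have "integrable lborel (\<lambda>x. (zt (x, t) - zt (x, t - h)) \<bullet> z (x, s))"
            using L2_inner_integrable[OF good(3) elim(2)] by simp
          moreover have "integrable lborel (\<lambda>x. Fh (x, t) \<bullet> zz (x, s))"
            by (rule L2_inner_integrable[OF good(4) elim(3)])
          moreover have "P (x, t) \<bullet> R (x, s) = mu t * ((zt (x, t) - zt (x, t - h)) \<bullet> z (x, s)) - mu t * (Fh (x, t) \<bullet> zz (x, s))" for x
            by (simp add: P_def R_def)
          ultimately show ?thesis using * by simp
        qed
      qed
    qed
  qed
  moreover have "(LBINT p. P p \<bullet> R p) = (LBINT p. mu (snd p) * ((zt p - zt (p - (0, h))) \<bullet> z p))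
     - (LBINT p. Fh p \<bullet> (mu (snd p) *\<^sub>R zz p))"
  proof -
    have "P p \<bullet> R p = mu (snd p) * ((zt p - zt (p - (0, h))) \<bullet> z p) - Fh p \<bullet> (mu (snd p) *\<^sub>R zz p)" for p
      by (simp add: P_def R_def)
    moreover have "integrable lborel (\<lambda>p. mu (snd p) * ((zt p - zt (p - (0, h))) \<bullet> z p))"
      using L2_inner_integrable[OF mdz z] by simp
    moreover have "integrable lborel (\<lambda>p. Fh p \<bullet> (mu (snd p) *\<^sub>R zz p))"
      by (rule L2_inner_integrable[OF Fh_L2 mzz])
    ultimately show ?thesis by simp
  qed
  ultimately show "(LBINT p. mu (snd p) * ((zt p - zt (p - (0, h))) \<bullet> z p)) =
    (LBINT s. indicator {0<..<h} s * (LBINT p. F (p - (0, s)) \<bullet> (mu (snd p) *\<^sub>R zz p)))"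
    using Fh_inner(1)[OF mzz] by simp
  show "integrable lborel (\<lambda>s. indicator {0<..<h} s * (LBINT p. F (p - (0, s)) \<bullet> (mu (snd p) *\<^sub>R zz p)))"
    by (rule Fh_inner(2)[OF mzz])
qed

text \<open>Formally one integrates m (|z|^2)' with m(t) = |A \<inter> (t, \<infinity>)|: since -m'
  is the indicator of A, this is the integral of |z|^2 over A minus |A| |z0|^2. Working with all
  sets A avoids selecting good times.\<close>

theorem energy_inequality_set:
  assumes A[measurable]: "A \<in> sets borel" and AT: "A \<subseteq> {0<..<T}"
  shows "(LBINT t. indicator A t * nsq lborel (\<lambda>x. z (x, t))) \<le> measure lborel A * nsq lborel z0
    + 2 * (LBINT r. indicator {0<..<T} r * measure lborel (A \<inter> {r<..}) * (LBINT x. F (x, r) \<bullet> zz (x, r)))"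
proof -
  define m where "m t = measure lborel (A \<inter> {t<..})" for t
  define mu where "mu t = indicator {0<..<T} t * m t" for t
  have finA: "emeasure lborel A < \<infinity>"
  proof -
    have "emeasure lborel A \<le> emeasure lborel {0<..<T}" by (rule emeasure_mono) (use AT in auto)
    also have "\<dots> < \<infinity>" using T by simp
    finally show ?thesis .
  qed
  have fA: "A \<in> fmeasurable lborel" by (rule fmeasurableI) (use finA in auto)
  have m_nonneg: "0 \<le> m t" for t by (simp add: m_def)
  have m_le: "m t \<le> measure lborel A" for t
    unfolding m_def by (rule measure_mono_fmeasurable[OF _ _ fA]) auto
  have m_T: "m t = 0" if "t \<ge> T" for t
  proof -
    have "A \<inter> {t<..} = {}" using AT that by auto
    then show ?thesis by (simp add: m_def)
  qed
  have m_meas[measurable]: "m \<in> borel_measurable borel"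
  proof -
    have "mono (\<lambda>t. - m t)"
      unfolding m_def by (intro monoI) (auto intro!: measure_mono_fmeasurable fmeasurable_Int_fmeasurable[OF fA])
    then have "(\<lambda>t. - (- m t)) \<in> borel_measurable borel"
      by (intro borel_measurable_uminus borel_measurable_mono)
    then show ?thesis by simp
  qed
  have mu_meas[measurable]: "mu \<in> borel_measurable borel" unfolding mu_def by measurable
  have mu0: "mu t = 0" if "t \<notin> {0<..<T}" for t using that by (simp add: mu_def)
  have mu_nn: "0 \<le> mu t" for t using m_nonneg by (simp add: mu_def)
  have mu_le: "mu t \<le> measure lborel A" for t using m_le by (auto simp: mu_def split: split_indicator)
  have mu_abs: "\<bar>mu t\<bar> \<le> measure lborel A" for t using mu_nn[of t] mu_le[of t] by simp
  have zt_meas[measurable]: "zt \<in> borel_measurable borel" using L2_meas[OF zt] by simp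
  \<comment> \<open>Delayed versions of the two sides of the claim. Their averages over 0 < s < h
    are what a time difference of step h produces, and both are continuous at s = 0 because
    translations are.\<close>
  define a where "a s = (LBINT p. indicator A (snd p + s) * (norm (z p))\<^sup>2)" for s
  define b where "b s = (LBINT p. F (p - (0, s)) \<bullet> (mu (snd p) *\<^sub>R zz p))" for s
  have mzz: "L2 lborel (\<lambda>p. mu (snd p) *\<^sub>R zz p)"
    by (rule L2_mult_bounded[OF zz, where B="measure lborel A"]) (use mu_abs in auto)
  have zsq: "integrable lborel (\<lambda>p. (norm (z p))\<^sup>2)" by (rule L2_int[OF z])
  have weighted: "integrable lborel (\<lambda>p. f (snd p) * (norm (g p))\<^sup>2)"
    if [measurable]: "f \<in> borel_measurable borel" and f: "\<And>t. \<bar>f t\<bar> \<le> B" and g: "L2 lborel g"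
    for f :: "real \<Rightarrow> real" and B and g :: "'a \<times> real \<Rightarrow> 'e"
  proof (rule Bochner_Integration.integrable_bound[OF integrable_mult_right[OF L2_int[OF g], of B]])
    have [measurable]: "g \<in> borel_measurable borel" using L2_meas[OF g] by simp
    show "(\<lambda>p. f (snd p) * (norm (g p))\<^sup>2) \<in> borel_measurable lborel" by measurable
    have "\<bar>f t\<bar> \<le> \<bar>B\<bar>" for t using f[of t] by simp
    then show "AE p in lborel. norm (f (snd p) * (norm (g p))\<^sup>2) \<le> norm (B * (norm (g p))\<^sup>2)"
      by (auto simp: abs_mult intro!: mult_right_mono)
  qed
  have ai: "integrable lborel (\<lambda>s. indicator {0<..<h} s * a s)"
    and aF: "(prim a h) = (LBINT p. (m (snd p) - m (snd p + h)) * (norm (z p))\<^sup>2)"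
    if h: "h > 0" for h
  proof -
    define H where "H q = indicator {0<..<h} (snd q) * indicator A (snd (fst q) + snd q) * (norm (z (fst q)))\<^sup>2"
      for q :: "('a \<times> real) \<times> real"
    have [measurable]: "(fst :: ('a \<times> real) \<times> real \<Rightarrow> _) \<in> borel_measurable borel"
      "(snd :: ('a \<times> real) \<times> real \<Rightarrow> _) \<in> borel_measurable borel"
      by (auto intro!: borel_measurable_continuous_onI continuous_intros)
    have "integrable lborel (\<lambda>q::('a \<times> real) \<times> real. (norm (z (fst q)))\<^sup>2 * indicator {0<..<h} (snd q))"
      using h by (intro integrable_lborel_tensor zsq integrable_real_indicator) auto
    moreover have "H \<in> borel_measurable lborel" unfolding H_def by measurable
    ultimately have Hi: "integrable lborel H"
      by (rule Bochner_Integration.integrable_bound) (auto simp: H_def split: split_indicator)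
    show "integrable lborel (\<lambda>s. indicator {0<..<h} s * a s)"
      using lborel_integrable_snd[OF Hi] by (simp add: H_def a_def mult.assoc)
    have "(prim a h) = (LBINT s. (LBINT p. H (p, s)))"
      by (simp add: H_def a_def mult.assoc)
    also have "\<dots> = (LBINT p. (LBINT s. H (p, s)))" by (rule lborel_integral_swap[OF Hi])
    also have "\<dots> = (LBINT p. (m (snd p) - m (snd p + h)) * (norm (z p))\<^sup>2)"
      unfolding m_def measure_tail_diff[OF A finA h] by (simp add: H_def)
    finally show "(prim a h) = (LBINT p. (m (snd p) - m (snd p + h)) * (norm (z p))\<^sup>2)" .
  qed
  have step: "(LBINT s. indicator {0<..<h} s * (a s - 2 * b s - measure lborel A * nsq lborel z0)) \<le> 0"
    and stepi: "integrable lborel (\<lambda>s. indicator {0<..<h} s * (a s - 2 * b s - measure lborel A * nsq lborel z0))"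
    if h: "0 < h" "h < 1" for h
  proof -
    note dq = difference_quotient[OF h mu_meas mu0 mu_abs, folded b_def]
    have ih: "integrable lborel (\<lambda>s. indicator {0<..<h} s * c)" for c :: real
      using h by (intro integrable_mult_left integrable_real_indicator) auto
    have split_eq: "indicator {0<..<h} s * (a s - 2 * b s - c) =
        indicator {0<..<h} s * a s - 2 * (indicator {0<..<h} s * b s) - indicator {0<..<h} s * c" for s c
      by (simp add: algebra_simps)
    show "integrable lborel (\<lambda>s. indicator {0<..<h} s * (a s - 2 * b s - measure lborel A * nsq lborel z0))"
      unfolding split_eq using ai[OF h(1)] dq(2) ih by (intro Bochner_Integration.integrable_diff integrable_mult_right)
    have i1: "integrable lborel (\<lambda>p. mu (snd p) * (norm (zt p))\<^sup>2)" by (rule weighted[OF mu_meas mu_abs zt])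
    have i2: "integrable lborel (\<lambda>p. mu (snd p) * (norm (zt (p - (0, h))))\<^sup>2)"
      by (rule weighted[OF mu_meas mu_abs L2_shift_minus(1)[OF zt]])
    have i3: "integrable lborel (\<lambda>p. mu (snd p + h) * (norm (z p))\<^sup>2)"
      by (rule weighted[OF _ _ z, where B="measure lborel A"]) (use mu_abs in auto)
    have i4: "integrable lborel (\<lambda>p. mu (snd p) * (norm (z p))\<^sup>2)" by (rule weighted[OF mu_meas mu_abs z])
    have L2e: "L2 lborel (\<lambda>p::'a\<times>real. indicator {-1<..0} (snd p) *\<^sub>R z0 (fst p))" by (rule L2_tensor[OF z0]) auto
    have i5: "integrable lborel (\<lambda>p::'a\<times>real. mu (snd p + h) * (norm (indicator {-1<..0} (snd p) *\<^sub>R z0 (fst p)))\<^sup>2)"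
      by (rule weighted[OF _ _ L2e, where B="measure lborel A"]) (use mu_abs in auto)
    have i6: "integrable lborel (\<lambda>p. mu (snd p) * ((zt p - zt (p - (0, h))) \<bullet> z p))"
    proof -
      have "L2 lborel (\<lambda>p. zt p - zt (p - (0, h)))" by (rule L2_diff[OF zt L2_shift_minus(1)[OF zt]])
      moreover have "L2 lborel (\<lambda>p. mu (snd p) *\<^sub>R z p)"
        by (rule L2_mult_bounded[OF z, where B="measure lborel A"]) (use mu_abs in auto)
      ultimately show ?thesis using L2_inner_integrable by fastforce
    qed
    have zero_neg: "z p = 0" if "snd p \<notin> {0<..<T}" for p
      using supp(1)[of "snd p" "fst p"] that by simp
    \<comment> \<open>Translating by h moves the delay from the solution to the weight. The extended
      solution then splits into z on (0, T) and z0 on the layer of nonpositive times.\<close>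
    have "(LBINT p. mu (snd p) * (norm (zt (p - (0, h))))\<^sup>2) = (LBINT p. mu (snd p + h) * (norm (zt p))\<^sup>2)"
      using integral_lborel_shift[of "\<lambda>p. mu (snd p) * (norm (zt (p - (0, h))))\<^sup>2" "(0, h)"] by simp
    also have "\<dots> = (LBINT p. mu (snd p + h) * (norm (z p))\<^sup>2 + mu (snd p + h) * (norm (indicator {-1<..0} (snd p) *\<^sub>R z0 (fst p)))\<^sup>2)"
    proof (rule Bochner_Integration.integral_cong[OF refl])
      fix p
      show "mu (snd p + h) * (norm (zt p))\<^sup>2 = mu (snd p + h) * (norm (z p))\<^sup>2 + mu (snd p + h) * (norm (indicator {-1<..0} (snd p) *\<^sub>R z0 (fst p)))\<^sup>2"
        using zero_neg[of p] by (cases "snd p \<in> {-1<..0}") (auto simp: zt_def)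
    qed
    also have "\<dots> = (LBINT p. mu (snd p + h) * (norm (z p))\<^sup>2)
        + (LBINT p. mu (snd p + h) * (norm (indicator {-1<..0} (snd p) *\<^sub>R z0 (fst p)))\<^sup>2)"
      by (rule Bochner_Integration.integral_add[OF i3 i5])
    \<comment> \<open>\<open>mu\<close> vanishes at nonpositive times, so only the part (-h, 0] of
      the layer is seen; it contributes at most h |A| |z0|^2.\<close>
    also have "(LBINT p. mu (snd p + h) * (norm (indicator {-1<..0} (snd p) *\<^sub>R z0 (fst p)))\<^sup>2) \<le>
        (LBINT p. measure lborel A * (norm (indicator {-h<..0} (snd p) *\<^sub>R z0 (fst p)))\<^sup>2)"
    proof (rule integral_mono[OF i5])
      show "integrable lborel (\<lambda>p::'a\<times>real. measure lborel A * (norm (indicator {-h<..0} (snd p) *\<^sub>R z0 (fst p)))\<^sup>2)"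
        using h by (intro integrable_mult_right L2_int L2_tensor z0) auto
      fix p :: "'a \<times> real"
      show "mu (snd p + h) * (norm (indicator {-1<..0} (snd p) *\<^sub>R z0 (fst p)))\<^sup>2 \<le> measure lborel A * (norm (indicator {-h<..0} (snd p) *\<^sub>R z0 (fst p)))\<^sup>2"
        using mu0[of "snd p + h"] mu_le[of "snd p + h"] h
        by (auto split: split_indicator intro!: mult_right_mono)
    qed
    also have "\<dots> = h * (measure lborel A * nsq lborel z0)"
    proof -
      have sq: "(indicator S t :: real)\<^sup>2 = indicator S t" for S :: "real set" and t
        by (simp split: split_indicator)
      have "(LBINT p. (norm (indicator {-h<..0} (snd p) *\<^sub>R z0 (fst p)))\<^sup>2) =
         (LBINT t. (LBINT x. indicator {-h<..0} t * (norm (z0 x))\<^sup>2))"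
        using lborel_Fubini_snd[OF L2_int[OF L2_tensor[OF z0, of "{-h<..0}"]], symmetric] h by (simp add: power_mult_distrib sq)
      also have "\<dots> = h * nsq lborel z0" using h by (simp add: nsq_def)
      finally show ?thesis by simp
    qed
    finally have shifted: "(LBINT p. mu (snd p) * (norm (zt (p - (0, h))))\<^sup>2) \<le>
       (LBINT p. mu (snd p + h) * (norm (z p))\<^sup>2) + h * (measure lborel A * nsq lborel z0)" by simp
    have "(prim a h) = (LBINT p. mu (snd p) * (norm (z p))\<^sup>2 - mu (snd p + h) * (norm (z p))\<^sup>2)"
      unfolding aF[OF h(1)]
    proof (rule Bochner_Integration.integral_cong[OF refl])
      fix p
      show "(m (snd p) - m (snd p + h)) * (norm (z p))\<^sup>2 = mu (snd p) * (norm (z p))\<^sup>2 - mu (snd p + h) * (norm (z p))\<^sup>2"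
        using zero_neg[of p] m_T[of "snd p + h"] h
        by (cases "snd p \<in> {0<..<T}") (auto simp: mu_def algebra_simps split: split_indicator)
    qed
    also have "\<dots> = (LBINT p. mu (snd p) * (norm (z p))\<^sup>2) - (LBINT p. mu (snd p + h) * (norm (z p))\<^sup>2)"
      by (rule Bochner_Integration.integral_diff[OF i4 i3])
    also have "(LBINT p. mu (snd p) * (norm (z p))\<^sup>2) = (LBINT p. mu (snd p) * (norm (zt p))\<^sup>2)"
      by (rule Bochner_Integration.integral_cong[OF refl]) (auto simp: mu_def zt_def split: split_indicator)
    also have "\<dots> - (LBINT p. mu (snd p + h) * (norm (z p))\<^sup>2) \<le>
       (LBINT p. mu (snd p) * (norm (zt p))\<^sup>2) - (LBINT p. mu (snd p) * (norm (zt (p - (0, h))))\<^sup>2)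
         + h * (measure lborel A * nsq lborel z0)"
      using shifted by simp
    also have "(LBINT p. mu (snd p) * (norm (zt p))\<^sup>2) - (LBINT p. mu (snd p) * (norm (zt (p - (0, h))))\<^sup>2)
      = (LBINT p. mu (snd p) * (norm (zt p))\<^sup>2 - mu (snd p) * (norm (zt (p - (0, h))))\<^sup>2)"
      by (rule Bochner_Integration.integral_diff[OF i1 i2, symmetric])
    \<comment> \<open>Convexity, with the extended solution equal to z wherever the weight is
      nonzero.\<close>
    also have "\<dots> \<le> (LBINT p. 2 * (mu (snd p) * ((zt p - zt (p - (0, h))) \<bullet> z p)))"
    proof (rule integral_mono[OF Bochner_Integration.integrable_diff[OF i1 i2] integrable_mult_right[OF i6]])
      fix p
      show "mu (snd p) * (norm (zt p))\<^sup>2 - mu (snd p) * (norm (zt (p - (0, h))))\<^sup>2 \<le> 2 * (mu (snd p) * ((zt p - zt (p - (0, h))) \<bullet> z p))"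
      proof (cases "snd p \<in> {0<..<T}")
        case True
        then have "zt p = z p" by (simp add: zt_def)
        then show ?thesis
          using mult_left_mono[OF norm_sq_diff_le[of "zt p" "zt (p - (0, h))"] mu_nn[of "snd p"]]
          by (simp add: algebra_simps)
      qed (simp add: mu0)
    qed
    also have "\<dots> = 2 * (prim b h)"
      using dq(1) by simp
    finally have main: "(prim a h) \<le>
        2 * (prim b h) + h * (measure lborel A * nsq lborel z0)" by simp
    show "(LBINT s. indicator {0<..<h} s * (a s - 2 * b s - measure lborel A * nsq lborel z0)) \<le> 0"
      unfolding split_eq using main ai[OF h(1)] dq(2) ih h by simp
  qed
  \<comment> \<open>The integral over (0, h) is nonpositive for every small h, hence so is the limit
    of the integrand at s = 0.\<close>
  have "a 0 - 2 * b 0 - measure lborel A * nsq lborel z0 \<le> 0"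
  proof (rule nonpos_of_averages[OF stepi step])
    fix s :: "nat \<Rightarrow> real" assume "s \<longlonglongrightarrow> 0"
    then have "(\<lambda>k. - (0::'a, s k)) \<longlonglongrightarrow> - (0, 0)" by (intro tendsto_Pair tendsto_const tendsto_minus)
    then have s0: "(\<lambda>k. - (0::'a, s k)) \<longlonglongrightarrow> 0" by (simp add: zero_prod_def)
    have shz: "(\<lambda>k. nsq lborel (\<lambda>p. z (p - (0, s k)) - z p)) \<longlonglongrightarrow> 0"
      using L2_shift_tendsto[OF z s0] by (simp only: add_uminus_conv_diff)
    have shF: "(\<lambda>k. nsq lborel (\<lambda>p. F (p - (0, s k)) - F p)) \<longlonglongrightarrow> 0"
      using L2_shift_tendsto[OF F s0] by (simp only: add_uminus_conv_diff)
    have "(\<lambda>k. b (s k)) \<longlonglongrightarrow> (LBINT p. F p \<bullet> (mu (snd p) *\<^sub>R zz p))"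
      unfolding b_def by (rule L2_inner_tendsto[OF F L2_shift_minus(1)[OF F] mzz shF])
    moreover have "(\<lambda>k. a (s k)) \<longlonglongrightarrow> a 0"
    proof -
      define f where "f g p = indicator A (snd p) *\<^sub>R g p" for g :: "'a \<times> real \<Rightarrow> 'e" and p
      have fL2: "L2 lborel (f g)" if "L2 lborel g" for g
        unfolding f_def by (rule L2_mult_bounded[OF that, where B=1]) (auto split: split_indicator)
      have a_eq: "a r = nsq lborel (f (\<lambda>p. z (p - (0, r))))" for r
      proof -
        have "a r = (LBINT p. indicator A (snd p) * (norm (z (p - (0, r))))\<^sup>2)"
          using integral_lborel_shift[of "\<lambda>p. indicator A (snd p) * (norm (z (p - (0, r))))\<^sup>2" "(0, r)"]
          by (simp add: a_def)
        then show ?thesis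
          unfolding nsq_def f_def by (simp add: power_mult_distrib)
             (intro Bochner_Integration.integral_cong, auto split: split_indicator)
      qed
      have "(\<lambda>k. nsq lborel (f (\<lambda>p. z (p - (0, s k))))) \<longlonglongrightarrow> nsq lborel (f z)"
      proof (rule nsq_tendsto[OF fL2[OF z] fL2[OF L2_shift_minus(1)[OF z]]])
        show "(\<lambda>k. nsq lborel (\<lambda>p. f (\<lambda>p. z (p - (0, s k))) p - f z p)) \<longlonglongrightarrow> 0"
        proof (rule Lim_null_comparison[OF _ shz], intro always_eventually allI)
          fix k
          have d: "L2 lborel (\<lambda>p. z (p - (0, s k)) - z p)" by (rule L2_diff[OF L2_shift_minus(1)[OF z] z])
          have "nsq lborel (f (\<lambda>p. z (p - (0, s k)) - z p)) \<le> nsq lborel (\<lambda>p. z (p - (0, s k)) - z p)"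
            unfolding nsq_def
            by (rule integral_mono[OF L2_int[OF fL2[OF d]] L2_int[OF d]]) (auto simp: f_def split: split_indicator)
          then show "norm (nsq lborel (\<lambda>p. f (\<lambda>p. z (p - (0, s k))) p - f z p)) \<le> nsq lborel (\<lambda>p. z (p - (0, s k)) - z p)"
            by (simp add: nsq_nonneg f_def[abs_def] scaleR_diff_right)
        qed
      qed
      then show ?thesis using a_eq[of 0] by (simp add: a_eq zero_prod_def[symmetric])
    qed
    ultimately show "(\<lambda>k. a (s k) - 2 * b (s k) - measure lborel A * nsq lborel z0) \<longlonglongrightarrow>
        a 0 - 2 * b 0 - measure lborel A * nsq lborel z0"
      by (auto intro!: tendsto_intros simp: b_def zero_prod_def[symmetric])
  qed
  moreover have "a 0 = (LBINT t. indicator A t * nsq lborel (\<lambda>x. z (x, t)))"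
  proof -
    have "integrable lborel (\<lambda>p. indicator A (snd p) * (norm (z p))\<^sup>2)"
      by (rule weighted[OF _ _ z, where B=1]) (auto split: split_indicator)
    from lborel_Fubini_snd[OF this] show ?thesis by (simp add: a_def nsq_def)
  qed
  moreover have "b 0 = (LBINT r. indicator {0<..<T} r * measure lborel (A \<inter> {r<..}) * (LBINT x. F (x, r) \<bullet> zz (x, r)))"
    using slice_inner_integrable(2)[OF F mzz] by (simp add: b_def mu_def m_def zero_prod_def[symmetric])
  ultimately show ?thesis by simp
qed

text \<open>The version over sets holds for every measurable subset of (0, T), which localises it to
  almost every time.\<close>

theorem energy_inequality:
  "AE t\<in>{0<..<T} in lborel. nsq lborel (\<lambda>x. z (x, t)) \<le> nsq lborel z0
    + 2 * (LBINT r. indicator {0<..<t} r * (LBINT x. F (x, r) \<bullet> zz (x, r)))"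
proof -
  define k where "k r = (LBINT x. F (x, r) \<bullet> zz (x, r))" for r
  have k: "integrable lborel k" unfolding k_def[abs_def] by (rule slice_inner_integrable(1)[OF F zz])
  have [measurable]: "k \<in> borel_measurable borel" using k by auto
  have ki: "integrable lborel (\<lambda>r. indicator A r * k r)" if "A \<in> sets borel" for A
    using integrable_mult_indicator[OF _ k, of A] that by simp
  define K where "K t = (prim k t)" for t
  have [measurable]: "(fst :: real \<times> real \<Rightarrow> _) \<in> borel_measurable borel"
      "(snd :: real \<times> real \<Rightarrow> _) \<in> borel_measurable borel"
    by (auto intro!: borel_measurable_continuous_onI continuous_intros)
  define N where "N t = nsq lborel (\<lambda>x. z (x, t))" for t
  have N: "integrable lborel N" unfolding N_def[abs_def] by (rule nsq_slice_integrable(2)[OF z])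
  define S where "S = {0<..<T}"
  define H where "H A q = indicator A (snd q) * (indicator {0<..<snd q} (fst q) * k (fst q))" for A :: "real set" and q :: "real \<times> real"
  have Hi: "integrable lborel (H A)" if [measurable]: "A \<in> sets borel" and "emeasure lborel A < \<infinity>" for A
  proof (rule Bochner_Integration.integrable_bound)
    show "integrable lborel (\<lambda>q::real \<times> real. k (fst q) * indicator A (snd q))"
      by (intro integrable_lborel_tensor k integrable_real_indicator) (use that in auto)
    have "Measurable.pred borel (\<lambda>q::real\<times>real. fst q \<in> {0<..<snd q})" by simp
    then have "(\<lambda>q::real\<times>real. indicator {0<..<snd q} (fst q) :: real) \<in> borel_measurable borel"
      unfolding indicator_def by simp
    then show "H A \<in> borel_measurable lborel" unfolding H_def by simp
  qed (auto simp: H_def split: split_indicator)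
  have HK: "(LBINT r. H A (r, t)) = indicator A t * K t" for A t
    by (simp add: H_def K_def)
  have Ki: "integrable lborel (\<lambda>t. indicator A t * K t)" if "A \<in> sets borel" "emeasure lborel A < \<infinity>" for A
    using lborel_integrable_snd[OF Hi[OF that]] by (simp add: HK)
  have finS: "emeasure lborel A < \<infinity>" if "A \<subseteq> S" for A
  proof -
    have "emeasure lborel A \<le> emeasure lborel S" by (rule emeasure_mono) (use that in \<open>auto simp: S_def\<close>)
    also have "\<dots> < \<infinity>" using T by (simp add: S_def)
    finally show ?thesis .
  qed
  have "AE t in lborel. t \<in> S \<longrightarrow> indicator S t * (N t - nsq lborel z0 - 2 * K t) \<le> 0"
  proof (rule AE_nonpos_of_set_integrals)
    have S: "integrable lborel (\<lambda>t. indicator S t * c)" for c :: real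
      using T by (intro integrable_mult_left integrable_real_indicator) (auto simp: S_def)
    have "integrable lborel (\<lambda>t. indicator S t * N t - indicator S t * nsq lborel z0 - 2 * (indicator S t * K t))"
      using integrable_mult_indicator[OF _ N, of S] finS
      by (intro Bochner_Integration.integrable_diff integrable_mult_right S Ki) (auto simp: S_def)
    then show "integrable lborel (\<lambda>t. indicator S t * (N t - nsq lborel z0 - 2 * K t))"
      by (simp add: algebra_simps)
    fix A assume A: "A \<in> sets lborel" "A \<subseteq> S"
    then have Ab[measurable]: "A \<in> sets borel" by simp
    have fin: "emeasure lborel A < \<infinity>" using A finS by auto
    have iN: "integrable lborel (\<lambda>t. indicator A t * N t)" using integrable_mult_indicator[OF A(1) N] by simp
    have ic: "integrable lborel (\<lambda>t. indicator A t * c)" for c :: real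
      using fin by (intro integrable_mult_left integrable_real_indicator) auto
    \<comment> \<open>Fubini turns the weight |A \<inter> (r, \<infinity>)| into an integral over t
      in A of the primitive of k up to t.\<close>
    have "(LBINT r. indicator {0<..<T} r * measure lborel (A \<inter> {r<..}) * k r) = (LBINT r. (LBINT t. H A (r, t)))"
    proof (rule Bochner_Integration.integral_cong[OF refl])
      fix r
      have "(LBINT t. H A (r, t)) = (LBINT t. indicator (A \<inter> {r<..}) t * (indicator {0<..} r * k r))"
        by (intro Bochner_Integration.integral_cong) (auto simp: H_def split: split_indicator)
      also have "\<dots> = measure lborel (A \<inter> {r<..}) * (indicator {0<..} r * k r)" by simp
      also have "\<dots> = indicator {0<..<T} r * measure lborel (A \<inter> {r<..}) * k r"
      proof (cases "r < T")
        case False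
        then have "A \<inter> {r<..} = {}" using A by (auto simp: S_def)
        then show ?thesis by simp
      qed (auto split: split_indicator)
      finally show "indicator {0<..<T} r * measure lborel (A \<inter> {r<..}) * k r = (LBINT t. H A (r, t))" by simp
    qed
    also have "\<dots> = (LBINT t. (LBINT r. H A (r, t)))"
      by (rule lborel_integral_swap[OF Hi[OF Ab fin], symmetric])
    also have "\<dots> = (LBINT t. indicator A t * K t)" by (simp add: HK)
    finally have "(LBINT t. indicator A t * N t) \<le> measure lborel A * nsq lborel z0 + 2 * (LBINT t. indicator A t * K t)"
      using energy_inequality_set[OF Ab] A by (simp add: S_def N_def k_def)
    moreover have "(LBINT t. indicator A t * (indicator S t * (N t - nsq lborel z0 - 2 * K t))) =
        (LBINT t. indicator A t * N t - indicator A t * nsq lborel z0 - 2 * (indicator A t * K t))"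
      using A by (intro Bochner_Integration.integral_cong) (auto split: split_indicator)
    moreover have "\<dots> = (LBINT t. indicator A t * N t) - measure lborel A * nsq lborel z0 - 2 * (LBINT t. indicator A t * K t)"
      using iN ic Ki[OF Ab fin] by simp
    ultimately show "(LBINT t. indicator A t * (indicator S t * (N t - nsq lborel z0 - 2 * K t))) \<le> 0" by simp
  qed (simp add: S_def)
  then show ?thesis
    by eventually_elim (auto simp: S_def N_def K_def k_def)
qed

end

subsection \<open>Smooth functions\<close>

lemma dd_eqI: "(f has_derivative f') (at z) \<Longrightarrow> dd e f z = f' e"
  unfolding dd_def by (simp add: frechet_derivative_at[symmetric])

lemma Ck_continuous: "Ck k f \<Longrightarrow> continuous_on UNIV f"
  by (cases k) auto

lemma Ck_SucI:
  assumes "\<And>z. (f has_derivative f' z) (at z)" "\<And>b. b \<in> Basis \<Longrightarrow> Ck k (\<lambda>z. f' z b)"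
  shows "Ck (Suc k) f"
proof -
  have "dd b f = (\<lambda>z. f' z b)" for b using dd_eqI[OF assms(1)] by auto
  moreover have "continuous_on UNIV f"
    using assms(1) by (auto intro!: continuous_at_imp_continuous_on has_derivative_continuous)
  moreover have "f differentiable (at z)" for z using assms(1) by (auto simp: differentiable_def)
  ultimately show ?thesis using assms(2) by simp
qed

lemma Ck_SucD:
  assumes "Ck (Suc k) f"
  shows "(f has_derivative (\<lambda>e. dd e f z)) (at z)" "b \<in> Basis \<Longrightarrow> Ck k (dd b f)"
proof -
  have "(f has_derivative frechet_derivative f (at z)) (at z)"
    using assms frechet_derivative_works by auto
  then show "(f has_derivative (\<lambda>e. dd e f z)) (at z)" by (simp add: dd_def)
  show "b \<in> Basis \<Longrightarrow> Ck k (dd b f)" using assms by simp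
qed

lemma Ck_Suc_imp: "Ck (Suc k) f \<Longrightarrow> Ck k f"
proof (induction k arbitrary: f)
  case (Suc k)
  show ?case
    by (rule Ck_SucI[OF Ck_SucD(1)[OF Suc.prems]]) (use Suc.IH Suc.prems in auto)
qed simp

lemma Ck_const: "Ck k (\<lambda>x. c)"
proof (induction k arbitrary: c)
  case (Suc k)
  show ?case by (rule Ck_SucI[where f'="\<lambda>_ _. 0"]) (use Suc in auto)
qed simp

lemma Ck_add: "Ck k f \<Longrightarrow> Ck k g \<Longrightarrow> Ck k (\<lambda>x. f x + g x)"
proof (induction k arbitrary: f g)
  case (Suc k)
  show ?case
    by (rule Ck_SucI[OF has_derivative_add[OF Ck_SucD(1)[OF Suc.prems(1)] Ck_SucD(1)[OF Suc.prems(2)]]])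
       (intro Suc.IH Ck_SucD(2)[OF Suc.prems(1)] Ck_SucD(2)[OF Suc.prems(2)])
qed (auto intro: continuous_intros)

lemma Ck_scaleR:
  fixes f :: "'a::euclidean_space \<Rightarrow> real" and g :: "'a \<Rightarrow> 'b::real_normed_vector"
  shows "Ck k f \<Longrightarrow> Ck k g \<Longrightarrow> Ck k (\<lambda>x. f x *\<^sub>R g x)"
proof (induction k arbitrary: f g)
  case (Suc k)
  show ?case
  proof (rule Ck_SucI[OF has_derivative_scaleR[OF Ck_SucD(1)[OF Suc.prems(1)] Ck_SucD(1)[OF Suc.prems(2)]]])
    fix b :: 'a assume "b \<in> Basis"
    then show "Ck k (\<lambda>z. f z *\<^sub>R dd b g z + dd b f z *\<^sub>R g z)"
      by (intro Ck_add Suc.IH Ck_SucD(2)[OF Suc.prems(1)] Ck_SucD(2)[OF Suc.prems(2)]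
          Ck_Suc_imp[OF Suc.prems(1)] Ck_Suc_imp[OF Suc.prems(2)])
  qed
qed (auto intro: continuous_intros)

text \<open>\<open>Ck\<close> speaks of derivatives in basis directions only, whereas the chain rule
  produces the direction L e; this direction is expanded in the basis before the induction
  hypothesis is used.\<close>

lemma Ck_bounded_linear_comp:
  fixes L :: "'a::euclidean_space \<Rightarrow> 'b::euclidean_space" and f :: "'b \<Rightarrow> 'c::real_normed_vector"
  assumes L: "bounded_linear L"
  shows "Ck k f \<Longrightarrow> Ck k (\<lambda>x. f (L x))"
proof (induction k arbitrary: f)
  case 0
  then show ?case
    using continuous_on_compose2[of UNIV f UNIV L] linear_continuous_on[OF L] by auto
next
  case (Suc k)
  note D = Ck_SucD(1)[OF Suc.prems]
  have "((\<lambda>x. f (L x)) has_derivative (\<lambda>e. dd (L e) f (L z))) (at z)" for z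
    using diff_chain_at[OF bounded_linear_imp_has_derivative[OF L] D[of "L z"]] by (simp add: o_def)
  moreover have "dd (L e) f y = (\<Sum>c\<in>Basis. (L e \<bullet> c) *\<^sub>R dd c f y)" for e y
  proof -
    have l: "linear (\<lambda>e. dd e f y)" using D[of y] by (simp add: has_derivative_linear)
    have "dd (L e) f y = dd (\<Sum>c\<in>Basis. (L e \<bullet> c) *\<^sub>R c) f y" by (simp add: euclidean_representation)
    also have "\<dots> = (\<Sum>c\<in>Basis. (L e \<bullet> c) *\<^sub>R dd c f y)"
      by (simp only: linear_sum[OF l] linear_cmul[OF l])
    finally show ?thesis .
  qed
  moreover have "Ck k (\<lambda>x. \<Sum>c\<in>B. (L e \<bullet> c) *\<^sub>R dd c f (L x))" if "B \<subseteq> Basis" for e B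
    using finite_subset[OF that finite_Basis] that
  proof (induction B rule: finite_induct)
    case (insert c B)
    then show ?case
      using Suc.IH Ck_SucD(2)[OF Suc.prems] by (auto intro!: Ck_add Ck_scaleR Ck_const)
  qed (simp add: Ck_const)
  ultimately show ?case by (intro Ck_SucI[where f'="\<lambda>z e. dd (L e) f (L z)"]) auto
qed

lemma Ck_bounded_linear:
  fixes L :: "'b::real_normed_vector \<Rightarrow> 'c::real_normed_vector" and f :: "'a::euclidean_space \<Rightarrow> 'b"
  assumes L: "bounded_linear L"
  shows "Ck k f \<Longrightarrow> Ck k (\<lambda>x. L (f x))"
proof (induction k arbitrary: f)
  case 0
  then show ?case
    using continuous_on_compose2[of UNIV L UNIV f] linear_continuous_on[OF L] by auto
next
  case (Suc k)
  have "((\<lambda>x. L (f x)) has_derivative (\<lambda>e. L (dd e f z))) (at z)" for z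
    using bounded_linear.has_derivative[OF L Ck_SucD(1)[OF Suc.prems]] .
  then show ?case
    by (rule Ck_SucI) (intro Suc.IH Ck_SucD(2)[OF Suc.prems])
qed

lemma smooth_const: "smooth (\<lambda>x. c)" by (simp add: smooth_def Ck_const)

lemma smooth_add: "smooth f \<Longrightarrow> smooth g \<Longrightarrow> smooth (\<lambda>x. f x + g x)"
  by (simp add: smooth_def Ck_add)

lemma smooth_scaleR:
  fixes f :: "'a::euclidean_space \<Rightarrow> real"
  shows "smooth f \<Longrightarrow> smooth g \<Longrightarrow> smooth (\<lambda>x. f x *\<^sub>R g x)"
  by (simp add: smooth_def Ck_scaleR)

lemma smooth_mult:
  fixes f g :: "'a::euclidean_space \<Rightarrow> real"
  shows "smooth f \<Longrightarrow> smooth g \<Longrightarrow> smooth (\<lambda>x. f x * g x)"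
  using smooth_scaleR[of f g] by simp

lemma smooth_bounded_linear_comp:
  "bounded_linear L \<Longrightarrow> smooth f \<Longrightarrow> smooth (\<lambda>x. f (L x))"
  by (simp add: smooth_def Ck_bounded_linear_comp)

lemma smooth_bounded_linear:
  "bounded_linear L \<Longrightarrow> smooth f \<Longrightarrow> smooth (\<lambda>x. L (f x))"
  by (simp add: smooth_def Ck_bounded_linear)

lemma smooth_diff:
  assumes "smooth f" "smooth g" shows "smooth (\<lambda>x. f x - g x)"
  using smooth_add[OF assms(1) smooth_bounded_linear[OF bounded_linear_minus[OF bounded_linear_ident] assms(2)]]
  by simp

lemma smooth_power:
  fixes f :: "'a::euclidean_space \<Rightarrow> real"
  shows "smooth f \<Longrightarrow> smooth (\<lambda>x. f x ^ n)"
  by (induction n) (auto intro: smooth_const smooth_mult)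

lemma smooth_prod:
  fixes f :: "'i \<Rightarrow> 'a::euclidean_space \<Rightarrow> real"
  shows "finite I \<Longrightarrow> (\<And>i. i \<in> I \<Longrightarrow> smooth (f i)) \<Longrightarrow> smooth (\<lambda>x. \<Prod>i\<in>I. f i x)"
  by (induction I rule: finite_induct) (auto intro: smooth_const smooth_mult)

lemma smooth_has_derivative: "smooth f \<Longrightarrow> (f has_derivative (\<lambda>e. dd e f z)) (at z)"
  using Ck_SucD(1)[of 0 f z] unfolding smooth_def by blast

lemma smooth_dd: "smooth f \<Longrightarrow> b \<in> Basis \<Longrightarrow> smooth (dd b f)"
  unfolding smooth_def using Ck_SucD(2) by blast

lemma smooth_continuous: "smooth f \<Longrightarrow> continuous_on UNIV f"
  unfolding smooth_def using Ck_continuous by blast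

lemma smooth_has_real_derivative:
  fixes f :: "real \<Rightarrow> real"
  assumes "smooth f" shows "(f has_field_derivative deriv f z) (at z)"
proof -
  have "f differentiable (at z)" using smooth_has_derivative[OF assms, of z] by (auto simp: differentiable_def)
  then have "f field_differentiable (at z)" using real_differentiable_def field_differentiable_def by blast
  then show ?thesis by (simp add: DERIV_deriv_iff_field_differentiable)
qed

text \<open>Smoothness of a primitive follows from that of its derivative; this is how
  antiderivatives of test functions become test functions.\<close>

lemma smooth_realI:
  fixes f :: "real \<Rightarrow> real"
  assumes "\<And>z. (f has_field_derivative f' z) (at z)" "smooth f'"
  shows "smooth f"
proof -
  have "Ck (Suc k) f" for k
    by (rule Ck_SucI[OF assms(1)[unfolded has_field_derivative_def]]) (use assms(2) in \<open>simp add: smooth_def\<close>)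
  then show ?thesis unfolding smooth_def using Ck_Suc_imp by blast
qed

lemma smooth_deriv:
  fixes f :: "real \<Rightarrow> real"
  assumes "smooth f" shows "smooth (deriv f)"
proof -
  have "dd 1 f = deriv f"
    using dd_eqI[OF smooth_has_real_derivative[OF assms, unfolded has_field_derivative_def]] by auto
  then show ?thesis using smooth_dd[OF assms, of 1] by simp
qed

section \<open>Flat functions and bumps on the line\<close>

definition flat :: "real poly \<Rightarrow> real \<Rightarrow> real" where
  "flat p x = (if x > 0 then poly p (1 / x) * exp (- (1 / x)) else 0)"

lemma poly_exp_tendsto: "((\<lambda>y. poly p y * exp (- y)) \<longlongrightarrow> (0::real)) at_top"
proof -
  have "((\<lambda>y. y ^ k * poly p y * exp (- y)) \<longlongrightarrow> (0::real)) at_top" for k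
  proof (induction p arbitrary: k)
    case (pCons a p)
    have "((\<lambda>y. a * (y ^ k / exp y) + y ^ Suc k * poly p y * exp (- y)) \<longlongrightarrow> a * 0 + 0) at_top"
      by (intro tendsto_intros tendsto_power_div_exp_0 pCons)
    then show ?case by (simp add: algebra_simps exp_minus divide_inverse)
  qed simp
  from this[of 0] show ?thesis by simp
qed

lemma flat_tendsto: "(flat p \<longlongrightarrow> 0) (at 0)"
proof (rule filterlim_split_at)
  have "\<forall>\<^sub>F x in at_left 0. flat p x = 0"
    unfolding eventually_at_filter by (intro always_eventually) (auto simp: flat_def)
  then show "(flat p \<longlongrightarrow> 0) (at_left 0)" by (rule tendsto_eventually)
  have "((\<lambda>x. poly p (inverse x) * exp (- inverse x)) \<longlongrightarrow> 0) (at_right 0)"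
    by (rule filterlim_compose[OF poly_exp_tendsto filterlim_inverse_at_top_right])
  moreover have "\<forall>\<^sub>F x in at_right 0. poly p (inverse x) * exp (- inverse x) = flat p x"
    unfolding eventually_at_filter by (intro always_eventually) (auto simp: flat_def divide_inverse)
  ultimately show "(flat p \<longlongrightarrow> 0) (at_right 0)" by (rule Lim_transform_eventually)
qed

text \<open>With y = 1/x, differentiating p(y) exp(-y) multiplies by y^2 and replaces p by p - p'.
  The family is closed under differentiation, which is why it is indexed by polynomials: smoothness
  becomes a plain induction.\<close>

lemma flat_deriv: "(flat p has_field_derivative flat (monom 1 2 * (p - pderiv p)) x) (at x)"
proof -
  consider "x > 0" | "x < 0" | "x = 0" by linarith
  then show ?thesis
  proof cases
    case 1
    have "((\<lambda>x. poly p (1 / x) * exp (- (1 / x))) has_field_derivative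
        flat (monom 1 2 * (p - pderiv p)) x) (at x)"
      using 1 by (auto intro!: derivative_eq_intros simp: flat_def poly_monom field_simps power2_eq_square)
    then show ?thesis
      by (rule has_field_derivative_transform_within_open[of _ _ _ "{0<..}"]) (use 1 in \<open>auto simp: flat_def\<close>)
  next
    case 2
    have "((\<lambda>x. 0) has_field_derivative flat (monom 1 2 * (p - pderiv p)) x) (at x)"
      using 2 by (auto simp: flat_def)
    then show ?thesis
      by (rule has_field_derivative_transform_within_open[of _ _ _ "{..<0}"]) (use 2 in \<open>auto simp: flat_def\<close>)
  next
    case 3
    \<comment> \<open>At the origin the difference quotient is again a flat function, for the
      polynomial X p, and tends to 0.\<close>
    have "((\<lambda>h. (flat p (0 + h) - flat p 0) / h) \<longlongrightarrow> 0) (at 0)"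
    proof (rule Lim_transform_eventually[OF flat_tendsto[of "monom 1 1 * p"]])
      show "\<forall>\<^sub>F h in at 0. flat (monom 1 1 * p) h = (flat p (0 + h) - flat p 0) / h"
        unfolding eventually_at_filter by (intro always_eventually) (auto simp: flat_def poly_monom)
    qed
    then show ?thesis using 3 by (simp add: DERIV_def flat_def)
  qed
qed

lemma smooth_flat: "smooth (flat p)"
proof -
  have "Ck k (flat p)" for k
  proof (induction k arbitrary: p)
    case 0
    show ?case
      using flat_deriv by (auto intro!: continuous_at_imp_continuous_on DERIV_isCont)
  next
    case (Suc k)
    show ?case
      by (rule Ck_SucI[OF flat_deriv[unfolded has_field_derivative_def]]) (use Suc in simp)
  qed
  then show ?thesis by (simp add: smooth_def)
qed

text \<open>The product of the two flat factors lies in [0, 1] and is positive exactly on the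
  shrunken open interval. The n-th power drives the value towards 1 at every fixed interior point,
  while the margin 1/(n+1) keeps the support compact inside (a, b).\<close>

definition bump :: "real \<Rightarrow> real \<Rightarrow> nat \<Rightarrow> real \<Rightarrow> real" where
  "bump a b n x = 1 - (1 - flat 1 (x - a - 1 / Suc n) * flat 1 (b - 1 / Suc n - x)) ^ n"

lemma flat_1: "0 \<le> flat 1 x" "flat 1 x \<le> 1" "flat 1 x > 0 \<longleftrightarrow> x > 0"
  by (auto simp: flat_def)

lemma smooth_real_affine:
  fixes f :: "real \<Rightarrow> real"
  assumes "smooth f" shows "smooth (\<lambda>x. f (c * x + d))"
proof -
  have "Ck k g \<Longrightarrow> Ck k (\<lambda>x. g (x + d))" for k and g :: "real \<Rightarrow> real"
  proof (induction k arbitrary: g)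
    case 0
    then show ?case by (auto intro!: continuous_intros intro: continuous_on_compose2)
  next
    case (Suc k)
    have "((\<lambda>x. g (x + d)) has_derivative (\<lambda>e. dd e g (z + d))) (at z)" for z
      using diff_chain_at[OF has_derivative_add_const[OF has_derivative_ident, of d] Ck_SucD(1)[OF Suc.prems]]
      by (simp add: o_def)
    then show ?case by (rule Ck_SucI) (use Suc.IH Ck_SucD(2)[OF Suc.prems] in auto)
  qed
  then have "smooth (\<lambda>x. f (x + d))" using assms by (simp add: smooth_def)
  from smooth_bounded_linear_comp[OF bounded_linear_mult_right this] show ?thesis by simp
qed

lemma smooth_bump: "smooth (bump a b n)"
proof -
  have "smooth (\<lambda>x. flat 1 (x - a - 1 / Suc n))" "smooth (\<lambda>x. flat 1 (b - 1 / Suc n - x))"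
    using smooth_real_affine[OF smooth_flat[of 1], of 1 "- a - 1 / Suc n"]
      smooth_real_affine[OF smooth_flat[of 1], of "-1" "b - 1 / Suc n"]
    by (simp_all add: algebra_simps)
  then show ?thesis unfolding bump_def[abs_def]
    by (intro smooth_diff smooth_power smooth_mult smooth_const)
qed

lemma bump_bounds: "0 \<le> bump a b n x" "bump a b n x \<le> 1"
proof -
  let ?g = "flat 1 (x - a - 1 / Suc n) * flat 1 (b - 1 / Suc n - x)"
  have "0 \<le> ?g" "?g \<le> 1" using flat_1 by (auto intro: mult_le_one)
  then have "0 \<le> (1 - ?g) ^ n" "(1 - ?g) ^ n \<le> 1" by (auto intro: power_le_one)
  then show "0 \<le> bump a b n x" "bump a b n x \<le> 1" by (simp_all add: bump_def)
qed

lemma bump_support: "x \<notin> {a + 1 / Suc n .. b - 1 / Suc n} \<Longrightarrow> bump a b n x = 0"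
  by (auto simp: bump_def flat_def)

lemma bump_interval: "{a + 1 / Suc n .. b - 1 / Suc n} \<subseteq> {a<..<b}"
proof -
  have *: "{a + w .. b - w} \<subseteq> {a<..<b}" if "0 < w" for w using that by auto
  show ?thesis by (rule *) simp
qed

lemma bump_support': "x \<notin> {a<..<b} \<Longrightarrow> bump a b n x = 0"
  by (rule bump_support) (use bump_interval[of a n b] in blast)

lemma bump_tendsto: "(\<lambda>n. bump a b n x) \<longlonglongrightarrow> indicator {a<..<b} x"
proof (cases "x \<in> {a<..<b}")
  case False
  then show ?thesis by (simp add: bump_support')
next
  case True
  define g where "g n = flat 1 (x - a - 1 / Suc n) * flat 1 (b - 1 / Suc n - x)" for n :: nat
  define G where "G = flat 1 (x - a) * flat 1 (b - x)"
  have G: "G > 0" using True by (simp add: G_def flat_1)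
  have c: "continuous_on UNIV (flat 1)" by (rule smooth_continuous[OF smooth_flat])
  have n0: "(\<lambda>n. 1 / real (Suc n)) \<longlonglongrightarrow> 0"
    using LIMSEQ_inverse_real_of_nat by (simp add: inverse_eq_divide)
  have "g \<longlonglongrightarrow> flat 1 (x - a - 0) * flat 1 (b - 0 - x)"
    unfolding g_def by (intro tendsto_mult continuous_on_tendsto_compose[OF c] tendsto_intros n0) auto
  \<comment> \<open>The factor moves with n, but stays above half of its positive limit, so the
    power is dominated by a geometric sequence.\<close>
  then have "\<forall>\<^sub>F n in sequentially. g n > G / 2"
    using G by (intro order_tendstoD) (auto simp: G_def mult.commute)
  then have ev: "\<forall>\<^sub>F n in sequentially. norm ((1 - g n) ^ n) \<le> (1 - G / 2) ^ n"
  proof eventually_elim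
    case (elim n)
    have "g n \<le> 1" unfolding g_def using flat_1 by (auto intro: mult_le_one)
    then show ?case using elim by (auto simp: norm_power intro!: power_mono)
  qed
  have "G \<le> 1" unfolding G_def using flat_1 by (auto intro: mult_le_one)
  then have "(\<lambda>n. (1 - G / 2) ^ n) \<longlonglongrightarrow> 0" using G by (intro LIMSEQ_realpow_zero) auto
  from Lim_null_comparison[OF ev this] have "(\<lambda>n. 1 - (1 - g n) ^ n) \<longlonglongrightarrow> 1 - 0"
    by (intro tendsto_intros)
  then show ?thesis using True by (simp add: bump_def g_def)
qed

lemma test_on_real_bump:
  assumes "{a<..<b} \<subseteq> U"
  shows "test_on U (bump a b n)"
proof -
  have sub: "{x. bump a b n x \<noteq> 0} \<subseteq> {a + 1 / Suc n .. b - 1 / Suc n}"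
    using bump_support by blast
  then have cl: "closure {x. bump a b n x \<noteq> 0} \<subseteq> {a + 1 / Suc n .. b - 1 / Suc n}"
    by (rule closure_minimal) simp
  show ?thesis unfolding test_on_def
    using bump_interval[of a n b] smooth_bump cl assms compact_closure bounded_subset[OF bounded_closed_interval sub] by auto
qed

lemma integral_mult_bump_tendsto:
  fixes W :: "real \<Rightarrow> real"
  assumes "set_integrable lborel {a<..<b} W"
  shows "(\<lambda>n. LBINT x. W x * bump a b n x) \<longlonglongrightarrow> (LBINT x. W x * indicator {a<..<b} x)"
proof -
  have "(\<lambda>n. LBINT x. (indicator {a<..<b} x * W x) * bump a b n x) \<longlonglongrightarrow> (LBINT x. (indicator {a<..<b} x * W x) * indicator {a<..<b} x)"
  proof (rule integral_dominated_convergence[where w="\<lambda>x. norm (indicator {a<..<b} x * W x)"])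
    have i: "integrable lborel (\<lambda>x. indicator {a<..<b} x * W x)"
      using assms by (simp add: set_integrable_def)
    then have [measurable]: "(\<lambda>x. indicator {a<..<b} x * W x) \<in> borel_measurable lborel" by simp
    have [measurable]: "bump a b n \<in> borel_measurable borel" for n
      by (intro borel_measurable_continuous_onI smooth_continuous smooth_bump)
    show "integrable lborel (\<lambda>x. norm (indicator {a<..<b} x * W x))" using i by simp
    show "(\<lambda>x. indicator {a<..<b} x * W x * bump a b n x) \<in> borel_measurable lborel" for n by measurable
    show "(\<lambda>x. indicator {a<..<b} x * W x * indicator {a<..<b} x) \<in> borel_measurable lborel" by measurable
    show "AE x in lborel. (\<lambda>n. indicator {a<..<b} x * W x * bump a b n x) \<longlonglongrightarrow> indicator {a<..<b} x * W x * indicator {a<..<b} x"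
      by (intro AE_I2 tendsto_intros bump_tendsto)
    show "AE x in lborel. norm (indicator {a<..<b} x * W x * bump a b n x) \<le> norm (indicator {a<..<b} x * W x)" for n
      using bump_bounds[of a b n] by (auto simp: abs_mult intro!: mult_left_le)
  qed
  moreover have "(indicator {a<..<b} x * W x) * bump a b n x = W x * bump a b n x" for x n
    using bump_support'[of x a b n] by (auto split: split_indicator)
  moreover have "(indicator {a<..<b} x * W x) * indicator {a<..<b} x = W x * indicator {a<..<b} x" for x
    by (auto split: split_indicator)
  ultimately show ?thesis by simp
qed

text \<open>The primitive starting at minus infinity vanishes to the left of the support, and to the
  right of it because the total integral is zero.\<close>

lemma smooth_primitive:
  fixes f :: "real \<Rightarrow> real"
  assumes f: "smooth f" and supp: "\<And>x. x \<notin> {a..b} \<Longrightarrow> f x = 0" and int: "(LBINT x. f x) = 0"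
  shows "\<exists>c. smooth c \<and> (\<forall>x. (c has_field_derivative f x) (at x)) \<and> (\<forall>x. x \<notin> {a..b} \<longrightarrow> c x = 0)"
proof -
  have cont: "continuous_on S f" for S using smooth_continuous[OF f] continuous_on_subset by blast
  have i: "integrable lborel f"
  proof -
    have "integrable lborel (\<lambda>x. indicator {a..b} x *\<^sub>R f x)"
      by (rule borel_integrable_compact[unfolded set_integrable_def]) (use cont in auto)
    moreover have "(\<lambda>x. indicator {a..b} x *\<^sub>R f x) = f" using supp by (fastforce split: split_indicator)
    ultimately show ?thesis by (simp only:)
  qed
  define c where "c x = (LBINT y. indicator {..x} y * f y)" for x
  have ii: "integrable lborel (\<lambda>y. indicator A y * f y)" if "A \<in> sets borel" for A
    using integrable_mult_indicator[OF _ i, of A] that by simp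
  have c_diff: "c y - c x = (LBINT t. indicator {x..y} t *\<^sub>R f t)" if "x \<le> y" for x y
  proof -
    have "c y - c x = (LBINT t. indicator {..y} t * f t - indicator {..x} t * f t)"
      unfolding c_def by (rule Bochner_Integration.integral_diff[symmetric]) (auto intro: ii)
    also have "\<dots> = (LBINT t. indicator {x..y} t *\<^sub>R f t)"
    proof (rule integral_cong_AE)
      have [measurable]: "f \<in> borel_measurable borel" using i by auto
      show "(\<lambda>t. indicator {..y} t * f t - indicator {..x} t * f t) \<in> borel_measurable lborel"
        "(\<lambda>t. indicator {x..y} t *\<^sub>R f t) \<in> borel_measurable lborel" by measurable
      show "AE t in lborel. indicator {..y} t * f t - indicator {..x} t * f t = indicator {x..y} t *\<^sub>R f t"
        using AE_lborel_singleton[of x] by eventually_elim (use that in \<open>auto split: split_indicator\<close>)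
    qed
    finally show ?thesis .
  qed
  have deriv: "(c has_field_derivative f x) (at x)" for x
  proof -
    obtain F where F: "\<And>t. t \<in> {x-1..x+1} \<Longrightarrow> (F has_vector_derivative f t) (at t within {x-1..x+1})"
      using antiderivative_continuous[OF cont] by blast
    have eq: "c y = F y + (c (x - 1) - F (x - 1))" if "y \<in> {x-1..x+1}" for y
    proof -
      have "c y - c (x - 1) = F y - F (x - 1)"
        unfolding c_diff[of "x - 1" y, OF that[THEN conjunct1[OF iffD1[OF atLeastAtMost_iff]]]]
      proof (rule integral_FTC_Icc)
        fix t assume "x - 1 \<le> t" "t \<le> y"
        then show "(F has_vector_derivative f t) (at t within {x - 1..y})"
          using that by (intro has_vector_derivative_within_subset[OF F]) auto
      qed (use that cont in auto)
      then show ?thesis by simp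
    qed
    have "(F has_vector_derivative f x) (at x within {x-1..x+1})" by (rule F) simp
    moreover have "at x within {x-1..x+1} = at x"
      by (rule at_within_interior) simp
    ultimately have "(F has_field_derivative f x) (at x)"
      by (simp add: has_real_derivative_iff_has_vector_derivative)
    then have "((\<lambda>y. F y + (c (x - 1) - F (x - 1))) has_field_derivative f x) (at x)"
      by (auto intro!: derivative_eq_intros)
    then show ?thesis
    proof (rule has_field_derivative_transform_within_open)
      show "open {x-1<..<x+1}" "x \<in> {x-1<..<x+1}" by auto
      show "F y + (c (x - 1) - F (x - 1)) = c y" if "y \<in> {x-1<..<x+1}" for y
        by (rule eq[symmetric]) (use that in auto)
    qed
  qed
  have "c x = 0" if "x \<notin> {a..b}" for x
  proof (cases "x < a")
    case True
    have "(LBINT y. indicator {..x} y * f y) = (\<integral>y. 0 \<partial>(lborel::real measure))"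
    proof (rule Bochner_Integration.integral_cong[OF refl])
      fix y show "indicator {..x} y * f y = 0"
        using True supp[of y] by (cases "y \<le> x") auto
    qed
    then show ?thesis by (simp add: c_def)
  next
    case False
    have "(LBINT y. indicator {..x} y * f y) = (LBINT y. f y)"
    proof (intro Bochner_Integration.integral_cong[OF refl])
      fix y show "indicator {..x} y * f y = f y"
        using False that supp[of y] by (cases "y \<le> x") auto
    qed
    then show ?thesis by (simp add: c_def int)
  qed
  then show ?thesis using deriv smooth_realI[OF deriv f] by blast
qed


section \<open>Compactly supported smooth functions\<close>

lemma test_on_outside:
  fixes \<phi> :: "'a::euclidean_space \<Rightarrow> 'b::real_normed_vector"
  assumes "test_on U \<phi>" "x \<notin> U"
  shows "\<phi> x = 0" "(\<phi> has_derivative (\<lambda>e. 0)) (at x)"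
proof -
  let ?C = "closure {z. \<phi> z \<noteq> 0}"
  have x: "x \<in> - ?C" using assms by (auto simp: test_on_def)
  have zero: "\<phi> y = 0" if "y \<in> - ?C" for y
    using that closure_subset[of "{z. \<phi> z \<noteq> 0}"] by auto
  show "\<phi> x = 0" by (rule zero[OF x])
  have "((\<lambda>_. 0) has_derivative (\<lambda>e. 0)) (at x)" by simp
  then show "(\<phi> has_derivative (\<lambda>e. 0)) (at x)"
  proof (rule has_derivative_transform_within_open)
    show "open (- ?C)" by (rule open_Compl[OF closed_closure])
    show "x \<in> - ?C" by (rule x)
    show "0 = \<phi> y" if "y \<in> - ?C" for y using zero[OF that] by simp
  qed
qed

lemma test_on_dd:
  fixes \<phi> :: "'a::euclidean_space \<Rightarrow> 'b::real_normed_vector"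
  assumes "test_on U \<phi>" "b \<in> Basis"
  shows "test_on U (dd b \<phi>)"
proof -
  let ?C = "closure {z. \<phi> z \<noteq> 0}"
  have C: "test_on ?C \<phi>" using assms(1) by (simp add: test_on_def)
  have "dd b \<phi> x = 0" if "x \<notin> ?C" for x
    using dd_eqI[OF test_on_outside(2)[OF C that]] .
  then have "{z. dd b \<phi> z \<noteq> 0} \<subseteq> ?C" by blast
  then have sub: "closure {z. dd b \<phi> z \<noteq> 0} \<subseteq> ?C" by (rule closure_minimal) simp
  have "compact (?C \<inter> closure {z. dd b \<phi> z \<noteq> 0})"
    by (rule compact_Int_closed) (use assms in \<open>auto simp: test_on_def\<close>)
  moreover have "?C \<inter> closure {z. dd b \<phi> z \<noteq> 0} = closure {z. dd b \<phi> z \<noteq> 0}" using sub by (rule Int_absorb1)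
  ultimately have "compact (closure {z. dd b \<phi> z \<noteq> 0})" by (simp only:)
  moreover have "?C \<subseteq> U" "smooth \<phi>" using assms(1) by (simp_all add: test_on_def)
  ultimately show ?thesis using smooth_dd[OF \<open>smooth \<phi>\<close> assms(2)] sub by (auto simp: test_on_def)
qed

lemma test_on_bounded:
  fixes \<phi> :: "'a::euclidean_space \<Rightarrow> 'b::euclidean_space"
  assumes "test_on U \<phi>"
  shows "\<exists>B. \<forall>x. norm (\<phi> x) \<le> B"
proof -
  let ?C = "closure {z. \<phi> z \<noteq> 0}"
  have "compact (\<phi> ` ?C)"
  proof (rule compact_continuous_image)
    show "continuous_on ?C \<phi>"
      using assms continuous_on_subset[OF smooth_continuous[of \<phi>] subset_UNIV] by (simp add: test_on_def)
    show "compact ?C" using assms by (simp add: test_on_def)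
  qed
  from compact_imp_bounded[OF this] obtain B where B: "\<forall>y\<in>\<phi> ` ?C. norm y \<le> B"
    unfolding bounded_iff by blast
  have "norm (\<phi> x) \<le> max B 0" for x
  proof (cases "\<phi> x = 0")
    case False
    then have "x \<in> ?C" using closure_subset[of "{z. \<phi> z \<noteq> 0}"] by blast
    then have "norm (\<phi> x) \<le> B" using B by blast
    then show ?thesis by simp
  qed simp
  then show ?thesis by blast
qed

lemma test_on_L2:
  fixes \<phi> :: "'a::euclidean_space \<Rightarrow> 'b::euclidean_space"
  assumes "test_on U \<phi>"
  shows "L2 lborel \<phi>" "integrable lborel \<phi>" "\<phi> \<in> borel_measurable borel"
proof -
  let ?C = "closure {z. \<phi> z \<noteq> 0}"
  have C: "compact ?C" and s: "smooth \<phi>" using assms by (auto simp: test_on_def)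
  show m[measurable]: "\<phi> \<in> borel_measurable borel"
    by (intro borel_measurable_continuous_onI smooth_continuous s)
  obtain B where B: "\<And>x. norm (\<phi> x) \<le> B" using test_on_bounded[OF assms] by blast
  have fin: "emeasure lborel ?C < \<infinity>" using C emeasure_bounded_finite compact_imp_bounded by blast
  have z: "\<phi> x = 0" if "x \<notin> ?C" for x using that closure_subset[of "{z. \<phi> z \<noteq> 0}"] by auto
  have i: "integrable lborel (\<lambda>x. indicator ?C x * c)" for c :: real
    by (intro integrable_mult_left integrable_real_indicator) (use fin in auto)
  show "L2 lborel \<phi>"
  proof (rule L2I_bound[OF _ i[of "B\<^sup>2"]])
    show "AE x in lborel. (norm (\<phi> x))\<^sup>2 \<le> indicator ?C x * B\<^sup>2"
    proof (intro AE_I2)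
      fix x show "(norm (\<phi> x))\<^sup>2 \<le> indicator ?C x * B\<^sup>2"
        using z[of x] power_mono[OF B[of x], of 2] by (auto split: split_indicator)
    qed
  qed simp
  show "integrable lborel \<phi>"
  proof (rule Bochner_Integration.integrable_bound[OF i[of B]])
    show "AE x in lborel. norm (\<phi> x) \<le> norm (indicator ?C x * B)"
    proof (intro AE_I2)
      fix x show "norm (\<phi> x) \<le> norm (indicator ?C x * B)"
        using z[of x] B[of x] by (auto split: split_indicator)
    qed
  qed simp
qed

subsection \<open>Weak limits determined by boxes\<close>

text \<open>Cauchy-Schwarz gives a bound by the measure of A that is uniform over all h of bounded
  norm; this equi-integrability is what lets countable unions be treated.\<close>

lemma weak_limit_set_bound:
  fixes h :: "'x::euclidean_space \<Rightarrow> real"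
  assumes S: "S \<in> sets borel" "emeasure lborel S < \<infinity>"
    and h: "L2 lborel h" "nsq lborel h \<le> C" and supp: "\<And>x. x \<notin> S \<Longrightarrow> h x = 0" and A: "A \<in> sets borel"
  shows "A \<inter> S \<in> fmeasurable lborel"
    and "integrable lborel (\<lambda>x. indicator A x * h x)"
    and "\<bar>\<integral>x. indicator A x * h x \<partial>lborel\<bar> \<le> sqrt (measure lborel (A \<inter> S)) * sqrt C"
proof -
  show fm: "A \<inter> S \<in> fmeasurable lborel"
  proof (rule fmeasurableI)
    have "emeasure lborel (A \<inter> S) \<le> emeasure lborel S" by (rule emeasure_mono) (use S in auto)
    then show "emeasure lborel (A \<inter> S) < \<infinity>" using S(2) by (rule le_less_trans)
  qed (use A S in auto)
  have L2S: "L2 lborel (\<lambda>x. indicator (A \<inter> S) x *\<^sub>R (1::real))"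
    by (rule L2_const_indicator) (use fm in \<open>auto simp: fmeasurable_def\<close>)
  have eqS: "indicator A x * h x = indicator (A \<inter> S) x *\<^sub>R 1 \<bullet> h x" for x
    using supp[of x] by (auto split: split_indicator)
  have nsqS: "nsq lborel (\<lambda>x. indicator (A \<inter> S) x *\<^sub>R (1::real)) = measure lborel (A \<inter> S)"
  proof -
    have "nsq lborel (\<lambda>x. indicator (A \<inter> S) x *\<^sub>R (1::real)) = (LBINT x. indicator (A \<inter> S) x)"
      unfolding nsq_def by (intro Bochner_Integration.integral_cong) (auto split: split_indicator)
    then show ?thesis by simp
  qed
  show "integrable lborel (\<lambda>x. indicator A x * h x)"
    unfolding eqS by (rule L2_inner_integrable[OF L2S h(1)])
  have "\<bar>\<integral>x. indicator A x * h x \<partial>lborel\<bar> \<le> sqrt (measure lborel (A \<inter> S)) * sqrt (nsq lborel h)"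
    unfolding eqS using L2_Cauchy_Schwarz[OF L2S h(1)] nsqS by simp
  also have "\<dots> \<le> sqrt (measure lborel (A \<inter> S)) * sqrt C"
    using h(2) by (intro mult_left_mono real_sqrt_le_mono) auto
  finally show "\<bar>\<integral>x. indicator A x * h x \<partial>lborel\<bar> \<le> sqrt (measure lborel (A \<inter> S)) * sqrt C" .
qed

text \<open>Finitely many pieces converge termwise, and the rest of the union has small measure and
  hence a small contribution, uniformly in the index.\<close>

lemma weak_limit_UN:
  fixes h :: "'i \<Rightarrow> 'x::euclidean_space \<Rightarrow> real" and F :: "'i filter" and A :: "nat \<Rightarrow> 'x set"
  assumes S: "S \<in> sets borel" "emeasure lborel S < \<infinity>"
    and bnd: "\<forall>\<^sub>F i in F. L2 lborel (h i) \<and> nsq lborel (h i) \<le> C"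
    and supp: "\<And>i x. x \<notin> S \<Longrightarrow> h i x = 0"
    and A: "\<And>j. A j \<in> sets borel" and disj: "disjoint_family A"
    and lim: "\<And>j. ((\<lambda>i. LBINT x. indicator (A j) x * h i x) \<longlongrightarrow> 0) F"
  shows "((\<lambda>i. LBINT x. indicator (\<Union>j. A j) x * h i x) \<longlongrightarrow> 0) F"
proof -
  have fm: "A \<inter> S \<in> fmeasurable lborel" if "A \<in> sets borel" for A
    by (rule weak_limit_set_bound(1)[where h="\<lambda>_. 0" and C=0]) (use S that in \<open>auto simp: L2_zero nsq_def\<close>)
  show ?thesis
  proof (rule tendstoI)
    fix e :: real assume e: "e > 0"
    define R where "R n = (\<Union>j. A j) - (\<Union>j<n. A j)" for n
    have R: "R n \<in> sets borel" for n unfolding R_def using A by auto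
    have "(\<lambda>n. measure lborel (R n \<inter> S)) \<longlonglongrightarrow> measure lborel (\<Inter>n. R n \<inter> S)"
    proof (rule Lim_measure_decseq)
      show "range (\<lambda>n. R n \<inter> S) \<subseteq> sets lborel" using R S by auto
      show "decseq (\<lambda>n. R n \<inter> S)" unfolding decseq_def R_def by force
      show "emeasure lborel (R n \<inter> S) \<noteq> \<infinity>" for n using fm[OF R[of n]] by (auto simp: fmeasurable_def)
    qed
    moreover have "(\<Inter>n. R n \<inter> S) = {}" by (auto simp: R_def)
    ultimately have "(\<lambda>n. sqrt (measure lborel (R n \<inter> S)) * sqrt C) \<longlonglongrightarrow> sqrt 0 * sqrt C"
      by (intro tendsto_intros) simp
    then have "\<forall>\<^sub>F n in sequentially. sqrt (measure lborel (R n \<inter> S)) * sqrt C < e / 2"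
      using e by (intro order_tendstoD) auto
    then obtain n where n: "sqrt (measure lborel (R n \<inter> S)) * sqrt C < e / 2"
      by (auto simp: eventually_sequentially)
    have "((\<lambda>i. \<Sum>j<n. \<integral>x. indicator (A j) x * h i x \<partial>lborel) \<longlongrightarrow> (\<Sum>j<n. 0)) F"
      by (intro tendsto_sum lim)
    then have "((\<lambda>i. \<Sum>j<n. \<integral>x. indicator (A j) x * h i x \<partial>lborel) \<longlongrightarrow> 0) F" by simp
    from order_tendstoD(2)[OF tendsto_rabs_zero[OF this], of "e / 2"]
    have "\<forall>\<^sub>F i in F. \<bar>\<Sum>j<n. \<integral>x. indicator (A j) x * h i x \<partial>lborel\<bar> < e / 2"
      using e by simp
    with bnd show "\<forall>\<^sub>F i in F. dist (LBINT x. indicator (\<Union>j. A j) x * h i x) 0 < e"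
    proof eventually_elim
      case (elim i)
      have hi: "L2 lborel (h i)" "nsq lborel (h i) \<le> C" using elim by auto
      have "indicator (\<Union>j. A j) x = (\<Sum>j<n. indicator (A j) x) + (indicator (R n) x :: real)" for x
      proof -
        have "(\<Sum>j<n. indicator (A j) x) = (indicator (\<Union>j<n. A j) x :: real)"
          using disj by (subst indicator_UN_disjoint) (auto simp: disjoint_family_on_def)
        then show ?thesis by (auto simp: R_def split: split_indicator)
      qed
      then have "(LBINT x. indicator (\<Union>j. A j) x * h i x) =
          (LBINT x. (\<Sum>j<n. indicator (A j) x * h i x) + indicator (R n) x * h i x)"
        by (simp add: algebra_simps sum_distrib_left)
      also have "\<dots> = (\<Sum>j<n. \<integral>x. indicator (A j) x * h i x \<partial>lborel) + (LBINT x. indicator (R n) x * h i x)"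
      proof -
        note iA = weak_limit_set_bound(2)[where h="h i", OF S hi supp A]
          and iR = weak_limit_set_bound(2)[where h="h i", OF S hi supp R]
        have "(LBINT x. (\<Sum>j<n. indicator (A j) x * h i x) + indicator (R n) x * h i x) =
            (LBINT x. (\<Sum>j<n. indicator (A j) x * h i x)) + (LBINT x. indicator (R n) x * h i x)"
          by (intro Bochner_Integration.integral_add Bochner_Integration.integrable_sum iA iR)
        moreover have "(LBINT x. (\<Sum>j<n. indicator (A j) x * h i x)) = (\<Sum>j<n. \<integral>x. indicator (A j) x * h i x \<partial>lborel)"
          by (intro Bochner_Integration.integral_sum iA)
        ultimately show ?thesis by simp
      qed
      finally have "\<bar>\<integral>x. indicator (\<Union>j. A j) x * h i x \<partial>lborel\<bar> < e / 2 + e / 2"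
        using weak_limit_set_bound(3)[where h="h i", OF S hi supp R[of n]] elim n by linarith
      then show ?case by simp
    qed
  qed
qed

text \<open>The sets along which the integrals vanish in the limit form a Dynkin system:
  \<open>whole\<close> provides complements, the uniform bound provides disjoint unions.
  Intersection stability of the generator does the rest.\<close>

lemma weak_limit_sets:
  fixes h :: "'i \<Rightarrow> 'x::euclidean_space \<Rightarrow> real" and F :: "'i filter"
  assumes S: "S \<in> sets borel" "emeasure lborel S < \<infinity>"
    and bnd: "\<forall>\<^sub>F i in F. L2 lborel (h i) \<and> nsq lborel (h i) \<le> C"
    and supp: "\<And>i x. x \<notin> S \<Longrightarrow> h i x = 0"
    and whole: "((\<lambda>i. LBINT x. h i x) \<longlongrightarrow> 0) F"
    and G: "sets borel = sigma_sets UNIV G" "Int_stable G"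
    and basic: "\<And>A. A \<in> G \<Longrightarrow> ((\<lambda>i. LBINT x. indicator A x * h i x) \<longlongrightarrow> 0) F"
    and A: "A \<in> sets borel"
  shows "((\<lambda>i. LBINT x. indicator A x * h i x) \<longlongrightarrow> 0) F"
proof -
  have "A \<in> sigma_sets UNIV G" using A G(1) by simp
  have "G \<subseteq> Pow UNIV" by simp
  from G(2) this \<open>A \<in> sigma_sets UNIV G\<close> show ?thesis
  proof (induction rule: sigma_sets_induct_disjoint)
    case (compl A)
    then have A: "A \<in> sets borel" using G by simp
    have "\<forall>\<^sub>F i in F. (LBINT x. h i x) - (LBINT x. indicator A x * h i x) = (LBINT x. indicator (UNIV - A) x * h i x)"
      using bnd
    proof eventually_elim
      case (elim i)
      have "(LBINT x. indicator (UNIV - A) x * h i x) = (LBINT x. indicator UNIV x * h i x - indicator A x * h i x)"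
        by (intro Bochner_Integration.integral_cong) (auto split: split_indicator)
      then show ?case
        using weak_limit_set_bound(2)[where h="h i" and C=C and A=UNIV, OF S _ _ supp]
          weak_limit_set_bound(2)[where h="h i" and C=C and A=A, OF S _ _ supp A] elim by simp
    qed
    then show ?case
      using tendsto_diff[OF whole compl(2)] by (simp add: tendsto_cong)
  next
    case (union A)
    then have A: "A j \<in> sets borel" for j using G by auto
    show ?case by (rule weak_limit_UN[OF S bnd supp A union(1) union(3)])
  qed (use G basic in auto)
qed

text \<open>Density of simple functions, with the uniform norm bound controlling the error of
  approximation.\<close>

lemma weak_limit_L2:
  fixes h :: "'i \<Rightarrow> 'x::euclidean_space \<Rightarrow> real" and F :: "'i filter"
  assumes bnd: "\<forall>\<^sub>F i in F. L2 lborel (h i) \<and> nsq lborel (h i) \<le> C"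
    and sets: "\<And>A. A \<in> sets borel \<Longrightarrow> ((\<lambda>i. LBINT x. indicator A x * h i x) \<longlongrightarrow> 0) F"
    and g: "L2 lborel g"
  shows "((\<lambda>i. LBINT x. g x * h i x) \<longlongrightarrow> 0) F"
  using g
proof (induction g rule: L2_induct)
  case (ind A c)
  have "((\<lambda>i. c * (LBINT x. indicator A x * h i x)) \<longlongrightarrow> c * 0) F"
    by (intro tendsto_intros sets) (use ind in auto)
  then show ?case by (simp add: mult.assoc[symmetric] mult.commute[of c] flip: integral_mult_right_zero)
next
  case (add f g)
  have "\<forall>\<^sub>F i in F. (LBINT x. f x * h i x) + (LBINT x. g x * h i x) = (LBINT x. (f x + g x) * h i x)"
    using bnd
  proof eventually_elim
    case (elim i)
    then show ?case
      using L2_inner_integrable[OF add(1), of "h i"] L2_inner_integrable[OF add(2), of "h i"]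
      by (simp add: algebra_simps)
  qed
  then show ?case using tendsto_add[OF add(3,4)] by (simp add: tendsto_cong)
next
  case (lim f s)
  show ?case
  proof (rule tendstoI)
    fix e :: real assume e: "e > 0"
    have "(\<lambda>n. sqrt (nsq lborel (\<lambda>x. s n x - f x)) * sqrt C) \<longlonglongrightarrow> sqrt 0 * sqrt C"
      by (intro tendsto_intros lim)
    then have "\<forall>\<^sub>F n in sequentially. sqrt (nsq lborel (\<lambda>x. s n x - f x)) * sqrt C < e / 2"
      using e by (intro order_tendstoD) auto
    then obtain n where n: "sqrt (nsq lborel (\<lambda>x. s n x - f x)) * sqrt C < e / 2"
      by (auto simp: eventually_sequentially)
    have "\<forall>\<^sub>F i in F. \<bar>\<integral>x. s n x * h i x \<partial>lborel\<bar> < e / 2"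
      using order_tendstoD(2)[OF tendsto_rabs_zero[OF lim(4)[of n]], of "e / 2"] e by simp
    with bnd show "\<forall>\<^sub>F i in F. dist (LBINT x. f x * h i x) 0 < e"
    proof eventually_elim
      case (elim i)
      then have h: "L2 lborel (h i)" by simp
      have d: "L2 lborel (\<lambda>x. s n x - f x)" by (rule L2_diff[OF lim(2,1)])
      have "(LBINT x. f x * h i x) = (LBINT x. s n x * h i x) - (LBINT x. (s n x - f x) * h i x)"
        using L2_inner_integrable[OF lim(2)[of n] h] L2_inner_integrable[OF lim(1) h] by (simp add: algebra_simps)
      moreover have "\<bar>\<integral>x. (s n x - f x) * h i x \<partial>lborel\<bar> \<le> sqrt (nsq lborel (\<lambda>x. s n x - f x)) * sqrt (nsq lborel (h i))"
        using L2_Cauchy_Schwarz[OF d h] by simp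
      moreover have "\<dots> \<le> sqrt (nsq lborel (\<lambda>x. s n x - f x)) * sqrt C"
        using elim by (intro mult_left_mono real_sqrt_le_mono) (auto simp: nsq_nonneg)
      ultimately show ?case using elim n by simp
    qed
  qed
qed

lemma AE_eq_0_of_set_integrals:
  fixes g :: "'a \<Rightarrow> real"
  assumes g: "integrable M g" and z: "\<And>A. A \<in> sets M \<Longrightarrow> (\<integral>x. indicator A x * g x \<partial>M) = 0"
  shows "AE x in M. g x = 0"
proof -
  have "AE x in M. x \<in> space M \<longrightarrow> g x \<le> 0"
    by (rule AE_nonpos_of_set_integrals[OF g]) (use z in auto)
  moreover have "AE x in M. x \<in> space M \<longrightarrow> - g x \<le> 0"
    by (rule AE_nonpos_of_set_integrals) (use z g in auto)
  ultimately show ?thesis using AE_space by eventually_elim auto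
qed

lemma test_on_deriv:
  fixes \<psi> :: "real \<Rightarrow> real"
  assumes "test_on U \<psi>" shows "test_on U (deriv \<psi>)"
proof -
  have "dd 1 \<psi> = deriv \<psi>"
    using dd_eqI[OF smooth_has_real_derivative[of \<psi>, unfolded has_field_derivative_def]] assms
    by (auto simp: test_on_def)
  then show ?thesis using test_on_dd[OF assms, of 1] by simp
qed

lemma borel_eq_sigma_box: "sets borel = sigma_sets UNIV (range (\<lambda>(a, b). box a b :: 'a::euclidean_space set))"
  by (subst borel_eq_box) simp

lemma Int_stable_box: "Int_stable (range (\<lambda>(a, b). box a b :: 'a::euclidean_space set))"
proof (rule Int_stableI_image, clarsimp)
  fix a b c d :: 'a
  have "box a b \<inter> box c d = box (\<Sum>i\<in>Basis. max (a\<bullet>i) (c\<bullet>i) *\<^sub>R i) (\<Sum>i\<in>Basis. min (b\<bullet>i) (d\<bullet>i) *\<^sub>R i)"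
    by (auto simp: set_eq_iff mem_box)
  then show "\<exists>aa ba. box a b \<inter> box c d = box aa ba" by blast
qed

section \<open>Primitives of integrable functions and the du Bois-Reymond lemma\<close>

lemma box_partial_integral_measurable:
  fixes b :: "real \<Rightarrow> real"
  assumes b: "integrable lborel b"
  shows "(\<lambda>t. LBINT r. indicator {0<..<t} r * b r) \<in> borel_measurable borel"
    and "\<bar>\<integral>r. indicator {0<..<t} r * b r \<partial>lborel\<bar> \<le> (LBINT r. \<bar>b r\<bar>)"
proof -
  have [measurable]: "b \<in> borel_measurable borel" using b by auto
  have [measurable]: "Measurable.pred (borel \<Otimes>\<^sub>M borel) (\<lambda>q::real\<times>real. snd q \<in> {0<..<fst q})"
    by simp
  have "(\<lambda>q::real\<times>real. indicator {0<..<fst q} (snd q) :: real) \<in> borel_measurable (borel \<Otimes>\<^sub>M borel)"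
    unfolding indicator_def by simp
  then have "(\<lambda>(t, r). indicator {0<..<t} r * b r) \<in> borel_measurable (borel \<Otimes>\<^sub>M lborel)"
    by (simp add: case_prod_beta)
  then show "(\<lambda>t. LBINT r. indicator {0<..<t} r * b r) \<in> borel_measurable borel"
    by (rule lborel.borel_measurable_lebesgue_integral)
  have "\<bar>\<integral>r. indicator {0<..<t} r * b r \<partial>lborel\<bar> \<le> (LBINT r. \<bar>indicator {0<..<t} r * b r\<bar>)"
    using integral_norm_bound[of lborel "\<lambda>r. indicator {0<..<t} r * b r"] by simp
  also have "\<dots> \<le> (LBINT r. \<bar>b r\<bar>)"
    by (rule integral_mono') (use b in \<open>auto split: split_indicator\<close>)
  finally show "\<bar>\<integral>r. indicator {0<..<t} r * b r \<partial>lborel\<bar> \<le> (LBINT r. \<bar>b r\<bar>)" .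
qed

lemma integral_deriv_tail:
  fixes \<psi> :: "real \<Rightarrow> real"
  assumes \<psi>: "smooth \<psi>" and z: "\<And>t. t \<ge> T \<Longrightarrow> \<psi> t = 0" "\<And>t. t \<ge> T \<Longrightarrow> deriv \<psi> t = 0"
  shows "(LBINT t. indicator {r<..} t * deriv \<psi> t) = - \<psi> r"
proof (cases "r < T")
  case True
  have m[measurable]: "deriv \<psi> \<in> borel_measurable borel"
    by (intro borel_measurable_continuous_onI smooth_continuous smooth_deriv \<psi>)
  have "(LBINT t. indicator {r<..} t * deriv \<psi> t) = (LBINT t. indicator {r..T} t *\<^sub>R deriv \<psi> t)"
  proof (rule integral_cong_AE)
    show "AE t in lborel. indicator {r<..} t * deriv \<psi> t = indicator {r..T} t *\<^sub>R deriv \<psi> t"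
      using AE_lborel_singleton[of r]
    proof eventually_elim
      case (elim t)
      then show ?case using z(2)[of t] by (auto split: split_indicator)
    qed
  qed measurable
  also have "\<dots> = \<psi> T - \<psi> r"
  proof (rule integral_FTC_Icc)
    show "r \<le> T" using True by simp
    show "(\<psi> has_vector_derivative deriv \<psi> t) (at t within {r..T})" for t
      using smooth_has_real_derivative[OF \<psi>, of t]
      by (simp add: has_real_derivative_iff_has_vector_derivative has_vector_derivative_at_within)
    show "continuous_on {r..T} (deriv \<psi>)"
      using smooth_continuous[OF smooth_deriv[OF \<psi>]] continuous_on_subset by blast
  qed
  finally show ?thesis using z by simp
next
  case False
  then have "indicator {r<..} t * deriv \<psi> t = 0" for t using z(2)[of t] by (auto split: split_indicator)
  then have "(LBINT t. indicator {r<..} t * deriv \<psi> t) = (\<integral>t. 0 \<partial>(lborel::real measure))" by (simp only:)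
  then show ?thesis using z(1)[of r] False by simp
qed

text \<open>Integration by parts obtained from Fubini on the triangle r < t: b is only integrable,
  so its primitive need not be differentiable everywhere, and all derivatives are left on
  \<psi>.\<close>

lemma integral_primitive_deriv:
  fixes \<psi> b :: "real \<Rightarrow> real"
  assumes b: "integrable lborel b" and \<psi>: "smooth \<psi>"
    and z: "\<And>t. t \<ge> T \<Longrightarrow> \<psi> t = 0" "\<And>t. t \<ge> T \<Longrightarrow> deriv \<psi> t = 0" and i: "integrable lborel (\<lambda>t. indicator {0<..} t * deriv \<psi> t)"
    and b0: "\<And>t. t \<le> 0 \<Longrightarrow> b t = 0"
  shows "(LBINT t. indicator {0<..} t * (prim b t) * deriv \<psi> t) = - (LBINT r. b r * \<psi> r)"
proof -
  have [measurable]: "(fst :: real \<times> real \<Rightarrow> _) \<in> borel_measurable borel"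
      "(snd :: real \<times> real \<Rightarrow> _) \<in> borel_measurable borel"
    by (auto intro!: borel_measurable_continuous_onI continuous_intros)
  have [measurable]: "b \<in> borel_measurable borel" using b by auto
  have [measurable]: "deriv \<psi> \<in> borel_measurable borel"
    by (intro borel_measurable_continuous_onI smooth_continuous smooth_deriv \<psi>)
  define H where "H q = indicator {0<..<snd q} (fst q) * (b (fst q) * (indicator {0<..} (snd q) * deriv \<psi> (snd q)))" for q :: "real \<times> real"
  have Hi: "integrable lborel H"
  proof (rule Bochner_Integration.integrable_bound)
    show "integrable lborel (\<lambda>q::real \<times> real. b (fst q) * (indicator {0<..} (snd q) * deriv \<psi> (snd q)))"
      by (rule integrable_lborel_tensor[OF b i])
    have "Measurable.pred borel (\<lambda>q::real\<times>real. fst q \<in> {0<..<snd q})" by simp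
    then have "(\<lambda>q::real\<times>real. indicator {0<..<snd q} (fst q) :: real) \<in> borel_measurable borel"
      unfolding indicator_def by simp
    then show "H \<in> borel_measurable lborel" unfolding H_def by simp
  qed (auto simp: H_def split: split_indicator)
  have "(LBINT t. indicator {0<..} t * (prim b t) * deriv \<psi> t) = (LBINT t. (LBINT r. H (r, t)))"
  proof (rule Bochner_Integration.integral_cong[OF refl])
    fix t
    have "(LBINT r. H (r, t)) = (LBINT r. (indicator {0<..<t} r * b r) * (indicator {0<..} t * deriv \<psi> t))"
      by (simp add: H_def mult.assoc)
    also have "\<dots> = (prim b t) * (indicator {0<..} t * deriv \<psi> t)"
      by (rule integral_mult_left_zero)
    finally show "indicator {0<..} t * (prim b t) * deriv \<psi> t = (LBINT r. H (r, t))"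
      by simp
  qed
  also have "\<dots> = (LBINT r. (LBINT t. H (r, t)))" by (rule lborel_integral_swap[OF Hi])
  also have "\<dots> = (LBINT r. - (b r * \<psi> r))"
  proof (rule Bochner_Integration.integral_cong[OF refl])
    fix r
    show "(LBINT t. H (r, t)) = - (b r * \<psi> r)"
    proof (cases "r > 0")
      case True
      then have "H (r, t) = b r * (indicator {r<..} t * deriv \<psi> t)" for t
        by (auto simp: H_def split: split_indicator)
      then show ?thesis using integral_deriv_tail[OF \<psi> z] by simp
    qed (simp add: H_def b0)
  qed
  finally show ?thesis by simp
qed

text \<open>The difference W of a and the primitive of b annihilates derivatives of test functions.
  A test function minus its integral times a fixed normalised bump has mean zero and is such a
  derivative, so W acts like a constant k on all bumps, hence on all intervals, hence almost
  everywhere.\<close>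

lemma du_Bois_Reymond:
  fixes a b :: "real \<Rightarrow> real"
  assumes T: "T > 0" and a: "L2 lborel (\<lambda>t. indicator {0<..<T} t * a t)"
    and b: "integrable lborel (\<lambda>t. indicator {0<..<T} t * b t)"
    and eq: "\<And>\<psi>. test_on {0<..<T} \<psi> \<Longrightarrow>
      - (LINT t:{0<..<T}|lborel. a t * deriv \<psi> t) = (LINT t:{0<..<T}|lborel. b t * \<psi> t)"
  shows "\<exists>k. AE t\<in>{0<..<T} in lborel. a t = k + (prim b t)"
proof -
  define S where "S = {0<..<T}"
  have Sm[measurable]: "S \<in> sets borel" and Sfin: "emeasure lborel S < \<infinity>" using T by (auto simp: S_def)
  define bb where "bb t = indicator S t * b t" for t
  have bb: "integrable lborel bb" using b by (simp add: bb_def[abs_def] S_def)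
  define B where "B t = (prim bb t)" for t
  have Bm[measurable]: "B \<in> borel_measurable borel" and Bb: "\<bar>B t\<bar> \<le> (LBINT r. \<bar>bb r\<bar>)" for t
    using box_partial_integral_measurable[OF bb] by (simp_all add: B_def[abs_def])
  have B_eq: "B t = (prim b t)" if "t \<in> S" for t
    unfolding B_def bb_def using that
    by (intro Bochner_Integration.integral_cong) (auto simp: S_def split: split_indicator)
  have aS: "L2 lborel (\<lambda>t. indicator S t * a t)" using a by (simp add: S_def)
  have one: "L2 lborel (\<lambda>t. indicator S t *\<^sub>R (1::real))" by (rule L2_const_indicator) (use Sfin in auto)
  have BS: "L2 lborel (\<lambda>t. B t *\<^sub>R (indicator S t *\<^sub>R (1::real)))"
    by (rule L2_mult_bounded[OF one]) (use Bb in auto)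
  define W where "W t = indicator S t * a t - indicator S t * B t" for t
  have W: "L2 lborel W" using L2_diff[OF aS BS] by (simp add: W_def[abs_def] mult.commute)
  have [measurable]: "W \<in> borel_measurable borel" using L2_meas[OF W] by simp
  have W0: "W t = 0" if "t \<notin> S" for t using that by (simp add: W_def)
  have Wtest: "(LBINT t. W t * deriv \<psi> t) = 0" if t: "test_on S \<psi>" for \<psi>
  proof -
    note dt = test_on_L2[OF test_on_deriv[OF t]]
    have [measurable]: "\<psi> \<in> borel_measurable borel" by (rule test_on_L2(3)[OF t])
    have s: "smooth \<psi>" using t by (simp add: test_on_def)
    have i1: "integrable lborel (\<lambda>t. indicator S t * a t * deriv \<psi> t)"
      and i2: "integrable lborel (\<lambda>t. B t *\<^sub>R (indicator S t *\<^sub>R 1) * deriv \<psi> t)"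
      using L2_inner_integrable[OF aS dt(1)] L2_inner_integrable[OF BS dt(1)] by simp_all
    have "(LBINT t. W t * deriv \<psi> t) = (LBINT t. indicator S t * a t * deriv \<psi> t) - (LBINT t. B t *\<^sub>R (indicator S t *\<^sub>R 1) * deriv \<psi> t)"
      unfolding Bochner_Integration.integral_diff[OF i1 i2, symmetric]
      by (intro Bochner_Integration.integral_cong) (auto simp: W_def algebra_simps)
    also have "(LBINT t. indicator S t * a t * deriv \<psi> t) = - (LBINT t. bb t * \<psi> t)"
      using eq[of \<psi>] t by (simp add: S_def bb_def set_lebesgue_integral_def mult.assoc)
    also have "(LBINT t. B t *\<^sub>R (indicator S t *\<^sub>R 1) * deriv \<psi> t) =
       (LBINT t. indicator {0<..} t * B t * deriv \<psi> t)"
    proof (intro Bochner_Integration.integral_cong refl)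
      fix t
      have "deriv \<psi> t = 0" if "t \<notin> S" using test_on_outside(1)[OF test_on_deriv[OF t] that] .
      then show "B t *\<^sub>R (indicator S t *\<^sub>R 1) * deriv \<psi> t = indicator {0<..} t * B t * deriv \<psi> t"
        by (cases "t \<in> S") (auto simp: S_def)
    qed
    also have "\<dots> = - (LBINT r. bb r * \<psi> r)"
      unfolding B_def
    proof (rule integral_primitive_deriv[OF bb s, where T=T])
      show "\<psi> t = 0" "deriv \<psi> t = 0" if "t \<ge> T" for t
        using test_on_outside(1)[OF t, of t] test_on_outside(1)[OF test_on_deriv[OF t], of t] that by (auto simp: S_def)
      show "bb t = 0" if "t \<le> 0" for t using that by (simp add: bb_def S_def)
      show "integrable lborel (\<lambda>t. indicator {0<..} t * deriv \<psi> t)"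
        using integrable_mult_indicator[OF _ dt(2), of "{0<..}"] by simp
    qed
    finally show ?thesis by simp
  qed
  have Wi: "set_integrable lborel {c<..<d} W" if "{c<..<d} \<subseteq> S" for c d
  proof -
    have "integrable lborel (\<lambda>t. W t \<bullet> (indicator S t *\<^sub>R 1))" by (rule L2_inner_integrable[OF W one])
    then have "integrable lborel W"
      by (rule Bochner_Integration.integrable_cong[THEN iffD1, rotated 2]) (auto simp: W0 split: split_indicator)
    then show ?thesis by (rule integrable_mult_indicator[folded set_integrable_def, rotated]) simp
  qed
  \<comment> \<open>The integrals of the bumps tend to T > 0, so one of them can be
    normalised.\<close>
  have "(\<lambda>n. LBINT x. 1 * bump 0 T n x) \<longlonglongrightarrow> (LBINT x. 1 * indicator {0<..<T} x)"
    by (rule integral_mult_bump_tendsto) (use T in \<open>auto simp: set_integrable_def\<close>)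
  then have "(\<lambda>n. LBINT x. bump 0 T n x) \<longlonglongrightarrow> T" using T by simp
  then have "\<forall>\<^sub>F n in sequentially. (LBINT x. bump 0 T n x) > 0"
    using T by (intro order_tendstoD)
  then obtain n0 where n0: "(LBINT x. bump 0 T n0 x) > 0"
    by (auto simp: eventually_sequentially)
  define \<beta> where "\<beta> x = bump 0 T n0 x / (LBINT x. bump 0 T n0 x)" for x
  have bumpT: "test_on S (bump c d n)" if "{c<..<d} \<subseteq> S" for c d n by (rule test_on_real_bump[OF that])
  have b0S: "test_on S (bump 0 T n0)" by (rule bumpT) (simp add: S_def)
  have \<beta>s: "smooth \<beta>" unfolding \<beta>_def[abs_def] divide_inverse by (intro smooth_mult smooth_bump smooth_const)
  have \<beta>i: "integrable lborel \<beta>" "(LBINT x. \<beta> x) = 1"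
    using test_on_L2(2)[OF b0S] n0 by (auto simp: \<beta>_def[abs_def])
  define k where "k = (LBINT x. W x * \<beta> x)"
  have bumpk: "(LBINT x. W x * bump c d n x) = k * (LBINT x. bump c d n x)" if sub: "{c<..<d} \<subseteq> S" for c d n
  proof -
    define f where "f x = bump c d n x - (LBINT x. bump c d n x) * \<beta> x" for x
    note bi = test_on_L2[OF bumpT[OF sub, of n]]
    have bL: "L2 lborel \<beta>"
      using L2_scaleR[OF test_on_L2(1)[OF b0S], of "inverse (LBINT x. bump 0 T n0 x)"]
      by (simp add: \<beta>_def[abs_def] divide_inverse mult.commute)
    have fs: "smooth f" unfolding f_def[abs_def] by (intro smooth_diff smooth_mult smooth_bump smooth_const \<beta>s)
    have fi: "(LBINT x. f x) = 0"
      unfolding f_def using bi(2) \<beta>i by simp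
    \<comment> \<open>The smaller of the two margins: both bumps, and therefore the primitive of f,
      are supported in [\<delta>, T - \<delta>].\<close>
    define \<delta> where "\<delta> = min (1 / real (Suc n)) (1 / real (Suc n0))"
    have \<delta>: "\<delta> > 0" by (simp add: \<delta>_def)
    have fz: "f x = 0" if x: "x \<notin> {\<delta>..T - \<delta>}" for x
    proof -
      have "bump c d n x = 0"
      proof (cases "c < d")
        case False
        then show ?thesis by (intro bump_support') auto
      next
        case True
        have "c \<ge> 0" 
        proof (rule ccontr)
          assume "\<not> c \<ge> 0"
          \<comment> \<open>A point of (c, d) that is negative, contradicting the inclusion in (0,
            T).\<close>
          then have "min (d/2 + c/2) (c/2) \<in> {c<..<d}" using True by (auto simp: min_def field_simps)
          then have "min (d/2 + c/2) (c/2) \<in> S" using sub by blast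
          then show False using \<open>\<not> c \<ge> 0\<close> by (auto simp: S_def min_def split: if_splits)
        qed
        moreover have "d \<le> T"
        proof (rule ccontr)
          assume "\<not> d \<le> T"
          then have "max (d/2 + c/2) (d/2 + T/2) \<in> {c<..<d}" using True by (auto simp: max_def field_simps)
          then have "max (d/2 + c/2) (d/2 + T/2) \<in> S" using sub by blast
          then show False using \<open>\<not> d \<le> T\<close> by (auto simp: S_def max_def split: if_splits)
        qed
        ultimately have "x \<notin> {c + 1 / Suc n .. d - 1 / Suc n}" using x by (auto simp: \<delta>_def min_def split: if_splits)
        then show ?thesis by (rule bump_support)
      qed
      moreover have "bump 0 T n0 x = 0"
        by (rule bump_support) (use x in \<open>auto simp: \<delta>_def min_def split: if_splits\<close>)
      ultimately show ?thesis by (simp add: f_def \<beta>_def)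
    qed
    obtain \<psi> where \<psi>: "smooth \<psi>" "\<And>x. (\<psi> has_field_derivative f x) (at x)" "\<And>x. x \<notin> {\<delta>..T - \<delta>} \<Longrightarrow> \<psi> x = 0"
      using smooth_primitive[OF fs fz fi] by blast
    have sub': "{x. \<psi> x \<noteq> 0} \<subseteq> {\<delta>..T - \<delta>}" using \<psi>(3) by blast
    have cl: "closure {x. \<psi> x \<noteq> 0} \<subseteq> {\<delta>..T - \<delta>}" by (rule closure_minimal[OF sub']) simp
    have "compact (closure {x. \<psi> x \<noteq> 0})"
      using bounded_subset[OF bounded_closed_interval sub'] compact_closure by blast
    moreover have "{\<delta>..T - \<delta>} \<subseteq> S" using \<delta> by (auto simp: S_def)
    ultimately have "test_on S \<psi>" using \<psi>(1) cl unfolding test_on_def by blast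
    from Wtest[OF this] have "(LBINT t. W t * f t) = 0"
      using DERIV_imp_deriv[OF \<psi>(2)] by simp
    moreover have "(LBINT t. W t * f t) = (LBINT t. W t * bump c d n t - (LBINT x. bump c d n x) * (W t * \<beta> t))"
      by (simp add: f_def algebra_simps)
    moreover have "\<dots> = (LBINT t. W t * bump c d n t) - (LBINT x. bump c d n x) * k"
      using L2_inner_integrable[OF W bi(1)] L2_inner_integrable[OF W bL] by (simp add: k_def)
    ultimately show ?thesis by simp
  qed
  have intk: "(LBINT x. W x * indicator {c<..<d} x) = k * (LBINT x. indicator {c<..<d} x)" if sub: "{c<..<d} \<subseteq> S" for c d
  proof (rule LIMSEQ_unique)
    show "(\<lambda>n. LBINT x. W x * bump c d n x) \<longlonglongrightarrow> (LBINT x. W x * indicator {c<..<d} x)"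
      by (rule integral_mult_bump_tendsto[OF Wi[OF sub]])
    have "set_integrable lborel {c<..<d} (\<lambda>x. 1::real)"
      unfolding set_integrable_def by (cases "c \<le> d") auto
    from integral_mult_bump_tendsto[OF this]
    show "(\<lambda>n. LBINT x. W x * bump c d n x) \<longlonglongrightarrow> k * (LBINT x. indicator {c<..<d} x)"
      unfolding bumpk[OF sub] by (intro tendsto_intros) simp
  qed
  define h where "h x = W x - k * indicator S x" for x
  have hL: "L2 lborel h" unfolding h_def[abs_def]
    using L2_diff[OF W L2_scaleR[OF one, of k]] by simp
  have hS: "h x = 0" if "x \<notin> S" for x using that by (simp add: h_def W0)
  have hi: "(LBINT x. indicator {c<..<d} x * h x) = 0" if sub: "{c<..<d} \<subseteq> S" for c d
  proof -
    have ii: "integrable lborel (indicator {c<..<d} :: real \<Rightarrow> real)" by (cases "c \<le> d") auto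
    have "(LBINT x. indicator {c<..<d} x * h x) = (LBINT x. W x * indicator {c<..<d} x - k * indicator {c<..<d} x)"
      using sub by (intro Bochner_Integration.integral_cong) (auto simp: h_def split: split_indicator)
    also have "\<dots> = 0"
      using Wi[OF sub] intk[OF sub] ii by (subst Bochner_Integration.integral_diff) (auto simp: set_integrable_def mult.commute)
    finally show ?thesis .
  qed
  \<comment> \<open>A family not depending on the index: convergence to 0 says that the integral
    vanishes, so the passage from boxes to Borel sets is available here too.\<close>
  have hA: "(\<lambda>i. LBINT x. indicator A x * h x) \<longlonglongrightarrow> 0" if "A \<in> sets borel" for A
  proof (rule weak_limit_sets[where S=S and C="nsq lborel h" and G="range (\<lambda>(a, b). box a b)"])
    have "(LBINT x. h x) = (prim h T)"
      by (intro Bochner_Integration.integral_cong) (auto simp: hS S_def split: split_indicator)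
    then show "(\<lambda>i. LBINT x. h x) \<longlonglongrightarrow> 0" using hi[of 0 T] by (simp add: S_def)
    show "Int_stable (range (\<lambda>(a, b). box a b :: real set))" by (rule Int_stable_box)
    show "sets borel = sigma_sets UNIV (range (\<lambda>(a, b). box a b :: real set))" by (rule borel_eq_sigma_box)
    fix A assume "A \<in> range (\<lambda>(a, b). box a b :: real set)"
    then obtain c d where A: "A = {c<..<d}" by auto
    have "(LBINT x. indicator A x * h x) = (LBINT x. indicator {max c 0<..<min d T} x * h x)"
      by (intro Bochner_Integration.integral_cong) (auto simp: hS S_def A split: split_indicator)
    also have "\<dots> = 0" by (rule hi) (auto simp: S_def)
    finally show "(\<lambda>i. LBINT x. indicator A x * h x) \<longlonglongrightarrow> 0" by simp
  qed (use Sfin hL hS that in auto)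
  have "integrable lborel h"
  proof -
    have "integrable lborel (\<lambda>t. h t \<bullet> (indicator S t *\<^sub>R 1))" by (rule L2_inner_integrable[OF hL one])
    then show ?thesis
      by (rule Bochner_Integration.integrable_cong[THEN iffD1, rotated 2]) (auto simp: hS split: split_indicator)
  qed
  from AE_eq_0_of_set_integrals[OF this] hA have "AE x in lborel. h x = 0"
    by (simp add: LIMSEQ_const_iff)
  then have "AE t\<in>{0<..<T} in lborel. a t = k + (prim b t)"
    by eventually_elim (auto simp: h_def W_def B_eq S_def[symmetric])
  then show ?thesis by blast
qed

subsection \<open>Functions on the domain and on the cylinder\<close>

abbreviation (input) "sl u t \<equiv> (\<lambda>x. u x t)"

locale space_time =
  fixes D :: "(real^'n::finite) set" and T :: real
  assumes D_open: "open D" and D_bounded: "bounded D" and T: "T > 0"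
begin

abbreviation "ipDt a b t \<equiv> ipD D (sl a t) (sl b t)"

text \<open>Extension by zero. It turns norms and pairings over D into whole-space ones, to which
  the preceding results on \<open>L2\<close> and on translations apply.\<close>

definition ex :: "(real^'n \<Rightarrow> 'b::real_normed_vector) \<Rightarrow> real^'n \<Rightarrow> 'b" where
  "ex g x = indicator D x *\<^sub>R g x"

definition exQ :: "(real^'n \<Rightarrow> real \<Rightarrow> 'b::real_normed_vector) \<Rightarrow> (real^'n) \<times> real \<Rightarrow> 'b" where
  "exQ g p = indicator (QT D T) p *\<^sub>R g (fst p) (snd p)"

lemma D_sets[measurable]: "D \<in> sets borel" using D_open by simp

lemma D_finite: "emeasure lborel D < \<infinity>"
  by (rule emeasure_bounded_finite[OF D_bounded])

lemma fst_snd_borel[measurable]: "(fst :: ((real^'n) \<times> real) \<Rightarrow> _) \<in> borel_measurable borel"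
      "(snd :: ((real^'n) \<times> real) \<Rightarrow> _) \<in> borel_measurable borel"
  by (auto intro!: borel_measurable_continuous_onI continuous_intros)

lemma QT_sets[measurable]: "QT D T \<in> sets borel"
  using D_open by (intro borel_open open_Times) auto

lemma QT_finite: "emeasure lborel (QT D T) < \<infinity>"
  by (intro emeasure_bounded_finite bounded_Times D_bounded) auto

lemma exQ_slice: "t \<in> {0<..<T} \<Longrightarrow> exQ g (x, t) = ex (sl g t) x"
  "t \<notin> {0<..<T} \<Longrightarrow> exQ g (x, t) = 0"
  by (auto simp: exQ_def ex_def split: split_indicator)

lemma ex_add: "ex (\<lambda>x. f x + g x) x = ex f x + ex g x"
  by (simp add: ex_def scaleR_add_right)

lemma ex_diff: "ex (\<lambda>x. f x - g x) x = ex f x - ex g x"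
  by (simp add: ex_def scaleR_diff_right)

lemma ex_scaleR: "ex (\<lambda>x. c *\<^sub>R f x) x = c *\<^sub>R ex f x"
  by (simp add: ex_def)

lemma ex_linear: "linear h \<Longrightarrow> ex (\<lambda>x. h (f x)) x = h (ex f x)"
  by (simp add: ex_def linear_cmul)

lemma exQ_linear: "linear h \<Longrightarrow> exQ (\<lambda>x t. h (f x t)) p = h (exQ f p)"
  by (simp add: exQ_def linear_cmul)

lemma exQ_diff: "exQ (\<lambda>x t. f x t - g x t) p = exQ f p - exQ g p"
  by (simp add: exQ_def scaleR_diff_right)

lemma L2D_iff:
  fixes g :: "real^'n \<Rightarrow> 'b::euclidean_space"
  shows "L2D D g \<longleftrightarrow> g \<in> borel_measurable borel \<and> L2 lborel (ex g)"
proof -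
  have eq: "(norm (ex g x))\<^sup>2 = indicator D x *\<^sub>R (norm (g x))\<^sup>2" for x
    by (auto simp: ex_def split: split_indicator)
  have "L2 lborel (ex g) \<longleftrightarrow> set_integrable lborel D (\<lambda>x. (norm (g x))\<^sup>2)" if [measurable]: "g \<in> borel_measurable borel"
  proof -
    have "ex g \<in> borel_measurable lborel" unfolding ex_def[abs_def] by measurable
    then show ?thesis by (simp add: L2_def eq set_integrable_def)
  qed
  then show ?thesis by (auto simp: L2D_def)
qed

lemma L2Q_iff:
  fixes g :: "real^'n \<Rightarrow> real \<Rightarrow> 'b::euclidean_space"
  shows "L2Q D T g \<longleftrightarrow> (\<lambda>p. g (fst p) (snd p)) \<in> borel_measurable borel \<and> L2 lborel (exQ g)"
proof -
  have eq: "(norm (exQ g p))\<^sup>2 = indicator (QT D T) p *\<^sub>R (norm (g (fst p) (snd p)))\<^sup>2" for p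
    by (auto simp: exQ_def split: split_indicator)
  have "L2 lborel (exQ g) \<longleftrightarrow> integrable lborel (\<lambda>p. indicator (QT D T) p *\<^sub>R (norm (g (fst p) (snd p)))\<^sup>2)"
    if [measurable]: "(\<lambda>p. g (fst p) (snd p)) \<in> borel_measurable borel"
  proof -
    have "exQ g \<in> borel_measurable lborel" unfolding exQ_def[abs_def] by measurable
    then show ?thesis by (simp add: L2_def eq)
  qed
  moreover have "(\<lambda>(x, t). g x t) = (\<lambda>p. g (fst p) (snd p))" "(\<lambda>(x, t). (norm (g x t))\<^sup>2) = (\<lambda>p. (norm (g (fst p) (snd p)))\<^sup>2)"
    by auto
  ultimately show ?thesis
    by (auto simp: L2Q_def set_integrable_def lborel_prod)
qed

lemma ipD_eq:
  fixes u v :: "real^'n \<Rightarrow> 'b::euclidean_space"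
  shows "ipD D u v = (LBINT x. ex u x \<bullet> ex v x)"
  unfolding ipD_def set_lebesgue_integral_def
  by (intro Bochner_Integration.integral_cong) (auto simp: ex_def split: split_indicator)

lemma ipD_commute: "ipD D u v = ipD D v u"
  for u v :: "real^'n \<Rightarrow> 'b::euclidean_space"
  by (simp add: ipD_def inner_commute)

lemma distD_eq:
  fixes u v :: "real^'n \<Rightarrow> 'b::euclidean_space"
  shows "distD D u v = nsq lborel (\<lambda>x. ex u x - ex v x)"
  unfolding distD_def set_lebesgue_integral_def nsq_def
  by (intro Bochner_Integration.integral_cong) (auto simp: ex_def split: split_indicator)

lemma L2D_ex: "L2D D g \<Longrightarrow> L2 lborel (ex g)" for g :: "real^'n \<Rightarrow> 'b::euclidean_space"
  by (simp add: L2D_iff)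

lemma L2D_diff: "L2D D f \<Longrightarrow> L2D D g \<Longrightarrow> L2D D (\<lambda>x. f x - g x)" for g :: "real^'n \<Rightarrow> 'b::euclidean_space"
  using L2_diff[of lborel "ex f" "ex g"] by (auto simp: L2D_iff ex_diff[abs_def])

lemma L2D_add: "L2D D f \<Longrightarrow> L2D D g \<Longrightarrow> L2D D (\<lambda>x. f x + g x)" for g :: "real^'n \<Rightarrow> 'b::euclidean_space"
  using L2_add[of lborel "ex f" "ex g"] by (auto simp: L2D_iff ex_add[abs_def])

lemma L2D_bounded_linear:
  fixes f :: "real^'n \<Rightarrow> 'b::euclidean_space" and h :: "'b \<Rightarrow> 'c::euclidean_space"
  assumes "bounded_linear h" "L2D D f" shows "L2D D (\<lambda>x. h (f x))"
proof -
  have "h \<in> borel_measurable borel"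
    using assms(1) by (intro borel_measurable_continuous_onI linear_continuous_on)
  then show ?thesis
    using L2_bounded_linear[OF assms(1), of lborel "ex f"] assms
    by (auto simp: L2D_iff ex_linear[OF bounded_linear.linear[OF assms(1)], abs_def])
qed

lemma L2Q_bounded_linear:
  fixes f :: "real^'n \<Rightarrow> real \<Rightarrow> 'b::euclidean_space" and h :: "'b \<Rightarrow> 'c::euclidean_space"
  assumes "bounded_linear h" "L2Q D T f" shows "L2Q D T (\<lambda>x t. h (f x t))"
proof -
  have "h \<in> borel_measurable borel"
    using assms(1) by (intro borel_measurable_continuous_onI linear_continuous_on)
  then show ?thesis
    using L2_bounded_linear[OF assms(1), of lborel "exQ f"] assms
    by (auto simp: L2Q_iff exQ_linear[OF bounded_linear.linear[OF assms(1)], abs_def])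
qed

lemma L2Q_diff: "L2Q D T f \<Longrightarrow> L2Q D T g \<Longrightarrow> L2Q D T (\<lambda>x t. f x t - g x t)"
  for g :: "real^'n \<Rightarrow> real \<Rightarrow> 'b::euclidean_space"
  using L2_diff[of lborel "exQ f" "exQ g"] by (auto simp: L2Q_iff exQ_diff[abs_def])

lemma L2Q_add: "L2Q D T f \<Longrightarrow> L2Q D T g \<Longrightarrow> L2Q D T (\<lambda>x t. f x t + g x t)"
  for g :: "real^'n \<Rightarrow> real \<Rightarrow> 'b::euclidean_space"
  using L2Q_diff[of f "\<lambda>x t. - g x t"] L2Q_bounded_linear[OF bounded_linear_minus[OF bounded_linear_ident], of g] by simp

lemma L2D_const: "L2D D (\<lambda>x. c)" for c :: "'b::euclidean_space"
  unfolding L2D_iff ex_def[abs_def] using D_finite by (auto intro!: L2_const_indicator)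

lemma L2Q_slice:
  fixes g :: "real^'n \<Rightarrow> real \<Rightarrow> 'b::euclidean_space"
  assumes "L2Q D T g"
  shows "AE t\<in>{0<..<T} in lborel. L2D D (sl g t)"
proof -
  have [measurable]: "(\<lambda>p. g (fst p) (snd p)) \<in> borel_measurable borel" using assms by (simp add: L2Q_iff)
  have m: "(sl g t) \<in> borel_measurable borel" for t
    using measurable_compose[of "\<lambda>x. (x, t)" borel borel "\<lambda>p. g (fst p) (snd p)" borel] by simp
  have "L2 lborel (exQ g)" using assms by (simp add: L2Q_iff)
  from nsq_slice_integrable(1)[OF this] show ?thesis
  proof eventually_elim
    case (elim t)
    show ?case
    proof
      assume t: "t \<in> {0<..<T}"
      then have "(\<lambda>x. exQ g (x, t)) = ex (sl g t)" by (auto simp: exQ_slice)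
      then show "L2D D (sl g t)" using elim m by (simp add: L2D_iff)
    qed
  qed
qed

lemma ipD_slice:
  fixes f g :: "real^'n \<Rightarrow> real \<Rightarrow> 'b::euclidean_space"
  shows "(LBINT x. exQ f (x, t) \<bullet> exQ g (x, t)) = indicator {0<..<T} t * ipDt f g t"
  by (cases "t \<in> {0<..<T}") (simp_all add: exQ_slice ipD_eq)

lemma L2Q_tensor:
  fixes v :: "real^'n \<Rightarrow> 'b::euclidean_space" and \<psi> :: "real \<Rightarrow> real"
  assumes v: "L2D D v" and m[measurable]: "\<psi> \<in> borel_measurable borel" and B: "\<And>t. \<bar>\<psi> t\<bar> \<le> B"
  shows "L2Q D T (\<lambda>x t. \<psi> t *\<^sub>R v x)"
proof -
  have [measurable]: "v \<in> borel_measurable borel" using v by (simp add: L2D_iff)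
  have "L2 lborel (\<lambda>p. indicator {0<..<T} (snd p) *\<^sub>R ex v (fst p))"
    by (rule L2_tensor[OF L2D_ex[OF v]]) (use T in auto)
  from L2_mult_bounded[OF this, of "\<lambda>p. \<psi> (snd p)" B]
  have "L2 lborel (\<lambda>p. \<psi> (snd p) *\<^sub>R indicator {0<..<T} (snd p) *\<^sub>R ex v (fst p))" using B by simp
  moreover have "\<psi> (snd p) *\<^sub>R indicator {0<..<T} (snd p) *\<^sub>R ex v (fst p) = exQ (\<lambda>x t. \<psi> t *\<^sub>R v x) p" for p
    by (cases p) (auto simp: exQ_def ex_def split: split_indicator)
  ultimately show ?thesis by (simp add: L2Q_iff)
qed

lemma intQ_eq: "intQ D T g = (LBINT p. indicator (QT D T) p * g (fst p) (snd p))"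
  by (simp add: intQ_def set_lebesgue_integral_def lborel_prod case_prod_beta)

lemma pairing_eq:
  fixes a b :: "real^'n \<Rightarrow> real \<Rightarrow> 'b::euclidean_space"
  assumes a: "L2Q D T a" and b: "L2Q D T b"
  shows "(LINT t:{0<..<T}|lborel. ipDt a b t) = (LBINT p. exQ a p \<bullet> exQ b p)"
    and "integrable lborel (\<lambda>t. indicator {0<..<T} t * ipDt a b t)"
    and "intQ D T (\<lambda>x t. a x t \<bullet> b x t) = (LBINT p. exQ a p \<bullet> exQ b p)"
    and "integrable lborel (\<lambda>p. indicator (QT D T) p * (a (fst p) (snd p) \<bullet> b (fst p) (snd p)))"
proof -
  have L: "L2 lborel (exQ a)" "L2 lborel (exQ b)" using a b by (auto simp: L2Q_iff)
  note s = slice_inner_integrable[OF L, unfolded ipD_slice]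
  show "(LINT t:{0<..<T}|lborel. ipDt a b t) = (LBINT p. exQ a p \<bullet> exQ b p)"
    using s(2) by (simp add: set_lebesgue_integral_def)
  show "integrable lborel (\<lambda>t. indicator {0<..<T} t * ipDt a b t)" by (rule s(1))
  have eq: "indicator (QT D T) p * (a (fst p) (snd p) \<bullet> b (fst p) (snd p)) = exQ a p \<bullet> exQ b p" for p
    by (auto simp: exQ_def split: split_indicator)
  show "intQ D T (\<lambda>x t. a x t \<bullet> b x t) = (LBINT p. exQ a p \<bullet> exQ b p)"
    unfolding intQ_eq eq ..
  show "integrable lborel (\<lambda>p. indicator (QT D T) p * (a (fst p) (snd p) \<bullet> b (fst p) (snd p)))"
    unfolding eq by (rule L2_inner_integrable[OF L])
qed

lemma ipD_scaleR_right: "ipD D u (\<lambda>x. c *\<^sub>R v x) = c * ipD D u v"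
  for u v :: "real^'n \<Rightarrow> 'b::euclidean_space"
  unfolding ipD_eq ex_scaleR by simp

lemma ipD_scaleR_left: "ipD D (\<lambda>x. c *\<^sub>R u x) v = c * ipD D u v"
  for u v :: "real^'n \<Rightarrow> 'b::euclidean_space"
  unfolding ipD_eq ex_scaleR by simp

lemma ipD_integrable: "L2D D u \<Longrightarrow> L2D D v \<Longrightarrow> integrable lborel (\<lambda>x. ex u x \<bullet> ex v x)"
  for u v :: "real^'n \<Rightarrow> 'b::euclidean_space"
  by (intro L2_inner_integrable L2D_ex)

lemma ipD_diff_left:
  fixes u v :: "real^'n \<Rightarrow> 'b::euclidean_space"
  assumes "L2D D u" "L2D D u'" "L2D D v" shows "ipD D (\<lambda>x. u x - u' x) v = ipD D u v - ipD D u' v"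
  unfolding ipD_eq ex_diff using ipD_integrable[OF assms(1,3)] ipD_integrable[OF assms(2,3)] by (simp add: inner_diff_left)

lemma ipD_add_left:
  fixes u v :: "real^'n \<Rightarrow> 'b::euclidean_space"
  assumes "L2D D u" "L2D D u'" "L2D D v" shows "ipD D (\<lambda>x. u x + u' x) v = ipD D u v + ipD D u' v"
  unfolding ipD_eq ex_add using ipD_integrable[OF assms(1,3)] ipD_integrable[OF assms(2,3)] by (simp add: inner_add_left)

lemma ipD_diff_right:
  fixes u v :: "real^'n \<Rightarrow> 'b::euclidean_space"
  assumes "L2D D u" "L2D D v" "L2D D v'" shows "ipD D u (\<lambda>x. v x - v' x) = ipD D u v - ipD D u v'"
  using ipD_diff_left[OF assms(2,3,1)] by (simp add: ipD_commute)

lemma ipD_self: "ipD D u u = nsq lborel (ex u)" for u :: "real^'n \<Rightarrow> 'b::euclidean_space"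
  by (simp add: ipD_eq nsq_inner)

lemma ipD_self_nonneg: "0 \<le> ipD D u u" for u :: "real^'n \<Rightarrow> 'b::euclidean_space"
  by (simp add: ipD_self nsq_nonneg)

lemma ipD_Cauchy_Schwarz:
  fixes u v :: "real^'n \<Rightarrow> 'b::euclidean_space"
  assumes "L2D D u" "L2D D v" shows "\<bar>ipD D u v\<bar> \<le> sqrt (ipD D u u) * sqrt (ipD D v v)"
  using L2_Cauchy_Schwarz[OF L2D_ex[OF assms(1)] L2D_ex[OF assms(2)]] by (simp add: ipD_eq nsq_inner)

lemma test_on_L2D:
  fixes \<phi> :: "real^'n \<Rightarrow> 'b::euclidean_space"
  assumes "test_on D \<phi>" shows "L2D D \<phi>" "ex \<phi> = \<phi>"
proof -
  show e: "ex \<phi> = \<phi>"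
  proof
    fix x show "ex \<phi> x = \<phi> x" using test_on_outside(1)[OF assms, of x] by (cases "x \<in> D") (auto simp: ex_def)
  qed
  show "L2D D \<phi>" using test_on_L2[OF assms] by (simp add: L2D_iff e)
qed

lemma test_on_pdx:
  fixes \<phi> :: "real^'n \<Rightarrow> 'b::euclidean_space"
  shows "test_on D \<phi> \<Longrightarrow> test_on D (pdx i \<phi>)"
  unfolding pdx_def by (rule test_on_dd) (auto simp: axis_in_Basis_iff)

lemma gradv_test:
  fixes \<phi> :: "real^'n \<Rightarrow> real^'n"
  assumes "test_on D \<phi>"
  shows "L2D D (gradv \<phi>)" "x \<notin> D \<Longrightarrow> gradv \<phi> x = 0"
proof -
  have eq: "gradv \<phi> x = (\<Sum>i\<in>UNIV. (\<chi> k j. if j = i then pdx i \<phi> x $ k else 0))" for x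
    by (simp add: gradv_def vec_eq_iff)
  have lin: "bounded_linear (\<lambda>v::real^'n. (\<chi> k j. if j = i then v $ k else 0) :: real^'n^'n)" for i
    by (intro linear_conv_bounded_linear[THEN iffD1] linearI) (auto simp: vec_eq_iff)
  have 1: "L2D D (\<lambda>x. \<Sum>i\<in>I. (\<chi> k j. if j = i then pdx i \<phi> x $ k else 0) :: real^'n^'n)" if "finite I" for I :: "'n set"
    using that
  proof (induction I rule: finite_induct)
    case empty
    then show ?case using L2D_const[of 0] by simp
  next
    case (insert i I)
    have "L2D D (\<lambda>x. (\<chi> k j. if j = i then pdx i \<phi> x $ k else 0) :: real^'n^'n)"
      by (rule L2D_bounded_linear[OF lin test_on_L2D(1)[OF test_on_pdx[OF assms]]])
    then show ?case using insert by (simp add: L2D_add)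
  qed
  show "L2D D (gradv \<phi>)" unfolding ext[of "gradv \<phi>", OF eq] by (rule 1) simp
  show "gradv \<phi> x = 0" if "x \<notin> D"
    using test_on_outside(1)[OF test_on_pdx[OF assms] that] by (simp add: gradv_def vec_eq_iff)
qed

lemma H01_L2D: "H01 D v G \<Longrightarrow> L2D D v" "H01 D v G \<Longrightarrow> L2D D G"
  by (auto simp: H01_def)

lemma Vsp_H01: "Vsp D v G \<Longrightarrow> H01 D v G"
  by (auto simp: H01_def Vsp_def)

lemma nsq_zero: "nsq M (\<lambda>x. 0) = 0" by (simp add: nsq_def)

lemma test_on_H01:
  assumes "test_on D \<phi>" shows "H01 D \<phi> (gradv \<phi>)"
proof -
  have "distD D \<phi> \<phi> = 0" "distD D (gradv \<phi>) (gradv \<phi>) = 0" by (simp_all add: distD_eq nsq_zero)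
  then show ?thesis unfolding H01_def using assms gradv_test test_on_L2D(1) by (auto intro!: exI[of _ "\<lambda>_. \<phi>"])
qed

lemma test_on_Vsp:
  assumes "test_on D \<phi>" "\<And>x. divv \<phi> x = 0" shows "Vsp D \<phi> (gradv \<phi>)"
proof -
  have "distD D \<phi> \<phi> = 0" "distD D (gradv \<phi>) (gradv \<phi>) = 0" by (simp_all add: distD_eq nsq_zero)
  then show ?thesis unfolding Vsp_def using assms gradv_test test_on_L2D(1) by (auto intro!: exI[of _ "\<lambda>_. \<phi>"])
qed

lemma test_on_diff:
  assumes "test_on D \<phi>" "test_on D \<psi>" shows "test_on D (\<lambda>x. \<phi> x - \<psi> x)"
proof -
  let ?C = "closure {x. \<phi> x \<noteq> 0} \<union> closure {x. \<psi> x \<noteq> 0}"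
  have C: "compact ?C" "?C \<subseteq> D" using assms by (auto simp: test_on_def)
  have "{x. \<phi> x - \<psi> x \<noteq> 0} \<subseteq> ?C"
  proof
    fix x assume "x \<in> {x. \<phi> x - \<psi> x \<noteq> 0}"
    then have "\<phi> x \<noteq> 0 \<or> \<psi> x \<noteq> 0" by auto
    then show "x \<in> ?C"
      using closure_subset[of "{x. \<phi> x \<noteq> 0}"] closure_subset[of "{x. \<psi> x \<noteq> 0}"] by blast
  qed
  then have cl: "closure {x. \<phi> x - \<psi> x \<noteq> 0} \<subseteq> ?C" using compact_imp_closed[OF C(1)] by (rule closure_minimal)
  have "?C \<inter> closure {x. \<phi> x - \<psi> x \<noteq> 0} = closure {x. \<phi> x - \<psi> x \<noteq> 0}" using cl by (rule Int_absorb1)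
  then have "compact (closure {x. \<phi> x - \<psi> x \<noteq> 0})"
    using compact_Int_closed[OF C(1), of "closure {x. \<phi> x - \<psi> x \<noteq> 0}"] by simp
  then show ?thesis using assms cl C(2) smooth_diff unfolding test_on_def by blast
qed

lemma pdx_diff:
  assumes "smooth \<phi>" "smooth \<psi>" shows "pdx i (\<lambda>x. \<phi> x - \<psi> x) x = pdx i \<phi> x - pdx i \<psi> x"
  unfolding pdx_def
  by (rule dd_eqI[OF has_derivative_diff[OF smooth_has_derivative[OF assms(1)] smooth_has_derivative[OF assms(2)]]])

text \<open>The approximating sequences are subtracted. The gradient is a separate argument
  determined by the approximation, so no uniqueness of weak gradients is involved.\<close>

lemma H01_diff:
  assumes "H01 D u G" "H01 D v H" shows "H01 D (\<lambda>x. u x - v x) (\<lambda>x. G x - H x)"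
proof -
  obtain \<phi> \<psi> where \<phi>: "\<And>k::nat. test_on D (\<phi> k)" "(\<lambda>k. distD D (\<phi> k) u) \<longlonglongrightarrow> 0" "(\<lambda>k. distD D (gradv (\<phi> k)) G) \<longlonglongrightarrow> 0"
    and \<psi>: "\<And>k::nat. test_on D (\<psi> k)" "(\<lambda>k. distD D (\<psi> k) v) \<longlonglongrightarrow> 0" "(\<lambda>k. distD D (gradv (\<psi> k)) H) \<longlonglongrightarrow> 0"
    using assms by (auto simp: H01_def)
  note L = H01_L2D[OF assms(1)] H01_L2D[OF assms(2)]
  have dist: "(\<lambda>k. distD D (\<lambda>x. f k x - g k x) (\<lambda>x. a x - b x)) \<longlonglongrightarrow> 0"
    if "\<And>k. L2D D (f k)" "\<And>k. L2D D (g k)" "L2D D a" "L2D D b"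
      "(\<lambda>k. distD D (f k) a) \<longlonglongrightarrow> 0" "(\<lambda>k. distD D (g k) b) \<longlonglongrightarrow> 0"
    for f g :: "nat \<Rightarrow> real^'n \<Rightarrow> 'b::euclidean_space" and a b
  proof (rule Lim_null_comparison)
    show "\<forall>\<^sub>F k in sequentially. norm (distD D (\<lambda>x. f k x - g k x) (\<lambda>x. a x - b x)) \<le> 2 * distD D (f k) a + 2 * distD D (g k) b"
    proof (intro always_eventually allI)
      fix k
      have "nsq lborel (\<lambda>x. (ex (f k) x - ex a x) + (ex b x - ex (g k) x)) \<le>
         2 * nsq lborel (\<lambda>x. ex (f k) x - ex a x) + 2 * nsq lborel (\<lambda>x. ex b x - ex (g k) x)"
        by (intro nsq_add_le L2_diff L2D_ex that)
      then show "norm (distD D (\<lambda>x. f k x - g k x) (\<lambda>x. a x - b x)) \<le> 2 * distD D (f k) a + 2 * distD D (g k) b"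
        by (simp add: distD_eq nsq_nonneg ex_diff nsq_commute[of _ "ex b"] algebra_simps)
    qed
    show "(\<lambda>k. 2 * distD D (f k) a + 2 * distD D (g k) b) \<longlonglongrightarrow> 0"
      using tendsto_add[OF tendsto_mult_right_zero[OF that(5), of 2] tendsto_mult_right_zero[OF that(6), of 2]] by simp
  qed
  have g: "gradv (\<lambda>x. \<phi> k x - \<psi> k x) = (\<lambda>x. gradv (\<phi> k) x - gradv (\<psi> k) x)" for k
    using \<phi>(1)[of k] \<psi>(1)[of k] by (auto simp: gradv_def vec_eq_iff pdx_diff test_on_def)
  show ?thesis
    unfolding H01_def
    using L2D_diff[OF L(1,3)] L2D_diff[OF L(2,4)] test_on_diff[OF \<phi>(1) \<psi>(1)]
      dist[OF test_on_L2D(1)[OF \<phi>(1)] test_on_L2D(1)[OF \<psi>(1)] L(1,3) \<phi>(2) \<psi>(2)]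
      dist[OF gradv_test(1)[OF \<phi>(1)] gradv_test(1)[OF \<psi>(1)] L(2,4) \<phi>(3) \<psi>(3)]
    by (auto intro!: exI[of _ "\<lambda>k x. \<phi> k x - \<psi> k x"] simp: g)
qed

lemma ipD_tendsto:
  fixes f :: "nat \<Rightarrow> real^'n \<Rightarrow> 'b::euclidean_space"
  assumes "\<And>k. L2D D (f k)" "L2D D a" "(\<lambda>k. distD D (f k) a) \<longlonglongrightarrow> 0" "L2D D r"
  shows "(\<lambda>k. ipD D (f k) r) \<longlonglongrightarrow> ipD D a r"
  unfolding ipD_eq
  by (rule L2_inner_tendsto[OF L2D_ex L2D_ex L2D_ex]) (use assms in \<open>auto simp: distD_eq\<close>)

section \<open>The divergence as a trace, and integration by parts\<close>

lemma trG_linear: "bounded_linear (trG :: real^'n^'n \<Rightarrow> real)"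
  unfolding trG_def[abs_def]
  by (intro bounded_linear_sum bounded_linear_compose[OF bounded_linear_vec_nth bounded_linear_vec_nth])

lemma trG_gradv: "trG (gradv \<phi> x) = divv \<phi> x"
  by (simp add: trG_def gradv_def divv_def)

lemma trG_mat: "trG G = mat 1 \<bullet> G" for G :: "real^'n^'n"
  by (simp add: trG_def inner_vec_def mat_def if_distrib[of "\<lambda>x. x * _"] cong: if_cong)

text \<open>The pairing of a pressure with a divergence becomes the pairing of the matrix r I with
  the full gradient, so that pressure and viscous stress can be merged into one flux.\<close>

lemma ipD_trG: "ipD D r (\<lambda>x. trG (G x)) = ipD D (\<lambda>x. r x *\<^sub>R mat 1) G"
  for G :: "real^'n \<Rightarrow> real^'n^'n"
  by (simp add: ipD_def trG_mat)

text \<open>The integral of every difference quotient is zero by translation invariance, and the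
  quotients converge dominatedly to the derivative.\<close>

lemma integral_pdx_test:
  fixes \<phi> :: "real^'n \<Rightarrow> real"
  assumes t: "test_on U \<phi>" and b: "b \<in> Basis"
  shows "(LBINT x. dd b \<phi> x) = 0"
proof -
  note i = test_on_L2(2)[OF t]
  have [measurable]: "\<phi> \<in> borel_measurable borel" by (rule test_on_L2(3)[OF t])
  have s: "smooth \<phi>" using t by (simp add: test_on_def)
  obtain B where B: "\<And>x. norm (dd b \<phi> x) \<le> B" using test_on_bounded[OF test_on_dd[OF t b]] by blast
  let ?C = "closure {z. \<phi> z \<noteq> 0}"
  have bC: "bounded ?C" using t compact_imp_bounded by (auto simp: test_on_def)
  then obtain R where R: "\<And>x. x \<in> ?C \<Longrightarrow> norm x \<le> R" by (auto simp: bounded_iff)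
  define e where "e k = 1 / real (Suc k)" for k
  have e: "e k > 0" "e k \<le> 1" for k by (auto simp: e_def)
  have e0: "e \<longlonglongrightarrow> 0" using LIMSEQ_inverse_real_of_nat by (simp add: e_def[abs_def] inverse_eq_divide)
  have line: "((\<lambda>t. \<phi> (x + t *\<^sub>R b)) has_real_derivative dd b \<phi> (x + t *\<^sub>R b)) (at t)" for x t
  proof -
    have "((\<lambda>t. x + t *\<^sub>R b) has_derivative (\<lambda>h. h *\<^sub>R b)) (at t)" by (auto intro!: derivative_eq_intros)
    then have "((\<lambda>t. \<phi> (x + t *\<^sub>R b)) has_derivative (\<lambda>h. dd (h *\<^sub>R b) \<phi> (x + t *\<^sub>R b))) (at t)"
      using diff_chain_at[of "\<lambda>t. x + t *\<^sub>R b" "\<lambda>h. h *\<^sub>R b" t \<phi> "\<lambda>e. dd e \<phi> (x + t *\<^sub>R b)"]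
        smooth_has_derivative[OF s, of "x + t *\<^sub>R b"] by (simp add: o_def)
    moreover have "dd (h *\<^sub>R b) \<phi> y = dd b \<phi> y * h" for h y
      using linear_cmul[OF has_derivative_linear[OF smooth_has_derivative[OF s, of y]], of h b] by simp
    ultimately show ?thesis by (simp add: has_field_derivative_def mult.commute[of _ "dd b \<phi> _"])
  qed
  have "(\<lambda>k. LBINT x. (\<phi> (x + e k *\<^sub>R b) - \<phi> x) / e k) \<longlonglongrightarrow> (LBINT x. dd b \<phi> x)"
  proof (rule integral_dominated_convergence[where w="\<lambda>x. B * indicator (cball 0 (R + 1)) x"])
    show "dd b \<phi> \<in> borel_measurable lborel" using test_on_L2(3)[OF test_on_dd[OF t b]] by simp
    show "(\<lambda>x. (\<phi> (x + e k *\<^sub>R b) - \<phi> x) / e k) \<in> borel_measurable lborel" for k by measurable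
    show "integrable lborel (\<lambda>x::real^'n. B * indicator (cball 0 (R + 1)) x)"
      by (intro integrable_mult_right integrable_real_indicator emeasure_bounded_finite) auto
    show "AE x in lborel. (\<lambda>k. (\<phi> (x + e k *\<^sub>R b) - \<phi> x) / e k) \<longlonglongrightarrow> dd b \<phi> x"
    proof (intro AE_I2)
      fix x
      have "((\<lambda>h. (\<phi> (x + (0 + h) *\<^sub>R b) - \<phi> (x + 0 *\<^sub>R b)) / h) \<longlongrightarrow> dd b \<phi> (x + 0 *\<^sub>R b)) (at 0)"
        using line[of x 0] by (simp add: DERIV_def)
      then have *: "((\<lambda>h. (\<phi> (x + h *\<^sub>R b) - \<phi> x) / h) \<longlongrightarrow> dd b \<phi> x) (at 0)" by simp
      have "filterlim e (at 0) sequentially"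
        unfolding filterlim_at using e0 e(1) by (auto intro!: always_eventually simp: less_imp_neq[symmetric] neq_iff)
      from filterlim_compose[OF * this] show "(\<lambda>k. (\<phi> (x + e k *\<^sub>R b) - \<phi> x) / e k) \<longlonglongrightarrow> dd b \<phi> x" .
    qed
    show "AE x in lborel. norm ((\<phi> (x + e k *\<^sub>R b) - \<phi> x) / e k) \<le> B * indicator (cball 0 (R + 1)) x" for k
    proof (intro AE_I2)
      fix x
      show "norm ((\<phi> (x + e k *\<^sub>R b) - \<phi> x) / e k) \<le> B * indicator (cball 0 (R + 1)) x"
      \<comment> \<open>Shifts have length at most 1, so outside this ball both values vanish;
        inside, the mean value theorem bounds the quotient by the supremum of the
        derivative.\<close>
      proof (cases "x \<in> cball 0 (R + 1)")
        case True
        obtain z where z: "\<phi> (x + e k *\<^sub>R b) - \<phi> (x + 0 *\<^sub>R b) = (e k - 0) * dd b \<phi> (x + z *\<^sub>R b)"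
          using MVT2[OF e(1)[of k] line[of x]] by blast
        then have "(\<phi> (x + e k *\<^sub>R b) - \<phi> x) / e k = dd b \<phi> (x + z *\<^sub>R b)" using e(1)[of k] by simp
        then show ?thesis using B True by simp
      next
        case False
        have out: "\<phi> y = 0" if "norm y > R" for y
        proof -
          have "y \<notin> ?C" using R[of y] that by auto
          then show ?thesis using closure_subset[of "{z. \<phi> z \<noteq> 0}"] by auto
        qed
        have nx: "norm x > R + 1" using False by simp
        have "norm (e k *\<^sub>R b) \<le> 1" using e[of k] b by simp
        then have "norm (x + e k *\<^sub>R b) > R" using nx norm_diff_ineq[of x "e k *\<^sub>R b"] by linarith
        then show ?thesis using out[of x] out[of "x + e k *\<^sub>R b"] nx by simp
      qed
    qed
  qed
  moreover have "(LBINT x. (\<phi> (x + e k *\<^sub>R b) - \<phi> x) / e k) = 0" for k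
    using i integrable_lborel_shift[OF i, of "e k *\<^sub>R b"] integral_lborel_shift[of \<phi> "e k *\<^sub>R b"] by simp
  ultimately have "(\<lambda>k. 0) \<longlonglongrightarrow> (LBINT x. dd b \<phi> x)" by (simp only:)
  then show ?thesis by (simp add: LIMSEQ_const_iff)
qed

end

lemma test_on_supportI:
  fixes \<phi> :: "'a::euclidean_space \<Rightarrow> 'b::real_normed_vector" and \<psi> :: "'a \<Rightarrow> 'c::real_normed_vector"
  assumes "compact C" "C \<subseteq> U" "smooth \<psi>" "\<And>x. x \<notin> C \<Longrightarrow> \<psi> x = 0"
  shows "test_on U \<psi>"
proof -
  have "{x. \<psi> x \<noteq> 0} \<subseteq> C" using assms(4) by blast
  then have cl: "closure {x. \<psi> x \<noteq> 0} \<subseteq> C" using compact_imp_closed[OF assms(1)] by (rule closure_minimal)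
  have "C \<inter> closure {x. \<psi> x \<noteq> 0} = closure {x. \<psi> x \<noteq> 0}" using cl by (rule Int_absorb1)
  then have "compact (closure {x. \<psi> x \<noteq> 0})"
    using compact_Int_closed[OF assms(1) closed_closure, of "{x. \<psi> x \<noteq> 0}"] by simp
  then show ?thesis using assms cl unfolding test_on_def by blast
qed

lemma test_on_multiple:
  fixes \<phi> :: "'a::euclidean_space \<Rightarrow> 'b::real_normed_vector" and \<psi> :: "'a \<Rightarrow> 'c::real_normed_vector"
  assumes "test_on U \<phi>" "smooth \<psi>" "\<And>x. \<phi> x = 0 \<Longrightarrow> \<psi> x = 0"
  shows "test_on U \<psi>"
proof (rule test_on_supportI)
  show "compact (closure {x. \<phi> x \<noteq> 0})" "closure {x. \<phi> x \<noteq> 0} \<subseteq> U" using assms(1) by (auto simp: test_on_def)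
  show "\<psi> x = 0" if "x \<notin> closure {x. \<phi> x \<noteq> 0}" for x
    using that closure_subset[of "{x. \<phi> x \<noteq> 0}"] by (intro assms(3)) auto
qed (rule assms(2))

lemma smooth_sum:
  fixes f :: "'i \<Rightarrow> 'a::euclidean_space \<Rightarrow> 'b::real_normed_vector"
  shows "finite I \<Longrightarrow> (\<And>i. i \<in> I \<Longrightarrow> smooth (f i)) \<Longrightarrow> smooth (\<lambda>x. \<Sum>i\<in>I. f i x)"
  by (induction I rule: finite_induct) (auto intro: smooth_const smooth_add)

lemma smooth_inner:
  fixes f g :: "'a::euclidean_space \<Rightarrow> 'b::euclidean_space"
  assumes "smooth f" "smooth g" shows "smooth (\<lambda>x. f x \<bullet> g x)"
proof -
  have "smooth (\<lambda>x. \<Sum>b\<in>Basis. (f x \<bullet> b) * (g x \<bullet> b))"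
    using assms by (intro smooth_sum smooth_mult smooth_bounded_linear[OF bounded_linear_inner_left]) auto
  then show ?thesis by (simp add: euclidean_inner[symmetric])
qed

lemma dd_bounded_linear:
  assumes "bounded_linear L" "smooth f" shows "dd b (\<lambda>x. L (f x)) x = L (dd b f x)"
  by (rule dd_eqI[OF bounded_linear.has_derivative[OF assms(1) smooth_has_derivative[OF assms(2)]]])

lemma axis_Basis: "axis i (1::real) \<in> Basis"
  by (auto simp: axis_in_Basis_iff)

context space_time
begin

lemma integral_divv_test:
  fixes \<phi> :: "real^'n \<Rightarrow> real^'n"
  assumes t: "test_on D \<phi>" shows "(LBINT x. divv \<phi> x) = 0"
proof -
  have s: "smooth \<phi>" using t by (simp add: test_on_def)
  have ti: "test_on D (\<lambda>x. \<phi> x $ i)" for i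
    by (rule test_on_multiple[OF t smooth_bounded_linear[OF bounded_linear_vec_nth s]]) simp
  have eq: "pdx i \<phi> x $ i = dd (axis i 1) (\<lambda>x. \<phi> x $ i) x" for i x
    unfolding pdx_def by (rule dd_bounded_linear[OF bounded_linear_vec_nth s, symmetric])
  have "integrable lborel (\<lambda>x. dd (axis i 1) (\<lambda>x. \<phi> x $ i) x)" for i
    by (rule test_on_L2(2)[OF test_on_dd[OF ti axis_Basis]])
  then show ?thesis
    unfolding divv_def eq using integral_pdx_test[OF ti axis_Basis] by simp
qed

lemma ipD_trG_tendsto:
  fixes G :: "real^'n \<Rightarrow> real^'n^'n"
  assumes "\<And>k::nat. test_on D (\<phi> k)" "L2D D G" "(\<lambda>k. distD D (gradv (\<phi> k)) G) \<longlonglongrightarrow> 0" "L2D D r"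
  shows "(\<lambda>k. ipD D r (\<lambda>x. divv (\<phi> k) x)) \<longlonglongrightarrow> ipD D r (\<lambda>x. trG (G x))"
proof -
  have bl: "bounded_linear (\<lambda>c::real. c *\<^sub>R (mat 1 :: real^'n^'n))" by (rule bounded_linear_scaleR_left)
  have "(\<lambda>k. ipD D (gradv (\<phi> k)) (\<lambda>x. r x *\<^sub>R mat 1)) \<longlonglongrightarrow> ipD D G (\<lambda>x. r x *\<^sub>R mat 1)"
    by (rule ipD_tendsto[OF gradv_test(1)[OF assms(1)] assms(2,3) L2D_bounded_linear[OF bl assms(4)]])
  then show ?thesis by (simp add: ipD_trG ipD_commute[of G] ipD_commute[of "gradv _"] flip: trG_gradv)
qed

text \<open>True for test fields because divergences integrate to zero, and preserved in the limit.
  It is the source of the conservation of the mean pressure.\<close>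

lemma H01_div_mean:
  assumes "H01 D v G" shows "ipD D (\<lambda>x. 1) (\<lambda>x. trG (G x)) = 0"
proof -
  obtain \<phi> where \<phi>: "\<And>k::nat. test_on D (\<phi> k)" "(\<lambda>k. distD D (gradv (\<phi> k)) G) \<longlonglongrightarrow> 0"
    using assms by (auto simp: H01_def)
  have "ipD D (\<lambda>x. 1) (\<lambda>x. divv (\<phi> k) x) = 0" for k
  proof -
    have "ipD D (\<lambda>x. 1) (\<lambda>x. divv (\<phi> k) x) = (LBINT x. divv (\<phi> k) x)"
      unfolding ipD_eq
    proof (rule Bochner_Integration.integral_cong[OF refl])
      fix x show "ex (\<lambda>x. 1) x \<bullet> ex (divv (\<phi> k)) x = divv (\<phi> k) x"
        using gradv_test(2)[OF \<phi>(1), of x k] by (cases "x \<in> D") (auto simp: ex_def trG_def simp flip: trG_gradv)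
    qed
    then show ?thesis using integral_divv_test[OF \<phi>(1)] by simp
  qed
  then show ?thesis
    using ipD_trG_tendsto[OF \<phi>(1) H01_L2D(2)[OF assms] \<phi>(2) L2D_const[of 1]] by (simp add: LIMSEQ_const_iff)
qed

text \<open>The approximating fields are divergence free pointwise, and the pairing is continuous in
  the gradient.\<close>

lemma Vsp_div:
  assumes "Vsp D v G" "L2D D r" shows "ipD D r (\<lambda>x. trG (G x)) = 0"
proof -
  obtain \<phi> where \<phi>: "\<And>k::nat. test_on D (\<phi> k)" "\<And>k x. divv (\<phi> k) x = 0" "(\<lambda>k. distD D (gradv (\<phi> k)) G) \<longlonglongrightarrow> 0"
    using assms by (auto simp: Vsp_def)
  have "ipD D r (\<lambda>x. divv (\<phi> k) x) = 0" for k
    using \<phi>(2) by (simp add: ipD_def)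
  then show ?thesis
    using ipD_trG_tendsto[OF \<phi>(1) H01_L2D(2)[OF Vsp_H01[OF assms(1)]] \<phi>(3) assms(2)] by (simp add: LIMSEQ_const_iff)
qed

definition lap :: "(real^'n \<Rightarrow> real^'n) \<Rightarrow> real^'n \<Rightarrow> real^'n" where
  "lap v x = (\<Sum>i\<in>UNIV. pdx i (pdx i v) x)"

lemma lap_L2D: assumes "test_on D v" shows "L2D D (lap v)"
proof -
  have "L2D D (\<lambda>x. \<Sum>i\<in>I. pdx i (pdx i v) x)" if "finite I" for I :: "'n set"
    using that
  proof (induction I rule: finite_induct)
    case empty
    then show ?case using L2D_const[of 0] by simp
  next
    case (insert i I)
    then show ?case using test_on_L2D(1)[OF test_on_pdx[OF test_on_pdx[OF assms]]] by (simp add: L2D_add)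
  qed
  then show ?thesis by (simp add: lap_def[abs_def])
qed

lemma gradv_inner: "gradv u x \<bullet> gradv v x = (\<Sum>i\<in>UNIV. pdx i u x \<bullet> pdx i v x)"
  unfolding gradv_def inner_vec_def by (simp, subst sum.swap, simp)

text \<open>The sum of the two integrands is the divergence of the fields u . d_i v, whose integrals
  vanish.\<close>

lemma test_Laplace:
  assumes u: "test_on D u" and v: "test_on D v"
  shows "ipD D u (lap v) = - ipD D (gradv u) (gradv v)"
proof -
  have s: "smooth u" "smooth v" "smooth (pdx i v)" for i
    using u v test_on_pdx[OF v] by (auto simp: test_on_def)
  define g where "g i x = u x \<bullet> pdx i v x" for i x
  have tg: "test_on D (g i)" for i unfolding g_def[abs_def]
    by (rule test_on_multiple[OF u smooth_inner[OF s(1,3)]]) simp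
  have dg: "dd (axis i 1) (g i) x = u x \<bullet> pdx i (pdx i v) x + pdx i u x \<bullet> pdx i v x" for i x
    unfolding g_def[abs_def] pdx_def
    by (rule dd_eqI[OF has_derivative_inner[OF smooth_has_derivative[OF s(1)] smooth_has_derivative[OF s(3)[unfolded pdx_def]]]])
  have "ipD D u (lap v) + ipD D (gradv u) (gradv v) = (LBINT x. ex u x \<bullet> ex (lap v) x + ex (gradv u) x \<bullet> ex (gradv v) x)"
    unfolding ipD_eq using ipD_integrable[OF test_on_L2D(1)[OF u] lap_L2D[OF v]]
      ipD_integrable[OF gradv_test(1)[OF u] gradv_test(1)[OF v]] by simp
  also have "\<dots> = (LBINT x. (\<Sum>i\<in>UNIV. dd (axis i 1) (g i) x))"
  proof (rule Bochner_Integration.integral_cong[OF refl])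
    fix x
    show "ex u x \<bullet> ex (lap v) x + ex (gradv u) x \<bullet> ex (gradv v) x = (\<Sum>i\<in>UNIV. dd (axis i 1) (g i) x)"
    proof (cases "x \<in> D")
      case True
      then show ?thesis by (simp add: ex_def dg lap_def inner_sum_right gradv_inner sum.distrib)
    next
      case False
      then show ?thesis using test_on_outside(1)[OF test_on_dd[OF tg axis_Basis] False] by (simp add: ex_def)
    qed
  qed
  also have "\<dots> = 0"
    using test_on_L2(2)[OF test_on_dd[OF tg axis_Basis]] integral_pdx_test[OF tg axis_Basis] by simp
  finally show ?thesis by simp
qed

text \<open>The distributional equation for w puts both derivatives of the viscous term on the test
  field; this moves one of them back to w.\<close>

lemma H01_Laplace:
  assumes w: "H01 D w G" and v: "test_on D v"
  shows "ipD D w (lap v) = - ipD D G (gradv v)"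
proof -
  obtain \<phi> where \<phi>: "\<And>k::nat. test_on D (\<phi> k)" "(\<lambda>k. distD D (\<phi> k) w) \<longlonglongrightarrow> 0" "(\<lambda>k. distD D (gradv (\<phi> k)) G) \<longlonglongrightarrow> 0"
    using w by (auto simp: H01_def)
  have "(\<lambda>k. ipD D (\<phi> k) (lap v)) \<longlonglongrightarrow> ipD D w (lap v)"
    by (rule ipD_tendsto[OF test_on_L2D(1)[OF \<phi>(1)] H01_L2D(1)[OF w] \<phi>(2) lap_L2D[OF v]])
  moreover have "(\<lambda>k. - ipD D (gradv (\<phi> k)) (gradv v)) \<longlonglongrightarrow> - ipD D G (gradv v)"
    by (intro tendsto_minus ipD_tendsto[OF gradv_test(1)[OF \<phi>(1)] H01_L2D(2)[OF w] \<phi>(3) gradv_test(1)[OF v]])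
  ultimately show ?thesis
    unfolding test_Laplace[OF \<phi>(1) v] by (rule LIMSEQ_unique)
qed

section \<open>Product test fields and weak equations in time\<close>

definition tensor :: "(real \<Rightarrow> real) \<Rightarrow> (real^'n \<Rightarrow> real^'n) \<Rightarrow> (real^'n) \<times> real \<Rightarrow> real^'n" where
  "tensor \<psi> v p = \<psi> (snd p) *\<^sub>R v (fst p)"

lemma tensor_derivative:
  assumes "smooth \<psi>" "smooth v"
  shows "dd e (tensor \<psi> v) p = \<psi> (snd p) *\<^sub>R dd (fst e) v (fst p) + (deriv \<psi> (snd p) * snd e) *\<^sub>R v (fst p)"
proof (rule dd_eqI)
  have 1: "((\<lambda>p. \<psi> (snd p)) has_derivative (\<lambda>e. deriv \<psi> (snd p) * snd e)) (at p)"
    using diff_chain_at[OF bounded_linear_imp_has_derivative[OF bounded_linear_snd]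
        smooth_has_real_derivative[OF assms(1), of "snd p", unfolded has_field_derivative_def]] by (simp add: o_def)
  have 2: "((\<lambda>p. v (fst p)) has_derivative (\<lambda>e. dd (fst e) v (fst p))) (at p)"
    using diff_chain_at[OF bounded_linear_imp_has_derivative[OF bounded_linear_fst]
        smooth_has_derivative[OF assms(2), of "fst p"]] by (simp add: o_def)
  show "(tensor \<psi> v has_derivative (\<lambda>e. \<psi> (snd p) *\<^sub>R dd (fst e) v (fst p) + (deriv \<psi> (snd p) * snd e) *\<^sub>R v (fst p))) (at p)"
    unfolding tensor_def[abs_def] by (rule has_derivative_scaleR[OF 1 2])
qed

lemma test_on_tensor:
  assumes \<psi>: "test_on {0<..<T} \<psi>" and v: "test_on D v"
  shows "test_on (QT D T) (tensor \<psi> v)"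
proof (rule test_on_supportI)
  show "compact (closure {x. v x \<noteq> 0} \<times> closure {x. \<psi> x \<noteq> 0})"
    using assms by (intro compact_Times) (auto simp: test_on_def)
  show "closure {x. v x \<noteq> 0} \<times> closure {x. \<psi> x \<noteq> 0} \<subseteq> QT D T"
    using assms by (intro Sigma_mono) (auto simp: test_on_def)
  show "smooth (tensor \<psi> v)"
    unfolding tensor_def[abs_def]
    by (intro smooth_scaleR smooth_bounded_linear_comp[OF bounded_linear_fst] smooth_bounded_linear_comp[OF bounded_linear_snd])
       (use assms in \<open>auto simp: test_on_def\<close>)
  show "tensor \<psi> v p = 0" if "p \<notin> closure {x. v x \<noteq> 0} \<times> closure {x. \<psi> x \<noteq> 0}" for p
    using that closure_subset[of "{x. v x \<noteq> 0}"] closure_subset[of "{x. \<psi> x \<noteq> 0}"]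
    by (cases p) (auto simp: tensor_def)
qed

text \<open>The scalar distribution t -> (a(t), v) applied to \<psi>. Product test fields reduce
  every space-time equation to relations between such values.\<close>

definition J :: "(real^'n \<Rightarrow> real \<Rightarrow> 'b::euclidean_space) \<Rightarrow> (real^'n \<Rightarrow> 'b) \<Rightarrow> (real \<Rightarrow> real) \<Rightarrow> real" where
  "J a v \<psi> = (LINT t:{0<..<T}|lborel. ipD D (sl a t) v * \<psi> t)"

lemma J_pairing:
  fixes a :: "real^'n \<Rightarrow> real \<Rightarrow> 'b::euclidean_space"
  assumes a: "L2Q D T a" and v: "L2D D v" and m: "\<psi> \<in> borel_measurable borel" and B: "\<And>t. \<bar>\<psi> t\<bar> \<le> B"
  shows "J a v \<psi> = (LBINT p. exQ a p \<bullet> exQ (\<lambda>x t. \<psi> t *\<^sub>R v x) p)"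
    "intQ D T (\<lambda>x t. a x t \<bullet> (\<psi> t *\<^sub>R v x)) = J a v \<psi>"
    "integrable lborel (\<lambda>p. indicator (QT D T) p * (a (fst p) (snd p) \<bullet> (\<psi> (snd p) *\<^sub>R v (fst p))))"
    "integrable lborel (\<lambda>t. indicator {0<..<T} t * (ipD D (sl a t) v * \<psi> t))"
  using pairing_eq[OF a L2Q_tensor[OF v m B]]
  by (simp_all add: J_def ipD_scaleR_right mult.commute[of _ "ipD _ _ _"])

lemma nsq_exQ_tensor_le:
  fixes g :: "real^'n \<Rightarrow> 'b::euclidean_space"
  assumes g: "L2D D g" and m: "\<psi> \<in> borel_measurable borel" and B: "\<And>t. \<bar>\<psi> t\<bar> \<le> B"
  shows "nsq lborel (exQ (\<lambda>x t. \<psi> t *\<^sub>R g x)) \<le> B\<^sup>2 * T * nsq lborel (ex g)"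
proof -
  have L: "L2 lborel (exQ (\<lambda>x t. \<psi> t *\<^sub>R g x))" using L2Q_tensor[OF assms] by (simp add: L2Q_iff)
  have eq: "nsq lborel (\<lambda>x. exQ (\<lambda>x t. \<psi> t *\<^sub>R g x) (x, t)) = indicator {0<..<T} t * (\<psi> t)\<^sup>2 * nsq lborel (ex g)" for t
    by (cases "t \<in> {0<..<T}") (simp_all add: exQ_slice ex_scaleR nsq_scaleR nsq_zero)
  have "nsq lborel (exQ (\<lambda>x t. \<psi> t *\<^sub>R g x)) = (LBINT t. indicator {0<..<T} t * (\<psi> t)\<^sup>2 * nsq lborel (ex g))"
    using nsq_slice_integrable(3)[OF L] by (simp add: eq)
  also have "\<dots> \<le> (LBINT t. indicator {0<..<T} t * (B\<^sup>2 * nsq lborel (ex g)))"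
  proof (rule integral_mono)
    show "integrable lborel (\<lambda>t. indicator {0<..<T} t * (\<psi> t)\<^sup>2 * nsq lborel (ex g))"
      using nsq_slice_integrable(2)[OF L] by (simp add: eq)
    show "integrable lborel (\<lambda>t. indicator {0<..<T} t * (B\<^sup>2 * nsq lborel (ex g)))"
      using T by (intro integrable_mult_left integrable_real_indicator) auto
    have "(\<psi> t)\<^sup>2 \<le> B\<^sup>2" for t using power_mono[OF B[of t], of 2] by simp
    then show "indicator {0<..<T} t * (\<psi> t)\<^sup>2 * nsq lborel (ex g) \<le> indicator {0<..<T} t * (B\<^sup>2 * nsq lborel (ex g))" for t
      by (auto intro!: mult_right_mono nsq_nonneg split: split_indicator)
  qed
  also have "\<dots> = B\<^sup>2 * T * nsq lborel (ex g)" using T by simp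
  finally show ?thesis .
qed

text \<open>Continuity in the spatial argument, which extends identities from smooth test fields to
  all of H_0^1.\<close>

lemma J_tendsto:
  fixes a :: "real^'n \<Rightarrow> real \<Rightarrow> 'b::euclidean_space"
  assumes a: "L2Q D T a" and v: "L2D D v" and m: "\<psi> \<in> borel_measurable borel" and B: "\<And>t. \<bar>\<psi> t\<bar> \<le> B"
    and f: "\<And>k::nat. L2D D (f k)" "(\<lambda>k. distD D (f k) v) \<longlonglongrightarrow> 0"
  shows "(\<lambda>k. J a (f k) \<psi>) \<longlonglongrightarrow> J a v \<psi>"
proof -
  let ?E = "\<lambda>g. exQ (\<lambda>x t. \<psi> t *\<^sub>R g x)"
  have L: "L2 lborel (?E g)" if "L2D D g" for g :: "real^'n \<Rightarrow> 'b" using L2Q_tensor[OF that m B] by (simp add: L2Q_iff)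
  have "(\<lambda>k. LBINT p. ?E (f k) p \<bullet> exQ a p) \<longlonglongrightarrow> (LBINT p. ?E v p \<bullet> exQ a p)"
  proof (rule L2_inner_tendsto[OF L[OF v] L[OF f(1)]])
    show "L2 lborel (exQ a)" using a by (simp add: L2Q_iff)
    show "(\<lambda>k. nsq lborel (\<lambda>p. ?E (f k) p - ?E v p)) \<longlonglongrightarrow> 0"
    proof (rule Lim_null_comparison)
      show "\<forall>\<^sub>F k in sequentially. norm (nsq lborel (\<lambda>p. ?E (f k) p - ?E v p)) \<le> B\<^sup>2 * T * distD D (f k) v"
      proof (intro always_eventually allI)
        fix k
        have "?E (f k) p - ?E v p = ?E (\<lambda>x. f k x - v x) p" for p
          by (simp add: exQ_def scaleR_diff_right)
        then show "norm (nsq lborel (\<lambda>p. ?E (f k) p - ?E v p)) \<le> B\<^sup>2 * T * distD D (f k) v"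
          using nsq_exQ_tensor_le[OF L2D_diff[OF f(1)[of k] v] m B] by (simp add: nsq_nonneg distD_eq ex_diff[abs_def])
      qed
      show "(\<lambda>k. B\<^sup>2 * T * distD D (f k) v) \<longlonglongrightarrow> 0" by (rule tendsto_mult_right_zero[OF f(2)])
    qed
  qed
  then show ?thesis unfolding J_pairing(1)[OF a v m B] J_pairing(1)[OF a f(1) m B] by (simp add: inner_commute)
qed

lemma ipD_L2:
  fixes a :: "real^'n \<Rightarrow> real \<Rightarrow> 'b::euclidean_space"
  assumes a: "L2Q D T a" and v: "L2D D v"
  shows "L2 lborel (\<lambda>t. indicator {0<..<T} t * ipD D (sl a t) v)"
    and "integrable lborel (\<lambda>t. indicator {0<..<T} t * ipD D (sl a t) v)"
proof -
  show i: "integrable lborel (\<lambda>t. indicator {0<..<T} t * ipD D (sl a t) v)"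
    using J_pairing(4)[OF a v, of "\<lambda>_. 1" 1] by simp
  have L: "L2 lborel (exQ a)" using a by (simp add: L2Q_iff)
  show "L2 lborel (\<lambda>t. indicator {0<..<T} t * ipD D (sl a t) v)"
  proof (rule L2I_bound)
    show "integrable lborel (\<lambda>t. nsq lborel (ex v) * nsq lborel (\<lambda>x. exQ a (x, t)))"
      by (intro integrable_mult_right nsq_slice_integrable(2)[OF L])
    show "AE t in lborel. (norm (indicator {0<..<T} t * ipD D (sl a t) v))\<^sup>2 \<le> nsq lborel (ex v) * nsq lborel (\<lambda>x. exQ a (x, t))"
      using L2Q_slice[OF a]
    proof eventually_elim
      case (elim t)
      show ?case
      proof (cases "t \<in> {0<..<T}")
        case True
        then have "\<bar>ipD D (sl a t) v\<bar> \<le> sqrt (ipDt a a t) * sqrt (ipD D v v)"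
          using elim ipD_Cauchy_Schwarz[OF _ v] by blast
        from power_mono[OF this, of 2] True show ?thesis
          by (simp add: power_mult_distrib ipD_self nsq_nonneg exQ_slice mult.commute)
      qed (simp add: nsq_nonneg)
    qed
  qed (use i in auto)
qed

text \<open>The constant remains unknown because the admissible \<psi> vanish near t = 0.\<close>

lemma weak_imp_primitive:
  fixes a :: "real^'n \<Rightarrow> real \<Rightarrow> 'b::euclidean_space" and F :: "real^'n \<Rightarrow> real \<Rightarrow> 'c::euclidean_space"
  assumes a: "L2Q D T a" and v: "L2D D v" and F: "L2Q D T F" and Y: "L2D D Y"
    and eq: "\<And>\<psi>. test_on {0<..<T} \<psi> \<Longrightarrow> - J a v (deriv \<psi>) = J F Y \<psi>"
  shows "\<exists>k. AE t\<in>{0<..<T} in lborel. ipD D (sl a t) v = k + (LBINT r. indicator {0<..<t} r * ipD D (sl F r) Y)"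
  by (rule du_Bois_Reymond[OF T ipD_L2(1)[OF a v] ipD_L2(2)[OF F Y]]) (use eq in \<open>simp add: J_def\<close>)

lemma test_on_test0T:
  assumes "test_on {0<..<T} \<psi>" shows "test0T T \<psi>" "\<psi> 0 = 0"
proof -
  show "\<psi> 0 = 0" by (rule test_on_outside(1)[OF assms]) simp
  let ?C = "closure {t. \<psi> t \<noteq> 0}"
  have C: "compact ?C" "?C \<subseteq> {0<..<T}" using assms by (auto simp: test_on_def)
  have "\<exists>e>0. \<forall>t\<in>?C. t < T - e"
  proof (cases "?C = {}")
    case True then show ?thesis by (auto intro: exI[of _ 1])
  next
    case False
    obtain s where s: "s \<in> ?C" "\<And>t. t \<in> ?C \<Longrightarrow> t \<le> s"
      using continuous_attains_sup[OF C(1) False, of "\<lambda>t. t"] by auto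
    have "s < T" using s(1) C(2) by auto
    then have "(T - s) / 2 > 0" "\<And>t. t \<in> ?C \<Longrightarrow> t < T - (T - s) / 2" using s(2) by (force simp: field_simps)+
    then show ?thesis by blast
  qed
  then obtain e where e: "e > 0" "\<And>t. t \<in> ?C \<Longrightarrow> t < T - e" by blast
  have "\<psi> t = 0" if "t \<ge> T - e" for t
    using e(2)[of t] that closure_subset[of "{t. \<psi> t \<noteq> 0}"] by force
  then show "test0T T \<psi>" using assms e(1) by (auto simp: test0T_def test_on_def)
qed

text \<open>Test functions vanishing at 0 give the identity up to a constant, and a single test
  function with nonzero value at 0 identifies that constant.\<close>

lemma weak_imp_primitive0:
  fixes a :: "real^'n \<Rightarrow> real \<Rightarrow> 'b::euclidean_space" and F :: "real^'n \<Rightarrow> real \<Rightarrow> 'c::euclidean_space"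
  assumes a: "L2Q D T a" and v: "L2D D v" and F: "L2Q D T F" and Y: "L2D D Y"
    and eq: "\<And>\<phi>. test0T T \<phi> \<Longrightarrow> - J a v (deriv \<phi>) - c * \<phi> 0 = J F Y \<phi>"
  shows "AE t\<in>{0<..<T} in lborel. ipD D (sl a t) v = c + (LBINT r. indicator {0<..<t} r * ipD D (sl F r) Y)"
proof -
  define S where "S = {0<..<T}"
  obtain k where k: "AE t in lborel. t \<in> S \<longrightarrow> ipD D (sl a t) v = k + (LBINT r. indicator {0<..<t} r * ipD D (sl F r) Y)"
    using weak_imp_primitive[OF a v F Y] eq test_on_test0T by (force simp: S_def)
  \<comment> \<open>Smooth, positive at 0, and zero from T/2 on, hence admissible.\<close>
  define \<phi> where "\<phi> t = flat 1 (- 1 * t + T / 2)" for t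
  have s: "smooth \<phi>" unfolding \<phi>_def[abs_def] by (rule smooth_real_affine[OF smooth_flat])
  have z: "\<phi> t = 0" if "t \<ge> T / 2" for t using that by (simp add: \<phi>_def flat_def)
  have t0: "test0T T \<phi>" unfolding test0T_def using s z T by (auto intro!: exI[of _ "T/2"])
  have d: "deriv \<phi> t = - flat (monom 1 2 * (1 - pderiv 1)) (- 1 * t + T / 2)" for t
  proof (rule DERIV_imp_deriv)
    have "((\<lambda>t. - 1 * t + T / 2) has_field_derivative -1) (at t)" by (auto intro!: derivative_eq_intros)
    from DERIV_chain2[OF flat_deriv this, of 1]
    show "(\<phi> has_field_derivative - flat (monom 1 2 * (1 - pderiv 1)) (- 1 * t + T / 2)) (at t)"
      by (simp add: \<phi>_def[abs_def])
  qed
  have dz: "deriv \<phi> t = 0" if "t \<ge> T / 2" for t using that by (simp add: d flat_def)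
  have \<phi>0: "\<phi> 0 > 0" using T by (simp add: \<phi>_def flat_1)
  have [measurable]: "deriv \<phi> \<in> borel_measurable borel" "\<phi> \<in> borel_measurable borel"
    by (auto intro!: borel_measurable_continuous_onI smooth_continuous smooth_deriv s)
  define b where "b r = indicator S r * ipD D (sl F r) Y" for r
  have bi: "integrable lborel b" using ipD_L2(2)[OF F Y] by (simp add: b_def[abs_def] S_def)
  define K where "K t = (prim b t)" for t
  have Km[measurable]: "K \<in> borel_measurable borel" and Kb: "\<bar>K t\<bar> \<le> (LBINT r. \<bar>b r\<bar>)" for t
    using box_partial_integral_measurable[OF bi] by (simp_all add: K_def[abs_def])
  have K_eq: "(LBINT r. indicator {0<..<t} r * ipD D (sl F r) Y) = K t" if "t \<in> S" for t
    unfolding K_def b_def using that by (intro Bochner_Integration.integral_cong) (auto simp: S_def split: split_indicator)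
  have "bounded (deriv \<phi> ` {0..T})"
    by (intro compact_imp_bounded compact_continuous_image continuous_on_subset[OF smooth_continuous[OF smooth_deriv[OF s]]]) auto
  then obtain B where "\<forall>t\<in>{0..T}. \<bar>deriv \<phi> t\<bar> \<le> B" by (auto simp: bounded_iff)
  then have B: "\<bar>deriv \<phi> t\<bar> \<le> B" if "t \<in> {0..T}" for t using that by blast
  have id: "integrable lborel (\<lambda>t. indicator {0<..} t * deriv \<phi> t)"
  proof (rule Bochner_Integration.integrable_bound)
    show "integrable lborel (\<lambda>t. indicator {0..T} t * B)" using T by (intro integrable_mult_left integrable_real_indicator) auto
    show "AE t in lborel. norm (indicator {0<..} t * deriv \<phi> t) \<le> norm (indicator {0..T} t * B)"
    proof (intro AE_I2)
      fix t show "norm (indicator {0<..} t * deriv \<phi> t) \<le> norm (indicator {0..T} t * B)"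
        using B[of t] dz[of t] T by (cases "t \<in> {0..T}") (auto split: split_indicator)
    qed
  qed measurable
  have iK: "integrable lborel (\<lambda>t. indicator {0<..} t * K t * deriv \<phi> t)"
  proof (rule Bochner_Integration.integrable_bound[OF integrable_mult_left[OF id, of "\<integral>r. \<bar>b r\<bar> \<partial>lborel"]])
    show "AE t in lborel. norm (indicator {0<..} t * K t * deriv \<phi> t) \<le> norm (indicator {0<..} t * deriv \<phi> t * (LBINT r. \<bar>b r\<bar>))"
    proof (intro AE_I2)
      fix t
      have Kt: "\<bar>K t\<bar> \<le> \<bar>\<integral>r. \<bar>b r\<bar> \<partial>lborel\<bar>" using Kb[of t] by simp
      then show "norm (indicator {0<..} t * K t * deriv \<phi> t) \<le> norm (indicator {0<..} t * deriv \<phi> t * (LBINT r. \<bar>b r\<bar>))"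
        using mult_right_mono[OF Kt, of "\<bar>deriv \<phi> t\<bar>"]
        by (auto simp: abs_mult mult.commute[of "\<bar>deriv \<phi> t\<bar>"] split: split_indicator)
    qed
  qed measurable
  have "J a v (deriv \<phi>) = (LBINT t. k * (indicator {0<..} t * deriv \<phi> t) + indicator {0<..} t * K t * deriv \<phi> t)"
    unfolding J_def set_lebesgue_integral_def
  proof (rule integral_cong_AE)
    have "(\<lambda>t. indicator S t * ipD D (sl a t) v) \<in> borel_measurable lborel"
      using ipD_L2(2)[OF a v] by (auto simp: S_def)
    then have "(\<lambda>t. (indicator S t * ipD D (sl a t) v) * deriv \<phi> t) \<in> borel_measurable lborel" by measurable
    then show "(\<lambda>t. indicator {0<..<T} t *\<^sub>R (ipD D (sl a t) v * deriv \<phi> t)) \<in> borel_measurable lborel"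
      by (simp add: S_def mult.assoc)
    show "AE t in lborel. indicator {0<..<T} t *\<^sub>R (ipD D (sl a t) v * deriv \<phi> t) =
        k * (indicator {0<..} t * deriv \<phi> t) + indicator {0<..} t * K t * deriv \<phi> t"
      using k
    proof eventually_elim
      case (elim t)
      then show ?case using K_eq[of t] dz[of t] T by (cases "t \<in> S") (auto simp: S_def algebra_simps split: split_indicator)
    qed
  qed measurable
  also have "\<dots> = k * (LBINT t. indicator {0<..} t * deriv \<phi> t) + (LBINT t. indicator {0<..} t * K t * deriv \<phi> t)"
    using id iK by simp
  also have "(LBINT t. indicator {0<..} t * deriv \<phi> t) = - \<phi> 0"
    by (rule integral_deriv_tail[OF s, where T="T/2"]) (auto simp: z dz)
  also have "(LBINT t. indicator {0<..} t * K t * deriv \<phi> t) = - (LBINT r. b r * \<phi> r)"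
    unfolding K_def by (rule integral_primitive_deriv[OF bi s _ _ id, where T="T/2"]) (auto simp: b_def S_def z dz)
  also have "(LBINT r. b r * \<phi> r) = J F Y \<phi>"
    by (simp add: b_def J_def set_lebesgue_integral_def S_def mult.assoc)
  finally have "k = c" using eq[OF t0] \<phi>0 by simp
  then show ?thesis using k by (simp add: S_def)
qed

end

text \<open>Absolute continuity of the integral, in the form needed to read off initial
  values.\<close>

lemma small_time_integral:
  fixes k :: "real \<Rightarrow> real"
  assumes k: "integrable lborel k" and e: "e > 0"
  shows "\<exists>\<delta>>0. \<forall>t<\<delta>. \<bar>\<integral>r. indicator {0<..<t} r * k r \<partial>lborel\<bar> \<le> e"
proof -
  have "(\<lambda>n. LBINT r. indicator {0<..<1 / real (Suc n)} r * \<bar>k r\<bar>) \<longlonglongrightarrow> (\<integral>r. 0 \<partial>(lborel :: real measure))"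
  proof (rule integral_dominated_convergence[where w="\<lambda>r. \<bar>k r\<bar>"])
    show "AE r in lborel. (\<lambda>n. indicator {0<..<1 / real (Suc n)} r * \<bar>k r\<bar>) \<longlonglongrightarrow> 0"
    proof (intro AE_I2 tendsto_eventually)
      fix r :: real
      show "\<forall>\<^sub>F n in sequentially. indicator {0<..<1 / real (Suc n)} r * \<bar>k r\<bar> = 0"
      proof (cases "r > 0")
        case True
        have "(\<lambda>n. 1 / real (Suc n)) \<longlonglongrightarrow> 0" using LIMSEQ_inverse_real_of_nat by (simp add: inverse_eq_divide)
        from order_tendstoD(2)[OF this True] show ?thesis by eventually_elim auto
      qed auto
    qed
  qed (use k in \<open>auto split: split_indicator\<close>)
  then have "(\<lambda>n. LBINT r. indicator {0<..<1 / real (Suc n)} r * \<bar>k r\<bar>) \<longlonglongrightarrow> 0" by simp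
  from order_tendstoD(2)[OF this e] obtain n where
    n: "(LBINT r. indicator {0<..<1 / real (Suc n)} r * \<bar>k r\<bar>) < e"
    by (auto simp: eventually_sequentially)
  have i: "integrable lborel (\<lambda>r. indicator A r * k r)" if "A \<in> sets borel" for A
    using integrable_mult_indicator[OF _ k, of A] that by simp
  have "\<bar>\<integral>r. indicator {0<..<t} r * k r \<partial>lborel\<bar> \<le> e" if "t < 1 / real (Suc n)" for t
  proof -
    have "\<bar>\<integral>r. indicator {0<..<t} r * k r \<partial>lborel\<bar> \<le> (LBINT r. \<bar>indicator {0<..<t} r * k r\<bar>)"
      using integral_norm_bound[of lborel "\<lambda>r. indicator {0<..<t} r * k r"] by simp
    also have "\<dots> \<le> (LBINT r. indicator {0<..<1 / real (Suc n)} r * \<bar>k r\<bar>)"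
    proof (rule integral_mono)
      show "integrable lborel (\<lambda>r. \<bar>indicator {0<..<t} r * k r\<bar>)" by (intro integrable_abs i) simp
      show "integrable lborel (\<lambda>r. indicator {0<..<1 / real (Suc n)} r * \<bar>k r\<bar>)"
        using integrable_abs[OF i[of "{0<..<1 / real (Suc n)}"]] by (simp add: abs_mult)
      show "\<bar>indicator {0<..<t} r * k r\<bar> \<le> indicator {0<..<1 / real (Suc n)} r * \<bar>k r\<bar>" for r
        using that by (auto simp: abs_mult split: split_indicator)
    qed
    finally show ?thesis using n by simp
  qed
  then show ?thesis by (intro exI[of _ "1 / real (Suc n)"]) auto
qed

text \<open>Estimates of c come out at almost every small t although c does not depend on t; the odd
  hypothesis records this, and any nonempty interval contains an admissible t.\<close>

lemma eq_of_AE_near_zero: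
  fixes c :: real
  assumes "\<And>e. e > 0 \<Longrightarrow> \<exists>\<delta>::real>0. AE t in lborel. t \<in> {0<..<\<delta>} \<longrightarrow> \<bar>c\<bar> \<le> e"
  shows "c = 0"
proof (rule ccontr)
  assume "c \<noteq> 0"
  then have "\<bar>c\<bar> / 2 > 0" by simp
  from assms[OF this] obtain \<delta> :: real where \<delta>: "\<delta> > 0" "AE t in lborel. t \<in> {0<..<\<delta>} \<longrightarrow> \<bar>c\<bar> \<le> \<bar>c\<bar> / 2"
    by blast
  from AE_lborel_ex_interval[OF \<delta>(2) \<delta>(1)] \<open>c \<noteq> 0\<close> show False by auto
qed

context space_time
begin

lemma ipD_Pair:
  fixes a c :: "real^'n \<Rightarrow> 'b::euclidean_space" and b d :: "real^'n \<Rightarrow> 'c::euclidean_space"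
  assumes "L2D D a" "L2D D b" "L2D D c" "L2D D d"
  shows "ipD D (\<lambda>x. (a x, b x)) (\<lambda>x. (c x, d x)) = ipD D a c + ipD D b d"
proof -
  have e: "ex (\<lambda>x. (g x, h x)) x = (ex g x, ex h x)" for g :: "real^'n \<Rightarrow> 'b" and h :: "real^'n \<Rightarrow> 'c" and x
    by (auto simp: ex_def split: split_indicator)
  show ?thesis unfolding ipD_eq e
    using ipD_integrable[OF assms(1,3)] ipD_integrable[OF assms(2,4)] by simp
qed

lemma L2D_Pair:
  fixes a :: "real^'n \<Rightarrow> 'b::euclidean_space" and b :: "real^'n \<Rightarrow> 'c::euclidean_space"
  assumes "L2D D a" "L2D D b" shows "L2D D (\<lambda>x. (a x, b x))"
proof -
  have e: "ex (\<lambda>x. (a x, b x)) = (\<lambda>x. (ex a x, ex b x))" by (auto simp: ex_def zero_prod_def split: split_indicator)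
  show ?thesis using assms L2_Pair[of lborel "ex a" "ex b"] unfolding L2D_iff e by (auto intro: borel_measurable_Pair)
qed

lemma L2Q_Pair:
  fixes a :: "real^'n \<Rightarrow> real \<Rightarrow> 'b::euclidean_space" and b :: "real^'n \<Rightarrow> real \<Rightarrow> 'c::euclidean_space"
  assumes "L2Q D T a" "L2Q D T b" shows "L2Q D T (\<lambda>x t. (a x t, b x t))"
proof -
  have e: "exQ (\<lambda>x t. (a x t, b x t)) = (\<lambda>p. (exQ a p, exQ b p))" by (auto simp: exQ_def zero_prod_def split: split_indicator)
  show ?thesis using assms L2_Pair[of lborel "exQ a" "exQ b"] unfolding L2Q_iff e by (auto intro: borel_measurable_Pair)
qed

lemma distD_Pair:
  fixes a c :: "real^'n \<Rightarrow> 'b::euclidean_space" and b d :: "real^'n \<Rightarrow> 'c::euclidean_space"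
  assumes "L2D D a" "L2D D b" "L2D D c" "L2D D d"
  shows "distD D (\<lambda>x. (a x, b x)) (\<lambda>x. (c x, d x)) = distD D a c + distD D b d"
proof -
  have e: "ex (\<lambda>x. (g x, h x)) x = (ex g x, ex h x)" for g :: "real^'n \<Rightarrow> 'b" and h :: "real^'n \<Rightarrow> 'c" and x
    by (auto simp: ex_def split: split_indicator)
  have "(norm ((a, b) - (c, d)))\<^sup>2 = (norm (a - c))\<^sup>2 + (norm (b - d))\<^sup>2" for a c :: 'b and b d :: 'c
    by (simp add: norm_Pair)
  then show ?thesis unfolding distD_eq e nsq_def
    using L2_int[OF L2_diff[OF L2D_ex[OF assms(1)] L2D_ex[OF assms(3)]]]
      L2_int[OF L2_diff[OF L2D_ex[OF assms(2)] L2D_ex[OF assms(4)]]] by simp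
qed

text \<open>The relation \<open>K v V\<close> says which data V, typically the field together with
  its gradient, may accompany the test function v. It is a relation because the gradient is not a
  function of v in this setting. The equation is required for admissible pairs only, and the
  solution has to be admissible at almost every time.\<close>

theorem energy_Q:
  fixes a :: "real^'n \<Rightarrow> real \<Rightarrow> 'e::euclidean_space" and Y F :: "real^'n \<Rightarrow> real \<Rightarrow> 'g::euclidean_space"
  assumes a: "L2Q D T a" and Y: "L2Q D T Y" and F: "L2Q D T F" and a0: "L2D D a0"
    and K: "AE s\<in>{0<..<T} in lborel. K (sl a s) (sl Y s)"
    and weak: "\<And>v V. K v V \<Longrightarrow> AE t\<in>{0<..<T} in lborel.
        ipD D (sl a t) v = ipD D a0 v + (LBINT r. indicator {0<..<t} r * ipD D (sl F r) V)"
  shows "AE t\<in>{0<..<T} in lborel. ipDt a a t \<le> ipD D a0 a0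
    + 2 * (LBINT r. indicator {0<..<t} r * ipDt F Y r)"
proof -
  have partial: "(LBINT r. indicator {0<..<t} r * (LBINT x. exQ F (x, r) \<bullet> W r x)) =
      (LBINT r. indicator {0<..<t} r * (LBINT x. ex (sl F r) x \<bullet> W r x))"
    if "t \<in> {0<..<T}" for t and W :: "real \<Rightarrow> real^'n \<Rightarrow> 'g"
    using that by (intro Bochner_Integration.integral_cong) (auto simp: exQ_slice split: split_indicator)
  interpret evolution T "exQ a" "exQ Y" "exQ F" "ex a0"
  proof
    show "L2 lborel (exQ a)" "L2 lborel (exQ Y)" "L2 lborel (exQ F)" using a Y F by (auto simp: L2Q_iff)
    show "AE s in lborel. AE t\<in>{0<..<T} in lborel.
      (LBINT x. exQ a (x, t) \<bullet> exQ a (x, s)) = (LBINT x. ex a0 x \<bullet> exQ a (x, s)) +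
        (LBINT r. indicator {0<..<t} r * (LBINT x. exQ F (x, r) \<bullet> exQ Y (x, s)))"
      using K
    proof eventually_elim
      case (elim s)
      show ?case
      proof (cases "s \<in> {0<..<T}")
        case True
        with elim have "K (sl a s) (sl Y s)" by simp
        from weak[OF this] show ?thesis
        proof eventually_elim
          case (elim t)
          then show ?case using True partial[of t "\<lambda>r x. ex (sl Y s) x"] by (simp add: exQ_slice ipD_eq)
        qed
      qed (simp add: exQ_slice)
    qed
  qed (use T a0 in \<open>auto simp: exQ_slice L2D_ex\<close>)
  show ?thesis
    using energy_inequality
  proof eventually_elim
    case (elim t)
    show ?case
    proof
      assume t: "t \<in> {0<..<T}"
      have "(LBINT r. indicator {0<..<t} r * (LBINT x. exQ F (x, r) \<bullet> exQ Y (x, r))) =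
        (LBINT r. indicator {0<..<t} r * ipDt F Y r)"
        unfolding ipD_slice using t by (intro Bochner_Integration.integral_cong) (auto split: split_indicator)
      moreover have "nsq lborel (\<lambda>x. exQ a (x, t)) = ipDt a a t"
        using t by (simp add: exQ_slice ipD_self)
      ultimately show "ipDt a a t \<le> ipD D a0 a0
        + 2 * (LBINT r. indicator {0<..<t} r * ipDt F Y r)"
        using elim t by (simp add: ipD_self)
    qed
  qed
qed

text \<open>The essential bound on f is a statement about points (x, t); Fubini for null sets makes
  it hold on almost every time slice, which gives the slicewise estimate.\<close>

lemma L2Q_mult_Linf:
  fixes s :: "real^'n \<Rightarrow> real \<Rightarrow> real" and f :: "real^'n \<Rightarrow> real \<Rightarrow> real^'n"
  assumes s: "L2Q D T s" and fm: "(\<lambda>(x, t). f x t) \<in> borel_measurable mQ"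
    and M: "AE z in mQ. z \<in> QT D T \<longrightarrow> norm (case_prod f z) \<le> M"
  shows "L2Q D T (\<lambda>x t. s x t *\<^sub>R f x t)"
    and "AE t\<in>{0<..<T} in lborel. ipD D (\<lambda>x. s x t *\<^sub>R f x t) (\<lambda>x. s x t *\<^sub>R f x t) \<le> M\<^sup>2 * ipDt s s t"
proof -
  have "(\<lambda>(x, t). f x t) = (\<lambda>p. f (fst p) (snd p))" by auto
  then have [measurable]: "(\<lambda>p. f (fst p) (snd p)) \<in> borel_measurable borel" using fm by (simp add: lborel_prod)
  have sm[measurable]: "(\<lambda>p. s (fst p) (snd p)) \<in> borel_measurable borel" and sL: "L2 lborel (exQ s)"
    using s by (auto simp: L2Q_iff)
  have M': "AE z in lborel. z \<in> QT D T \<longrightarrow> norm (f (fst z) (snd z)) \<le> M"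
    using M by (subst (asm) lborel_prod) (simp add: case_prod_beta)
  have pw: "(norm (a *\<^sub>R b))\<^sup>2 \<le> M\<^sup>2 * (norm a)\<^sup>2" if "norm b \<le> M" for a :: real and b :: "real^'n"
    using mult_left_mono[OF power_mono[OF that, of 2], of "a\<^sup>2"] by (simp add: power_mult_distrib mult.commute)
  show L: "L2Q D T (\<lambda>x t. s x t *\<^sub>R f x t)"
    unfolding L2Q_iff
  proof
    show [measurable]: "(\<lambda>p. s (fst p) (snd p) *\<^sub>R f (fst p) (snd p)) \<in> borel_measurable borel" by measurable
    show "L2 lborel (exQ (\<lambda>x t. s x t *\<^sub>R f x t))"
    proof (rule L2I_bound[OF _ integrable_mult_right[OF L2_int[OF sL], of "M\<^sup>2"]])
      show "exQ (\<lambda>x t. s x t *\<^sub>R f x t) \<in> borel_measurable lborel" unfolding exQ_def[abs_def] by measurable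
      show "AE p in lborel. (norm (exQ (\<lambda>x t. s x t *\<^sub>R f x t) p))\<^sup>2 \<le> M\<^sup>2 * (norm (exQ s p))\<^sup>2"
        using M' by eventually_elim (use pw in \<open>auto simp: exQ_def split: split_indicator\<close>)
    qed
  qed
  have "AE p in lborel \<Otimes>\<^sub>M lborel. p \<in> QT D T \<longrightarrow> norm (f (fst p) (snd p)) \<le> M"
    using M by (simp add: case_prod_beta)
  then have "AE x in lborel. AE t in lborel. (x, t) \<in> QT D T \<longrightarrow> norm (f x t) \<le> M"
    by (rule lborel_pair.AE_pair[THEN eventually_mono]) simp
  then have slice: "AE t in lborel. AE x in lborel. (x, t) \<in> QT D T \<longrightarrow> norm (f x t) \<le> M"
  proof (subst (asm) lborel_pair.AE_commute)
    have "Measurable.pred borel (\<lambda>z. (fst z, snd z) \<in> QT D T \<longrightarrow> norm (f (fst z) (snd z)) \<le> M)"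
      by measurable
    then have "{z \<in> space lborel. (fst z, snd z) \<in> QT D T \<longrightarrow> norm (f (fst z) (snd z)) \<le> M} \<in> sets lborel"
      by (simp add: pred_def)
    then show "{z \<in> space (lborel \<Otimes>\<^sub>M lborel). (fst z, snd z) \<in> QT D T \<longrightarrow> norm (f (fst z) (snd z)) \<le> M} \<in> sets (lborel \<Otimes>\<^sub>M lborel)"
      by (simp only: lborel_prod)
  qed
  show "AE t\<in>{0<..<T} in lborel. ipD D (\<lambda>x. s x t *\<^sub>R f x t) (\<lambda>x. s x t *\<^sub>R f x t) \<le> M\<^sup>2 * ipDt s s t"
    using slice L2Q_slice[OF L] L2Q_slice[OF s]
  proof eventually_elim
    case (elim t)
    show ?case
    proof
      assume t: "t \<in> {0<..<T}"
      have L: "L2 lborel (ex (\<lambda>x. s x t *\<^sub>R f x t))" "L2 lborel (ex (sl s t))"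
        using elim t by (auto intro: L2D_ex)
      have "nsq lborel (ex (\<lambda>x. s x t *\<^sub>R f x t)) \<le> (LBINT x. M\<^sup>2 * (norm (ex (sl s t) x))\<^sup>2)"
        unfolding nsq_def
      proof (rule integral_mono_AE[OF L2_int[OF L(1)] integrable_mult_right[OF L2_int[OF L(2)]]])
        show "AE x in lborel. (norm (ex (\<lambda>x. s x t *\<^sub>R f x t) x))\<^sup>2 \<le> M\<^sup>2 * (norm (ex (sl s t) x))\<^sup>2"
          using elim(1) by eventually_elim (use pw t in \<open>auto simp: ex_def split: split_indicator\<close>)
      qed
      then show "ipD D (\<lambda>x. s x t *\<^sub>R f x t) (\<lambda>x. s x t *\<^sub>R f x t) \<le> M\<^sup>2 * ipDt s s t"
        by (simp add: ipD_self nsq_def)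
    qed
  qed
qed

lemma L2Q_const: "L2Q D T (\<lambda>x t. c)" for c :: "'b::euclidean_space"
  using L2Q_tensor[OF L2D_const[of c], of "\<lambda>_. 1" 1] by simp

lemma L2Q_scaleR: "L2Q D T g \<Longrightarrow> L2Q D T (\<lambda>x t. c *\<^sub>R g x t)" for g :: "real^'n \<Rightarrow> real \<Rightarrow> 'b::euclidean_space"
  by (rule L2Q_bounded_linear[OF bounded_linear_scaleR_right])

lemma L2D_scaleR: "L2D D g \<Longrightarrow> L2D D (\<lambda>x. c *\<^sub>R g x)" for g :: "real^'n \<Rightarrow> 'b::euclidean_space"
  by (rule L2D_bounded_linear[OF bounded_linear_scaleR_right])

text \<open>Both sides are continuous along the approximating sequence; field and gradient converge
  together as one pair.\<close>

lemma J_eq_H01: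
  fixes a :: "real^'n \<Rightarrow> real \<Rightarrow> real^'n" and F :: "real^'n \<Rightarrow> real \<Rightarrow> (real^'n) \<times> (real^'n^'n)"
  assumes a: "L2Q D T a" and F: "L2Q D T F"
    and m: "\<psi> \<in> borel_measurable borel" "\<And>t. \<bar>\<psi> t\<bar> \<le> B" and m': "\<psi>' \<in> borel_measurable borel" "\<And>t. \<bar>\<psi>' t\<bar> \<le> B"
    and eq: "\<And>v. test_on D v \<Longrightarrow> - J a v \<psi>' = J F (\<lambda>x. (v x, gradv v x)) \<psi>"
    and v: "H01 D v G"
  shows "- J a v \<psi>' = J F (\<lambda>x. (v x, G x)) \<psi>"
proof -
  obtain \<phi> where \<phi>: "\<And>k::nat. test_on D (\<phi> k)" "(\<lambda>k. distD D (\<phi> k) v) \<longlonglongrightarrow> 0" "(\<lambda>k. distD D (gradv (\<phi> k)) G) \<longlonglongrightarrow> 0"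
    using v by (auto simp: H01_def)
  note L = H01_L2D[OF v] test_on_L2D(1)[OF \<phi>(1)] gradv_test(1)[OF \<phi>(1)]
  have "(\<lambda>k. - J a (\<phi> k) \<psi>') \<longlonglongrightarrow> - J a v \<psi>'"
    by (intro tendsto_minus J_tendsto[OF a L(1) m' L(3) \<phi>(2)])
  moreover have "(\<lambda>k. distD D (\<lambda>x. (\<phi> k x, gradv (\<phi> k) x)) (\<lambda>x. (v x, G x))) \<longlonglongrightarrow> 0"
    unfolding distD_Pair[OF L(3,4,1,2)] using tendsto_add[OF \<phi>(2,3)] by simp
  then have "(\<lambda>k. J F (\<lambda>x. (\<phi> k x, gradv (\<phi> k) x)) \<psi>) \<longlonglongrightarrow> J F (\<lambda>x. (v x, G x)) \<psi>"
    by (rule J_tendsto[OF F L2D_Pair[OF L(1,2)] m L2D_Pair[OF L(3,4)]])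
  ultimately show ?thesis unfolding eq[OF \<phi>(1)] by (rule LIMSEQ_unique)
qed

end

subsection \<open>The incompressible problem\<close>

text \<open>Collects the data and the solution of (S) with the existential witnesses named:
  \<open>Gw\<close> is the gradient of w, \<open>qt\<close> the time derivative of q, and
  \<open>M\<close> an essential bound for f.\<close>

locale limit_problem = space_time D T for D :: "(real^'n::finite) set" and T :: real +
  fixes \<rho>0 \<mu> \<eta> :: real
    and f :: "real^'n \<Rightarrow> real \<Rightarrow> real^'n" and u0 :: "real^'n \<Rightarrow> real^'n" and p0 :: "real^'n \<Rightarrow> real"
    and w :: "real^'n \<Rightarrow> real \<Rightarrow> real^'n" and q :: "real^'n \<Rightarrow> real \<Rightarrow> real"
    and Gw :: "real^'n \<Rightarrow> real \<Rightarrow> real^'n^'n" and qt :: "real^'n \<Rightarrow> real \<Rightarrow> real" and M :: real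
  assumes D_connected: "connected D" and D_nonempty: "D \<noteq> {}"
    and \<rho>0: "\<rho>0 > 0" and \<mu>: "\<mu> > 0" and \<eta>: "\<eta> \<ge> 0"
    and f_meas: "(\<lambda>(x, t). f x t) \<in> borel_measurable mQ"
    and f_bound: "AE z in mQ. z \<in> QT D T \<longrightarrow> norm (case_prod f z) \<le> M"
    and u0: "L2D D u0" and p0: "L2D D p0" and Ju0: "Jsp D u0"
    and wV: "L2V D T w Gw"
    and S_dist: "\<And>\<Phi>::(real^'n) \<times> real \<Rightarrow> real^'n. test_on (QT D T) \<Phi> \<Longrightarrow>
       intQ D T (\<lambda>x t. - \<rho>0 * inner (w x t) (dd (0,1) \<Phi> (x,t))
                       - q x t * (\<Sum>i\<in>UNIV. dd (axis i 1, 0) \<Phi> (x,t) $ i))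
     = intQ D T (\<lambda>x t. \<mu> * inner (w x t) (\<Sum>i\<in>UNIV. dd (axis i 1, 0) (dd (axis i 1, 0) \<Phi>) (x,t))
                       + \<rho>0 * inner (f x t) (\<Phi> (x,t)))"
    and S_V: "\<And>\<phi> v Gv. test0T T \<phi> \<Longrightarrow> Vsp D v Gv \<Longrightarrow>
       - (LINT t:{0<..<T}|lborel. \<rho>0 * ipD D (sl w t) v * deriv \<phi> t)
       - \<rho>0 * ipD D u0 v * \<phi> 0
     = - \<mu> * (LINT t:{0<..<T}|lborel. ipD D (sl Gw t) Gv * \<phi> t)
       + (LINT t:{0<..<T}|lborel. ipD D (\<lambda>x. \<rho>0 *\<^sub>R f x t) v * \<phi> t)"
    and q: "L2Q D T q" and qt: "L2Q D T qt"
    and q_weak: "\<And>\<psi> r. test_on {0<..<T} \<psi> \<Longrightarrow> L2D D r \<Longrightarrow>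
        (LINT t:{0<..<T}|lborel. ipD D (sl q t) r * deriv \<psi> t)
      = - (LINT t:{0<..<T}|lborel. ipD D (sl qt t) r * \<psi> t)"
    and q_mean: "AE t in lborel. t \<in> {0..T} \<longrightarrow> (LINT x:D|lborel. q x t) = (LINT x:D|lborel. p0 x)"
begin

lemma w: "L2Q D T w" and Gw: "L2Q D T Gw"
  and w_Vsp: "AE t\<in>{0<..<T} in lborel. Vsp D (sl w t) (sl Gw t)"
  using wV by (auto simp: L2V_def)

lemma f: "L2Q D T f"
  using L2Q_mult_Linf(1)[OF L2Q_const[of 1] f_meas f_bound] by simp

lemma J_scaleR: "J (\<lambda>x t. c *\<^sub>R a x t) v \<psi> = c * J a v \<psi>"
  for a :: "real^'n \<Rightarrow> real \<Rightarrow> 'b::euclidean_space"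
  unfolding J_def set_lebesgue_integral_def ipD_scaleR_left
  by (simp add: mult.assoc mult.left_commute[of _ c])

lemma J_add:
  fixes a b :: "real^'n \<Rightarrow> real \<Rightarrow> 'b::euclidean_space"
  assumes a: "L2Q D T a" and b: "L2Q D T b" and v: "L2D D v"
    and m: "\<psi> \<in> borel_measurable borel" "\<And>t. \<bar>\<psi> t\<bar> \<le> B"
  shows "J (\<lambda>x t. a x t + b x t) v \<psi> = J a v \<psi> + J b v \<psi>"
  unfolding J_pairing(1)[OF a v m] J_pairing(1)[OF b v m] J_pairing(1)[OF L2Q_add[OF a b] v m]
proof -
  have L: "L2 lborel (exQ a)" "L2 lborel (exQ b)" "L2 lborel (exQ (\<lambda>x t. \<psi> t *\<^sub>R v x))"
    using a b L2Q_tensor[OF v m] by (auto simp: L2Q_iff)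
  have "exQ (\<lambda>x t. a x t + b x t) p = exQ a p + exQ b p" for p by (simp add: exQ_def scaleR_add_right)
  then show "(LBINT p. exQ (\<lambda>x t. a x t + b x t) p \<bullet> exQ (\<lambda>x t. \<psi> t *\<^sub>R v x) p) =
    (LBINT p. exQ a p \<bullet> exQ (\<lambda>x t. \<psi> t *\<^sub>R v x) p) + (LBINT p. exQ b p \<bullet> exQ (\<lambda>x t. \<psi> t *\<^sub>R v x) p)"
    using L2_inner_integrable[OF L(1,3)] L2_inner_integrable[OF L(2,3)] by (simp add: inner_add_left)
qed

lemma J_Pair:
  fixes a :: "real^'n \<Rightarrow> real \<Rightarrow> 'b::euclidean_space" and b :: "real^'n \<Rightarrow> real \<Rightarrow> 'c::euclidean_space"
  assumes a: "L2Q D T a" and b: "L2Q D T b" and v: "L2D D v" and G: "L2D D G"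
    and m: "\<psi> \<in> borel_measurable borel" "\<And>t. \<bar>\<psi> t\<bar> \<le> B"
  shows "J (\<lambda>x t. (a x t, b x t)) (\<lambda>x. (v x, G x)) \<psi> = J a v \<psi> + J b G \<psi>"
proof -
  have "(LBINT t. indicator {0<..<T} t * (ipD D (\<lambda>x. (a x t, b x t)) (\<lambda>x. (v x, G x)) * \<psi> t)) =
     (LBINT t. indicator {0<..<T} t * (ipD D (sl a t) v * \<psi> t) + indicator {0<..<T} t * (ipD D (sl b t) G * \<psi> t))"
  proof (rule integral_cong_AE)
    have i: "integrable lborel (\<lambda>t. indicator {0<..<T} t * (ipD D (\<lambda>x. (a x t, b x t)) (\<lambda>x. (v x, G x)) * \<psi> t))"
      by (rule J_pairing(4)[OF L2Q_Pair[OF a b] L2D_Pair[OF v G] m])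
    then show "(\<lambda>t. indicator {0<..<T} t * (ipD D (\<lambda>x. (a x t, b x t)) (\<lambda>x. (v x, G x)) * \<psi> t)) \<in> borel_measurable lborel" by simp
    show "(\<lambda>t. indicator {0<..<T} t * (ipD D (sl a t) v * \<psi> t) + indicator {0<..<T} t * (ipD D (sl b t) G * \<psi> t)) \<in> borel_measurable lborel"
      using J_pairing(4)[OF a v m] J_pairing(4)[OF b G m] by (intro borel_measurable_add) auto
    show "AE t in lborel. indicator {0<..<T} t * (ipD D (\<lambda>x. (a x t, b x t)) (\<lambda>x. (v x, G x)) * \<psi> t) =
      indicator {0<..<T} t * (ipD D (sl a t) v * \<psi> t) + indicator {0<..<T} t * (ipD D (sl b t) G * \<psi> t)"
      using L2Q_slice[OF a] L2Q_slice[OF b]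
    proof eventually_elim
      case (elim t)
      then show ?case using ipD_Pair[OF _ _ v G] by (cases "t \<in> {0<..<T}") (auto simp: algebra_simps)
    qed
  qed
  then show ?thesis
    unfolding J_def set_lebesgue_integral_def
    using J_pairing(4)[OF a v m] J_pairing(4)[OF b G m] by simp
qed

text \<open>The right-hand side of the momentum equation, paired with a test field and its gradient:
  force in the first slot, pressure times identity minus viscous stress in the second.\<close>

definition Fw :: "real^'n \<Rightarrow> real \<Rightarrow> (real^'n) \<times> (real^'n^'n)" where
  "Fw x t = (\<rho>0 *\<^sub>R f x t, q x t *\<^sub>R mat 1 - \<mu> *\<^sub>R Gw x t)"

lemma qI: "L2Q D T (\<lambda>x t. q x t *\<^sub>R (mat 1 :: real^'n^'n))"
  by (rule L2Q_bounded_linear[OF bounded_linear_scaleR_left q])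

lemma Fw: "L2Q D T Fw"
  unfolding Fw_def[abs_def] by (intro L2Q_Pair L2Q_diff L2Q_scaleR f Gw qI)

text \<open>The distributional equation is tested with \<psi>(t) v(x). The pressure term becomes a
  pairing with grad v by the trace identity, and the Laplacian is integrated by parts once on almost
  every slice.\<close>

lemma w_test:
  assumes \<psi>: "test_on {0<..<T} \<psi>" and v: "test_on D v"
  shows "- J (\<lambda>x t. \<rho>0 *\<^sub>R w x t) v (deriv \<psi>) = J Fw (\<lambda>x. (v x, gradv v x)) \<psi>"
proof -
  have s: "smooth \<psi>" "smooth v" "smooth (pdx i v)" for i
    using \<psi> v test_on_pdx[OF v] by (auto simp: test_on_def)
  obtain B where B: "\<And>t. \<bar>\<psi> t\<bar> \<le> B" using test_on_bounded[OF \<psi>] by auto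
  obtain B' where B': "\<And>t. \<bar>deriv \<psi> t\<bar> \<le> B'" using test_on_bounded[OF test_on_deriv[OF \<psi>]] by auto
  have m: "\<psi> \<in> borel_measurable borel" "deriv \<psi> \<in> borel_measurable borel"
    using test_on_L2(3)[OF \<psi>] test_on_L2(3)[OF test_on_deriv[OF \<psi>]] by auto
  have vL: "L2D D v" "L2D D (gradv v)" "L2D D (lap v)" "L2D D (divv v)"
    using test_on_L2D(1)[OF v] gradv_test(1)[OF v] lap_L2D[OF v] L2D_bounded_linear[OF trG_linear gradv_test(1)[OF v]]
    by (simp_all add: trG_gradv)
  have d1: "dd (0,1) (tensor \<psi> v) (x, t) = deriv \<psi> t *\<^sub>R v x" for x t
  proof -
    have "dd 0 v x = 0" using linear_0[OF has_derivative_linear[OF smooth_has_derivative[OF s(2)]]] .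
    then show ?thesis by (simp add: tensor_derivative[OF s(1,2)])
  qed
  have d2: "dd (axis i 1, 0) (tensor \<psi> v) = tensor \<psi> (pdx i v)" for i
    by (rule ext) (simp add: tensor_derivative[OF s(1,2)] tensor_def pdx_def)
  have d3: "dd (axis i 1, 0) (tensor \<psi> (pdx i v)) (x, t) = \<psi> t *\<^sub>R pdx i (pdx i v) x" for i x t
    by (simp add: tensor_derivative[OF s(1,3)], simp add: pdx_def)
  let ?i = "indicator (QT D T) :: _ \<Rightarrow> real"
  note j1 = J_pairing[OF w vL(1) m(2) B'] and j2 = J_pairing[OF q vL(4) m(1) B]
    and j3 = J_pairing[OF w vL(3) m(1) B] and j4 = J_pairing[OF f vL(1) m(1) B]
  have "intQ D T (\<lambda>x t. - \<rho>0 * inner (w x t) (dd (0,1) (tensor \<psi> v) (x,t))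
                       - q x t * (\<Sum>i\<in>UNIV. dd (axis i 1, 0) (tensor \<psi> v) (x,t) $ i))
     = intQ D T (\<lambda>x t. \<mu> * inner (w x t) (\<Sum>i\<in>UNIV. dd (axis i 1, 0) (dd (axis i 1, 0) (tensor \<psi> v)) (x,t))
                       + \<rho>0 * inner (f x t) (tensor \<psi> v (x,t)))"
    by (rule S_dist[OF test_on_tensor[OF \<psi> v]])
  also have "(\<lambda>x t. - \<rho>0 * inner (w x t) (dd (0,1) (tensor \<psi> v) (x,t))
                       - q x t * (\<Sum>i\<in>UNIV. dd (axis i 1, 0) (tensor \<psi> v) (x,t) $ i))
      = (\<lambda>x t. - \<rho>0 * (w x t \<bullet> (deriv \<psi> t *\<^sub>R v x)) - q x t \<bullet> (\<psi> t *\<^sub>R divv v x))"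
    by (simp add: d1 d2 tensor_def divv_def sum_distrib_left)
  also have "(\<lambda>x t. \<mu> * inner (w x t) (\<Sum>i\<in>UNIV. dd (axis i 1, 0) (dd (axis i 1, 0) (tensor \<psi> v)) (x,t))
                       + \<rho>0 * inner (f x t) (tensor \<psi> v (x,t)))
      = (\<lambda>x t. \<mu> * (w x t \<bullet> (\<psi> t *\<^sub>R lap v x)) + \<rho>0 * (f x t \<bullet> (\<psi> t *\<^sub>R v x)))"
    by (simp add: d2 d3 tensor_def lap_def scaleR_sum_right)
  also have "intQ D T (\<lambda>x t. - \<rho>0 * (w x t \<bullet> (deriv \<psi> t *\<^sub>R v x)) - q x t \<bullet> (\<psi> t *\<^sub>R divv v x))
      = (LBINT p. - \<rho>0 * (?i p * (w (fst p) (snd p) \<bullet> (deriv \<psi> (snd p) *\<^sub>R v (fst p)))) -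
           ?i p * (q (fst p) (snd p) \<bullet> (\<psi> (snd p) *\<^sub>R divv v (fst p))))"
    unfolding intQ_eq by (intro Bochner_Integration.integral_cong refl) (auto simp: algebra_simps split: split_indicator)
  also have "\<dots> = - \<rho>0 * J w v (deriv \<psi>) - J q (divv v) \<psi>"
    using j1(3) j2(3) by (subst Bochner_Integration.integral_diff)
      (auto simp: j1(2)[unfolded intQ_eq] j2(2)[unfolded intQ_eq] simp del: inner_scaleR_right real_scaleR_def inner_real_def)
  also have "intQ D T (\<lambda>x t. \<mu> * (w x t \<bullet> (\<psi> t *\<^sub>R lap v x)) + \<rho>0 * (f x t \<bullet> (\<psi> t *\<^sub>R v x)))
      = (LBINT p. \<mu> * (?i p * (w (fst p) (snd p) \<bullet> (\<psi> (snd p) *\<^sub>R lap v (fst p)))) +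
           \<rho>0 * (?i p * (f (fst p) (snd p) \<bullet> (\<psi> (snd p) *\<^sub>R v (fst p)))))"
    unfolding intQ_eq by (intro Bochner_Integration.integral_cong refl) (auto simp: algebra_simps split: split_indicator)
  also have "\<dots> = \<mu> * J w (lap v) \<psi> + \<rho>0 * J f v \<psi>"
    using j3(3) j4(3) by (subst Bochner_Integration.integral_add)
      (auto simp: j3(2)[unfolded intQ_eq] j4(2)[unfolded intQ_eq] simp del: inner_scaleR_right)
  finally have main: "- \<rho>0 * J w v (deriv \<psi>) - J q (divv v) \<psi> = \<mu> * J w (lap v) \<psi> + \<rho>0 * J f v \<psi>" .
  have "J w (lap v) \<psi> = - J Gw (gradv v) \<psi>"
  proof -
    have "(LBINT t. indicator {0<..<T} t * (ipD D (sl w t) (lap v) * \<psi> t)) =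
       (LBINT t. - (indicator {0<..<T} t * (ipD D (sl Gw t) (gradv v) * \<psi> t)))"
    proof (rule integral_cong_AE)
      show "(\<lambda>t. indicator {0<..<T} t * (ipD D (sl w t) (lap v) * \<psi> t)) \<in> borel_measurable lborel"
        using j3(4) by simp
      show "(\<lambda>t. - (indicator {0<..<T} t * (ipD D (sl Gw t) (gradv v) * \<psi> t))) \<in> borel_measurable lborel"
        using J_pairing(4)[OF Gw vL(2) m(1) B] by (intro borel_measurable_uminus) simp
      show "AE t in lborel. indicator {0<..<T} t * (ipD D (sl w t) (lap v) * \<psi> t) =
        - (indicator {0<..<T} t * (ipD D (sl Gw t) (gradv v) * \<psi> t))"
        using w_Vsp
      proof eventually_elim
        case (elim t)
        then show ?case using H01_Laplace[OF Vsp_H01 v] by (cases "t \<in> {0<..<T}") auto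
      qed
    qed
    then show ?thesis unfolding J_def set_lebesgue_integral_def by simp
  qed
  moreover have "J q (divv v) \<psi> = J (\<lambda>x t. q x t *\<^sub>R mat 1) (gradv v) \<psi>"
    unfolding J_def by (simp add: ipD_trG[symmetric] trG_gradv)
  moreover have "J Fw (\<lambda>x. (v x, gradv v x)) \<psi> = \<rho>0 * J f v \<psi> + (J (\<lambda>x t. q x t *\<^sub>R mat 1) (gradv v) \<psi> - \<mu> * J Gw (gradv v) \<psi>)"
  proof -
    have "J Fw (\<lambda>x. (v x, gradv v x)) \<psi> = J (\<lambda>x t. \<rho>0 *\<^sub>R f x t) v \<psi> + J (\<lambda>x t. q x t *\<^sub>R mat 1 - \<mu> *\<^sub>R Gw x t) (gradv v) \<psi>"
      unfolding Fw_def[abs_def]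
      by (rule J_Pair[OF L2Q_scaleR[OF f] L2Q_diff[OF qI L2Q_scaleR[OF Gw]] vL(1,2) m(1) B])
    moreover have "J (\<lambda>x t. q x t *\<^sub>R mat 1 - \<mu> *\<^sub>R Gw x t) (gradv v) \<psi> =
       J (\<lambda>x t. q x t *\<^sub>R mat 1) (gradv v) \<psi> + J (\<lambda>x t. (- \<mu>) *\<^sub>R Gw x t) (gradv v) \<psi>"
      using J_add[OF qI L2Q_scaleR[OF Gw, of "- \<mu>"] vL(2) m(1) B] by simp
    ultimately show ?thesis by (simp only: J_scaleR)
  qed
  ultimately show ?thesis using main by (simp only: J_scaleR)
qed

lemma w_H01_test:
  fixes \<psi> :: "real \<Rightarrow> real"
  assumes \<psi>: "test_on {0<..<T} \<psi>" and v: "H01 D v G"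
  shows "- J (\<lambda>x t. \<rho>0 *\<^sub>R w x t) v (deriv \<psi>) = J Fw (\<lambda>x. (v x, G x)) \<psi>"
proof -
  obtain B where B: "\<And>t. \<bar>\<psi> t\<bar> \<le> B" using test_on_bounded[OF \<psi>] by auto
  obtain B' where B': "\<And>t. \<bar>deriv \<psi> t\<bar> \<le> B'" using test_on_bounded[OF test_on_deriv[OF \<psi>]] by auto
  have b: "\<bar>\<psi> t\<bar> \<le> max B B'" "\<bar>deriv \<psi> t\<bar> \<le> max B B'" for t using B[of t] B'[of t] by auto
  show ?thesis
    by (rule J_eq_H01[OF L2Q_scaleR[OF w] Fw test_on_L2(3)[OF \<psi>] b(1) test_on_L2(3)[OF test_on_deriv[OF \<psi>]] b(2) w_test[OF \<psi>] v])
qed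

lemma w_primitive:
  assumes v: "H01 D v G"
  shows "\<exists>k. AE t\<in>{0<..<T} in lborel. ipD D (\<lambda>x. \<rho>0 *\<^sub>R w x t) v =
      k + (LBINT r. indicator {0<..<t} r * ipD D (sl Fw r) (\<lambda>x. (v x, G x)))"
  by (rule weak_imp_primitive[OF L2Q_scaleR[OF w] H01_L2D(1)[OF v] Fw L2D_Pair[OF H01_L2D[OF v]] w_H01_test[OF _ v]])

end

context space_time
begin

text \<open>Functions in \<open>test0T\<close> may be unbounded for negative t. Cutting them off
  outside (0, T) leaves the pairing unchanged and makes them bounded multipliers.\<close>

lemma J_truncate: "J a v (\<lambda>t. indicator {0<..<T} t * \<phi> t) = J a v \<phi>"
  for a :: "real^'n \<Rightarrow> real \<Rightarrow> 'b::euclidean_space"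
  unfolding J_def set_lebesgue_integral_def
  by (intro Bochner_Integration.integral_cong) (auto split: split_indicator)

lemma truncate_bounded:
  fixes \<phi> :: "real \<Rightarrow> real"
  assumes "continuous_on UNIV \<phi>"
  shows "(\<lambda>t. indicator {0<..<T} t * \<phi> t) \<in> borel_measurable borel"
    and "\<exists>B. \<forall>t. \<bar>indicator {0<..<T} t * \<phi> t\<bar> \<le> B"
proof -
  have [measurable]: "\<phi> \<in> borel_measurable borel" using assms by (rule borel_measurable_continuous_onI)
  show "(\<lambda>t. indicator {0<..<T} t * \<phi> t) \<in> borel_measurable borel" by measurable
  have "bounded (\<phi> ` {0..T})"
    by (intro compact_imp_bounded compact_continuous_image continuous_on_subset[OF assms]) auto
  then obtain B where B: "\<forall>t\<in>{0..T}. \<bar>\<phi> t\<bar> \<le> B" by (auto simp: bounded_iff)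
  have "\<bar>indicator {0<..<T} t * \<phi> t\<bar> \<le> max B 0" for t
  proof (cases "t \<in> {0<..<T}")
    case True
    then have "\<bar>\<phi> t\<bar> \<le> B" using B by auto
    then show ?thesis using True by simp
  qed simp
  then show "\<exists>B. \<forall>t. \<bar>indicator {0<..<T} t * \<phi> t\<bar> \<le> B" by blast
qed

text \<open>The integral in time of the zero extension represents the averaged functional. It also
  serves to produce the trace q0 and to turn time-averaged pressures into functions on D.\<close>

lemma time_mean:
  fixes g :: "real^'n \<Rightarrow> real \<Rightarrow> real"
  assumes g: "L2Q D T g"
  shows "\<exists>m. L2D D m \<and> (\<forall>r. L2D D r \<longrightarrow> ipD D m r = (LBINT t. indicator {0<..<T} t * ipD D (sl g t) r))"
proof -
  have L: "L2 lborel (exQ g)" using g by (simp add: L2Q_iff)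
  have [measurable]: "exQ g \<in> borel_measurable borel" using L2_meas[OF L] by simp
  define m where "m x = (LBINT t. exQ g (x, t))" for x
  have slice: "AE x in lborel. L2 lborel (\<lambda>t. exQ g (x, t))"
    using lborel_AE_integrable_fst[OF L2_int[OF L]] by eventually_elim (simp add: L2_def)
  have m_out: "m x = 0" if "x \<notin> D" for x using that by (simp add: m_def exQ_def)
  then have exm: "ex m = m" by (auto simp: ex_def split: split_indicator)
  have [measurable]: "m \<in> borel_measurable borel" unfolding m_def by measurable
  have mL: "L2 lborel m"
  proof (rule L2I_bound)
    show "integrable lborel (\<lambda>x. T * (LBINT t. (norm (exQ g (x, t)))\<^sup>2))"
      by (intro integrable_mult_right lborel_integrable_fst L2_int[OF L])
    show "AE x in lborel. (norm (m x))\<^sup>2 \<le> T * (LBINT t. (norm (exQ g (x, t)))\<^sup>2)"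
      using slice
    proof eventually_elim
      case (elim x)
      from norm_integral_sq_le(2)[OF this T] show ?case by (simp add: m_def nsq_def exQ_slice)
    qed
  qed simp
  have "ipD D m r = (LBINT t. indicator {0<..<T} t * ipD D (sl g t) r)" if r: "L2D D r" for r
  proof -
    have R: "L2Q D T (\<lambda>x t. 1 *\<^sub>R r x)" by (rule L2Q_tensor[OF r]) auto
    have RL: "L2 lborel (exQ (\<lambda>x t. r x))" using R by (simp add: L2Q_iff)
    note i = L2_inner_integrable[OF L RL]
    have [measurable]: "ex r \<in> borel_measurable borel" using L2_meas[OF L2D_ex[OF r]] by simp
    have "ipD D m r = (LBINT x. m x * ex r x)" by (simp add: ipD_eq exm)
    also have "\<dots> = (LBINT x. (LBINT t. exQ g (x, t) \<bullet> exQ (\<lambda>x t. r x) (x, t)))"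
    proof (rule integral_cong_AE)
      show "AE x in lborel. m x * ex r x = (LBINT t. exQ g (x, t) \<bullet> exQ (\<lambda>x t. r x) (x, t))"
      proof (intro AE_I2)
        fix x
        have "exQ g (x, t) \<bullet> exQ (\<lambda>x t. r x) (x, t) = exQ g (x, t) * ex r x" for t
          by (cases "t \<in> {0<..<T}") (auto simp: exQ_slice)
        then show "m x * ex r x = (LBINT t. exQ g (x, t) \<bullet> exQ (\<lambda>x t. r x) (x, t))"
          by (simp only: m_def integral_mult_left_zero)
      qed
      show "(\<lambda>x. LBINT t. exQ g (x, t) \<bullet> exQ (\<lambda>x t. r x) (x, t)) \<in> borel_measurable lborel"
        using lborel_integrable_fst[OF i] by auto
    qed measurable
    also have "\<dots> = (LBINT t. (LBINT x. exQ g (x, t) \<bullet> exQ (\<lambda>x t. r x) (x, t)))"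
      by (rule lborel_integral_swap[OF i, symmetric])
    finally show ?thesis by (simp only: ipD_slice)
  qed
  then show ?thesis using mL exm by (intro exI[of _ m]) (auto simp: L2D_iff)
qed

lemma partial_integral_restrict:
  assumes "t \<le> T"
  shows "(LBINT r. indicator {0<..<t} r * (k r :: real)) = (LBINT r. indicator {0<..<t} r * (indicator {0<..<T} r * k r))"
  using assms by (intro Bochner_Integration.integral_cong) (auto split: split_indicator)

end

context limit_problem
begin

text \<open>The flux without pressure, which is all that divergence-free test fields see.\<close>

definition FV :: "real^'n \<Rightarrow> real \<Rightarrow> (real^'n) \<times> (real^'n^'n)" where
  "FV x t = (\<rho>0 *\<^sub>R f x t, (- \<mu>) *\<^sub>R Gw x t)"

lemma FV: "L2Q D T FV"
  unfolding FV_def[abs_def] by (intro L2Q_Pair L2Q_scaleR f Gw)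

lemma w_V_primitive:
  assumes v: "Vsp D v G"
  shows "AE t\<in>{0<..<T} in lborel. ipD D (\<lambda>x. \<rho>0 *\<^sub>R w x t) v = \<rho>0 * ipD D u0 v +
      (LBINT r. indicator {0<..<t} r * ipD D (sl FV r) (\<lambda>x. (v x, G x)))"
proof -
  note L = H01_L2D[OF Vsp_H01[OF v]]
  show ?thesis
  proof (rule weak_imp_primitive0[OF L2Q_scaleR[OF w] L(1) FV L2D_Pair[OF L]])
    fix \<phi> assume \<phi>: "test0T T \<phi>"
    define \<psi> where "\<psi> t = indicator {0<..<T} t * \<phi> t" for t
    have c: "continuous_on UNIV \<phi>" using \<phi> smooth_continuous by (auto simp: test0T_def)
    obtain B where B: "\<And>t. \<bar>\<psi> t\<bar> \<le> B" using truncate_bounded(2)[OF c] by (auto simp: \<psi>_def)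
    have m: "\<psi> \<in> borel_measurable borel" using truncate_bounded(1)[OF c] by (simp add: \<psi>_def[abs_def])
    have "J FV (\<lambda>x. (v x, G x)) \<psi> = J (\<lambda>x t. \<rho>0 *\<^sub>R f x t) v \<psi> + J (\<lambda>x t. (- \<mu>) *\<^sub>R Gw x t) G \<psi>"
      unfolding FV_def[abs_def] by (rule J_Pair[OF L2Q_scaleR[OF f] L2Q_scaleR[OF Gw] L m B])
    then have "J FV (\<lambda>x. (v x, G x)) \<phi> = J (\<lambda>x t. \<rho>0 *\<^sub>R f x t) v \<phi> - \<mu> * J Gw G \<phi>"
      unfolding J_scaleR by (simp add: \<psi>_def[abs_def] J_truncate)
    then show "- J (\<lambda>x t. \<rho>0 *\<^sub>R w x t) v (deriv \<phi>) - \<rho>0 * ipD D u0 v * \<phi> 0 = J FV (\<lambda>x. (v x, G x)) \<phi>"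
      using S_V[OF \<phi> v] by (simp add: J_def ipD_scaleR_left)
  qed
qed

text \<open>Each w(t) is divergence free and hence admissible in its own equation. Only the
  integrability of k is kept, since the bound is used for t near 0.\<close>

lemma w_energy:
  "\<exists>k. integrable lborel k \<and> (AE t\<in>{0<..<T} in lborel.
     ipDt w w t \<le> ipD D u0 u0 + 2 * (prim k t))"
proof -
  define F where "F x t = (1 / \<rho>0) *\<^sub>R FV x t" for x t
  have F: "L2Q D T F" unfolding F_def[abs_def] by (rule L2Q_scaleR[OF FV])
  define Y where "Y x t = (w x t, Gw x t)" for x t
  have Y: "L2Q D T Y" unfolding Y_def[abs_def] by (rule L2Q_Pair[OF w Gw])
  define k where "k r = indicator {0<..<T} r * ipDt F Y r" for r
  have k: "integrable lborel k" unfolding k_def[abs_def] by (rule pairing_eq(2)[OF F Y])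
  have "AE t\<in>{0<..<T} in lborel. ipDt w w t \<le> ipD D u0 u0
    + 2 * (LBINT r. indicator {0<..<t} r * ipDt F Y r)"
  proof (rule energy_Q[OF w Y F u0, where K="\<lambda>v V. \<exists>G. Vsp D v G \<and> V = (\<lambda>x. (v x, G x))"])
    show "AE s\<in>{0<..<T} in lborel. (\<exists>G. Vsp D (sl w s) G \<and> (sl Y s) = (\<lambda>x. (w x s, G x)))"
      using w_Vsp by eventually_elim (auto simp: Y_def)
    fix v V assume "\<exists>G. Vsp D v G \<and> V = (\<lambda>x. (v x, G x))"
    then obtain G where v: "Vsp D v G" and V: "V = (\<lambda>x. (v x, G x))" by blast
    show "AE t\<in>{0<..<T} in lborel. ipD D (sl w t) v =
        ipD D u0 v + (LBINT r. indicator {0<..<t} r * ipD D (sl F r) V)"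
      using w_V_primitive[OF v]
    proof eventually_elim
      case (elim t)
      show ?case
      proof
        assume "t \<in> {0<..<T}"
        with elim have e: "\<rho>0 * ipD D (sl w t) v = \<rho>0 * ipD D u0 v +
          (LBINT r. indicator {0<..<t} r * ipD D (sl FV r) V)" by (simp add: ipD_scaleR_left V)
        have "(LBINT r. indicator {0<..<t} r * ipD D (sl F r) V) =
          (LBINT r. (1 / \<rho>0) * (indicator {0<..<t} r * ipD D (sl FV r) V))"
          by (simp only: F_def ipD_scaleR_left mult.left_commute)
        also have "\<dots> = (1 / \<rho>0) * (LBINT r. indicator {0<..<t} r * ipD D (sl FV r) V)"
          by (rule integral_mult_right_zero)
        finally show "ipD D (sl w t) v =
          ipD D u0 v + (LBINT r. indicator {0<..<t} r * ipD D (sl F r) V)"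
        proof -
          have "(LBINT r. indicator {0<..<t} r * ipD D (sl FV r) V) =
              \<rho>0 * (LBINT r. indicator {0<..<t} r * ipD D (sl F r) V)"
            using \<open>(LBINT r. indicator {0<..<t} r * ipD D (sl F r) V) = _\<close> \<rho>0 by simp
          with e have "\<rho>0 * ipD D (sl w t) v =
              \<rho>0 * (ipD D u0 v + (LBINT r. indicator {0<..<t} r * ipD D (sl F r) V))"
            by (simp only: distrib_left)
          then show ?thesis using \<rho>0 by (simp only: mult_cancel_left) simp
        qed
      qed
    qed
  qed
  then have "AE t\<in>{0<..<T} in lborel. ipDt w w t \<le> ipD D u0 u0
    + 2 * (prim k t)"
  proof eventually_elim
    case (elim t)
    then show ?case using partial_integral_restrict[of t "\<lambda>r. ipDt F Y r"] by (simp add: k_def)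
  qed
  then show ?thesis using k by blast
qed

text \<open>\<open>w(t) \<rightarrow> u0\<close> strongly: the energy inequality bounds \<open>limsup |w(t)|\<close> by \<open>|u0|\<close>, and
  \<open>(w(t), u0) \<rightarrow> |u0|\<^sup>2\<close> because \<open>u0\<close> is a limit of divergence-free test functions.\<close>

lemma w_initial:
  assumes e: "e > 0"
  shows "\<exists>\<delta>::real>0. \<delta> \<le> T \<and> (AE t in lborel. t \<in> {0<..<\<delta>} \<longrightarrow>
     ipD D (\<lambda>x. w x t - u0 x) (\<lambda>x. w x t - u0 x) \<le> e)"
proof -
  obtain k where k: "integrable lborel k"
    and kb: "AE t\<in>{0<..<T} in lborel. ipDt w w t \<le> ipD D u0 u0 + 2 * (prim k t)"
    using w_energy by blast
  obtain \<phi> where \<phi>: "\<And>j::nat. test_on D (\<phi> j)" "\<And>j x. divv (\<phi> j) x = 0" "(\<lambda>j. distD D (\<phi> j) u0) \<longlonglongrightarrow> 0"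
    using Ju0 by (auto simp: Jsp_def)
  define n0 where "n0 = ipD D u0 u0"
  have n0: "n0 \<ge> 0" by (simp add: n0_def ipD_self_nonneg)
  \<comment> \<open>The factor n0 + 1 anticipates the bound |w(t)|^2 \<le> |u0|^2 + 1 for small t,
    so one approximant of u0 serves for both w(t) and u0.\<close>
  have "(\<lambda>j. sqrt (n0 + 1) * sqrt (distD D (\<phi> j) u0)) \<longlonglongrightarrow> sqrt (n0 + 1) * sqrt 0"
    by (intro tendsto_intros \<phi>)
  then have "\<forall>\<^sub>F j in sequentially. sqrt (n0 + 1) * sqrt (distD D (\<phi> j) u0) < e / 16"
    using e by (intro order_tendstoD) auto
  then obtain j where j: "sqrt (n0 + 1) * sqrt (distD D (\<phi> j) u0) < e / 16" by (auto simp: eventually_sequentially)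
  define v where "v = \<phi> j"
  have tv: "test_on D v" and Vv: "Vsp D v (gradv v)" using \<phi> test_on_Vsp by (auto simp: v_def)
  have vL: "L2D D v" by (rule test_on_L2D(1)[OF tv])
  have uvL: "L2D D (\<lambda>x. u0 x - v x)" by (rule L2D_diff[OF u0 vL])
  have duv: "ipD D (\<lambda>x. u0 x - v x) (\<lambda>x. u0 x - v x) = distD D (\<phi> j) u0"
    by (simp add: ipD_self distD_eq v_def ex_diff[abs_def] nsq_commute[of _ "ex u0"])
  define b where "b r = indicator {0<..<T} r * ipD D (sl FV r) (\<lambda>x. (v x, gradv v x))" for r
  have b: "integrable lborel b" unfolding b_def[abs_def] by (rule ipD_L2(2)[OF FV L2D_Pair[OF vL gradv_test(1)[OF tv]]])
  obtain \<delta>1 where \<delta>1: "\<delta>1 > 0" "\<And>t. t < \<delta>1 \<Longrightarrow> \<bar>\<integral>r. indicator {0<..<t} r * k r \<partial>lborel\<bar> \<le> min (1/2) (e / 8)"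
    using small_time_integral[OF k, of "min (1/2) (e/8)"] e by auto
  obtain \<delta>2 where \<delta>2: "\<delta>2 > 0" "\<And>t. t < \<delta>2 \<Longrightarrow> \<bar>\<integral>r. indicator {0<..<t} r * b r \<partial>lborel\<bar> \<le> \<rho>0 * (e / 16)"
    using small_time_integral[OF b, of "\<rho>0 * (e/16)"] e \<rho>0 by auto
  define \<delta> where "\<delta> = min T (min \<delta>1 \<delta>2)"
  have \<delta>: "\<delta> > 0" "\<delta> \<le> T" "\<delta> \<le> \<delta>1" "\<delta> \<le> \<delta>2" using \<delta>1 \<delta>2 T by (auto simp: \<delta>_def)
  have "AE t in lborel. t \<in> {0<..<\<delta>} \<longrightarrow> ipD D (\<lambda>x. w x t - u0 x) (\<lambda>x. w x t - u0 x) \<le> e"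
    using kb w_V_primitive[OF Vv] L2Q_slice[OF w]
  proof eventually_elim
    case (elim t)
    show ?case
    proof
      assume t: "t \<in> {0<..<\<delta>}"
      then have tT: "t \<in> {0<..<T}" and t1: "t < \<delta>1" "t < \<delta>2" using \<delta> by auto
      have wL: "L2D D (sl w t)" using elim tT by simp
      define N where "N = ipDt w w t"
      have N: "N \<le> n0 + e / 4" "N \<le> n0 + 1" using elim(1) tT \<delta>1(2)[OF t1(1)] by (auto simp: N_def n0_def)
      have "\<rho>0 * ipD D (sl w t) v = \<rho>0 * ipD D u0 v + (prim b t)"
        using elim(2) tT partial_integral_restrict[of t "\<lambda>r. ipD D (sl FV r) (\<lambda>x. (v x, gradv v x))"]
        by (simp add: ipD_scaleR_left b_def)
      then have "\<rho>0 * (ipD D (sl w t) v - ipD D u0 v) = (prim b t)"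
        by (simp add: right_diff_distrib)
      then have "\<bar>\<rho>0 * (ipD D (sl w t) v - ipD D u0 v)\<bar> \<le> \<rho>0 * (e / 16)"
        using \<delta>2(2)[OF t1(2)] by (simp only:)
      then have "\<rho>0 * \<bar>ipD D (sl w t) v - ipD D u0 v\<bar> \<le> \<rho>0 * (e / 16)"
        using \<rho>0 by (simp only: abs_mult abs_of_pos)
      then have 1: "\<bar>ipD D (sl w t) v - ipD D u0 v\<bar> \<le> e / 16" using \<rho>0 by simp
      have "\<bar>ipD D (sl w t) (\<lambda>x. u0 x - v x)\<bar> \<le> sqrt N * sqrt (distD D (\<phi> j) u0)"
        using ipD_Cauchy_Schwarz[OF wL uvL] by (simp add: duv N_def)
      also have "\<dots> \<le> sqrt (n0 + 1) * sqrt (distD D (\<phi> j) u0)"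
        using N by (intro mult_right_mono real_sqrt_le_mono) (auto simp: distD_eq nsq_nonneg)
      finally have 2: "\<bar>ipD D (sl w t) (\<lambda>x. u0 x - v x)\<bar> \<le> e / 16" using j by simp
      have "\<bar>ipD D u0 (\<lambda>x. u0 x - v x)\<bar> \<le> sqrt n0 * sqrt (distD D (\<phi> j) u0)"
        using ipD_Cauchy_Schwarz[OF u0 uvL] by (simp add: duv n0_def)
      also have "\<dots> \<le> sqrt (n0 + 1) * sqrt (distD D (\<phi> j) u0)"
        by (intro mult_right_mono real_sqrt_le_mono) (auto simp: distD_eq nsq_nonneg)
      finally have 3: "\<bar>ipD D u0 (\<lambda>x. u0 x - v x)\<bar> \<le> e / 16" using j by simp
      \<comment> \<open>Three errors of e/16: the equation tested with v, and the replacement of u0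
        by v in each of the two products. Together with N \<le> n0 + e/4 the squared distance is at
        most 5e/8.\<close>
      have 4: "ipD D (sl w t) u0 \<ge> n0 - 3 * (e / 16)"
        using 1 2 3 ipD_diff_right[OF wL u0 vL] ipD_diff_right[OF u0 u0 vL] unfolding n0_def by linarith
      have "ipD D (\<lambda>x. w x t - u0 x) (\<lambda>x. w x t - u0 x) = N - 2 * ipD D (sl w t) u0 + n0"
        using nsq_diff[OF L2D_ex[OF wL] L2D_ex[OF u0]] by (simp add: ipD_self ex_diff[abs_def] N_def n0_def ipD_eq nsq_inner)
      then show "ipD D (\<lambda>x. w x t - u0 x) (\<lambda>x. w x t - u0 x) \<le> e" using N(1) 4 e by linarith
    qed
  qed
  then show ?thesis using \<delta> by blast
qed

text \<open>For general H_0^1 fields the distributional equation leaves a constant undetermined, and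
  the initial condition of (S) speaks of divergence-free fields only. Strong convergence of w(t) to
  u0 fixes the constant for every v.\<close>

theorem w_equation:
  assumes v: "H01 D v G"
  shows "AE t\<in>{0<..<T} in lborel. \<rho>0 * ipD D (sl w t) v =
      \<rho>0 * ipD D u0 v + (LBINT r. indicator {0<..<t} r * ipD D (sl Fw r) (\<lambda>x. (v x, G x)))"
proof -
  note L = H01_L2D[OF v]
  obtain c where c: "AE t\<in>{0<..<T} in lborel. ipD D (\<lambda>x. \<rho>0 *\<^sub>R w x t) v =
      c + (LBINT r. indicator {0<..<t} r * ipD D (sl Fw r) (\<lambda>x. (v x, G x)))"
    using w_primitive[OF v] by blast
  define b where "b r = indicator {0<..<T} r * ipD D (sl Fw r) (\<lambda>x. (v x, G x))" for r
  have b: "integrable lborel b" unfolding b_def[abs_def] by (rule ipD_L2(2)[OF Fw L2D_Pair[OF L]])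
  have "c - \<rho>0 * ipD D u0 v = 0"
  proof (rule eq_of_AE_near_zero)
    fix e :: real assume e: "e > 0"
    define nv where "nv = sqrt (ipD D v v)"
    have nv: "nv \<ge> 0" by (simp add: nv_def ipD_self_nonneg)
    \<comment> \<open>Chosen so that \<open>\<rho>0\<close> times the distance of w(t) from u0 times
      |v| is at most e/2; adding 1 to the norm avoids a division by zero.\<close>
    define e' where "e' = (e / (2 * \<rho>0 * (nv + 1)))\<^sup>2"
    have e': "e' > 0" using e \<rho>0 nv by (auto simp: e'_def intro!: zero_less_power divide_pos_pos mult_pos_pos)
    obtain \<delta>1 :: real where \<delta>1: "\<delta>1 > 0" "\<delta>1 \<le> T" and AE1: "AE t in lborel. t \<in> {0<..<\<delta>1} \<longrightarrow>
       ipD D (\<lambda>x. w x t - u0 x) (\<lambda>x. w x t - u0 x) \<le> e'"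
      using w_initial[OF e'] by blast
    obtain \<delta>2 where \<delta>2: "\<delta>2 > 0" "\<And>t. t < \<delta>2 \<Longrightarrow> \<bar>\<integral>r. indicator {0<..<t} r * b r \<partial>lborel\<bar> \<le> e / 2"
      using small_time_integral[OF b, of "e/2"] e by auto
    define \<delta> where "\<delta> = min \<delta>1 \<delta>2"
    have "AE t in lborel. t \<in> {0<..<\<delta>} \<longrightarrow> \<bar>c - \<rho>0 * ipD D u0 v\<bar> \<le> e"
      using AE1 c L2Q_slice[OF w]
    proof eventually_elim
      case (elim t)
      show ?case
      proof
        assume "t \<in> {0<..<\<delta>}"
        then have t: "t \<in> {0<..<T}" "t \<in> {0<..<\<delta>1}" "t < \<delta>2" using \<delta>1 by (auto simp: \<delta>_def)
        have wL: "L2D D (sl w t)" using elim t by simp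
        have eq: "\<rho>0 * ipD D (sl w t) v = c + (prim b t)"
          using elim(2) t partial_integral_restrict[of t "\<lambda>r. ipD D (sl Fw r) (\<lambda>x. (v x, G x))"]
          by (simp add: ipD_scaleR_left b_def)
        have "\<bar>ipD D (\<lambda>x. w x t - u0 x) v\<bar> \<le> sqrt (ipD D (\<lambda>x. w x t - u0 x) (\<lambda>x. w x t - u0 x)) * nv"
          unfolding nv_def by (rule ipD_Cauchy_Schwarz[OF L2D_diff[OF wL u0] L(1)])
        also have "\<dots> \<le> sqrt e' * nv" using elim(1) t nv by (intro mult_right_mono real_sqrt_le_mono) auto
        also have "sqrt e' = e / (2 * \<rho>0 * (nv + 1))" unfolding e'_def using e \<rho>0 nv by (intro real_sqrt_unique) auto
        also have "e / (2 * \<rho>0 * (nv + 1)) * nv \<le> e / (2 * \<rho>0 * (nv + 1)) * (nv + 1)"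
          using e \<rho>0 nv by (intro mult_left_mono divide_nonneg_nonneg) auto
        also have "\<dots> = e / (2 * \<rho>0)" using nv by simp
        finally have "\<rho>0 * \<bar>ipD D (\<lambda>x. w x t - u0 x) v\<bar> \<le> e / 2" using \<rho>0 by (simp add: field_simps)
        then have "\<bar>\<rho>0 * ipD D (sl w t) v - \<rho>0 * ipD D u0 v\<bar> \<le> e / 2"
          using \<rho>0 by (simp add: ipD_diff_left[OF wL u0 L(1)] abs_mult flip: right_diff_distrib)
        then show "\<bar>c - \<rho>0 * ipD D u0 v\<bar> \<le> e" using eq \<delta>2(2)[OF t(3)] by linarith
      qed
    qed
    moreover have "\<delta> > 0" using \<delta>1 \<delta>2 by (simp add: \<delta>_def)
    ultimately show "\<exists>\<delta>::real>0. AE t in lborel. t \<in> {0<..<\<delta>} \<longrightarrow> \<bar>c - \<rho>0 * ipD D u0 v\<bar> \<le> e" by blast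
  qed
  then show ?thesis using c by (simp add: ipD_scaleR_left)
qed

subsection \<open>The initial value of the pressure\<close>

lemma q_primitive:
  assumes r: "L2D D r"
  shows "\<exists>k. AE t\<in>{0<..<T} in lborel. ipD D (sl q t) r =
      k + (LBINT s. indicator {0<..<t} s * ipD D (sl qt s) r)"
proof (rule weak_imp_primitive[OF q r qt r])
  fix \<psi> :: "real \<Rightarrow> real" assume "test_on {0<..<T} \<psi>"
  from q_weak[OF this r] show "- J q r (deriv \<psi>) = J qt r \<psi>" by (simp add: J_def)
qed

text \<open>The trace of q at t = 0. For each r the constant of \<open>q_primitive\<close> is linear
  in r, and averaging q minus the primitive of qt over (0, T) exhibits it as the pairing with a
  single function.\<close>

lemma q_initial:
  "\<exists>q0. L2D D q0 \<and> (\<forall>r. L2D D r \<longrightarrow> (AE t\<in>{0<..<T} in lborel. ipD D (sl q t) r =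
      ipD D q0 r + (LBINT s. indicator {0<..<t} s * ipD D (sl qt s) r)))"
proof -
  \<comment> \<open>Integrating the primitive of qt over (0, T) gives qt the weight T - t; hence T
    q0 is the time integral of q - (T - t) qt.\<close>
  define c where "c t = indicator {0<..<T} t * (T - t)" for t
  have [measurable]: "c \<in> borel_measurable borel" unfolding c_def by measurable
  have cb: "\<bar>c t\<bar> \<le> T" for t using T by (auto simp: c_def split: split_indicator)
  have cqt: "L2Q D T (\<lambda>x t. c t *\<^sub>R qt x t)"
    unfolding L2Q_iff
  proof
    have [measurable]: "(\<lambda>p. qt (fst p) (snd p)) \<in> borel_measurable borel" using qt by (simp add: L2Q_iff)
    show "(\<lambda>p. c (snd p) *\<^sub>R qt (fst p) (snd p)) \<in> borel_measurable borel" by measurable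
    have "L2 lborel (\<lambda>p. c (snd p) *\<^sub>R exQ qt p)"
      by (rule L2_mult_bounded[where B=T]) (use qt cb in \<open>auto simp: L2Q_iff\<close>)
    then show "L2 lborel (exQ (\<lambda>x t. c t *\<^sub>R qt x t))" by (simp add: exQ_def[abs_def] mult.left_commute)
  qed
  obtain m where m: "L2D D m" and mr: "\<And>r. L2D D r \<Longrightarrow>
      ipD D m r = (LBINT t. indicator {0<..<T} t * ipD D (\<lambda>x. q x t - c t *\<^sub>R qt x t) r)"
    using time_mean[OF L2Q_diff[OF q cqt]] by blast
  define q0 where "q0 x = (1 / T) *\<^sub>R m x" for x
  have q0: "L2D D q0" unfolding q0_def[abs_def] by (rule L2D_scaleR[OF m])
  have "AE t\<in>{0<..<T} in lborel. ipD D (sl q t) r =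
      ipD D q0 r + (LBINT s. indicator {0<..<t} s * ipD D (sl qt s) r)" if r: "L2D D r" for r
  proof -
    obtain k where k: "AE t\<in>{0<..<T} in lborel. ipD D (sl q t) r =
      k + (LBINT s. indicator {0<..<t} s * ipD D (sl qt s) r)"
      using q_primitive[OF r] by blast
    define b where "b s = indicator {0<..<T} s * ipD D (sl qt s) r" for s
    have b: "integrable lborel b" unfolding b_def[abs_def] by (rule ipD_L2(2)[OF qt r])
    have [measurable]: "b \<in> borel_measurable borel" using b by auto
    define K where "K t = (prim b t)" for t
    have [measurable]: "K \<in> borel_measurable borel" and Kb: "\<bar>K t\<bar> \<le> (LBINT r. \<bar>b r\<bar>)" for t
      using box_partial_integral_measurable[OF b] by (simp_all add: K_def[abs_def])
    have Ki: "integrable lborel (\<lambda>t. indicator {0<..<T} t * K t)"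
    proof (rule Bochner_Integration.integrable_bound)
      show "integrable lborel (\<lambda>t. indicator {0<..<T} t * (LBINT r. \<bar>b r\<bar>))"
        using T by (intro integrable_mult_left integrable_real_indicator) auto
      show "AE t in lborel. norm (indicator {0<..<T} t * K t) \<le> norm (indicator {0<..<T} t * (LBINT r. \<bar>b r\<bar>))"
      proof (intro AE_I2)
        fix t show "norm (indicator {0<..<T} t * K t) \<le> norm (indicator {0<..<T} t * (LBINT r. \<bar>b r\<bar>))"
          using Kb[of t] by (auto split: split_indicator)
      qed
    qed measurable
    have cb_i: "integrable lborel (\<lambda>t. c t * b t)"
      by (rule Bochner_Integration.integrable_bound[OF integrable_mult_right[OF b, of T]])
         (use cb T in \<open>auto simp: abs_mult intro!: mult_right_mono\<close>)
    \<comment> \<open>Fubini on the triangle s < t < T produces the weight T - s.\<close>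
    have swap: "(prim K T) = (LBINT t. c t * b t)"
    proof -
      define H where "H p = indicator {0<..<snd p} (fst p) * (b (fst p) * indicator {0<..<T} (snd p))" for p :: "real \<times> real"
      have [measurable]: "(fst :: real \<times> real \<Rightarrow> _) \<in> borel_measurable borel"
          "(snd :: real \<times> real \<Rightarrow> _) \<in> borel_measurable borel"
        by (auto intro!: borel_measurable_continuous_onI continuous_intros)
      have Hi: "integrable lborel H"
      proof (rule Bochner_Integration.integrable_bound)
        show "integrable lborel (\<lambda>p::real \<times> real. b (fst p) * indicator {0<..<T} (snd p))"
          using T by (intro integrable_lborel_tensor b integrable_real_indicator) auto
        have "Measurable.pred borel (\<lambda>q::real\<times>real. fst q \<in> {0<..<snd q})" by simp
        then have "(\<lambda>q::real\<times>real. indicator {0<..<snd q} (fst q) :: real) \<in> borel_measurable borel"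
          unfolding indicator_def by simp
        then show "H \<in> borel_measurable lborel" unfolding H_def by simp
      qed (auto simp: H_def split: split_indicator)
      have 1: "(LBINT s. H (s, t)) = indicator {0<..<T} t * K t" for t
      proof -
        have "(LBINT s. H (s, t)) = (LBINT s. indicator {0<..<T} t * (indicator {0<..<t} s * b s))"
          by (intro Bochner_Integration.integral_cong) (auto simp: H_def)
        also have "\<dots> = indicator {0<..<T} t * K t" unfolding K_def by (rule integral_mult_right_zero)
        finally show ?thesis .
      qed
      have 2: "(LBINT t. H (s, t)) = c s * b s" for s
      proof (cases "s \<in> {0<..<T}")
        case True
        have "(LBINT t. H (s, t)) = (LBINT t. b s * indicator {s<..<T} t)"
          by (intro Bochner_Integration.integral_cong) (use True in \<open>auto simp: H_def split: split_indicator\<close>)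
        then show ?thesis using True by (simp add: c_def mult.commute)
      next
        case False
        then show ?thesis by (simp add: H_def b_def)
      qed
      show ?thesis using lborel_integral_swap[OF Hi] by (simp add: 1 2)
    qed
    have "ipD D m r = (LBINT t. k * indicator {0<..<T} t + indicator {0<..<T} t * K t - c t * b t)"
      unfolding mr[OF r]
    proof (rule integral_cong_AE)
      show "(\<lambda>t. indicator {0<..<T} t * ipD D (\<lambda>x. q x t - c t *\<^sub>R qt x t) r) \<in> borel_measurable lborel"
        using ipD_L2(2)[OF L2Q_diff[OF q cqt] r] by (rule borel_measurable_integrable)
      show "AE t in lborel. indicator {0<..<T} t * ipD D (\<lambda>x. q x t - c t *\<^sub>R qt x t) r =
          k * indicator {0<..<T} t + indicator {0<..<T} t * K t - c t * b t"
        using k L2Q_slice[OF q] L2Q_slice[OF qt]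
      proof eventually_elim
        case (elim t)
        show ?case
        proof (cases "t \<in> {0<..<T}")
          case True
          then have L: "L2D D (sl q t)" "L2D D (sl qt t)" using elim by auto
          have "ipD D (sl q t) r = k + K t"
            using elim(1) True partial_integral_restrict[of t "\<lambda>s. ipD D (sl qt s) r"] by (simp add: K_def b_def)
          then show ?thesis using True ipD_diff_left[OF L(1) L2D_scaleR[OF L(2)] r, of "c t"]
            by (simp add: ipD_scaleR_left b_def del: real_scaleR_def)
        qed (simp add: c_def)
      qed
    qed measurable
    also have "\<dots> = k * T" using Ki cb_i swap T by simp
    finally have "ipD D q0 r = k" using T unfolding q0_def ipD_scaleR_left by simp
    then show ?thesis using k by simp
  qed
  then show ?thesis using q0 by blast
qed

end

lemma Gronwall_AE:
  fixes N :: "real \<Rightarrow> real"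
  assumes N: "integrable lborel (\<lambda>t. indicator {0<..<T} t * N t)" "\<And>t. 0 \<le> N t"
    and A: "A \<ge> 0" and C: "C > 0"
    and le: "AE t\<in>{0<..<T} in lborel. N t \<le> A + C * (prim N t)"
  shows "AE t\<in>{0<..<T} in lborel. N t \<le> 2 * A * exp (2 * C * t)"
proof -
  define NT where "NT = (prim N T)"
  have restr: "indicator {0<..<t} r * N r = indicator {0<..<t} r * (indicator {0<..<T} r * N r)" if "t \<le> T" for t r
    using that by (auto split: split_indicator)
  have Ni: "integrable lborel (\<lambda>r. indicator {0<..<t} r * N r)" if "t \<le> T" for t
    unfolding restr[OF that] using integrable_mult_indicator[OF _ N(1), of "{0<..<t}"] by simp
  have NT: "(prim N t) \<le> NT" if "t \<le> T" for t
    unfolding NT_def by (rule integral_mono[OF Ni[OF that] N(1)]) (use that N(2) in \<open>auto split: split_indicator\<close>)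
  have NT0: "NT \<ge> 0" unfolding NT_def by (rule integral_nonneg_AE) (use N(2) in auto)
  define B0 where "B0 = A + C * NT"
  have B0: "B0 \<ge> 0" using A C NT0 by (simp add: B0_def)
  \<comment> \<open>Closed form of the iteration B -> A + B/2 started at the crude bound
    \<open>B0\<close>.\<close>
  have step: "AE t\<in>{0<..<T} in lborel. N t \<le> (2 * A + (B0 - 2 * A) / 2 ^ k) * exp (2 * C * t)" for k :: nat
  proof (induction k)
    case 0
    show ?case using le
    proof eventually_elim
      case (elim t)
      show ?case
      proof
        assume t: "t \<in> {0<..<T}"
        then have "C * (prim N t) \<le> C * NT"
          using NT[of t] C by (intro mult_left_mono) auto
        then have "N t \<le> A + C * NT" using elim t by auto
        also have "\<dots> \<le> B0 * exp (2 * C * t)" using B0 C t mult_left_mono[of 1 "exp (2 * C * t)" B0] by (simp add: B0_def)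
        finally show "N t \<le> (2 * A + (B0 - 2 * A) / 2 ^ 0) * exp (2 * C * t)" by simp
      qed
    qed
  next
    case (Suc k)
    define B where "B = 2 * A + (B0 - 2 * A) / 2 ^ k"
    have B: "B \<ge> 0"
    proof -
      have "(B0 - 2 * A) / 2 ^ k \<ge> - (2 * A) / 2 ^ k" using B0 by (intro divide_right_mono) auto
      moreover have "2 * A / 2 ^ k \<le> 2 * A / 1" using A by (intro divide_left_mono) auto
      ultimately show ?thesis by (simp add: B_def)
    qed
    have Suc_eq: "2 * A + (B0 - 2 * A) / 2 ^ Suc k = A + B / 2" by (simp add: B_def field_simps)
    show ?case unfolding Suc_eq using le
    proof eventually_elim
      case (elim t)
      show ?case
      proof
        assume t: "t \<in> {0<..<T}"
        have E: "(LBINT r. indicator {0..t} r *\<^sub>R (B * exp (2 * C * r))) = B / (2 * C) * exp (2 * C * t) - B / (2 * C) * exp (2 * C * 0)"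
        proof (rule integral_FTC_Icc)
          show "((\<lambda>r. B / (2 * C) * exp (2 * C * r)) has_vector_derivative B * exp (2 * C * r)) (at r within {0..t})" for r
            unfolding has_real_derivative_iff_has_vector_derivative[symmetric]
            by (rule DERIV_subset) (use C in \<open>auto intro!: derivative_eq_intros\<close>)
        qed (use t in \<open>auto intro!: continuous_intros\<close>)
        have "(prim N t) \<le> (LBINT r. indicator {0..t} r *\<^sub>R (B * exp (2 * C * r)))"
        proof (rule integral_mono_AE)
          show "integrable lborel (\<lambda>r. indicator {0<..<t} r * N r)" using t by (intro Ni) auto
          show "integrable lborel (\<lambda>r. indicator {0..t} r *\<^sub>R (B * exp (2 * C * r)))"
            by (rule borel_integrable_compact[unfolded set_integrable_def]) (auto intro!: continuous_intros)
          show "AE r in lborel. indicator {0<..<t} r * N r \<le> indicator {0..t} r *\<^sub>R (B * exp (2 * C * r))"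
            using Suc.IH by eventually_elim (use t B in \<open>auto simp: B_def split: split_indicator\<close>)
        qed
        also have "\<dots> \<le> B / (2 * C) * exp (2 * C * t)" unfolding E using B C by simp
        finally have "C * (prim N t) \<le> B / 2 * exp (2 * C * t)"
          using C by (simp add: field_simps)
        moreover have "A \<le> A * exp (2 * C * t)" using A C t mult_left_mono[of 1 "exp (2 * C * t)" A] by simp
        ultimately show "N t \<le> (A + B / 2) * exp (2 * C * t)" using elim t by (simp add: distrib_right)
      qed
    qed
  qed
  have "AE t in lborel. \<forall>k. t \<in> {0<..<T} \<longrightarrow> N t \<le> (2 * A + (B0 - 2 * A) / 2 ^ k) * exp (2 * C * t)"
    unfolding AE_all_countable using step by (rule allI)
  then show ?thesis
  proof eventually_elim
    case (elim t)
    show ?case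
    proof
      assume t: "t \<in> {0<..<T}"
      have "(\<lambda>k. (B0 - 2 * A) / 2 ^ k) \<longlonglongrightarrow> 0"
        using tendsto_mult_right_zero[OF LIMSEQ_realpow_zero[of "1/2"], of "B0 - 2 * A"] by (simp add: power_divide)
      then have "(\<lambda>k. (2 * A + (B0 - 2 * A) / 2 ^ k) * exp (2 * C * t)) \<longlonglongrightarrow> (2 * A + 0) * exp (2 * C * t)"
        by (intro tendsto_intros)
      from LIMSEQ_le_const[OF this, of "N t"] elim t show "N t \<le> 2 * A * exp (2 * C * t)" by auto
    qed
  qed
qed

subsection \<open>The compressible problem\<close>

text \<open>A solution for one fixed \<alpha> together with its gradient \<open>Gu\<close>. The
  trace \<open>q0\<close> is a parameter so that it is chosen once, independently of
  \<alpha>.\<close>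

locale compressible = limit_problem D T \<rho>0 \<mu> \<eta> f u0 p0 w q Gw qt M
  for D :: "(real^'n::finite) set" and T \<rho>0 \<mu> \<eta> f u0 p0 w q Gw qt M +
  fixes \<alpha> :: real and u :: "real^'n \<Rightarrow> real \<Rightarrow> real^'n" and p :: "real^'n \<Rightarrow> real \<Rightarrow> real"
    and Gu :: "real^'n \<Rightarrow> real \<Rightarrow> real^'n^'n" and q0 :: "real^'n \<Rightarrow> real"
  assumes \<alpha>: "0 < \<alpha>" "\<alpha> < 1"
    and uH: "L2H01 D T u Gu" and p: "L2Q D T p"
    and C1: "\<And>\<phi> r. test0T T \<phi> \<Longrightarrow> L2D D r \<Longrightarrow>
       - (LINT t:{0<..<T}|lborel. ipD D (\<lambda>x. \<alpha> * p x t) r * deriv \<phi> t)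
       - ipD D (\<lambda>x. \<alpha> * p0 x) r * \<phi> 0
       + (LINT t:{0<..<T}|lborel. ipD D (\<lambda>x. \<rho>0 * trG (Gu x t)) r * \<phi> t) = 0"
    and C2: "\<And>\<phi> v Gv. test0T T \<phi> \<Longrightarrow> H01 D v Gv \<Longrightarrow>
       - (LINT t:{0<..<T}|lborel. \<rho>0 * ipD D (sl u t) v * deriv \<phi> t)
       - \<rho>0 * ipD D u0 v * \<phi> 0
       - (LINT t:{0<..<T}|lborel. ipD D (sl p t) (\<lambda>x. trG (Gv x)) * \<phi> t)
     = - \<mu> * (LINT t:{0<..<T}|lborel. ipD D (sl Gu t) Gv * \<phi> t)
       - \<eta> * (LINT t:{0<..<T}|lborel. ipD D (\<lambda>x. trG (Gu x t)) (\<lambda>x. trG (Gv x)) * \<phi> t)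
       + (LINT t:{0<..<T}|lborel. ipD D (\<lambda>x. (\<rho>0 + \<alpha> * p x t) *\<^sub>R f x t) v * \<phi> t)"
    and q0: "L2D D q0"
    and q_eq: "\<And>r. L2D D r \<Longrightarrow> AE t\<in>{0<..<T} in lborel. ipD D (sl q t) r =
      ipD D q0 r + (LBINT s. indicator {0<..<t} s * ipD D (sl qt s) r)"
begin

lemma u: "L2Q D T u" and Gu: "L2Q D T Gu"
  and u_H01: "AE t\<in>{0<..<T} in lborel. H01 D (sl u t) (sl Gu t)"
  using uH by (auto simp: L2H01_def)

lemma divu: "L2Q D T (\<lambda>x t. trG (Gu x t))"
  by (rule L2Q_bounded_linear[OF trG_linear Gu])

lemma I_L2Q: "L2Q D T s \<Longrightarrow> L2Q D T (\<lambda>x t. s x t *\<^sub>R (mat 1 :: real^'n^'n))"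
  by (rule L2Q_bounded_linear[OF bounded_linear_scaleR_left])

lemma \<rho>p: "L2Q D T (\<lambda>x t. \<rho>0 + \<alpha> * p x t)"
  using L2Q_add[OF L2Q_const[of \<rho>0] L2Q_scaleR[OF p, of \<alpha>]] by simp

lemma \<rho>pf: "L2Q D T (\<lambda>x t. (\<rho>0 + \<alpha> * p x t) *\<^sub>R f x t)"
  by (rule L2Q_mult_Linf(1)[OF \<rho>p f_meas f_bound])

lemma pf: "L2Q D T (\<lambda>x t. p x t *\<^sub>R f x t)"
  by (rule L2Q_mult_Linf(1)[OF p f_meas f_bound])

definition Fu :: "real^'n \<Rightarrow> real \<Rightarrow> (real^'n) \<times> (real^'n^'n)" where
  "Fu x t = ((\<rho>0 + \<alpha> * p x t) *\<^sub>R f x t,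
     p x t *\<^sub>R mat 1 + ((- \<mu>) *\<^sub>R Gu x t + (- \<eta>) *\<^sub>R (trG (Gu x t) *\<^sub>R mat 1)))"

lemma Fu2: "L2Q D T (\<lambda>x t. (- \<mu>) *\<^sub>R Gu x t + (- \<eta>) *\<^sub>R (trG (Gu x t) *\<^sub>R mat 1))"
  by (intro L2Q_add L2Q_scaleR Gu I_L2Q divu)

lemma Fu: "L2Q D T Fu"
  unfolding Fu_def[abs_def] by (intro L2Q_Pair \<rho>pf L2Q_add I_L2Q p L2Q_scaleR Gu divu)

lemma u_test:
  assumes \<phi>: "test0T T \<phi>" and v: "H01 D v G"
  shows "- J (\<lambda>x t. \<rho>0 *\<^sub>R u x t) v (deriv \<phi>) - \<rho>0 * ipD D u0 v * \<phi> 0 = J Fu (\<lambda>x. (v x, G x)) \<phi>"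
proof -
  note L = H01_L2D[OF v]
  define \<psi> where "\<psi> t = indicator {0<..<T} t * \<phi> t" for t
  have c: "continuous_on UNIV \<phi>" using \<phi> smooth_continuous by (auto simp: test0T_def)
  obtain B where B: "\<And>t. \<bar>\<psi> t\<bar> \<le> B" using truncate_bounded(2)[OF c] by (auto simp: \<psi>_def)
  have m: "\<psi> \<in> borel_measurable borel" using truncate_bounded(1)[OF c] by (simp add: \<psi>_def[abs_def])
  have "J Fu (\<lambda>x. (v x, G x)) \<psi> = J (\<lambda>x t. (\<rho>0 + \<alpha> * p x t) *\<^sub>R f x t) v \<psi> +
     (J (\<lambda>x t. p x t *\<^sub>R mat 1) G \<psi> + (J (\<lambda>x t. (- \<mu>) *\<^sub>R Gu x t) G \<psi> +
        J (\<lambda>x t. (- \<eta>) *\<^sub>R (trG (Gu x t) *\<^sub>R mat 1)) G \<psi>))"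
    unfolding Fu_def[abs_def]
    by (simp only: J_Pair[OF \<rho>pf L2Q_add[OF I_L2Q[OF p] Fu2] L m B]
        J_add[OF I_L2Q[OF p] Fu2 L(2) m B] J_add[OF L2Q_scaleR[OF Gu] L2Q_scaleR[OF I_L2Q[OF divu]] L(2) m B])
  then have "J Fu (\<lambda>x. (v x, G x)) \<phi> = J (\<lambda>x t. (\<rho>0 + \<alpha> * p x t) *\<^sub>R f x t) v \<phi> +
     (J (\<lambda>x t. p x t *\<^sub>R mat 1) G \<phi> - \<mu> * J Gu G \<phi> - \<eta> * J (\<lambda>x t. trG (Gu x t) *\<^sub>R mat 1) G \<phi>)"
    unfolding J_scaleR \<psi>_def[abs_def] J_truncate by simp
  then show ?thesis
    using C2[OF \<phi> v] by (simp add: J_def ipD_scaleR_left ipD_trG)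
qed

lemma u_equation:
  assumes v: "H01 D v G"
  shows "AE t\<in>{0<..<T} in lborel. ipD D (\<lambda>x. \<rho>0 *\<^sub>R u x t) v = \<rho>0 * ipD D u0 v +
      (LBINT r. indicator {0<..<t} r * ipD D (sl Fu r) (\<lambda>x. (v x, G x)))"
  by (rule weak_imp_primitive0[OF L2Q_scaleR[OF u] H01_L2D(1)[OF v] Fu L2D_Pair[OF H01_L2D[OF v]] u_test[OF _ v]])

lemma p_equation:
  assumes r: "L2D D r"
  shows "AE t\<in>{0<..<T} in lborel. ipD D (\<lambda>x. \<alpha> *\<^sub>R p x t) r = \<alpha> * ipD D p0 r +
      (LBINT s. indicator {0<..<t} s * ipD D (\<lambda>x. (- \<rho>0) *\<^sub>R trG (Gu x s)) r)"
proof (rule weak_imp_primitive0[OF L2Q_scaleR[OF p] r L2Q_scaleR[OF divu] r])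
  fix \<phi> assume \<phi>: "test0T T \<phi>"
  have "ipD D (\<lambda>x. \<alpha> * p0 x) r = \<alpha> * ipD D p0 r"
    using ipD_scaleR_left[of \<alpha> p0 r] by simp
  moreover have "J (\<lambda>x t. (- \<rho>0) *\<^sub>R trG (Gu x t)) r \<phi> = - (LINT t:{0<..<T}|lborel. ipD D (\<lambda>x. \<rho>0 * trG (Gu x t)) r * \<phi> t)"
    using J_scaleR[of "-1" "\<lambda>x t. \<rho>0 * trG (Gu x t)" r \<phi>] by (simp add: J_def)
  ultimately show "- J (\<lambda>x t. \<alpha> *\<^sub>R p x t) r (deriv \<phi>) - \<alpha> * ipD D p0 r * \<phi> 0 = J (\<lambda>x t. (- \<rho>0) *\<^sub>R trG (Gu x t)) r \<phi>"
    using C1[OF \<phi> r] by (simp add: J_def)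
qed

definition z where "z x t = u x t - w x t"
definition Gz where "Gz x t = Gu x t - Gw x t"
definition \<pi> where "\<pi> x t = p x t - q x t"

lemma z: "L2Q D T z" and Gz: "L2Q D T Gz" and \<pi>: "L2Q D T \<pi>"
  unfolding z_def[abs_def] Gz_def[abs_def] \<pi>_def[abs_def]
  by (auto intro: L2Q_diff u w Gu Gw p q)

lemma z_H01: "AE t\<in>{0<..<T} in lborel. H01 D (sl z t) (sl Gz t)"
  using u_H01 w_Vsp by eventually_elim (auto simp: z_def Gz_def intro!: H01_diff[OF _ Vsp_H01])

text \<open>The scaling by \<open>sqrt \<rho>0\<close> and \<open>sqrt (\<alpha> / \<rho>0)\<close> makes the pressure-divergence terms of the two
  equations cancel.\<close>

definition En where "En x t = (sqrt \<rho>0 *\<^sub>R z x t, sqrt (\<alpha> / \<rho>0) *\<^sub>R \<pi> x t)"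
definition Ez where "Ez x t = ((z x t, Gz x t), \<pi> x t)"
text \<open>The rate of change of \<open>En\<close>, to be paired with \<open>Ez\<close>. The second
  slot is the pressure equation divided by \<open>\<rho>0\<close>, diminished by the contribution of
  the time derivative of q.\<close>

definition Ef where "Ef x t = (Fu x t - Fw x t, (-1) *\<^sub>R trG (Gu x t) + (- (\<alpha> / \<rho>0)) *\<^sub>R qt x t)"

lemma En: "L2Q D T En" and Ez: "L2Q D T Ez" and Ef: "L2Q D T Ef"
  unfolding En_def[abs_def] Ez_def[abs_def] Ef_def[abs_def]
  by (intro L2Q_Pair L2Q_scaleR L2Q_diff L2Q_add z Gz \<pi> Fu Fw divu qt)+

lemma sqrt_\<rho>: "sqrt \<rho>0 * sqrt \<rho>0 = \<rho>0" "sqrt (\<alpha> / \<rho>0) * sqrt (\<alpha> / \<rho>0) = \<alpha> / \<rho>0"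
  using \<rho>0 \<alpha> by (auto simp: real_sqrt_mult_self)

lemma En_pair:
  assumes "L2D D a" "L2D D b" "L2D D v" "L2D D r"
  shows "ipD D (\<lambda>x. (sqrt \<rho>0 *\<^sub>R (a x :: real^'n), sqrt (\<alpha> / \<rho>0) *\<^sub>R (b x :: real))) (\<lambda>x. (sqrt \<rho>0 *\<^sub>R v x, sqrt (\<alpha> / \<rho>0) *\<^sub>R r x))
     = \<rho>0 * ipD D a v + (\<alpha> / \<rho>0) * ipD D b r"
  unfolding ipD_Pair[OF L2D_scaleR[OF assms(1)] L2D_scaleR[OF assms(2)] L2D_scaleR[OF assms(3)] L2D_scaleR[OF assms(4)]]
    ipD_scaleR_left ipD_scaleR_right
  by (simp only: mult.assoc[symmetric] sqrt_\<rho>)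

text \<open>The two momentum identities share the initial term (u0, v), which cancels in the
  difference; only the initial pressure discrepancy p0 - q0 remains.\<close>

lemma difference_energy:
  "AE t\<in>{0<..<T} in lborel. ipDt En En t \<le> (\<alpha> / \<rho>0) * ipD D (\<lambda>x. p0 x - q0 x) (\<lambda>x. p0 x - q0 x)
    + 2 * (LBINT r. indicator {0<..<t} r * ipDt Ef Ez r)"
proof -
  have \<pi>0: "L2D D (\<lambda>x. p0 x - q0 x)" by (rule L2D_diff[OF p0 q0])
  have zero: "L2D D (\<lambda>x. 0 :: real^'n)" by (rule L2D_const)
  define E0 where "E0 x = (sqrt \<rho>0 *\<^sub>R (0 :: real^'n), sqrt (\<alpha> / \<rho>0) *\<^sub>R (p0 x - q0 x))" for x
  have E0: "L2D D E0" unfolding E0_def[abs_def] by (rule L2D_Pair[OF L2D_scaleR[OF zero] L2D_scaleR[OF \<pi>0]])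
  have ip0: "ipD D (\<lambda>x. 0 :: real^'n) v = 0" for v by (simp add: ipD_def)
  have E0E0: "ipD D E0 E0 = (\<alpha> / \<rho>0) * ipD D (\<lambda>x. p0 x - q0 x) (\<lambda>x. p0 x - q0 x)"
    unfolding E0_def[abs_def] En_pair[OF zero \<pi>0 zero \<pi>0] by (simp add: ip0)
  \<comment> \<open>Admissible test data: the scaled fields appear in v, their unscaled versions and
    the gradient in V. Multiplying by the square roots twice gives the factors of the
    equations.\<close>
  define K where "K v V \<longleftrightarrow> (\<exists>v' G r. H01 D v' G \<and> L2D D r \<and> v = (\<lambda>x. (sqrt \<rho>0 *\<^sub>R v' x, sqrt (\<alpha> / \<rho>0) *\<^sub>R r x))
      \<and> V = (\<lambda>x. ((v' x, G x), r x)))" for v :: "real^'n \<Rightarrow> (real^'n) \<times> real" and V :: "real^'n \<Rightarrow> ((real^'n) \<times> (real^'n^'n)) \<times> real"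
  have "AE t\<in>{0<..<T} in lborel. ipDt En En t \<le> ipD D E0 E0
    + 2 * (LBINT r. indicator {0<..<t} r * ipDt Ef Ez r)"
  proof (rule energy_Q[OF En Ez Ef E0, where K=K])
    show "AE s\<in>{0<..<T} in lborel. K (sl En s) (sl Ez s)"
      using z_H01 L2Q_slice[OF \<pi>] by eventually_elim (auto simp: K_def En_def Ez_def)
    fix v V assume "K v V"
    then obtain v' G r where v': "H01 D v' G" and r: "L2D D r"
      and v: "v = (\<lambda>x. (sqrt \<rho>0 *\<^sub>R v' x, sqrt (\<alpha> / \<rho>0) *\<^sub>R r x))" and V: "V = (\<lambda>x. ((v' x, G x), r x))"
      unfolding K_def by blast
    note L = H01_L2D[OF v']
    note LP = L2D_Pair[OF L]
    define b1 where "b1 s = indicator {0<..<T} s * ipD D (sl Fu s) (\<lambda>x. (v' x, G x))" for s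
    define b2 where "b2 s = indicator {0<..<T} s * ipD D (sl Fw s) (\<lambda>x. (v' x, G x))" for s
    define b3 where "b3 s = indicator {0<..<T} s * ipD D (\<lambda>x. (- \<rho>0) *\<^sub>R trG (Gu x s)) r" for s
    define b4 where "b4 s = indicator {0<..<T} s * ipD D (sl qt s) r" for s
    define b where "b s = indicator {0<..<T} s * ipD D (sl Ef s) V" for s
    have bi: "integrable lborel b1" "integrable lborel b2" "integrable lborel b3" "integrable lborel b4"
      unfolding b1_def[abs_def] b2_def[abs_def] b3_def[abs_def] b4_def[abs_def]
      by (intro ipD_L2(2) Fu Fw LP L2Q_scaleR divu qt r)+
    have ib: "integrable lborel b" unfolding b_def[abs_def] V by (intro ipD_L2(2) Ef L2D_Pair L r)
    have bsum: "AE s in lborel. b s = b1 s - b2 s + (1 / \<rho>0) * b3 s - (\<alpha> / \<rho>0) * b4 s"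
      using L2Q_slice[OF Fu] L2Q_slice[OF Fw] L2Q_slice[OF divu] L2Q_slice[OF qt]
    proof eventually_elim
      case (elim s)
      show ?case
      proof (cases "s \<in> {0<..<T}")
        case True
        then have S: "L2D D (sl Fu s)" "L2D D (sl Fw s)" "L2D D (\<lambda>x. trG (Gu x s))" "L2D D (sl qt s)"
          using elim by auto
        have "ipD D (sl Ef s) V = ipD D (sl Fu s) (\<lambda>x. (v' x, G x)) - ipD D (sl Fw s) (\<lambda>x. (v' x, G x))
          + ((-1) * ipD D (\<lambda>x. trG (Gu x s)) r + (- (\<alpha> / \<rho>0)) * ipD D (sl qt s) r)"
          unfolding Ef_def V
          by (simp only: ipD_Pair[OF L2D_diff[OF S(1,2)] L2D_add[OF L2D_scaleR[OF S(3)] L2D_scaleR[OF S(4)]] LP r]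
              ipD_diff_left[OF S(1,2) LP] ipD_add_left[OF L2D_scaleR[OF S(3)] L2D_scaleR[OF S(4)] r] ipD_scaleR_left)
        moreover have "ipD D (\<lambda>x. (- \<rho>0) *\<^sub>R trG (Gu x s)) r = (- \<rho>0) * ipD D (\<lambda>x. trG (Gu x s)) r"
          by (rule ipD_scaleR_left)
        ultimately show ?thesis using True \<rho>0 by (simp add: b_def b1_def b2_def b3_def b4_def)
      qed (simp add: b_def b1_def b2_def b3_def b4_def)
    qed
    have ii: "integrable lborel (\<lambda>s. indicator {0<..<t} s * k s)" if "integrable lborel k" for k :: "real \<Rightarrow> real" and t
      using integrable_mult_indicator[OF _ that, of "{0<..<t}"] by simp
    have bint: "(prim b t) = (prim b1 t) - (prim b2 t)
       + (1 / \<rho>0) * (prim b3 t) - (\<alpha> / \<rho>0) * (prim b4 t)" for t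
    proof -
      have "(prim b t) = (LBINT s. indicator {0<..<t} s * b1 s - indicator {0<..<t} s * b2 s
         + (1 / \<rho>0) * (indicator {0<..<t} s * b3 s) - (\<alpha> / \<rho>0) * (indicator {0<..<t} s * b4 s))"
      proof (rule integral_cong_AE)
        show "(\<lambda>s. indicator {0<..<t} s * b s) \<in> borel_measurable lborel" using ii[OF ib, of t] by (rule borel_measurable_integrable)
        show "(\<lambda>s. indicator {0<..<t} s * b1 s - indicator {0<..<t} s * b2 s
         + (1 / \<rho>0) * (indicator {0<..<t} s * b3 s) - (\<alpha> / \<rho>0) * (indicator {0<..<t} s * b4 s)) \<in> borel_measurable lborel"
          using borel_measurable_integrable[OF bi(1)] borel_measurable_integrable[OF bi(2)]
            borel_measurable_integrable[OF bi(3)] borel_measurable_integrable[OF bi(4)]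
          by (intro borel_measurable_diff borel_measurable_add borel_measurable_times) auto
        show "AE s in lborel. indicator {0<..<t} s * b s = indicator {0<..<t} s * b1 s - indicator {0<..<t} s * b2 s
         + (1 / \<rho>0) * (indicator {0<..<t} s * b3 s) - (\<alpha> / \<rho>0) * (indicator {0<..<t} s * b4 s)"
          using bsum by eventually_elim (simp add: algebra_simps split: split_indicator)
      qed
      then show ?thesis
        using ii[OF bi(1), of t] ii[OF bi(2), of t] ii[OF bi(3), of t] ii[OF bi(4), of t] by simp
    qed
    show "AE t\<in>{0<..<T} in lborel. ipD D (sl En t) v =
        ipD D E0 v + (LBINT r. indicator {0<..<t} r * ipD D (sl Ef r) V)"
      using u_equation[OF v'] w_equation[OF v'] p_equation[OF r] q_eq[OF r]
        L2Q_slice[OF u] L2Q_slice[OF w] L2Q_slice[OF p] L2Q_slice[OF q]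
    proof eventually_elim
      case (elim t)
      show ?case
      proof
        assume t: "t \<in> {0<..<T}"
        then have S: "L2D D (sl u t)" "L2D D (sl w t)" "L2D D (sl p t)" "L2D D (sl q t)"
          using elim by auto
        note pr = partial_integral_restrict[of t]
        have e1: "\<rho>0 * ipD D (sl u t) v' = \<rho>0 * ipD D u0 v' + (prim b1 t)"
          using elim(1) t pr[of "\<lambda>s. ipD D (sl Fu s) (\<lambda>x. (v' x, G x))"] by (simp add: ipD_scaleR_left b1_def)
        have e2: "\<rho>0 * ipD D (sl w t) v' = \<rho>0 * ipD D u0 v' + (prim b2 t)"
          using elim(2) t pr[of "\<lambda>s. ipD D (sl Fw s) (\<lambda>x. (v' x, G x))"] by (simp add: b2_def)
        have e3: "\<alpha> * ipD D (sl p t) r = \<alpha> * ipD D p0 r + (prim b3 t)"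
          using elim(3) t pr[of "\<lambda>s. ipD D (\<lambda>x. (- \<rho>0) *\<^sub>R trG (Gu x s)) r"] ipD_scaleR_left[of \<alpha> "sl p t" r] by (simp add: b3_def)
        have e4: "ipD D (sl q t) r = ipD D q0 r + (prim b4 t)"
          using elim(4) t pr[of "\<lambda>s. ipD D (sl qt s) r"] by (simp add: b4_def)
        have l: "ipD D (sl En t) v = \<rho>0 * (ipD D (sl u t) v' - ipD D (sl w t) v')
            + (\<alpha> / \<rho>0) * (ipD D (sl p t) r - ipD D (sl q t) r)"
          unfolding En_def v z_def \<pi>_def
          by (simp only: En_pair[OF L2D_diff[OF S(1,2)] L2D_diff[OF S(3,4)] L(1) r] ipD_diff_left[OF S(1,2) L(1)] ipD_diff_left[OF S(3,4) r])
        have r0: "ipD D E0 v = (\<alpha> / \<rho>0) * (ipD D p0 r - ipD D q0 r)"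
          unfolding E0_def[abs_def] v En_pair[OF zero \<pi>0 L(1) r] ip0 ipD_diff_left[OF p0 q0 r] by simp
        have "(\<alpha> / \<rho>0) * ipD D (sl p t) r = (1 / \<rho>0) * (\<alpha> * ipD D (sl p t) r)" by simp
        also have "\<dots> = (\<alpha> / \<rho>0) * ipD D p0 r + (1 / \<rho>0) * (prim b3 t)"
          unfolding e3 by (simp add: distrib_left)
        finally have e3': "(\<alpha> / \<rho>0) * ipD D (sl p t) r = (\<alpha> / \<rho>0) * ipD D p0 r + (1 / \<rho>0) * (prim b3 t)" .
        have e4': "(\<alpha> / \<rho>0) * ipD D (sl q t) r = (\<alpha> / \<rho>0) * ipD D q0 r + (\<alpha> / \<rho>0) * (prim b4 t)"
          unfolding e4 by (rule distrib_left)
        have "ipD D (sl En t) v = ipD D E0 v + (prim b t)"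
          unfolding l r0 bint right_diff_distrib e1 e2 e3' e4' by linarith
        then show "ipD D (sl En t) v = ipD D E0 v + (LBINT r. indicator {0<..<t} r * ipD D (sl Ef r) V)"
          using pr[of "\<lambda>s. ipD D (sl Ef s) V"] t by (simp add: b_def)
      qed
    qed
  qed
  then show ?thesis by (simp only: E0E0)
qed

end

text \<open>Estimates hold at almost every t < T, never directly at the end point; they are carried
  to T along good times.\<close>

lemma integral_le_of_AE_partial:
  fixes k :: "real \<Rightarrow> real"
  assumes k: "integrable lborel k" and T: "T > 0"
    and le: "AE t\<in>{0<..<T} in lborel. (prim k t) \<le> c"
  shows "(prim k T) \<le> c"
proof -
  have "\<exists>t. T - T / real (n + 2) < t \<and> t < T \<and> (t \<in> {0<..<T} \<longrightarrow> (prim k t) \<le> c)" for n :: nat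
    using AE_lborel_ex_interval[OF le, of "T - T / real (n + 2)" T] T by auto
  then obtain t where t: "\<And>n::nat. T - T / real (n + 2) < t n" "\<And>n. t n < T"
    "\<And>n. t n \<in> {0<..<T} \<longrightarrow> (prim k (t n)) \<le> c" by metis
  have pos: "0 < t n" for n
  proof -
    have "T / real (n + 2) \<le> T / 1" using T by (intro divide_left_mono) auto
    then show ?thesis using t(1)[of n] by simp
  qed
  have tT: "t \<longlonglongrightarrow> T"
  proof (rule tendsto_sandwich)
    show "\<forall>\<^sub>F n in sequentially. T - T / real (n + 2) \<le> t n" "\<forall>\<^sub>F n in sequentially. t n \<le> T"
      using t(1,2) by (auto intro: less_imp_le always_eventually)
    have "(\<lambda>n. T * inverse (real (Suc (n + 1)))) \<longlonglongrightarrow> 0"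
      by (rule tendsto_mult_right_zero[OF LIMSEQ_ignore_initial_segment[OF LIMSEQ_inverse_real_of_nat]])
    then have "(\<lambda>n. T - T * inverse (real (Suc (n + 1)))) \<longlonglongrightarrow> T - 0" by (intro tendsto_intros)
    then show "(\<lambda>n. T - T / real (n + 2)) \<longlonglongrightarrow> T" by (simp add: divide_inverse)
  qed simp
  have "(\<lambda>n. LBINT r. indicator {0<..<t n} r * k r) \<longlonglongrightarrow> (prim k T)"
  proof (rule integral_dominated_convergence[where w="\<lambda>r. \<bar>k r\<bar>"])
    show "AE r in lborel. (\<lambda>n. indicator {0<..<t n} r * k r) \<longlonglongrightarrow> indicator {0<..<T} r * k r"
    proof (intro AE_I2 tendsto_eventually)
      fix r
      show "\<forall>\<^sub>F n in sequentially. indicator {0<..<t n} r * k r = indicator {0<..<T} r * k r"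
      proof (cases "r < T")
        case True
        show ?thesis using order_tendstoD(1)[OF tT True] by eventually_elim (use True in \<open>auto split: split_indicator\<close>)
      next
        case False
        have "r \<notin> {0<..<t n}" for n using t(2)[of n] False by auto
        then show ?thesis using False by (intro always_eventually) auto
      qed
    qed
  qed (use k in \<open>auto split: split_indicator\<close>)
  then show ?thesis by (rule LIMSEQ_le_const2) (use t pos in auto)
qed

section \<open>Energy estimates uniform in \<alpha>\<close>

context space_time
begin

lemma ipD_Young:
  fixes a b :: "real^'n \<Rightarrow> 'b::euclidean_space"
  assumes "L2D D a" "L2D D b" shows "\<bar>ipD D a b\<bar> \<le> (ipD D a a + ipD D b b) / 2"
proof -
  have "\<bar>ipD D a b\<bar> \<le> sqrt (ipD D a a) * sqrt (ipD D b b)" by (rule ipD_Cauchy_Schwarz[OF assms])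
  also have "\<dots> \<le> ((sqrt (ipD D a a))\<^sup>2 + (sqrt (ipD D b b))\<^sup>2) / 2"
    using sum_squares_bound[of "sqrt (ipD D a a)" "sqrt (ipD D b b)"] by simp
  finally show ?thesis by (simp add: ipD_self_nonneg)
qed

lemma ipD_add_self_le:
  fixes a b :: "real^'n \<Rightarrow> 'b::euclidean_space"
  assumes "L2D D a" "L2D D b" shows "ipD D (\<lambda>x. a x + b x) (\<lambda>x. a x + b x) \<le> 2 * ipD D a a + 2 * ipD D b b"
  using nsq_add_le[OF L2D_ex[OF assms(1)] L2D_ex[OF assms(2)]] by (simp add: ipD_self ex_add[abs_def])

end

context limit_problem
begin

text \<open>The constants of the energy estimate, none of which contains \<alpha>. The source
  \<kappa> comes from Young's inequality applied to q f and qt; \<open>gC\<close> is the growth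
  rate; \<open>gA\<close> collects initial discrepancy and source; \<open>gB\<close> is the
  resulting Gronwall bound; \<open>gG\<close> bounds the dissipation. The energy and the dissipation
  will be at most \<alpha> times the last two.\<close>

definition "\<kappa> t = 2 * M\<^sup>2 * ipDt q q t + (1 / \<rho>0) * ipDt qt qt t"
definition "gC = 2 * M\<^sup>2 * \<rho>0 + 1 / \<rho>0 + 1"
definition "gA q0 = (1 / \<rho>0) * ipD D (\<lambda>x. p0 x - q0 x) (\<lambda>x. p0 x - q0 x) + (prim \<kappa> T)"
definition "gB q0 = 2 * gA q0 * exp (2 * gC * T)"
definition "gG q0 = (gA q0 + gC * (T * gB q0)) / (2 * \<mu>)"

lemma \<kappa>: "integrable lborel (\<lambda>r. indicator {0<..<T} r * \<kappa> r)" "0 \<le> \<kappa> t"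
proof -
  have "integrable lborel (\<lambda>r. 2 * M\<^sup>2 * (indicator {0<..<T} r * ipDt q q r)
     + (1 / \<rho>0) * (indicator {0<..<T} r * ipDt qt qt r))"
    by (intro Bochner_Integration.integrable_add integrable_mult_right pairing_eq(2) q qt)
  then show "integrable lborel (\<lambda>r. indicator {0<..<T} r * \<kappa> r)" by (simp add: \<kappa>_def algebra_simps)
  show "0 \<le> \<kappa> t" using \<rho>0 by (simp add: \<kappa>_def ipD_self_nonneg)
qed

lemma gC: "gC > 0" using \<rho>0 by (auto simp: gC_def intro!: add_nonneg_pos add_nonneg_nonneg)

lemma gA: "gA q0 \<ge> 0"
proof -
  have "(prim \<kappa> T) \<ge> 0" by (rule integral_nonneg_AE) (use \<kappa>(2) in auto)
  then show ?thesis using \<rho>0 by (simp add: gA_def ipD_self_nonneg)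
qed

end

context compressible
begin

definition "N t = \<rho>0 * ipDt z z t + (\<alpha> / \<rho>0) * ipDt \<pi> \<pi> t"

lemma N_nonneg: "0 \<le> N t" using \<rho>0 \<alpha> by (simp add: N_def ipD_self_nonneg)

lemma N_integrable: "integrable lborel (\<lambda>t. indicator {0<..<T} t * N t)"
proof -
  have "integrable lborel (\<lambda>r. \<rho>0 * (indicator {0<..<T} r * ipDt z z r)
     + (\<alpha> / \<rho>0) * (indicator {0<..<T} r * ipDt \<pi> \<pi> r))"
    by (intro Bochner_Integration.integrable_add integrable_mult_right pairing_eq(2) z \<pi>)
  then show ?thesis by (simp add: N_def algebra_simps)
qed

text \<open>The force \<open>\<rho>0\<close> f cancels in the difference, and what remains of the
  force carries a factor \<alpha>.\<close>

lemma Ef_eq: "Ef x t = ((\<alpha> *\<^sub>R (p x t *\<^sub>R f x t), \<pi> x t *\<^sub>R mat 1 + ((- \<mu>) *\<^sub>R Gz x t + (- \<eta>) *\<^sub>R (trG (Gu x t) *\<^sub>R mat 1))),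
   (-1) *\<^sub>R trG (Gu x t) + (- (\<alpha> / \<rho>0)) *\<^sub>R qt x t)"
  by (simp add: Ef_def Fu_def Fw_def \<pi>_def Gz_def algebra_simps)

text \<open>With div w = 0 the pressure work (\<pi>, div z) equals (\<pi>, div u) and cancels
  against the pressure equation. The \<open>\<eta>\<close> term has a favourable sign; what is left
  is handled by Young's inequality.\<close>

lemma energy_density:
  "AE t\<in>{0<..<T} in lborel. 2 * ipDt Ef Ez t \<le>
     gC * N t + \<alpha> * \<kappa> t - 2 * \<mu> * ipDt Gz Gz t"
  using L2Q_slice[OF z] L2Q_slice[OF Gz] L2Q_slice[OF \<pi>] L2Q_slice[OF p] L2Q_slice[OF q] L2Q_slice[OF qt]
    L2Q_slice[OF divu] L2Q_slice[OF pf] w_Vsp L2Q_mult_Linf(2)[OF p f_meas f_bound] L2Q_slice[OF Gw]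
proof eventually_elim
  case (elim t)
  show ?case
  proof
    assume t: "t \<in> {0<..<T}"
    have S: "L2D D (sl z t)" "L2D D (sl Gz t)" "L2D D (sl \<pi> t)" "L2D D (sl p t)" "L2D D (sl q t)"
      "L2D D (sl qt t)" "L2D D (\<lambda>x. trG (Gu x t))" "L2D D (\<lambda>x. p x t *\<^sub>R f x t)" "L2D D (sl Gw t)"
      and V: "Vsp D (sl w t) (sl Gw t)"
      and Mp: "ipD D (\<lambda>x. p x t *\<^sub>R f x t) (\<lambda>x. p x t *\<^sub>R f x t) \<le> M\<^sup>2 * ipDt p p t"
      using elim t by auto
    have LI: "L2D D (\<lambda>x. s x *\<^sub>R (mat 1 :: real^'n^'n))" if "L2D D s" for s
      by (rule L2D_bounded_linear[OF bounded_linear_scaleR_left that])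
    have tw: "L2D D (\<lambda>x. trG (Gw x t))" by (rule L2D_bounded_linear[OF trG_linear S(9)])
    have div: "ipD D r (\<lambda>x. trG (Gz x t)) = ipD D r (\<lambda>x. trG (Gu x t))" if r: "L2D D r" for r
    proof -
      have "trG (Gz x t) = trG (Gu x t) - trG (Gw x t)" for x
        unfolding Gz_def by (rule linear_diff[OF bounded_linear.linear[OF trG_linear]])
      then show ?thesis using ipD_diff_right[OF r S(7) tw] Vsp_div[OF V r] by simp
    qed
    define a where "a = ipD D (\<lambda>x. p x t *\<^sub>R f x t) (sl z t)"
    define c where "c = ipDt qt \<pi> t"
    define g where "g = ipDt Gz Gz t"
    define d where "d = ipD D (\<lambda>x. trG (Gu x t)) (\<lambda>x. trG (Gu x t))"
    define Z where "Z = ipDt z z t"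
    define P where "P = ipDt \<pi> \<pi> t"
    define Q where "Q = ipDt q q t"
    define R where "R = ipDt qt qt t"
    have nn: "Z \<ge> 0" "P \<ge> 0" "Q \<ge> 0" "R \<ge> 0" "d \<ge> 0" unfolding Z_def P_def Q_def R_def d_def by (rule ipD_self_nonneg)+
    have L23: "L2D D (\<lambda>x. (- \<mu>) *\<^sub>R Gz x t + (- \<eta>) *\<^sub>R (trG (Gu x t) *\<^sub>R mat 1))"
      by (intro L2D_add L2D_scaleR S LI)
    have L2': "L2D D (\<lambda>x. \<pi> x t *\<^sub>R mat 1 + ((- \<mu>) *\<^sub>R Gz x t + (- \<eta>) *\<^sub>R (trG (Gu x t) *\<^sub>R mat 1)))"
      by (intro L2D_add L2D_scaleR S LI)
    have L3: "L2D D (\<lambda>x. (-1) *\<^sub>R trG (Gu x t) + (- (\<alpha> / \<rho>0)) *\<^sub>R qt x t)"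
      by (intro L2D_add L2D_scaleR S)
    have e: "ipDt Ef Ez t = \<alpha> * a + (ipD D (\<lambda>x. \<pi> x t *\<^sub>R mat 1) (sl Gz t) + ((- \<mu>) * g +
        (- \<eta>) * ipD D (\<lambda>x. trG (Gu x t) *\<^sub>R mat 1) (sl Gz t))) + ((-1) * ipD D (\<lambda>x. trG (Gu x t)) (sl \<pi> t) + (- (\<alpha> / \<rho>0)) * c)"
      unfolding Ef_eq Ez_def a_def c_def g_def
      by (simp only: ipD_Pair[OF L2D_Pair[OF L2D_scaleR[OF S(8)] L2'] L3 L2D_Pair[OF S(1,2)] S(3)]
          ipD_Pair[OF L2D_scaleR[OF S(8)] L2' S(1,2)] ipD_add_left[OF LI[OF S(3)] L23 S(2)]
          ipD_add_left[OF L2D_scaleR[OF S(2)] L2D_scaleR[OF LI[OF S(7)]] S(2)]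
          ipD_add_left[OF L2D_scaleR[OF S(7)] L2D_scaleR[OF S(6)] S(3)] ipD_scaleR_left)
    \<comment> \<open>The cancellation of the pressure-divergence terms happens in this
      line.\<close>
    have "ipDt Ef Ez t = \<alpha> * a - \<mu> * g - \<eta> * d - (\<alpha> / \<rho>0) * c"
      unfolding e ipD_trG[symmetric] div[OF S(3)] div[OF S(7)]
      by (simp add: d_def ipD_commute[of "\<lambda>x. trG (Gu x t)" "sl \<pi> t"])
    moreover have "2 * a \<le> 2 * M\<^sup>2 * P + 2 * M\<^sup>2 * Q + Z"
    proof -
      have pp: "(sl p t) = (\<lambda>x. \<pi> x t + q x t)" by (simp add: \<pi>_def)
      have "ipDt p p t \<le> 2 * P + 2 * Q"
        unfolding pp P_def Q_def by (rule ipD_add_self_le[OF S(3,5)])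
      then have "M\<^sup>2 * ipDt p p t \<le> M\<^sup>2 * (2 * P + 2 * Q)" by (rule mult_left_mono) simp
      moreover have "2 * a \<le> ipD D (\<lambda>x. p x t *\<^sub>R f x t) (\<lambda>x. p x t *\<^sub>R f x t) + Z"
        using ipD_Young[OF S(8,1)] by (simp add: a_def Z_def abs_le_iff)
      ultimately show ?thesis using Mp by (simp add: distrib_left)
    qed
    then have "\<alpha> * (2 * a) \<le> \<alpha> * (2 * M\<^sup>2 * P + 2 * M\<^sup>2 * Q + Z)" using \<alpha> by (intro mult_left_mono) auto
    moreover have "- (2 * c) \<le> R + P"
      using ipD_Young[OF S(6,3)] by (simp add: c_def P_def R_def abs_le_iff)
    then have "(\<alpha> / \<rho>0) * (- (2 * c)) \<le> (\<alpha> / \<rho>0) * (R + P)" using \<alpha> \<rho>0 by (intro mult_left_mono) auto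
    moreover have "0 \<le> \<eta> * d" using \<eta> nn by simp
    moreover have "\<alpha> * (2 * M\<^sup>2 * P + 2 * M\<^sup>2 * Q + Z) + (\<alpha> / \<rho>0) * (R + P) \<le> gC * N t + \<alpha> * \<kappa> t"
    proof -
      \<comment> \<open>The three summands of \<open>gC\<close> absorb, in order, the force acting
        on \<pi>, the term \<alpha> |z|^2, and the term from qt; the surplus is written out, with 1
        - \<alpha> as one of its factors.\<close>
      have "gC * N t + \<alpha> * \<kappa> t - (\<alpha> * (2 * M\<^sup>2 * P + 2 * M\<^sup>2 * Q + Z) + (\<alpha> / \<rho>0) * (R + P))
         = 2 * M\<^sup>2 * \<rho>0 * (\<rho>0 * Z) + (1 - \<alpha>) * Z + \<rho>0 * Z + (1 / \<rho>0) * ((\<alpha> / \<rho>0) * P)"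
        using \<rho>0 unfolding gC_def N_def \<kappa>_def Z_def[symmetric] P_def[symmetric] Q_def[symmetric] R_def[symmetric]
        by (simp add: field_simps power2_eq_square)
      also have "\<dots> \<ge> 0" using nn \<alpha> \<rho>0 by (intro add_nonneg_nonneg mult_nonneg_nonneg) auto
      finally show ?thesis by simp
    qed
    ultimately have "2 * ipDt Ef Ez t \<le> gC * N t + \<alpha> * \<kappa> t - 2 * \<mu> * g"
      by (simp add: algebra_simps)
    then show "2 * ipDt Ef Ez t \<le> gC * N t + \<alpha> * \<kappa> t - 2 * \<mu> * ipDt Gz Gz t"
      by (simp add: g_def)
  qed
qed

lemma gz_integrable: "integrable lborel (\<lambda>t. indicator {0<..<T} t * ipDt Gz Gz t)"
  by (rule pairing_eq(2)[OF Gz Gz])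

lemma energy_estimate:
  "AE t\<in>{0<..<T} in lborel. N t + 2 * \<mu> * (LBINT r. indicator {0<..<t} r * ipDt Gz Gz r)
     \<le> \<alpha> * gA q0 + gC * (prim N t)"
  using difference_energy L2Q_slice[OF z] L2Q_slice[OF \<pi>]
proof eventually_elim
  case (elim t)
  show ?case
  proof
    assume t: "t \<in> {0<..<T}"
    define I where "I = (indicator {0<..<t} :: real \<Rightarrow> real)"
    have II: "I r * k r = indicator {0<..<t} r * (indicator {0<..<T} r * k r)" for k and r
      using t by (auto simp: I_def split: split_indicator)
    have ii: "integrable lborel (\<lambda>r. I r * k r)" if "integrable lborel (\<lambda>r. indicator {0<..<T} r * k r)" for k
      unfolding II using integrable_mult_indicator[OF _ that, of "{0<..<t}"] by simp
    note iN = ii[OF N_integrable] and i\<kappa> = ii[OF \<kappa>(1)] and ig = ii[OF gz_integrable] and iE = ii[OF pairing_eq(2)[OF Ef Ez]]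
    have S: "L2D D (sl z t)" "L2D D (sl \<pi> t)" using elim t by auto
    have "2 * (LBINT r. I r * ipDt Ef Ez r) = (LBINT r. 2 * (I r * ipDt Ef Ez r))"
      by simp
    also have "\<dots> \<le> (LBINT r. gC * (I r * N r) + \<alpha> * (I r * \<kappa> r) - 2 * \<mu> * (I r * ipDt Gz Gz r))"
    proof (rule integral_mono_AE)
      show "AE r in lborel. 2 * (I r * ipDt Ef Ez r) \<le>
         gC * (I r * N r) + \<alpha> * (I r * \<kappa> r) - 2 * \<mu> * (I r * ipDt Gz Gz r)"
        using energy_density by eventually_elim (use t in \<open>auto simp: I_def split: split_indicator\<close>)
    qed (intro Bochner_Integration.integrable_diff Bochner_Integration.integrable_add integrable_mult_right iN i\<kappa> ig iE)+
    also have "\<dots> = gC * (LBINT r. I r * N r) + \<alpha> * (LBINT r. I r * \<kappa> r) - 2 * \<mu> * (LBINT r. I r * ipDt Gz Gz r)"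
      using iN i\<kappa> ig by simp
    also have "(LBINT r. I r * \<kappa> r) \<le> (prim \<kappa> T)"
      by (rule integral_mono[OF i\<kappa> \<kappa>(1)]) (use t \<kappa>(2) in \<open>auto simp: I_def split: split_indicator\<close>)
    finally have 1: "2 * (LBINT r. I r * ipDt Ef Ez r) \<le>
        gC * (LBINT r. I r * N r) + \<alpha> * (prim \<kappa> T) - 2 * \<mu> * (LBINT r. I r * ipDt Gz Gz r)"
      using \<alpha> by (simp add: mult_left_mono)
    have "N t = ipDt En En t" unfolding En_def N_def En_pair[OF S S] ..
    then have "N t \<le> (\<alpha> / \<rho>0) * ipD D (\<lambda>x. p0 x - q0 x) (\<lambda>x. p0 x - q0 x) + 2 * (LBINT r. I r * ipDt Ef Ez r)"
      using elim(1) t by (simp add: I_def)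
    moreover have "\<alpha> * gA q0 = (\<alpha> / \<rho>0) * ipD D (\<lambda>x. p0 x - q0 x) (\<lambda>x. p0 x - q0 x) + \<alpha> * (prim \<kappa> T)"
      by (simp add: gA_def distrib_left)
    ultimately show "N t + 2 * \<mu> * (LBINT r. indicator {0<..<t} r * ipDt Gz Gz r)
     \<le> \<alpha> * gA q0 + gC * (prim N t)"
      using 1 unfolding I_def by linarith
  qed
qed

lemma partial_nonneg: "(\<And>r. 0 \<le> k r) \<Longrightarrow> 0 \<le> (\<integral>r. indicator {0<..<t} r * (k r :: real) \<partial>(lborel :: real measure))"
  by (rule integral_nonneg_AE) auto

text \<open>Gronwall after discarding the dissipation; the factor \<alpha> passes through because it
  multiplies the inhomogeneity.\<close>

lemma N_bound: "AE t\<in>{0<..<T} in lborel. N t \<le> \<alpha> * gB q0"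
proof -
  have "AE t\<in>{0<..<T} in lborel. N t \<le> 2 * (\<alpha> * gA q0) * exp (2 * gC * t)"
  proof (rule Gronwall_AE[OF N_integrable N_nonneg _ gC])
    show "0 \<le> \<alpha> * gA q0" using \<alpha> gA by simp
    show "AE t\<in>{0<..<T} in lborel. N t \<le> \<alpha> * gA q0 + gC * (prim N t)"
      using energy_estimate
    proof eventually_elim
      case (elim t)
      have "0 \<le> 2 * \<mu> * (LBINT r. indicator {0<..<t} r * ipDt Gz Gz r)"
        using \<mu> by (intro mult_nonneg_nonneg partial_nonneg ipD_self_nonneg) auto
      then show ?case using elim by auto
    qed
  qed
  then show ?thesis
  proof eventually_elim
    case (elim t)
    show ?case
    proof
      assume t: "t \<in> {0<..<T}"
      have "exp (2 * gC * t) \<le> exp (2 * gC * T)" using t gC by simp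
      then have "2 * (\<alpha> * gA q0) * exp (2 * gC * t) \<le> 2 * (\<alpha> * gA q0) * exp (2 * gC * T)"
        using \<alpha> gA by (intro mult_left_mono) auto
      then show "N t \<le> \<alpha> * gB q0" using elim t by (simp add: gB_def mult_ac)
    qed
  qed
qed

lemma gB: "gB q0 \<ge> 0" using gA by (simp add: gB_def)

lemma z_bound: "AE t\<in>{0<..<T} in lborel. ipDt z z t \<le> \<alpha> * (gB q0 / \<rho>0)"
  using N_bound
proof eventually_elim
  case (elim t)
  have "0 \<le> (\<alpha> / \<rho>0) * ipDt \<pi> \<pi> t" using \<alpha> \<rho>0 by (simp add: ipD_self_nonneg)
  then have "t \<in> {0<..<T} \<longrightarrow> ipDt z z t * \<rho>0 \<le> \<alpha> * gB q0"
    using elim by (auto simp: N_def mult.commute)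
  then show ?case using \<rho>0 by (simp add: pos_le_divide_eq)
qed

text \<open>The energy is O(\<alpha>) and contains (\<alpha> / \<rho>0) |\<pi>|^2, so \<alpha>
  cancels: a bound, but no decay.\<close>

lemma \<pi>_bound: "AE t\<in>{0<..<T} in lborel. ipDt \<pi> \<pi> t \<le> \<rho>0 * gB q0"
  using N_bound
proof eventually_elim
  case (elim t)
  show ?case
  proof
    assume "t \<in> {0<..<T}"
    moreover have "0 \<le> \<rho>0 * ipDt z z t" using \<rho>0 by (simp add: ipD_self_nonneg)
    ultimately have "(\<alpha> / \<rho>0) * ipDt \<pi> \<pi> t \<le> (\<alpha> / \<rho>0) * (\<rho>0 * gB q0)"
      using elim \<rho>0 by (simp add: N_def)
    then show "ipDt \<pi> \<pi> t \<le> \<rho>0 * gB q0" by (rule mult_left_le_imp_le) (use \<alpha> \<rho>0 in auto)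
  qed
qed

text \<open>The energy bound is put back into the estimate that still contains the
  dissipation.\<close>

lemma Gz_bound: "(LBINT r. indicator {0<..<T} r * ipDt Gz Gz r) \<le> \<alpha> * gG q0"
proof -
  define g where "g r = indicator {0<..<T} r * ipDt Gz Gz r" for r
  have "(prim g T) \<le> \<alpha> * gG q0"
  proof (rule integral_le_of_AE_partial[OF _ T])
    show "integrable lborel g" unfolding g_def[abs_def] by (rule gz_integrable)
    have NB: "(prim N t) \<le> T * (\<alpha> * gB q0)" if t: "t \<in> {0<..<T}" for t
    proof -
      have "(prim N t) \<le> (LBINT r. indicator {0<..<T} r * (\<alpha> * gB q0))"
      proof (rule integral_mono_AE)
        have "(\<lambda>r. indicator {0<..<t} r * N r) = (\<lambda>r. indicator {0<..<t} r *\<^sub>R (indicator {0<..<T} r * N r))"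
          using t by (intro ext) (auto split: split_indicator)
        then show "integrable lborel (\<lambda>r. indicator {0<..<t} r * N r)"
          using integrable_mult_indicator[OF _ N_integrable, of "{0<..<t}"] by (simp only:) simp
        show "integrable lborel (\<lambda>r. indicator {0<..<T} r * (\<alpha> * gB q0))"
          using T by (intro integrable_mult_left integrable_real_indicator) auto
        show "AE r in lborel. indicator {0<..<t} r * N r \<le> indicator {0<..<T} r * (\<alpha> * gB q0)"
          using N_bound by eventually_elim (use t gB \<alpha> in \<open>auto split: split_indicator\<close>)
      qed
      then show ?thesis using T by simp
    qed
    show "AE t\<in>{0<..<T} in lborel. (prim g t) \<le> \<alpha> * gG q0"
      using energy_estimate
    proof eventually_elim
      case (elim t)
      show ?case
      proof
        assume t: "t \<in> {0<..<T}"
        define G where "G = (LBINT r. indicator {0<..<t} r * ipDt Gz Gz r)"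
        have "gC * (prim N t) \<le> gC * (T * (\<alpha> * gB q0))"
          using gC by (intro mult_left_mono NB t) auto
        then have "2 * \<mu> * G \<le> \<alpha> * gA q0 + gC * (T * (\<alpha> * gB q0))"
          using elim t N_nonneg[of t] unfolding G_def by auto
        then have "G \<le> \<alpha> * gG q0" using \<mu> by (simp add: gG_def field_simps)
        moreover have "(prim g t) = G"
          unfolding G_def g_def using t by (intro Bochner_Integration.integral_cong) (auto split: split_indicator)
        ultimately show "(prim g t) \<le> \<alpha> * gG q0" by simp
      qed
    qed
  qed
  moreover have "(\<lambda>r. indicator {0<..<T} r * g r) = g" by (rule ext) (auto simp: g_def split: split_indicator)
  ultimately have "integral\<^sup>L lborel g \<le> \<alpha> * gG q0" by (simp only:)
  then show ?thesis unfolding g_def[abs_def] .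
qed

text \<open>The pressure equation tested with the constant 1: the divergence of an H_0^1 field has
  mean zero.\<close>

lemma p_mean: "AE t\<in>{0<..<T} in lborel. ipD D (sl p t) (\<lambda>x. 1) = ipD D p0 (\<lambda>x. 1)"
proof -
  have one: "L2D D (\<lambda>x. 1 :: real)" by (rule L2D_const)
  have z0: "AE s\<in>{0<..<T} in lborel. ipD D (\<lambda>x. (- \<rho>0) *\<^sub>R trG (Gu x s)) (\<lambda>x. 1) = 0"
    using u_H01
  proof eventually_elim
    case (elim s)
    then show ?case
      unfolding ipD_scaleR_left using ipD_commute[of "\<lambda>x. trG (Gu x s)" "\<lambda>x. 1"] H01_div_mean by auto
  qed
  have "(LBINT s. indicator {0<..<t} s * ipD D (\<lambda>x. (- \<rho>0) *\<^sub>R trG (Gu x s)) (\<lambda>x. 1)) = 0" if t: "t \<le> T" for t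
  proof -
    have "(LBINT s. indicator {0<..<t} s * (indicator {0<..<T} s * ipD D (\<lambda>x. (- \<rho>0) *\<^sub>R trG (Gu x s)) (\<lambda>x. 1))) = 0"
      by (rule integral_eq_zero_AE) (use z0 in \<open>eventually_elim, auto split: split_indicator\<close>)
    then show ?thesis using partial_integral_restrict[OF t, of "\<lambda>s. ipD D (\<lambda>x. (- \<rho>0) *\<^sub>R trG (Gu x s)) (\<lambda>x. 1)"] by simp
  qed
  then show ?thesis
    using p_equation[OF one]
  proof (elim eventually_mono)
    fix t
    assume e: "t \<in> {0<..<T} \<longrightarrow> ipD D (\<lambda>x. \<alpha> *\<^sub>R p x t) (\<lambda>x. 1) = \<alpha> * ipD D p0 (\<lambda>x. 1) +
      (LBINT s. indicator {0<..<t} s * ipD D (\<lambda>x. (- \<rho>0) *\<^sub>R trG (Gu x s)) (\<lambda>x. 1))"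
    assume zz: "\<And>t. t \<le> T \<Longrightarrow> (LBINT s. indicator {0<..<t} s * ipD D (\<lambda>x. (- \<rho>0) *\<^sub>R trG (Gu x s)) (\<lambda>x. 1)) = 0"
    show "t \<in> {0<..<T} \<longrightarrow> ipD D (sl p t) (\<lambda>x. 1) = ipD D p0 (\<lambda>x. 1)"
      using e zz[of t] \<alpha> unfolding ipD_scaleR_left by auto
  qed
qed

lemma \<pi>_mean: "AE t\<in>{0<..<T} in lborel. ipD D (sl \<pi> t) (\<lambda>x. 1) = 0"
  using p_mean q_mean L2Q_slice[OF p] L2Q_slice[OF q]
proof eventually_elim
  case (elim t)
  show ?case
  proof
    assume t: "t \<in> {0<..<T}"
    have "ipD D (sl q t) (\<lambda>x. 1) = ipD D p0 (\<lambda>x. 1)" using elim(2) t by (auto simp: ipD_def)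
    then show "ipD D (sl \<pi> t) (\<lambda>x. 1) = 0"
      unfolding \<pi>_def using elim t ipD_diff_left[OF _ _ L2D_const[of 1], of "sl p t" "sl q t"] by auto
  qed
qed

end

subsection \<open>Products of one-dimensional bumps\<close>

definition bprod :: "('n::finite \<Rightarrow> real \<Rightarrow> real) \<Rightarrow> real^'n \<Rightarrow> real" where
  "bprod g x = (\<Prod>i\<in>UNIV. g i (x $ i))"

lemma smooth_coord: "smooth f \<Longrightarrow> smooth (\<lambda>x :: real^'n::finite. f (x $ i))"
  by (rule smooth_bounded_linear_comp[OF bounded_linear_vec_nth])

lemma smooth_bprod: "(\<And>i. smooth (g i)) \<Longrightarrow> smooth (bprod g)"
  unfolding bprod_def[abs_def] by (intro smooth_prod smooth_coord) auto

lemma bprod_split: "bprod g x = g j (x $ j) * (\<Prod>i\<in>UNIV - {j}. g i (x $ i))"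
  unfolding bprod_def by (rule prod.remove) auto

lemma line_derivative:
  fixes \<phi> :: "'a::euclidean_space \<Rightarrow> real"
  assumes "smooth \<phi>"
  shows "((\<lambda>t. \<phi> (x + t *\<^sub>R b)) has_real_derivative dd b \<phi> x) (at 0)"
proof -
  have "((\<lambda>t. x + t *\<^sub>R b) has_derivative (\<lambda>h. h *\<^sub>R b)) (at 0)" by (auto intro!: derivative_eq_intros)
  from diff_chain_at[OF this, of \<phi> "\<lambda>e. dd e \<phi> x"] smooth_has_derivative[OF assms, of x]
  have "((\<lambda>t. \<phi> (x + t *\<^sub>R b)) has_derivative (\<lambda>h. dd (h *\<^sub>R b) \<phi> x)) (at 0)" by (simp add: o_def)
  moreover have "dd (h *\<^sub>R b) \<phi> x = dd b \<phi> x * h" for h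
    using linear_cmul[OF has_derivative_linear[OF smooth_has_derivative[OF assms, of x]], of h b] by simp
  ultimately show ?thesis by (simp add: has_field_derivative_def mult.commute[of _ "dd b \<phi> _"])
qed

lemma dd_bprod:
  fixes g :: "'n::finite \<Rightarrow> real \<Rightarrow> real"
  assumes s: "\<And>i. smooth (g i)" and d: "(g j has_field_derivative f') (at (x $ j))"
  shows "dd (axis j 1) (bprod g) x = f' * (\<Prod>i\<in>UNIV - {j}. g i (x $ i))"
proof -
  have "bprod g (x + t *\<^sub>R axis j 1) = g j (x $ j + t) * (\<Prod>i\<in>UNIV - {j}. g i (x $ i))" for t
    unfolding bprod_split[of g _ j] by (auto simp: axis_def intro!: arg_cong2[where f="(*)"] prod.cong)
  moreover have "((\<lambda>t. g j (x $ j + t) * (\<Prod>i\<in>UNIV - {j}. g i (x $ i))) has_real_derivative f' * (\<Prod>i\<in>UNIV - {j}. g i (x $ i))) (at 0)"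
  proof -
    have "((\<lambda>t. g j (x $ j + t)) has_real_derivative f' * 1) (at 0)"
      by (rule DERIV_chain2[of "g j"]) (use d in \<open>auto intro!: derivative_eq_intros\<close>)
    from DERIV_cmult_right[OF this] show ?thesis by simp
  qed
  ultimately show ?thesis
    using DERIV_unique[OF line_derivative[OF smooth_bprod[OF s], where x=x and b="axis j 1"]] by simp
qed

lemma measure_box_cart:
  fixes c d :: "real^'n::finite"
  assumes "\<And>i. c $ i \<le> d $ i"
  shows "measure lborel (box c d) = (\<Prod>i\<in>UNIV. d $ i - c $ i)"
proof -
  have "measure lborel (box c d) = (\<Prod>b\<in>Basis. (d - c) \<bullet> b)"
    by (rule measure_lborel_box) (use assms in \<open>auto simp: Basis_vec_def inner_axis\<close>)
  also have "Basis = (\<lambda>i. axis i (1::real)) ` (UNIV :: 'n set)" by (auto simp: Basis_vec_def)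
  also have "(\<Prod>b\<in>\<dots>. (d - c) \<bullet> b) = (\<Prod>i\<in>UNIV. d $ i - c $ i)"
    by (subst prod.reindex) (auto simp: inj_on_def axis_eq_axis inner_axis)
  finally show ?thesis .
qed

context space_time
begin

lemma test_on_bprod:
  assumes s: "\<And>i. smooth (g i)" and z: "\<And>i t. t \<notin> {a $ i..b $ i} \<Longrightarrow> g i t = 0" and sub: "cbox a b \<subseteq> D"
  shows "test_on D (bprod g)"
proof (rule test_on_supportI[OF compact_cbox sub smooth_bprod[OF s]])
  fix x assume "x \<notin> cbox a b"
  then obtain i where "x $ i \<notin> {a $ i..b $ i}" by (auto simp: mem_box_cart)
  then have "g i (x $ i) = 0" by (rule z)
  then show "bprod g x = 0" unfolding bprod_def by (auto intro: prod_zero)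
qed

text \<open>The mean-zero factor has a compactly supported primitive; the product with this factor
  replaced by its primitive, pointing in direction j, is the required field.\<close>

lemma bprod_eq_divv:
  assumes s: "\<And>i. smooth (g i)" and z: "\<And>i t. t \<notin> {a $ i..b $ i} \<Longrightarrow> g i t = 0" and sub: "cbox a b \<subseteq> D"
    and mean: "(LBINT t. g j t) = 0"
  shows "\<exists>v. test_on D v \<and> divv v = bprod g"
proof -
  obtain c where c: "smooth c" "\<And>t. (c has_field_derivative g j t) (at t)" "\<And>t. t \<notin> {a $ j..b $ j} \<Longrightarrow> c t = 0"
    using smooth_primitive[OF s z mean] by blast
  define h where "h = g(j := c)"
  have hs: "smooth (h i)" for i using s c by (simp add: h_def)
  have th: "test_on D (bprod h)"
    by (rule test_on_bprod[OF hs _ sub]) (use z c in \<open>auto simp: h_def\<close>)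
  define v where "v x = bprod h x *\<^sub>R axis j (1::real)" for x
  have vs: "smooth v" unfolding v_def[abs_def] by (intro smooth_scaleR smooth_bprod hs smooth_const)
  have tv: "test_on D v" by (rule test_on_multiple[OF th vs]) (simp add: v_def)
  have "divv v x = bprod g x" for x
  proof -
    have "pdx i v x $ i = (if i = j then dd (axis j 1) (bprod h) x else 0)" for i
    proof -
      have "pdx i v x = dd (axis i 1) (bprod h) x *\<^sub>R axis j 1"
        unfolding pdx_def v_def[abs_def]
        by (rule dd_bounded_linear[OF bounded_linear_scaleR_left smooth_bprod[OF hs]])
      then show ?thesis by (auto simp: axis_def)
    qed
    then have "divv v x = dd (axis j 1) (bprod h) x" by (simp add: divv_def)
    also have "\<dots> = g j (x $ j) * (\<Prod>i\<in>UNIV - {j}. h i (x $ i))"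
      by (rule dd_bprod[OF hs]) (use c in \<open>simp add: h_def\<close>)
    also have "(\<Prod>i\<in>UNIV - {j}. h i (x $ i)) = (\<Prod>i\<in>UNIV - {j}. g i (x $ i))"
      by (rule prod.cong) (auto simp: h_def)
    finally show ?thesis by (simp add: bprod_split[of g x j])
  qed
  then show ?thesis using tv by blast
qed

end

section \<open>Bounded families whose weak gradient tends to zero\<close>

locale weakly_gradient_free = space_time D T for D :: "(real^'n::finite) set" and T :: real +
  fixes m :: "'i \<Rightarrow> real^'n \<Rightarrow> real" and F :: "'i filter" and C :: real
  assumes bnd: "\<forall>\<^sub>F a in F. L2D D (m a) \<and> ipD D (m a) (m a) \<le> C"
    and div0: "\<And>v. test_on D v \<Longrightarrow> ((\<lambda>a. ipD D (m a) (divv v)) \<longlongrightarrow> 0) F"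
    and conn: "connected D" and nonempty: "D \<noteq> {}"
begin

lemma m_bound:
  assumes g: "L2D D g"
  shows "\<forall>\<^sub>F a in F. \<bar>ipD D (m a) g\<bar> \<le> sqrt C * sqrt (ipD D g g)"
  using bnd
proof eventually_elim
  case (elim a)
  have "\<bar>ipD D (m a) g\<bar> \<le> sqrt (ipD D (m a) (m a)) * sqrt (ipD D g g)"
    using elim by (intro ipD_Cauchy_Schwarz g) auto
  also have "\<dots> \<le> sqrt C * sqrt (ipD D g g)"
    using elim by (intro mult_right_mono real_sqrt_le_mono) (auto simp: ipD_self_nonneg)
  finally show ?case .
qed

text \<open>Replacing one factor at a time changes the product by a function of mean zero in one variable,
  which is the divergence of a test field.\<close>

lemma replace_factors:
  fixes f \<beta> :: "'n \<Rightarrow> real \<Rightarrow> real"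
  assumes fs: "\<And>i. smooth (f i)" and fz: "\<And>i t. t \<notin> {a $ i..b $ i} \<Longrightarrow> f i t = 0"
    and bs: "\<And>i. smooth (\<beta> i)" and bz: "\<And>i t. t \<notin> {a $ i..b $ i} \<Longrightarrow> \<beta> i t = 0"
    and sub: "cbox a b \<subseteq> D"
    and fi: "\<And>i. integrable lborel (f i)" and bi: "\<And>i. integrable lborel (\<beta> i)" and b1: "\<And>i. (LBINT t. \<beta> i t) = 1"
  shows "((\<lambda>a. ipD D (m a) (bprod f) - (\<Prod>i\<in>UNIV. \<integral>t. f i t \<partial>lborel) * ipD D (m a) (bprod \<beta>)) \<longlongrightarrow> 0) F"
proof -
  define I where "I i = (LBINT t. f i t)" for i
  \<comment> \<open>The factors with index in S are already replaced by a multiple of \<beta> of the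
    same integral; the induction is on S.\<close>
  define g where "g S i = (if i \<in> S then (\<lambda>t. I i * \<beta> i t) else f i)" for S i
  have gs: "smooth (g S i)" for S i by (auto simp: g_def intro!: smooth_mult smooth_const fs bs)
  have gz: "g S i t = 0" if "t \<notin> {a $ i..b $ i}" for S i t using fz bz that by (auto simp: g_def)
  have gL: "L2D D (bprod (g S))" for S by (rule test_on_L2D(1)[OF test_on_bprod[OF gs gz sub]])
  have "((\<lambda>a. ipD D (m a) (bprod f) - ipD D (m a) (bprod (g S))) \<longlongrightarrow> 0) F" for S
    using finite[of S]
  proof (induction S rule: finite_induct)
    case empty
    have "g {} = f" by (auto simp: g_def)
    then show ?case by simp
  next
    case (insert j S)
    \<comment> \<open>The change made by treating index j: a product whose j-th factor has mean
      zero.\<close>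
    define d where "d = (g S)(j := (\<lambda>t. f j t - I j * \<beta> j t))"
    have ds: "smooth (d i)" for i using gs fs bs by (auto simp: d_def intro!: smooth_diff smooth_mult smooth_const)
    have dz: "d i t = 0" if "t \<notin> {a $ i..b $ i}" for i t using gz[OF that] fz[OF that] bz[OF that] by (auto simp: d_def)
    have "(LBINT t. d j t) = 0" using fi[of j] bi[of j] b1[of j] by (simp add: d_def I_def)
    then obtain v where v: "test_on D v" "divv v = bprod d" using bprod_eq_divv[where g=d and a=a and b=b and j=j, OF ds dz sub] by blast
    have diff: "bprod (g S) x - bprod (g (insert j S)) x = bprod d x" for x
    proof -
      have "(\<Prod>i\<in>UNIV - {j}. g (insert j S) i (x $ i)) = (\<Prod>i\<in>UNIV - {j}. g S i (x $ i))"
        "(\<Prod>i\<in>UNIV - {j}. d i (x $ i)) = (\<Prod>i\<in>UNIV - {j}. g S i (x $ i))"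
        by (auto simp: g_def d_def intro!: prod.cong)
      then show ?thesis
        unfolding bprod_split[of _ x j] using insert(2) by (simp add: g_def d_def algebra_simps)
    qed
    have "\<forall>\<^sub>F a in F. (ipD D (m a) (bprod f) - ipD D (m a) (bprod (g S))) + ipD D (m a) (divv v) =
        ipD D (m a) (bprod f) - ipD D (m a) (bprod (g (insert j S)))"
      using bnd
    proof eventually_elim
      case (elim a)
      have "ipD D (m a) (\<lambda>x. bprod (g S) x - bprod (g (insert j S)) x) = ipD D (m a) (bprod (g S)) - ipD D (m a) (bprod (g (insert j S)))"
        using elim by (intro ipD_diff_right gL) auto
      then show ?case unfolding v(2) diff by simp
    qed
    moreover have "((\<lambda>a. (ipD D (m a) (bprod f) - ipD D (m a) (bprod (g S))) + ipD D (m a) (divv v)) \<longlongrightarrow> 0 + 0) F"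
      by (intro tendsto_add insert div0 v)
    ultimately show ?case by (auto intro: Lim_transform_eventually)
  qed
  from this[of UNIV] have "((\<lambda>a. ipD D (m a) (bprod f) - ipD D (m a) (bprod (g UNIV))) \<longlongrightarrow> 0) F" .
  moreover have "bprod (g UNIV) = (\<lambda>x. (\<Prod>i\<in>UNIV. I i) *\<^sub>R bprod \<beta> x)"
    by (auto simp: bprod_def g_def prod.distrib)
  ultimately show ?thesis by (simp add: ipD_scaleR_right I_def del: real_scaleR_def)
qed

text \<open>The bounds on \<open>m a\<close> and \<open>k a\<close> make the approximation errors
  uniform in the index, so the limits in n and along F can be exchanged.\<close>

lemma limit_closed:
  fixes g :: "nat \<Rightarrow> real^'n \<Rightarrow> real"
  assumes gn: "\<And>n. L2D D (g n)" and g': "L2D D g'" and d: "(\<lambda>n. distD D (g n) g') \<longlonglongrightarrow> 0"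
    and V: "V \<longlonglongrightarrow> V'" and kb: "\<forall>\<^sub>F a in F. \<bar>k a\<bar> \<le> K"
    and lim: "\<And>n. ((\<lambda>a. ipD D (m a) (g n) - V n * k a) \<longlongrightarrow> 0) F"
  shows "((\<lambda>a. ipD D (m a) g' - V' * k a) \<longlongrightarrow> 0) F"
proof (rule tendstoI)
  fix e :: real assume e: "e > 0"
  have "(\<lambda>n. sqrt C * sqrt (distD D (g n) g') + \<bar>V n - V'\<bar> * K) \<longlonglongrightarrow> sqrt C * sqrt 0 + \<bar>V' - V'\<bar> * K"
    by (intro tendsto_intros d V)
  then have "\<forall>\<^sub>F n in sequentially. sqrt C * sqrt (distD D (g n) g') + \<bar>V n - V'\<bar> * K < e / 2"
    using e by (intro order_tendstoD) auto
  then obtain n where n: "sqrt C * sqrt (distD D (g n) g') + \<bar>V n - V'\<bar> * K < e / 2" by (auto simp: eventually_sequentially)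
  have "\<forall>\<^sub>F a in F. \<bar>ipD D (m a) (g n) - V n * k a\<bar> < e / 2"
    using order_tendstoD(2)[OF tendsto_rabs_zero[OF lim[of n]], of "e / 2"] e by simp
  with bnd kb m_bound[OF L2D_diff[OF gn[of n] g']]
  show "\<forall>\<^sub>F a in F. dist (ipD D (m a) g' - V' * k a) 0 < e"
  proof eventually_elim
    case (elim a)
    have "ipD D (m a) (\<lambda>x. g n x - g' x) = ipD D (m a) (g n) - ipD D (m a) g'"
      using elim by (intro ipD_diff_right gn g') auto
    moreover have "ipD D (\<lambda>x. g n x - g' x) (\<lambda>x. g n x - g' x) = distD D (g n) g'"
      by (simp add: ipD_self distD_eq ex_diff[abs_def])
    ultimately have 1: "\<bar>ipD D (m a) (g n) - ipD D (m a) g'\<bar> \<le> sqrt C * sqrt (distD D (g n) g')" using elim(3) by simp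
    have "\<bar>(V n - V') * k a\<bar> \<le> \<bar>V n - V'\<bar> * K" using elim(2) by (simp add: abs_mult mult_left_mono)
    then have "\<bar>V n * k a - V' * k a\<bar> \<le> \<bar>V n - V'\<bar> * K" by (simp only: left_diff_distrib)
    then have "\<bar>ipD D (m a) g' - V' * k a\<bar> < e"
      using 1 elim(4) n by linarith
    then show ?case by simp
  qed
qed

lemma ipD_box: "box c d \<subseteq> D \<Longrightarrow> ex (indicator (box c d)) = (\<lambda>x. indicator (box c d) x :: real)"
  by (rule ext) (auto simp: ex_def split: split_indicator)

lemma L2D_box: "box c d \<subseteq> D \<Longrightarrow> L2D D (\<lambda>x. indicator (box c d) x :: real)"
  unfolding L2D_iff ipD_box using L2_const_indicator[of "box c d" lborel "1::real"] by (simp add: emeasure_bounded_finite[OF bounded_box, simplified])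

text \<open>The local constant is the pairing with one fixed normalised product of bumps on the box.
  Any other product of bumps agrees in the limit with its integral times this constant, and
  indicators of subboxes are L^2 limits of such products.\<close>

lemma local_constant:
  assumes sub: "box l r \<subseteq> D" and ne: "box l r \<noteq> {}"
  shows "\<exists>k K. (\<forall>\<^sub>F a in F. \<bar>k a\<bar> \<le> K) \<and> (\<forall>c d. box c d \<subseteq> box l r \<longrightarrow>
     ((\<lambda>a. ipD D (m a) (indicator (box c d)) - measure lborel (box c d) * k a) \<longlongrightarrow> 0) F)"
proof -
  have lt_of_ne: "x $ i < y $ i" if "box x y \<noteq> {}" for x y :: "real^'n" and i
  proof -
    have "x \<bullet> axis i 1 < y \<bullet> axis i 1" using that axis_Basis[of i] unfolding box_ne_empty(2) by blast
    then show ?thesis by (simp add: inner_axis)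
  qed
  note lr = lt_of_ne[OF ne]
  have bint: "(\<lambda>n. LBINT t. bump c d n t) \<longlonglongrightarrow> d - c" if "c \<le> d" for c d
    using integral_mult_bump_tendsto[of c d "\<lambda>_. 1"] that by (simp add: set_integrable_def)
  have "\<forall>\<^sub>F n in sequentially. (LBINT t. bump (l $ i) (r $ i) n t) > 0" for i
    using lr[of i] by (intro order_tendstoD(1)[OF bint]) auto
  then have "\<forall>\<^sub>F n in sequentially. \<forall>i. (LBINT t. bump (l $ i) (r $ i) n t) > 0"
    by (rule eventually_all_finite)
  then obtain N where N: "\<And>i. (LBINT t. bump (l $ i) (r $ i) N t) > 0" by (auto simp: eventually_sequentially)
  define \<beta> where "\<beta> i t = bump (l $ i) (r $ i) N t * inverse (LBINT t. bump (l $ i) (r $ i) N t)" for i t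
  have bump_i: "integrable lborel (bump c d n)" for c d n
    by (rule test_on_L2(2)[OF test_on_real_bump[OF order_refl]])
  have \<beta>s: "smooth (\<beta> i)" for i unfolding \<beta>_def[abs_def] by (intro smooth_mult smooth_bump smooth_const)
  have \<beta>i: "integrable lborel (\<beta> i)" "(LBINT t. \<beta> i t) = 1" for i
    using bump_i N[of i] by (auto simp: \<beta>_def[abs_def])
  \<comment> \<open>Margins are the smaller of those of the n-th bumps and of \<beta>, so one
    compact box in D contains both supports.\<close>
  define A where "A n = (\<chi> i. l $ i + min (1 / Suc n) (1 / Suc N))" for n
  define B where "B n = (\<chi> i. r $ i - min (1 / Suc n) (1 / Suc N))" for n
  have AB: "cbox (A n) (B n) \<subseteq> D" for n
  proof -
    have "0 < min (1 / real (Suc n)) (1 / real (Suc N))" by simp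
    moreover define e where "e = min (1 / real (Suc n)) (1 / real (Suc N))"
    ultimately have "e > 0" by simp
    have "cbox (A n) (B n) \<subseteq> box l r"
      unfolding A_def B_def mem_box_cart subset_eq e_def[symmetric] vec_lambda_beta
    proof (intro ballI allI)
      fix x i assume "x \<in> cbox (\<chi> i. l $ i + e) (\<chi> i. r $ i - e)"
      then have "l $ i + e \<le> x $ i" "x $ i \<le> r $ i - e" by (auto simp: mem_box_cart)
      then show "l $ i < x $ i \<and> x $ i < r $ i" using \<open>e > 0\<close> by linarith
    qed
    then show ?thesis using sub by blast
  qed
  have \<beta>z: "\<beta> i t = 0" if "t \<notin> {A n $ i..B n $ i}" for i t n
  proof -
    have "t \<notin> {l $ i + 1 / Suc N..r $ i - 1 / Suc N}" using that by (auto simp: A_def B_def)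
    from bump_support[OF this] show ?thesis by (simp add: \<beta>_def)
  qed
  define k where "k a = ipD D (m a) (bprod \<beta>)" for a
  define K where "K = sqrt C * sqrt (ipD D (bprod \<beta>) (bprod \<beta>))"
  have kb: "\<forall>\<^sub>F a in F. \<bar>k a\<bar> \<le> K"
    unfolding k_def K_def by (rule m_bound[OF test_on_L2D(1)[OF test_on_bprod[OF \<beta>s \<beta>z AB]]])
  have "((\<lambda>a. ipD D (m a) (indicator (box c d)) - measure lborel (box c d) * k a) \<longlongrightarrow> 0) F"
    if cd: "box c d \<subseteq> box l r" for c d
  proof (cases "box c d = {}")
    case True
    then show ?thesis by (simp add: ipD_def)
  next
    case False
    note lt = lt_of_ne[OF False]
    have le: "l $ i \<le> c $ i" "d $ i \<le> r $ i" for i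
      using cd lt subset_interval_cart(4)[of c d l r] by (auto simp: not_le less_imp_le)
    have cdD: "box c d \<subseteq> D" using cd sub by blast
    define f where "f n i = bump (c $ i) (d $ i) n" for n i
    have fz: "f n i t = 0" if t: "t \<notin> {A n $ i..B n $ i}" for n i t
    proof -
      have "t \<notin> {c $ i + 1 / Suc n..d $ i - 1 / Suc n}" using t le[of i] by (auto simp: A_def B_def)
      from bump_support[OF this] show ?thesis by (simp add: f_def)
    qed
    have fs: "smooth (f n i)" for n i by (simp add: f_def smooth_bump)
    have tf: "test_on D (bprod (f n))" for n by (rule test_on_bprod[OF fs fz AB])
    have pt: "(\<lambda>n. bprod (f n) x) \<longlonglongrightarrow> indicator (box c d) x" for x
    proof -
      have "(\<lambda>n. bprod (f n) x) \<longlonglongrightarrow> (\<Prod>i\<in>UNIV. indicator {c $ i<..<d $ i} (x $ i))"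
        unfolding bprod_def f_def by (intro tendsto_prod bump_tendsto)
      moreover have "(\<Prod>i\<in>UNIV. indicator {c $ i<..<d $ i} (x $ i)) = (indicator (box c d) x :: real)"
        by (auto simp: mem_box_cart indicator_def prod_zero_iff)
      ultimately show ?thesis by simp
    qed
    have b01: "0 \<le> bprod (f n) x" "bprod (f n) x \<le> 1" for n x
      using bump_bounds by (auto simp: bprod_def f_def intro!: prod_nonneg prod_le_1)
    have dist: "(\<lambda>n. distD D (bprod (f n)) (indicator (box c d))) \<longlonglongrightarrow> 0"
    proof -
      have [measurable]: "bprod (f n) \<in> borel_measurable borel" for n by (rule test_on_L2(3)[OF tf])
      have "(\<lambda>n. LBINT x. indicator D x *\<^sub>R (norm (bprod (f n) x - indicator (box c d) x))\<^sup>2) \<longlonglongrightarrow> (\<integral>x. 0 \<partial>(lborel :: (real^'n) measure))"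
      proof (rule integral_dominated_convergence[where w="indicator D"])
        show "integrable lborel (indicator D :: _ \<Rightarrow> real)" using D_finite by (intro integrable_real_indicator) auto
        show "AE x in lborel. (\<lambda>n. indicator D x *\<^sub>R (norm (bprod (f n) x - indicator (box c d) x))\<^sup>2) \<longlonglongrightarrow> 0"
        proof (intro AE_I2)
          fix x
          have "(\<lambda>n. indicator D x *\<^sub>R (norm (bprod (f n) x - indicator (box c d) x))\<^sup>2) \<longlonglongrightarrow>
            indicator D x *\<^sub>R (norm (indicator (box c d) x - indicator (box c d) x :: real))\<^sup>2"
            by (intro tendsto_intros pt)
          then show "(\<lambda>n. indicator D x *\<^sub>R (norm (bprod (f n) x - indicator (box c d) x))\<^sup>2) \<longlonglongrightarrow> 0" by simp
        qed
        show "AE x in lborel. norm (indicator D x *\<^sub>R (norm (bprod (f n) x - indicator (box c d) x))\<^sup>2) \<le> indicator D x" for n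
        proof (intro AE_I2)
          fix x
          have "\<bar>bprod (f n) x - indicator (box c d) x\<bar> \<le> 1" using b01[of n x] by (auto split: split_indicator)
          then have "(bprod (f n) x - indicator (box c d) x)\<^sup>2 \<le> 1" by (simp add: abs_square_le_1)
          then show "norm (indicator D x *\<^sub>R (norm (bprod (f n) x - indicator (box c d) x))\<^sup>2) \<le> indicator D x"
            by (auto split: split_indicator)
        qed
      qed measurable
      then show ?thesis by (simp add: distD_def set_lebesgue_integral_def)
    qed
    have V: "(\<lambda>n. \<Prod>i\<in>UNIV. \<integral>t. f n i t \<partial>lborel) \<longlonglongrightarrow> measure lborel (box c d)"
      unfolding measure_box_cart[of c d, OF less_imp_le[OF lt]] f_def
      by (intro tendsto_prod bint less_imp_le lt)
    show ?thesis
    proof (rule limit_closed[OF test_on_L2D(1)[OF tf] L2D_box[OF cdD] dist V kb])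
      fix n
      show "((\<lambda>a. ipD D (m a) (bprod (f n)) - (\<Prod>i\<in>UNIV. \<integral>t. f n i t \<partial>lborel) * k a) \<longlongrightarrow> 0) F"
        unfolding k_def by (rule replace_factors[OF fs fz \<beta>s \<beta>z AB _ \<beta>i]) (simp_all add: f_def bump_i)
    qed
  qed
  then show ?thesis using kb by blast
qed

text \<open>The local constants agree up to \<open>o(1)\<close> on overlapping boxes, hence on the connected set \<open>D\<close>.\<close>

lemma weak_limit_up_to_constant:
  "\<exists>k K. (\<forall>\<^sub>F a in F. \<bar>k a\<bar> \<le> K) \<and> (\<forall>A \<in> sets borel.
     ((\<lambda>a. LBINT x. indicator A x * (ex (m a) x - k a * indicator D x)) \<longlongrightarrow> 0) F)"
proof -
  have box_in: "\<exists>l r. y \<in> box l r \<and> box l r \<subseteq> U" if U: "open U" "y \<in> U" for U and y :: "real^'n"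
  proof -
    obtain e where e: "e > 0" "ball y e \<subseteq> U" by (rule openE[OF U])
    obtain l r where "y \<in> box l r" "box l r \<subseteq> ball y e" using rational_boxes[OF e(1), of y] by metis
    then show ?thesis using e(2) by (intro exI[of _ l] exI[of _ r]) simp
  qed
  obtain l r where lr: "\<And>y. y \<in> D \<Longrightarrow> y \<in> box (l y) (r y)" "\<And>y. y \<in> D \<Longrightarrow> box (l y) (r y) \<subseteq> D"
    using box_in[OF D_open] by metis
  define Q where "Q y = box (l y) (r y)" for y
  have Q: "y \<in> Q y" "Q y \<subseteq> D" if "y \<in> D" for y using lr[OF that] by (auto simp: Q_def)
  have Qo[simp]: "open (Q y)" for y by (simp add: Q_def open_box)
  have "\<exists>k. (\<exists>K. \<forall>\<^sub>F a in F. \<bar>k a\<bar> \<le> K) \<and> (\<forall>c d. box c d \<subseteq> Q y \<longrightarrow>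
     ((\<lambda>a. ipD D (m a) (indicator (box c d)) - measure lborel (box c d) * k a) \<longlongrightarrow> 0) F)" if "y \<in> D" for y
  proof -
    have "box (l y) (r y) \<noteq> {}" using lr(1)[OF that] by blast
    from local_constant[OF lr(2)[OF that] this] show ?thesis 
      unfolding Q_def by (elim exE conjE) (intro exI conjI; assumption)
  qed
  then have "\<forall>y\<in>D. \<exists>k. (\<exists>K. \<forall>\<^sub>F a in F. \<bar>k a\<bar> \<le> K) \<and> (\<forall>c d. box c d \<subseteq> Q y \<longrightarrow>
     ((\<lambda>a. ipD D (m a) (indicator (box c d)) - measure lborel (box c d) * k a) \<longlongrightarrow> 0) F)" by (rule ballI)
  from bchoice[OF this] obtain k where "\<forall>y\<in>D. (\<exists>K. \<forall>\<^sub>F a in F. \<bar>k y a\<bar> \<le> K) \<and> (\<forall>c d. box c d \<subseteq> Q y \<longrightarrow>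
     ((\<lambda>a. ipD D (m a) (indicator (box c d)) - measure lborel (box c d) * k y a) \<longlongrightarrow> 0) F)" ..
  then have k: "\<And>y. y \<in> D \<Longrightarrow> \<exists>K. \<forall>\<^sub>F a in F. \<bar>k y a\<bar> \<le> K"
    and kc: "\<And>y c d. y \<in> D \<Longrightarrow> box c d \<subseteq> Q y \<Longrightarrow>
     ((\<lambda>a. ipD D (m a) (indicator (box c d)) - measure lborel (box c d) * k y a) \<longlongrightarrow> 0) F"
    by simp_all
  have agree: "((\<lambda>a. k y a - k y' a) \<longlongrightarrow> 0) F" if y: "y \<in> D" "y' \<in> D" and ne: "Q y \<inter> Q y' \<noteq> {}" for y y'
  proof -
    obtain x where x: "x \<in> Q y \<inter> Q y'" using ne by blast
    have "open (Q y \<inter> Q y')" by (intro open_Int Qo)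
    from box_in[OF this x] obtain c d where cd: "x \<in> box c d" "box c d \<subseteq> Q y \<inter> Q y'" by (elim exE conjE)
    have "c $ i < d $ i" for i using cd(1) by (auto simp: mem_box_cart intro: less_trans)
    then have pos: "measure lborel (box c d) > 0" by (simp add: measure_box_cart less_imp_le prod_pos)
    \<comment> \<open>Both local constants describe the family on a common small box; since its
      measure is positive, their difference tends to 0.\<close>
    have "((\<lambda>a. (1 / measure lborel (box c d)) * ((ipD D (m a) (indicator (box c d)) - measure lborel (box c d) * k y' a) -
       (ipD D (m a) (indicator (box c d)) - measure lborel (box c d) * k y a))) \<longlongrightarrow> (1 / measure lborel (box c d)) * (0 - 0)) F"
      using cd(2) by (intro tendsto_intros kc y) auto
    moreover have "(1 / measure lborel (box c d)) * ((ipD D (m a) (indicator (box c d)) - measure lborel (box c d) * k y' a) -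
       (ipD D (m a) (indicator (box c d)) - measure lborel (box c d) * k y a)) = k y a - k y' a" for a
      using pos by (simp add: field_simps)
    ultimately show ?thesis by simp
  qed
  obtain y0 where y0: "y0 \<in> D" using nonempty by blast
  define S where "S = {y \<in> D. ((\<lambda>a. k y a - k y0 a) \<longlongrightarrow> 0) F}"
  have "y0 \<in> S" using y0 by (simp add: S_def)
  have close: "y' \<in> S" if "y \<in> S" "y' \<in> D" "Q y \<inter> Q y' \<noteq> {}" for y y'
  proof -
    have "((\<lambda>a. (k y' a - k y a) + (k y a - k y0 a)) \<longlongrightarrow> 0 + 0) F"
      by (rule tendsto_add[OF agree]) (use that in \<open>auto simp: S_def\<close>)
    then show ?thesis using that by (simp add: S_def)
  qed
  have SD: "y \<in> S" if "y \<in> D" for y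
  proof (rule ccontr)
    assume "y \<notin> S"
    \<comment> \<open>Boxes around points of S and boxes around the remaining points cannot meet, so
      they would separate the connected set D.\<close>
    let ?A = "\<Union>y\<in>S. Q y" and ?B = "\<Union>y\<in>D - S. Q y"
    have "open ?A" "open ?B" by auto
    moreover have "D \<subseteq> ?A \<union> ?B" using Q(1) by blast
    moreover have "?A \<inter> ?B \<inter> D = {}" using close by blast
    moreover have "?A \<inter> D \<noteq> {}" using \<open>y0 \<in> S\<close> y0 Q(1) by blast
    moreover have "?B \<inter> D \<noteq> {}" using \<open>y \<notin> S\<close> that Q(1) by blast
    ultimately show False using conn unfolding connected_def by blast
  qed
  obtain K where K: "\<forall>\<^sub>F a in F. \<bar>k y0 a\<bar> \<le> K" using k[OF y0] by blast
  \<comment> \<open>The single constant belonging to \<open>y0\<close> now serves on all of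
    D.\<close>
  define h where "h a x = ex (m a) x - k y0 a * indicator D x" for a x
  define Ch where "Ch = 2 * C + 2 * (K\<^sup>2 * measure lborel D)"
  have one: "L2 lborel (\<lambda>x. c *\<^sub>R (indicator D x *\<^sub>R (1::real)))" for c
    by (intro L2_scaleR L2_const_indicator) (use D_finite in auto)
  have nsq1: "nsq lborel (\<lambda>x. indicator D x *\<^sub>R (1::real)) = measure lborel D"
  proof -
    have "nsq lborel (\<lambda>x. indicator D x *\<^sub>R (1::real)) = (LBINT x. indicator D x)"
      unfolding nsq_def by (intro Bochner_Integration.integral_cong) (auto split: split_indicator)
    then show ?thesis by simp
  qed
  have hb: "\<forall>\<^sub>F a in F. L2 lborel (h a) \<and> nsq lborel (h a) \<le> Ch"
    using bnd K
  proof eventually_elim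
    case (elim a)
    have e: "L2 lborel (ex (m a))" using elim by (intro L2D_ex) auto
    have "k y0 a ^ 2 \<le> K\<^sup>2" using power_mono[OF elim(2), of 2] by simp
    then have kk: "k y0 a ^ 2 * measure lborel D \<le> K\<^sup>2 * measure lborel D" by (rule mult_right_mono) simp
    have h_eq: "h a = (\<lambda>x. ex (m a) x + (- k y0 a) *\<^sub>R (indicator D x *\<^sub>R (1::real)))" by (auto simp: h_def)
    have "nsq lborel (h a) \<le> 2 * nsq lborel (ex (m a)) + 2 * nsq lborel (\<lambda>x. (- k y0 a) *\<^sub>R (indicator D x *\<^sub>R (1::real)))"
      unfolding h_eq by (rule nsq_add_le[OF e one])
    also have "nsq lborel (\<lambda>x. (- k y0 a) *\<^sub>R (indicator D x *\<^sub>R (1::real))) = k y0 a ^ 2 * measure lborel D"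
      unfolding nsq_scaleR nsq1 by simp
    finally have "nsq lborel (h a) \<le> Ch" using elim kk by (simp add: Ch_def ipD_self)
    moreover have "L2 lborel (h a)" unfolding h_eq by (rule L2_add[OF e one])
    ultimately show ?case by simp
  qed
  have h0: "h a x = 0" if "x \<notin> D" for a x using that by (simp add: h_def ex_def)
  have hbox: "((\<lambda>a. LBINT x. indicator (box c d) x * h a x) \<longlongrightarrow> 0) F" if y: "y \<in> D" and cd: "box c d \<subseteq> Q y" for y c d
  proof -
    have cdD: "box c d \<subseteq> D" using cd Q(2)[OF y] by blast
    have "((\<lambda>a. (ipD D (m a) (indicator (box c d)) - measure lborel (box c d) * k y a) + measure lborel (box c d) * (k y a - k y0 a))
       \<longlongrightarrow> 0 + measure lborel (box c d) * 0) F"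
      using SD[OF y] by (intro tendsto_intros kc y cd) (simp add: S_def)
    moreover have "\<forall>\<^sub>F a in F. (ipD D (m a) (indicator (box c d)) - measure lborel (box c d) * k y a) + measure lborel (box c d) * (k y a - k y0 a)
       = (LBINT x. indicator (box c d) x * h a x)"
      using bnd
    proof eventually_elim
      case (elim a)
      have i1: "integrable lborel (\<lambda>x. ex (m a) x * indicator (box c d) x)"
        using ipD_integrable[OF _ L2D_box[OF cdD], of "m a"] elim unfolding ipD_box[OF cdD] by simp
      have i2: "integrable lborel (indicator (box c d) :: real^'n \<Rightarrow> real)"
        by (rule integrable_real_indicator) (auto simp: emeasure_bounded_finite[OF bounded_box, simplified])
      have "(LBINT x. indicator (box c d) x * h a x) = (LBINT x. ex (m a) x * indicator (box c d) x - k y0 a * indicator (box c d) x)"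
        using cdD by (intro Bochner_Integration.integral_cong) (auto simp: h_def split: split_indicator)
      also have "\<dots> = (LBINT x. ex (m a) x * indicator (box c d) x) - k y0 a * measure lborel (box c d)"
        using i1 i2 by simp
      also have "(LBINT x. ex (m a) x * indicator (box c d) x) = ipD D (m a) (indicator (box c d))"
        unfolding ipD_eq ipD_box[OF cdD] by simp
      finally show ?case by (simp add: algebra_simps)
    qed
    ultimately show ?thesis by (auto intro: Lim_transform_eventually)
  qed
  have hQ: "((\<lambda>a. LBINT x. indicator A x * (indicator (Q y) x * h a x)) \<longlongrightarrow> 0) F"
    if y: "y \<in> D" and A: "A \<in> sets borel" for y A
  proof (rule weak_limit_sets[where S="Q y" and C=Ch and G="range (\<lambda>(a, b). box a b)"])
    show "Q y \<in> sets borel" by simp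
    have "bounded (Q y)" by (simp add: Q_def bounded_box)
    then show "emeasure lborel (Q y) < \<infinity>" by (rule emeasure_bounded_finite)
    show "\<forall>\<^sub>F a in F. L2 lborel (\<lambda>x. indicator (Q y) x * h a x) \<and> nsq lborel (\<lambda>x. indicator (Q y) x * h a x) \<le> Ch"
      using hb
    proof eventually_elim
      case (elim a)
      have L: "L2 lborel (\<lambda>x. indicator (Q y) x * h a x)" using L2_indicator[of lborel "h a" "Q y"] elim by simp
      have "nsq lborel (\<lambda>x. indicator (Q y) x * h a x) \<le> nsq lborel (h a)"
        unfolding nsq_def by (rule integral_mono[OF L2_int[OF L] L2_int]) (use elim in \<open>auto split: split_indicator\<close>)
      then show ?case using L elim by simp
    qed
    show "indicator (Q y) x * h a x = 0" if "x \<notin> Q y" for a x using that by simp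
    show "((\<lambda>a. LBINT x. indicator (Q y) x * h a x) \<longlongrightarrow> 0) F"
      using hbox[OF y, of "l y" "r y"] by (simp add: Q_def)
    show "Int_stable (range (\<lambda>(a, b). box a b :: (real^'n) set))" by (rule Int_stable_box)
    show "sets borel = sigma_sets UNIV (range (\<lambda>(a, b). box a b :: (real^'n) set))" by (rule borel_eq_sigma_box)
    show "A \<in> sets borel" by (rule A)
    fix A :: "(real^'n) set" assume "A \<in> range (\<lambda>(a, b). box a b)"
    moreover have "Q y \<in> range (\<lambda>(a, b). box a b)" by (auto simp: Q_def)
    \<comment> \<open>Boxes are stable under intersection, so an arbitrary box is replaced by one
      inside \<open>Q y\<close>.\<close>
    ultimately have "A \<inter> Q y \<in> range (\<lambda>(a, b). box a b)" 
      by (intro Int_stableD[OF Int_stable_box])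
    then obtain c d where cd: "A \<inter> Q y = box c d" by auto
    have e: "indicator A x * (indicator (Q y) x * h a x) = indicator (box c d) x * h a x" for a x
      unfolding cd[symmetric] by (auto split: split_indicator)
    have "box c d \<subseteq> Q y" using cd by blast
    from hbox[OF y this] show "((\<lambda>a. LBINT x. indicator A x * (indicator (Q y) x * h a x)) \<longlongrightarrow> 0) F"
      unfolding e .
  qed
  have op: "\<And>S. S \<in> Q ` D \<Longrightarrow> open S" by auto
  \<comment> \<open>A countable subcover, made disjoint, cuts every Borel subset of D into countably
    many pieces, each inside a single \<open>Q y\<close>.\<close>
  obtain \<F>' where F': "\<F>' \<subseteq> Q ` D" "countable \<F>'" "\<Union>\<F>' = \<Union>(Q ` D)"
    by (rule Lindelof[OF op])
  have UD: "\<Union>\<F>' = D" using F'(3) Q by auto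
  have F'ne: "\<F>' \<noteq> {}" using UD nonempty by auto
  define B where "B j = from_nat_into \<F>' j" for j
  have Bran: "range B = \<F>'" unfolding B_def[abs_def] using F'ne F'(2) by (rule range_from_nat_into)
  have BQ: "\<exists>y\<in>D. B j = Q y" for j
  proof -
    have "B j \<in> \<F>'" using Bran by auto
    then show ?thesis using F'(1) by auto
  qed
  have Bm: "B j \<in> sets borel" for j using BQ[of j] by auto
  have dm: "disjointed B j \<in> sets borel" for j
    using sets.range_disjointed_sets[of B borel] Bm by auto
  have "((\<lambda>a. LBINT x. indicator A x * h a x) \<longlongrightarrow> 0) F" if A: "A \<in> sets borel" for A
  proof -
    define E where "E j = A \<inter> disjointed B j" for j
    have Em: "E j \<in> sets borel" for j unfolding E_def using A dm by auto
    have "((\<lambda>a. LBINT x. indicator (\<Union>j. E j) x * h a x) \<longlongrightarrow> 0) F"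
    proof (rule weak_limit_UN[where S=D and C=Ch and A=E, OF D_sets D_finite hb h0 Em])
      show "disjoint_family E" unfolding E_def
        using disjoint_family_disjointed[of B] by (auto simp: disjoint_family_on_def)
      fix j
      obtain y where y: "y \<in> D" "B j = Q y" using BQ[of j] by blast
      have "E j \<subseteq> Q y" using disjointed_subset[of B j] y by (auto simp: E_def)
      then have e: "indicator (E j) x * (indicator (Q y) x * h a x) = indicator (E j) x * h a x" for a x
        by (auto split: split_indicator)
      from hQ[OF y(1) Em[of j]] show "((\<lambda>a. LBINT x. indicator (E j) x * h a x) \<longlongrightarrow> 0) F"
        unfolding e .
    qed
    moreover have "(\<Union>j. E j) = A \<inter> D"
    proof -
      have "(\<Union>j. E j) = A \<inter> (\<Union>j. disjointed B j)" by (auto simp: E_def)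
      also have "(\<Union>j. disjointed B j) = D" unfolding UN_disjointed_eq using Bran UD by auto
      finally show ?thesis .
    qed
    moreover have "indicator (A \<inter> D) x * h a x = indicator A x * h a x" for a x
      using h0[of x a] by (auto split: split_indicator)
    ultimately show ?thesis by simp
  qed
  then show ?thesis using K unfolding h_def by blast
qed

text \<open>Comparing the mean of \<open>m a\<close> with the constant on all of D, a set of
  positive measure, forces the constants to 0.\<close>

theorem weak_limit_zero:
  assumes mean: "((\<lambda>a. ipD D (m a) (\<lambda>x. 1)) \<longlongrightarrow> 0) F" and g: "L2D D g"
  shows "((\<lambda>a. ipD D (m a) g) \<longlongrightarrow> 0) F"
proof -
  obtain k K where k: "\<And>A. A \<in> sets borel \<Longrightarrow>
     ((\<lambda>a. LBINT x. indicator A x * (ex (m a) x - k a * indicator D x)) \<longlongrightarrow> 0) F"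
    using weak_limit_up_to_constant by blast
  have split: "\<forall>\<^sub>F a in F. (LBINT x. indicator A x * (ex (m a) x - k a * indicator D x))
      = (LBINT x. indicator A x * ex (m a) x) - k a * measure lborel (A \<inter> D)" if A: "A \<in> sets borel" for A
    using bnd
  proof eventually_elim
    case (elim a)
    have e: "L2 lborel (ex (m a))" using elim by (intro L2D_ex) auto
    have i1: "integrable lborel (\<lambda>x. indicator A x * ex (m a) x)"
      by (rule weak_limit_set_bound(2)[OF D_sets D_finite e order_refl _ A]) (simp add: ex_def)
    have "A \<inter> D \<in> fmeasurable lborel"
      by (rule weak_limit_set_bound(1)[OF D_sets D_finite e order_refl _ A]) (simp add: ex_def)
    then have i2: "integrable lborel (indicator (A \<inter> D) :: real^'n \<Rightarrow> real)"
      by (intro integrable_real_indicator) (auto simp: fmeasurable_def)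
    have "(LBINT x. indicator A x * (ex (m a) x - k a * indicator D x)) =
       (LBINT x. indicator A x * ex (m a) x - k a * indicator (A \<inter> D) x)"
      by (intro Bochner_Integration.integral_cong) (auto split: split_indicator)
    also have "\<dots> = (LBINT x. indicator A x * ex (m a) x) - k a * measure lborel (A \<inter> D)"
      using i1 i2 by simp
    finally show ?case .
  qed
  have Dpos: "measure lborel D > 0"
  proof -
    have "emeasure lborel D \<noteq> 0"
      using open_not_negligible[OF D_open nonempty] D_open by (simp add: negligible_iff_emeasure0)
    then show ?thesis using D_finite by (simp add: measure_def enn2real_positive_iff zero_less_iff_neq_zero less_top)
  qed
  have "ipD D (m a) (\<lambda>x. 1) = (LBINT x. indicator UNIV x * ex (m a) x)" for a
    unfolding ipD_eq by (intro Bochner_Integration.integral_cong) (auto simp: ex_def split: split_indicator)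
  then have "((\<lambda>a. LBINT x. indicator UNIV x * ex (m a) x) \<longlongrightarrow> 0) F" using mean by simp
  moreover have "((\<lambda>a. (LBINT x. indicator UNIV x * ex (m a) x) - k a * measure lborel (UNIV \<inter> D)) \<longlongrightarrow> 0) F"
    by (rule Lim_transform_eventually[OF k[of UNIV] split[of UNIV]]) auto
  \<comment> \<open>The difference of the two null quantities is \<open>k a\<close> times the
    measure of D.\<close>
  ultimately have "((\<lambda>a. (1 / measure lborel D) * ((LBINT x. indicator UNIV x * ex (m a) x) -
     ((LBINT x. indicator UNIV x * ex (m a) x) - k a * measure lborel (UNIV \<inter> D)))) \<longlongrightarrow> (1 / measure lborel D) * (0 - 0)) F"
    by (intro tendsto_intros)
  then have k0: "(k \<longlongrightarrow> 0) F" using Dpos by simp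
  have sets: "((\<lambda>a. LBINT x. indicator A x * ex (m a) x) \<longlongrightarrow> 0) F" if A: "A \<in> sets borel" for A
  proof -
    have "((\<lambda>a. (LBINT x. indicator A x * ex (m a) x) - k a * measure lborel (A \<inter> D)) \<longlongrightarrow> 0) F"
      by (rule Lim_transform_eventually[OF k[OF A] split[OF A]])
    from tendsto_add[OF this tendsto_mult_left_zero[OF k0, of "measure lborel (A \<inter> D)"]] show ?thesis by simp
  qed
  have "\<forall>\<^sub>F a in F. L2 lborel (ex (m a)) \<and> nsq lborel (ex (m a)) \<le> C"
    using bnd by eventually_elim (auto simp: ipD_self intro: L2D_ex)
  from weak_limit_L2[OF this sets L2D_ex[OF g]] show ?thesis
    unfolding ipD_eq by (simp add: mult.commute)
qed

end

subsection \<open>Weak convergence in space-time\<close>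

context space_time
begin

lemma nsq_exQ_le:
  fixes a :: "real^'n \<Rightarrow> real \<Rightarrow> 'b::euclidean_space"
  assumes a: "L2Q D T a" and le: "AE t\<in>{0<..<T} in lborel. ipDt a a t \<le> c"
  shows "nsq lborel (exQ a) \<le> T * c"
proof -
  have "nsq lborel (exQ a) = (LBINT t. indicator {0<..<T} t * ipDt a a t)"
    using pairing_eq(1)[OF a a] by (simp add: nsq_inner set_lebesgue_integral_def)
  also have "\<dots> \<le> (LBINT t. indicator {0<..<T} t * c)"
  proof (rule integral_mono_AE[OF pairing_eq(2)[OF a a]])
    show "integrable lborel (\<lambda>t. indicator {0<..<T} t * c)"
      using T by (intro integrable_mult_left integrable_real_indicator) auto
    show "AE t in lborel. indicator {0<..<T} t * ipDt a a t \<le> indicator {0<..<T} t * c"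
      using le by eventually_elim (auto split: split_indicator)
  qed
  finally show ?thesis using T by simp
qed

lemma J_bound:
  fixes a :: "real^'n \<Rightarrow> real \<Rightarrow> 'b::euclidean_space"
  assumes a: "L2Q D T a" and v: "L2D D v" and m: "\<psi> \<in> borel_measurable borel" and B: "\<And>t. \<bar>\<psi> t\<bar> \<le> B"
  shows "\<bar>J a v \<psi>\<bar> \<le> sqrt (nsq lborel (exQ a)) * sqrt (B\<^sup>2 * T * ipD D v v)"
proof -
  have L: "L2 lborel (exQ a)" "L2 lborel (exQ (\<lambda>x t. \<psi> t *\<^sub>R v x))"
    using a L2Q_tensor[OF v m B] by (auto simp: L2Q_iff)
  have "\<bar>J a v \<psi>\<bar> \<le> sqrt (nsq lborel (exQ a)) * sqrt (nsq lborel (exQ (\<lambda>x t. \<psi> t *\<^sub>R v x)))"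
    unfolding J_pairing(1)[OF a v m B] by (rule L2_Cauchy_Schwarz[OF L])
  also have "\<dots> \<le> sqrt (nsq lborel (exQ a)) * sqrt (B\<^sup>2 * T * ipD D v v)"
    unfolding ipD_self by (intro mult_left_mono real_sqrt_le_mono nsq_exQ_tensor_le[OF v m B]) (simp add: nsq_nonneg)
  finally show ?thesis .
qed

lemma measurable_mQ_iff:
  "(\<lambda>(x, t). g x t) \<in> borel_measurable mQ \<longleftrightarrow> (\<lambda>p. g (fst p) (snd p)) \<in> borel_measurable borel"
  for g :: "real^'n \<Rightarrow> real \<Rightarrow> real"
  by (simp add: lborel_prod case_prod_unfold)

lemma ipD_measurable:
  fixes g :: "real^'n \<Rightarrow> real \<Rightarrow> real"
  assumes "(\<lambda>p. f (fst p) (snd p)) \<in> borel_measurable borel" "(\<lambda>p. g (fst p) (snd p)) \<in> borel_measurable borel"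
  shows "(\<lambda>t. ipDt f g t) \<in> borel_measurable borel"
proof -
  define F G where "F p = f (fst p) (snd p)" and "G p = g (fst p) (snd p)" for p
  have [measurable]: "F \<in> borel_measurable borel" "G \<in> borel_measurable borel"
    using assms by (simp_all add: F_def[abs_def] G_def[abs_def])
  have "(\<lambda>t. LBINT x. indicator D x * (F (x, t) * G (x, t))) \<in> borel_measurable borel" by measurable
  then show ?thesis by (simp add: ipD_def set_lebesgue_integral_def F_def G_def)
qed

lemma slice_measurable:
  fixes g :: "real^'n \<Rightarrow> real \<Rightarrow> real"
  assumes "(\<lambda>p. g (fst p) (snd p)) \<in> borel_measurable borel" shows "(sl g t) \<in> borel_measurable borel"
  using measurable_compose[of "\<lambda>x. (x, t)" borel borel "\<lambda>p. g (fst p) (snd p)" borel] assms by simp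

lemma L2D_dominated:
  fixes g h :: "real^'n \<Rightarrow> real"
  assumes g: "L2D D g" and h[measurable]: "h \<in> borel_measurable borel" and le: "\<And>x. \<bar>h x\<bar> \<le> \<bar>g x\<bar>"
  shows "L2D D h" "ipD D h h \<le> ipD D g g"
proof -
  have le2: "(norm (ex h x))\<^sup>2 \<le> (norm (ex g x))\<^sup>2" for x
    using power_mono[OF le[of x], of 2] by (auto simp: ex_def split: split_indicator)
  have "ex h \<in> borel_measurable lborel" unfolding ex_def[abs_def] by measurable
  from L2I_bound[OF this L2_int[OF L2D_ex[OF g]]] have L: "L2 lborel (ex h)" using le2 by simp
  then show "L2D D h" by (simp add: L2D_iff)
  show "ipD D h h \<le> ipD D g g"
    unfolding ipD_self nsq_def by (rule integral_mono[OF L2_int[OF L] L2_int[OF L2D_ex[OF g]] le2])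
qed

lemma L1L2_D:
  assumes "L1L2 D T g"
  shows "(\<lambda>p. g (fst p) (snd p)) \<in> borel_measurable borel"
    and "AE t\<in>{0<..<T} in lborel. L2D D (sl g t)"
    and "integrable lborel (\<lambda>t. indicator {0<..<T} t * sqrt (ipDt g g t))"
  using assms by (simp_all add: L1L2_def measurable_mQ_iff set_integrable_def ipD_def power2_eq_square)

lemma L1L2_dominated:
  assumes g: "L1L2 D T g" and m: "(\<lambda>p. h (fst p) (snd p)) \<in> borel_measurable borel" and le: "\<And>x t. \<bar>h x t\<bar> \<le> \<bar>g x t\<bar>"
  shows "L1L2 D T h"
proof -
  note [measurable] = ipD_measurable[OF m m]
  have "AE t\<in>{0<..<T} in lborel. L2D D (sl h t)"
    using L1L2_D(2)[OF g] by eventually_elim (use le in \<open>auto intro!: L2D_dominated(1)[OF _ slice_measurable[OF m]]\<close>)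
  moreover have "integrable lborel (\<lambda>t. indicator {0<..<T} t * sqrt (ipDt h h t))"
  proof (rule Bochner_Integration.integrable_bound[OF L1L2_D(3)[OF g]])
    show "AE t in lborel. norm (indicator {0<..<T} t * sqrt (ipDt h h t))
        \<le> norm (indicator {0<..<T} t * sqrt (ipDt g g t))"
      using L1L2_D(2)[OF g]
    proof eventually_elim
      case (elim t)
      then have "t \<in> {0<..<T} \<Longrightarrow> ipDt h h t \<le> ipDt g g t"
        using le by (intro L2D_dominated(2) slice_measurable[OF m]) auto
      then show ?case by (auto simp: ipD_self_nonneg split: split_indicator)
    qed
  qed measurable
  ultimately show ?thesis
    using m by (simp add: L1L2_def measurable_mQ_iff set_integrable_def ipD_def power2_eq_square)
qed

text \<open>The duality bound between essentially bounded and integrable functions of time with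
  values in L^2(D), from Cauchy-Schwarz on almost every slice.\<close>

lemma L1L2_pairing:
  fixes P :: "real^'n \<Rightarrow> real \<Rightarrow> real"
  assumes P: "L2Q D T P" and C: "AE t\<in>{0<..<T} in lborel. ipDt P P t \<le> C"
    and g: "L1L2 D T g"
  shows "integrable lborel (\<lambda>t. indicator {0<..<T} t * ipDt P g t)"
    and "\<bar>pairT D T P g\<bar> \<le> sqrt C * (LBINT t. indicator {0<..<T} t * sqrt (ipDt g g t))"
proof -
  have "(\<lambda>p. P (fst p) (snd p)) \<in> borel_measurable borel" using P by (simp add: L2Q_iff)
  note [measurable] = ipD_measurable[OF this L1L2_D(1)[OF g]]
  note gi = integrable_mult_right[OF L1L2_D(3)[OF g], of "sqrt C"]
  have b: "AE t in lborel. \<bar>indicator {0<..<T} t * ipDt P g t\<bar> \<le>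
     sqrt C * (indicator {0<..<T} t * sqrt (ipDt g g t))"
    using L2Q_slice[OF P] L1L2_D(2)[OF g] C
  proof eventually_elim
    case (elim t)
    show ?case
    proof (cases "t \<in> {0<..<T}")
      case True
      then have "\<bar>ipDt P g t\<bar> \<le> sqrt (ipDt P P t) * sqrt (ipDt g g t)"
        using elim by (intro ipD_Cauchy_Schwarz) auto
      also have "\<dots> \<le> sqrt C * sqrt (ipDt g g t)"
        using elim True by (intro mult_right_mono real_sqrt_le_mono) (auto simp: ipD_self_nonneg)
      finally show ?thesis using True by simp
    qed simp
  qed
  show i: "integrable lborel (\<lambda>t. indicator {0<..<T} t * ipDt P g t)"
  proof (rule Bochner_Integration.integrable_bound[OF gi])
    show "AE t in lborel. norm (indicator {0<..<T} t * ipDt P g t) \<le>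
       norm (sqrt C * (indicator {0<..<T} t * sqrt (ipDt g g t)))"
      using b by eventually_elim (unfold real_norm_def, erule order_trans[OF _ abs_ge_self])
  qed measurable
  have "\<bar>pairT D T P g\<bar> \<le> (LBINT t. \<bar>indicator {0<..<T} t * ipDt P g t\<bar>)"
    unfolding pairT_def set_lebesgue_integral_def real_scaleR_def by (rule integral_abs_bound)
  also have "\<dots> \<le> (LBINT t. sqrt C * (indicator {0<..<T} t * sqrt (ipDt g g t)))"
    by (rule integral_mono_AE[OF integrable_abs[OF i] gi b])
  finally show "\<bar>pairT D T P g\<bar> \<le> sqrt C * (LBINT t. indicator {0<..<T} t * sqrt (ipDt g g t))" by simp
qed

lemma pairT_diff_left:
  fixes P R :: "real^'n \<Rightarrow> real \<Rightarrow> real"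
  assumes P: "L2Q D T P" "AE t\<in>{0<..<T} in lborel. ipDt P P t \<le> C"
    and R: "L2Q D T R" "AE t\<in>{0<..<T} in lborel. ipDt R R t \<le> C'" and g: "L1L2 D T g"
  shows "pairT D T (\<lambda>x t. P x t - R x t) g = pairT D T P g - pairT D T R g"
proof -
  note i = L1L2_pairing(1)[OF P g] L1L2_pairing(1)[OF R g]
  have "(\<lambda>p. P (fst p) (snd p) - R (fst p) (snd p)) \<in> borel_measurable borel"
    using L2Q_diff[OF P(1) R(1)] by (simp add: L2Q_iff)
  note [measurable] = ipD_measurable[of "\<lambda>x t. P x t - R x t", OF this L1L2_D(1)[OF g]]
  have "(LBINT t. indicator {0<..<T} t * ipD D (\<lambda>x. P x t - R x t) (sl g t)) =
     (LBINT t. indicator {0<..<T} t * ipDt P g t - indicator {0<..<T} t * ipDt R g t)"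
  proof (rule integral_cong_AE)
    show "AE t in lborel. indicator {0<..<T} t * ipD D (\<lambda>x. P x t - R x t) (sl g t) =
       indicator {0<..<T} t * ipDt P g t - indicator {0<..<T} t * ipDt R g t"
      using L2Q_slice[OF P(1)] L2Q_slice[OF R(1)] L1L2_D(2)[OF g]
      by eventually_elim (auto simp: ipD_diff_left split: split_indicator)
  qed (use i in \<open>auto intro: borel_measurable_diff\<close>)
  then show ?thesis using i by (simp add: pairT_def set_lebesgue_integral_def)
qed

lemma pairT_diff_right:
  fixes P :: "real^'n \<Rightarrow> real \<Rightarrow> real"
  assumes P: "L2Q D T P" "AE t\<in>{0<..<T} in lborel. ipDt P P t \<le> C"
    and g: "L1L2 D T g" "L1L2 D T h" "L1L2 D T (\<lambda>x t. g x t - h x t)"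
  shows "pairT D T P (\<lambda>x t. g x t - h x t) = pairT D T P g - pairT D T P h"
proof -
  note i = L1L2_pairing(1)[OF P g(1)] L1L2_pairing(1)[OF P g(2)] L1L2_pairing(1)[OF P g(3)]
  have "(LBINT t. indicator {0<..<T} t * ipD D (sl P t) (\<lambda>x. g x t - h x t)) =
     (LBINT t. indicator {0<..<T} t * ipDt P g t - indicator {0<..<T} t * ipDt P h t)"
  proof (rule integral_cong_AE)
    show "AE t in lborel. indicator {0<..<T} t * ipD D (sl P t) (\<lambda>x. g x t - h x t) =
       indicator {0<..<T} t * ipDt P g t - indicator {0<..<T} t * ipDt P h t"
      using L2Q_slice[OF P(1)] L1L2_D(2)[OF g(1)] L1L2_D(2)[OF g(2)]
      by eventually_elim (auto simp: ipD_diff_right split: split_indicator)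
  qed (use i in \<open>auto intro: borel_measurable_diff\<close>)
  then show ?thesis using i by (simp add: pairT_def set_lebesgue_integral_def)
qed

text \<open>Truncation at height k. Bounded functions are square integrable on the bounded cylinder,
  and dominated convergence is used twice, on each slice and then in time.\<close>

lemma L1L2_approx:
  assumes g: "L1L2 D T g"
  shows "\<exists>h. (\<forall>k. L2Q D T (h k) \<and> L1L2 D T (h k) \<and> L1L2 D T (\<lambda>x t. g x t - h k x t)) \<and>
    (\<lambda>k::nat. LBINT t. indicator {0<..<T} t * sqrt (ipD D (\<lambda>x. g x t - h k x t) (\<lambda>x. g x t - h k x t))) \<longlonglongrightarrow> 0"
proof -
  define h where "h k x t = (if \<bar>g x t\<bar> \<le> real k then g x t else 0)" for k :: nat and x t
  note gm[measurable] = L1L2_D(1)[OF g]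
  have hm[measurable]: "(\<lambda>p. h k (fst p) (snd p)) \<in> borel_measurable borel" for k unfolding h_def by measurable
  have dm[measurable]: "(\<lambda>p. g (fst p) (snd p) - h k (fst p) (snd p)) \<in> borel_measurable borel" for k by measurable
  have hL: "L2Q D T (h k)" for k
    unfolding L2Q_iff
  proof
    show "L2 lborel (exQ (h k))"
    proof (rule L2I_bound)
      show "exQ (h k) \<in> borel_measurable lborel" unfolding exQ_def[abs_def] by measurable
      show "integrable lborel (\<lambda>p. indicator (QT D T) p * (real k)\<^sup>2)"
        using QT_finite by (intro integrable_mult_left integrable_real_indicator) auto
      have "(h k x t)\<^sup>2 \<le> (real k)\<^sup>2" for x t using power_mono[of "\<bar>h k x t\<bar>" "real k" 2] by (auto simp: h_def)
      then show "AE p in lborel. (norm (exQ (h k) p))\<^sup>2 \<le> indicator (QT D T) p * (real k)\<^sup>2"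
        by (intro AE_I2) (auto simp: exQ_def split: split_indicator)
    qed
  qed (rule hm)
  have h1: "L1L2 D T (h k)" for k by (rule L1L2_dominated[OF g hm]) (simp add: h_def)
  have d1: "L1L2 D T (\<lambda>x t. g x t - h k x t)" for k by (rule L1L2_dominated[OF g dm]) (simp add: h_def)
  note [measurable] = ipD_measurable[OF dm dm]
  have pt: "\<forall>\<^sub>F k in sequentially. g x t - h k x t = 0" for x t
  proof -
    obtain N :: nat where "\<bar>g x t\<bar> \<le> real N" using real_arch_simple by blast
    then show ?thesis by (intro eventually_sequentiallyI[of N]) (auto simp: h_def)
  qed
  have "(\<lambda>k. LBINT t. indicator {0<..<T} t * sqrt (ipD D (\<lambda>x. g x t - h k x t) (\<lambda>x. g x t - h k x t))) \<longlonglongrightarrow> (\<integral>t. 0 \<partial>(lborel :: real measure))"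
  proof (rule integral_dominated_convergence[OF _ _ L1L2_D(3)[OF g]])
    show "AE t in lborel. (\<lambda>k. indicator {0<..<T} t * sqrt (ipD D (\<lambda>x. g x t - h k x t) (\<lambda>x. g x t - h k x t))) \<longlonglongrightarrow> 0"
      using L1L2_D(2)[OF g]
    proof eventually_elim
      case (elim t)
      show ?case
      proof (cases "t \<in> {0<..<T}")
        case True
        have "(\<lambda>k. LBINT x. (norm (ex (\<lambda>x. g x t - h k x t) x))\<^sup>2) \<longlonglongrightarrow> (\<integral>x. 0 \<partial>(lborel :: (real^'n) measure))"
        proof (rule integral_dominated_convergence)
          show "integrable lborel (\<lambda>x. (norm (ex (sl g t) x))\<^sup>2)" using elim True by (intro L2_int L2D_ex) auto
          show "(\<lambda>x. (norm (ex (\<lambda>x. g x t - h k x t) x))\<^sup>2) \<in> borel_measurable lborel" for k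
            using slice_measurable[of "\<lambda>x t. g x t - h k x t" t, OF dm] unfolding ex_def[abs_def] by measurable
          show "AE x in lborel. (\<lambda>k. (norm (ex (\<lambda>x. g x t - h k x t) x))\<^sup>2) \<longlonglongrightarrow> 0"
          proof (intro AE_I2 tendsto_eventually)
            fix x
            show "\<forall>\<^sub>F k in sequentially. (norm (ex (\<lambda>x. g x t - h k x t) x))\<^sup>2 = 0"
              using pt[of x t] by eventually_elim (simp add: ex_def)
          qed
          show "AE x in lborel. norm ((norm (ex (\<lambda>x. g x t - h k x t) x))\<^sup>2) \<le> (norm (ex (sl g t) x))\<^sup>2" for k
            by (intro AE_I2) (auto simp: ex_def h_def)
        qed simp
        then have "(\<lambda>k. sqrt (ipD D (\<lambda>x. g x t - h k x t) (\<lambda>x. g x t - h k x t))) \<longlonglongrightarrow> sqrt 0"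
          unfolding ipD_self nsq_def by (intro tendsto_real_sqrt) simp
        then show ?thesis using True by simp
      qed simp
    qed
    show "AE t in lborel. norm (indicator {0<..<T} t * sqrt (ipD D (\<lambda>x. g x t - h k x t) (\<lambda>x. g x t - h k x t)))
        \<le> indicator {0<..<T} t * sqrt (ipDt g g t)" for k
      using L1L2_D(2)[OF g]
    proof eventually_elim
      case (elim t)
      then have "t \<in> {0<..<T} \<Longrightarrow> ipD D (\<lambda>x. g x t - h k x t) (\<lambda>x. g x t - h k x t) \<le> ipDt g g t"
        by (intro L2D_dominated(2) slice_measurable[OF dm]) (auto simp: h_def)
      then show ?case by (auto simp: ipD_self_nonneg split: split_indicator)
    qed
  qed measurable
  with hL h1 d1 show ?thesis by (intro exI[of _ h]) auto
qed

end

text \<open>Pressure differences along a filter, detached from the fluid equations: bounded in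
  L^2(D) uniformly in time, of mean zero, and with gradients tending to 0 against products of test
  functions.\<close>

locale bounded_pressures = space_time D T for D :: "(real^'n::finite) set" and T :: real +
  fixes P :: "'i \<Rightarrow> real^'n \<Rightarrow> real \<Rightarrow> real" and F :: "'i filter" and C :: real
  assumes P: "\<forall>\<^sub>F a in F. L2Q D T (P a) \<and>
      (AE t\<in>{0<..<T} in lborel. ipD D (\<lambda>x. P a x t) (\<lambda>x. P a x t) \<le> C) \<and>
      (AE t\<in>{0<..<T} in lborel. ipD D (\<lambda>x. P a x t) (\<lambda>x. 1) = 0)"
    and C: "C \<ge> 0"
    and grad: "\<And>\<psi> v. test_on {0<..<T} \<psi> \<Longrightarrow> test_on D v \<Longrightarrow> ((\<lambda>a. J (P a) (divv v) \<psi>) \<longlongrightarrow> 0) F"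
    and connected: "connected D" and nonempty: "D \<noteq> {}"
begin

text \<open>For a fixed \<psi> the weighted time average of \<open>P a\<close> is a function on D.
  These averages are bounded, have mean zero and vanishing weak gradient, so the result on a single
  domain applies.\<close>

lemma J_test_zero:
  assumes \<psi>: "test_on {0<..<T} \<psi>" and r: "L2D D r"
  shows "((\<lambda>a. J (P a) r \<psi>) \<longlongrightarrow> 0) F"
proof -
  obtain B where B: "\<And>t. \<bar>\<psi> t\<bar> \<le> B" using test_on_bounded[OF \<psi>] by auto
  have \<psi>m[measurable]: "\<psi> \<in> borel_measurable borel" by (rule test_on_L2(3)[OF \<psi>])
  \<comment> \<open>The representer exists for the square-integrable \<open>P a\<close>, hence for
    all indices that matter along the filter.\<close>
  define m where "m a = (SOME m. L2D D m \<and> (\<forall>r. L2D D r \<longrightarrow> ipD D m r = J (P a) r \<psi>))" for a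
  have m: "L2D D (m a)" "\<And>r. L2D D r \<Longrightarrow> ipD D (m a) r = J (P a) r \<psi>" if Pa: "L2Q D T (P a)" for a
  proof -
    have "L2Q D T (\<lambda>x t. \<psi> t * P a x t)"
      unfolding L2Q_iff
    proof
      have [measurable]: "(\<lambda>p. P a (fst p) (snd p)) \<in> borel_measurable borel" using Pa by (simp add: L2Q_iff)
      show "(\<lambda>p. \<psi> (snd p) * P a (fst p) (snd p)) \<in> borel_measurable borel" by measurable
      have "L2 lborel (\<lambda>p. \<psi> (snd p) *\<^sub>R exQ (P a) p)"
        by (rule L2_mult_bounded[where B=B]) (use Pa B in \<open>auto simp: L2Q_iff\<close>)
      then show "L2 lborel (exQ (\<lambda>x t. \<psi> t * P a x t))" by (simp add: exQ_def[abs_def] mult.left_commute)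
    qed
    moreover have "ipD D (\<lambda>x. \<psi> t * P a x t) r = ipD D (\<lambda>x. P a x t) r * \<psi> t" for t r
      using ipD_scaleR_left[of "\<psi> t" "\<lambda>x. P a x t" r] by simp
    ultimately have "\<exists>m. L2D D m \<and> (\<forall>r. L2D D r \<longrightarrow> ipD D m r = J (P a) r \<psi>)"
      using time_mean[of "\<lambda>x t. \<psi> t * P a x t"] by (simp add: J_def set_lebesgue_integral_def)
    from someI_ex[OF this] show "L2D D (m a)" "\<And>r. L2D D r \<Longrightarrow> ipD D (m a) r = J (P a) r \<psi>"
      unfolding m_def by auto
  qed
  interpret weakly_gradient_free D T m F "T * C * (B\<^sup>2 * T)"
  proof
    show "\<forall>\<^sub>F a in F. L2D D (m a) \<and> ipD D (m a) (m a) \<le> T * C * (B\<^sup>2 * T)"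
      using P
    proof eventually_elim
      case (elim a)
      \<comment> \<open>The representer is paired with itself: X is at most the square root of T C
        B^2 T X, which bounds X.\<close>
      define X where "X = ipD D (m a) (m a)"
      note ma = m[of a] and Pa = nsq_exQ_le[of "P a" C]
      have "X = J (P a) (m a) \<psi>" using ma elim by (simp add: X_def)
      also have "\<dots> \<le> sqrt (nsq lborel (exQ (P a))) * sqrt (B\<^sup>2 * T * X)"
        using J_bound[OF _ ma(1) \<psi>m B, of "P a"] elim by (auto simp: X_def abs_le_iff)
      also have "\<dots> \<le> sqrt (T * C) * sqrt (B\<^sup>2 * T * X)"
        using Pa elim by (intro mult_right_mono real_sqrt_le_mono) (auto simp: X_def ipD_self_nonneg T less_imp_le)
      finally have "X \<le> sqrt (T * C * (B\<^sup>2 * T) * X)" by (simp add: real_sqrt_mult mult.assoc)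
      moreover have X0: "X \<ge> 0" by (simp add: X_def ipD_self_nonneg)
      ultimately have "X * X \<le> T * C * (B\<^sup>2 * T) * X"
        using power_mono[of X "sqrt (T * C * (B\<^sup>2 * T) * X)" 2] T C by (simp add: power2_eq_square)
      then have "X \<le> T * C * (B\<^sup>2 * T)" using X0 T C by (cases "X = 0") (auto simp: mult_le_cancel_right)
      then show ?case using ma elim by (simp add: X_def)
    qed
    show "((\<lambda>a. ipD D (m a) (divv v)) \<longlongrightarrow> 0) F" if v: "test_on D v" for v
    proof (rule Lim_transform_eventually[OF grad[OF \<psi> v]])
      have "L2D D (divv v)"
        using L2D_bounded_linear[OF trG_linear gradv_test(1)[OF v]] by (simp add: trG_gradv)
      then show "\<forall>\<^sub>F a in F. J (P a) (divv v) \<psi> = ipD D (m a) (divv v)"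
        using P by (auto elim!: eventually_mono simp: m)
    qed
  qed (rule connected nonempty)+
  have "((\<lambda>a. ipD D (m a) r) \<longlongrightarrow> 0) F"
  proof (rule weak_limit_zero[OF _ r], rule tendsto_eventually)
    show "\<forall>\<^sub>F a in F. ipD D (m a) (\<lambda>x. 1) = 0"
      using P
    proof eventually_elim
      case (elim a)
      then have "ipD D (m a) (\<lambda>x. 1) = J (P a) (\<lambda>x. 1) \<psi>" by (intro m L2D_const) auto
      also have "\<dots> = 0" unfolding J_def set_lebesgue_integral_def
      proof (rule integral_eq_zero_AE)
        have "AE t\<in>{0<..<T} in lborel. ipD D (\<lambda>x. P a x t) (\<lambda>x. 1) = 0" using elim by simp
        then show "AE t in lborel. indicator {0<..<T} t *\<^sub>R (ipD D (\<lambda>x. P a x t) (\<lambda>x. 1) * \<psi> t) = 0"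
          by eventually_elim (auto split: split_indicator)
      qed
      finally show ?case .
    qed
  qed
  moreover have "\<forall>\<^sub>F a in F. ipD D (m a) r = J (P a) r \<psi>"
    using P by (rule eventually_mono) (auto intro: m r)
  ultimately show ?thesis by (rule Lim_transform_eventually)
qed

text \<open>The bound is uniform in time, so the time weight enters only through its L^1 norm; this
  allows it to be changed from a bump to an indicator.\<close>

lemma J_L1_bound:
  assumes Pa: "L2Q D T p" "AE t\<in>{0<..<T} in lborel. ipDt p p t \<le> C"
    and r: "L2D D r" and m: "\<phi> \<in> borel_measurable borel" "\<And>t. \<bar>\<phi> t\<bar> \<le> B" and i: "integrable lborel \<phi>"
  shows "\<bar>J p r \<phi>\<bar> \<le> sqrt C * sqrt (ipD D r r) * (LBINT t. \<bar>\<phi> t\<bar>)"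
proof -
  have "\<bar>J p r \<phi>\<bar> \<le> (LBINT t. \<bar>indicator {0<..<T} t * (ipD D (sl p t) r * \<phi> t)\<bar>)"
    unfolding J_def set_lebesgue_integral_def real_scaleR_def by (rule integral_abs_bound)
  also have "\<dots> \<le> (LBINT t. sqrt C * sqrt (ipD D r r) * \<bar>\<phi> t\<bar>)"
  proof (rule integral_mono_AE)
    show "integrable lborel (\<lambda>t. \<bar>indicator {0<..<T} t * (ipD D (sl p t) r * \<phi> t)\<bar>)"
      by (rule integrable_abs[OF J_pairing(4)[OF Pa(1) r m]])
    show "integrable lborel (\<lambda>t. sqrt C * sqrt (ipD D r r) * \<bar>\<phi> t\<bar>)" using i by simp
    show "AE t in lborel. \<bar>indicator {0<..<T} t * (ipD D (sl p t) r * \<phi> t)\<bar> \<le> sqrt C * sqrt (ipD D r r) * \<bar>\<phi> t\<bar>"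
      using L2Q_slice[OF Pa(1)] Pa(2)
    proof eventually_elim
      case (elim t)
      show ?case
      proof (cases "t \<in> {0<..<T}")
        case True
        then have "\<bar>ipD D (sl p t) r\<bar> \<le> sqrt (ipDt p p t) * sqrt (ipD D r r)"
          using elim r by (intro ipD_Cauchy_Schwarz) auto
        also have "\<dots> \<le> sqrt C * sqrt (ipD D r r)"
          using elim True by (intro mult_right_mono real_sqrt_le_mono) (auto simp: ipD_self_nonneg)
        finally show ?thesis using True by (simp add: abs_mult mult_right_mono)
      qed (simp add: C ipD_self_nonneg)
    qed
  qed
  finally show ?thesis by simp
qed

text \<open>A bump close to the indicator in L^1 serves all indices at once.\<close>

lemma J_interval_zero:
  assumes r: "L2D D r" and st: "{s<..<t} \<subseteq> {0<..<T}"
  shows "((\<lambda>a. J (P a) r (indicator {s<..<t})) \<longlongrightarrow> 0) F"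
proof (rule tendstoI)
  fix e :: real assume e: "e > 0"
  define K where "K = sqrt C * sqrt (ipD D r r)"
  have fin: "emeasure lborel {s<..<t} < \<infinity>" by (intro emeasure_bounded_finite) simp
  have Ii: "integrable lborel (indicator {s<..<t} :: real \<Rightarrow> real)" using fin by (intro integrable_real_indicator) auto
  have bt: "test_on {0<..<T} (bump s t n)" for n by (rule test_on_real_bump[OF st])
  have bi: "integrable lborel (bump s t n)" and bm[measurable]: "bump s t n \<in> borel_measurable borel" for n
    using test_on_L2(2,3)[OF bt] by auto
  have "(\<lambda>n. LBINT x. bump s t n x) \<longlonglongrightarrow> (LBINT x. indicator {s<..<t} x)"
    using integral_mult_bump_tendsto[of s t "\<lambda>_. 1"] Ii by (simp add: set_integrable_def)
  then have "(\<lambda>n. K * ((LBINT x. indicator {s<..<t} x) - (LBINT x. bump s t n x))) \<longlonglongrightarrow>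
     K * ((LBINT x. indicator {s<..<t} x) - (LBINT x. indicator {s<..<t} x))" by (intro tendsto_intros)
  from order_tendstoD(2)[OF this, of "e / 2"] e
  obtain n where n: "K * ((LBINT x. indicator {s<..<t} x) - (LBINT x. bump s t n x)) < e / 2"
    by (auto simp: eventually_sequentially)
  define \<phi> where "\<phi> x = indicator {s<..<t} x - bump s t n x" for x
  have \<phi>01: "0 \<le> \<phi> x" "\<phi> x \<le> 1" for x
    using bump_bounds[of s t n x] bump_support'[of x s t n] by (auto simp: \<phi>_def split: split_indicator)
  have \<phi>m: "\<phi> \<in> borel_measurable borel" unfolding \<phi>_def[abs_def] by measurable
  have \<phi>b: "\<bar>\<phi> x\<bar> \<le> 1" for x using \<phi>01[of x] by simp
  have \<phi>i: "integrable lborel \<phi>" unfolding \<phi>_def[abs_def] using Ii bi by simp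
  have \<phi>int: "(LBINT x. \<bar>\<phi> x\<bar>) = (LBINT x. indicator {s<..<t} x) - (LBINT x. bump s t n x)"
    using \<phi>01(1) Ii bi by (simp add: \<phi>_def)
  have "\<forall>\<^sub>F a in F. \<bar>J (P a) r (bump s t n)\<bar> < e / 2"
    using order_tendstoD(2)[OF tendsto_rabs_zero[OF J_test_zero[OF bt r]], of "e / 2"] e by simp
  with P show "\<forall>\<^sub>F a in F. dist (J (P a) r (indicator {s<..<t})) 0 < e"
  proof eventually_elim
    case (elim a)
    have bb: "\<bar>bump s t n x\<bar> \<le> 1" for x using bump_bounds[of s t n x] by simp
    have "J (P a) r (indicator {s<..<t}) = J (P a) r \<phi> + J (P a) r (bump s t n)"
      unfolding J_def set_lebesgue_integral_def real_scaleR_def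
      using J_pairing(4)[OF _ r \<phi>m \<phi>b, of "P a"] J_pairing(4)[OF _ r bm[of n] bb, of "P a"] elim
      by (subst Bochner_Integration.integral_add[symmetric]) (auto simp: \<phi>_def algebra_simps)
    moreover have "\<bar>J (P a) r \<phi>\<bar> < e / 2"
      using J_L1_bound[OF _ _ r \<phi>m \<phi>b \<phi>i, of "P a"] elim n by (simp add: K_def \<phi>int)
    ultimately show ?case using elim by simp
  qed
qed

text \<open>Space-time boxes are products of a spatial box and a time interval, which are already
  treated; the generation argument for boxes covers the rest.\<close>

lemma L2Q_zero:
  assumes g: "L2Q D T g"
  shows "((\<lambda>a. pairT D T (P a) g) \<longlongrightarrow> 0) F"
proof -
  have bnd: "\<forall>\<^sub>F a in F. L2 lborel (exQ (P a)) \<and> nsq lborel (exQ (P a)) \<le> T * C"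
    using P by eventually_elim (auto simp: L2Q_iff intro: nsq_exQ_le)
  have out: "exQ (P a) p = 0" if "p \<notin> QT D T" for a p using that by (simp add: exQ_def)
  have box: "((\<lambda>a. LBINT p. indicator A p * exQ (P a) p) \<longlongrightarrow> 0) F" if A: "A \<in> range (\<lambda>(a, b). box a b)" for A
  proof -
    obtain c s d t where A: "A = box (c, s) (d, t)" using A by auto
    have Abox: "(x, r) \<in> A \<longleftrightarrow> x \<in> box c d \<and> s < r \<and> r < t" for x r
      unfolding A by (auto simp: mem_box Basis_prod_def)
    have r: "L2D D (indicator (box c d) :: _ \<Rightarrow> real)"
      by (rule L2D_dominated(1)[OF L2D_const[of 1]]) (auto split: split_indicator)
    \<comment> \<open>The zero extension vanishes outside (0, T), so the time interval of the box
      may be cut accordingly.\<close>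
    define s' t' where "s' = max s 0" and "t' = min t T"
    have ib: "\<bar>indicator {s'<..<t'} x\<bar> \<le> (1::real)" for x by (auto split: split_indicator)
    have im: "(indicator {s'<..<t'} :: real \<Rightarrow> real) \<in> borel_measurable borel" by simp
    have "((\<lambda>a. J (P a) (indicator (box c d)) (indicator {s'<..<t'})) \<longlongrightarrow> 0) F"
      by (rule J_interval_zero[OF r]) (auto simp: s'_def t'_def)
    moreover have "\<forall>\<^sub>F a in F. J (P a) (indicator (box c d)) (indicator {s'<..<t'}) = (LBINT p. indicator A p * exQ (P a) p)"
      using P
    proof eventually_elim
      case (elim a)
      have e: "exQ (P a) p \<bullet> exQ (\<lambda>x t. indicator {s'<..<t'} t *\<^sub>R indicator (box c d) x) p = indicator A p * exQ (P a) p" for p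
        by (cases p) (auto simp: exQ_def Abox s'_def t'_def split: split_indicator)
      have "L2Q D T (P a)" using elim by simp
      from J_pairing(1)[OF this r im ib] show ?case unfolding e by simp
    qed
    ultimately show ?thesis by (rule Lim_transform_eventually)
  qed
  obtain b where b: "QT D T \<subseteq> box (- b) b"
    using bounded_subset_box_symmetric[of "QT D T"] bounded_Times[OF D_bounded, of "{0<..<T}"] by auto
  have e: "indicator (box (- b) b) p * exQ (P a) p = exQ (P a) p" for a p
    using b by (auto simp: exQ_def split: split_indicator)
  have "box (- b) b \<in> range (\<lambda>(a, b). box a b)" by auto
  from box[OF this] have whole: "((\<lambda>a. LBINT p. exQ (P a) p) \<longlongrightarrow> 0) F" unfolding e .
  have "((\<lambda>a. LBINT p. exQ g p * exQ (P a) p) \<longlongrightarrow> 0) F"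
  proof (rule weak_limit_L2[OF bnd])
    show "L2 lborel (exQ g)" using g by (simp add: L2Q_iff)
    show "((\<lambda>a. LBINT p. indicator A p * exQ (P a) p) \<longlongrightarrow> 0) F" if "A \<in> sets borel" for A
      by (rule weak_limit_sets[OF QT_sets QT_finite bnd out whole borel_eq_sigma_box Int_stable_box box that])
  qed
  moreover have "\<forall>\<^sub>F a in F. (LBINT p. exQ g p * exQ (P a) p) = pairT D T (P a) g"
    using P by eventually_elim (use pairing_eq(1)[OF _ g] in \<open>simp add: pairT_def mult.commute\<close>)
  ultimately show ?thesis by (rule Lim_transform_eventually)
qed

text \<open>Density of square-integrable functions in the predual, combined with the bound that is
  uniform along the filter.\<close>

theorem L1L2_zero:
  assumes g: "L1L2 D T g"
  shows "((\<lambda>a. pairT D T (P a) g) \<longlongrightarrow> 0) F"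
proof (rule tendstoI)
  fix e :: real assume e: "e > 0"
  obtain h where h: "(\<forall>k. L2Q D T (h k) \<and> L1L2 D T (h k) \<and> L1L2 D T (\<lambda>x t. g x t - h k x t)) \<and>
    (\<lambda>k::nat. LBINT t. indicator {0<..<T} t * sqrt (ipD D (\<lambda>x. g x t - h k x t) (\<lambda>x. g x t - h k x t))) \<longlonglongrightarrow> 0"
    using L1L2_approx[OF g] ..
  then have hk: "L2Q D T (h k)" "L1L2 D T (h k)" "L1L2 D T (\<lambda>x t. g x t - h k x t)" for k by blast+
  from order_tendstoD(2)[OF tendsto_mult_right_zero[OF conjunct2[OF h], of "sqrt C"], of "e / 2"] e
  obtain k where k: "sqrt C * (LBINT t. indicator {0<..<T} t * sqrt (ipD D (\<lambda>x. g x t - h k x t) (\<lambda>x. g x t - h k x t))) < e / 2"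
    by (auto simp: eventually_sequentially)
  have "\<forall>\<^sub>F a in F. \<bar>pairT D T (P a) (h k)\<bar> < e / 2"
    using order_tendstoD(2)[OF tendsto_rabs_zero[OF L2Q_zero[OF hk(1)]], of "e / 2"] e by simp
  with P show "\<forall>\<^sub>F a in F. dist (pairT D T (P a) g) 0 < e"
  proof eventually_elim
    case (elim a)
    then have Pa: "L2Q D T (P a)" "AE t\<in>{0<..<T} in lborel. ipD D (\<lambda>x. P a x t) (\<lambda>x. P a x t) \<le> C" by auto
    have "\<bar>pairT D T (P a) g - pairT D T (P a) (h k)\<bar> < e / 2"
      using L1L2_pairing(2)[OF Pa hk(3), of k] k pairT_diff_right[OF Pa g hk(2,3), of k] by linarith
    then show ?case using elim(2) unfolding dist_real_def by linarith
  qed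
qed

end

section \<open>Bounds for the limit pressure and the momentum balance\<close>

context limit_problem
begin

text \<open>The energy inequality for q itself, with right-hand side \<open>qt\<close> and no
  gradient data, so that the test data coincide with the test function.\<close>

lemma q_bounded:
  assumes q0: "L2D D q0" and q_eq: "\<forall>r. L2D D r \<longrightarrow> (AE t\<in>{0<..<T} in lborel. ipD D (sl q t) r =
      ipD D q0 r + (LBINT s. indicator {0<..<t} s * ipD D (sl qt s) r))"
  shows "\<exists>B. AE t\<in>{0<..<T} in lborel. ipDt q q t \<le> B"
proof -
  have "AE s\<in>{0<..<T} in lborel. L2D D (sl q s) \<and> (sl q s) = (sl q s)"
    using L2Q_slice[OF q] by simp
  from energy_Q[OF q q qt q0, of "\<lambda>v V. L2D D v \<and> V = v", OF this]
  have "AE t\<in>{0<..<T} in lborel. ipDt q q t \<le> ipD D q0 q0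
    + 2 * (LBINT r. indicator {0<..<t} r * ipDt qt q r)"
    using q_eq by auto
  moreover have "\<bar>\<integral>r. indicator {0<..<t} r * ipDt qt q r \<partial>lborel\<bar> \<le>
      (LBINT r. \<bar>indicator {0<..<T} r * ipDt qt q r\<bar>)" if "t \<le> T" for t
    using box_partial_integral_measurable(2)[OF pairing_eq(2)[OF qt q], of t]
      partial_integral_restrict[OF that, of "\<lambda>r. ipDt qt q r"] by simp
  ultimately show ?thesis
    by (intro exI[of _ "ipD D q0 q0 + 2 * (LBINT r. \<bar>indicator {0<..<T} r * ipDt qt q r\<bar>)"])
      (elim eventually_mono, smt (verit, best) greaterThanLessThan_iff)
qed


text \<open>The constant in the bound for the pressure gradient: inertia and force on the first
  line, the two viscosities on the others. B is to bound \<psi> and its derivative; \<alpha> does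
  not occur.\<close>

definition pC :: "(real^'n \<Rightarrow> real) \<Rightarrow> real \<Rightarrow> (real^'n \<Rightarrow> real^'n) \<Rightarrow> real" where
  "pC q0 B v = (\<rho>0 * sqrt (T * (gB q0 / \<rho>0)) + sqrt (T * M\<^sup>2 * (2 * (\<rho>0 * gB q0)) + M\<^sup>2 * (2 * nsq lborel (exQ q)))) * sqrt (B\<^sup>2 * T * ipD D v v)
    + \<mu> * sqrt (gG q0) * sqrt (B\<^sup>2 * T * ipD D (gradv v) (gradv v))
    + \<eta> * sqrt (gG q0) * sqrt (B\<^sup>2 * T * ipD D (\<lambda>x. divv v x *\<^sub>R (mat 1 :: real^'n^'n)) (\<lambda>x. divv v x *\<^sub>R mat 1))"

end

context compressible
begin

text \<open>The difference of the two momentum equations solved for the pressure term. Test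
  functions vanish near t = 0, so initial values play no part.\<close>

lemma pressure_identity:
  assumes \<psi>: "test_on {0<..<T} \<psi>" and v: "test_on D v"
  shows "J \<pi> (divv v) \<psi> = - \<rho>0 * J z v (deriv \<psi>) - \<alpha> * J (\<lambda>x t. p x t *\<^sub>R f x t) v \<psi>
     + \<mu> * J Gz (gradv v) \<psi> + \<eta> * J Gz (\<lambda>x. divv v x *\<^sub>R mat 1) \<psi>"
proof -
  note v0 = test_on_H01[OF v]
  note L = H01_L2D[OF v0]
  have dv: "L2D D (divv v)"
    using L2D_bounded_linear[OF trG_linear L(2)] by (simp add: trG_gradv)
  have dvI: "L2D D (\<lambda>x. divv v x *\<^sub>R (mat 1 :: real^'n^'n))"
    by (rule L2D_bounded_linear[OF bounded_linear_scaleR_left dv])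
  obtain B where B: "\<And>t. \<bar>\<psi> t\<bar> \<le> B" using test_on_bounded[OF \<psi>] by auto
  note m = test_on_L2(3)[OF \<psi>]
  obtain B' where B': "\<And>t. \<bar>deriv \<psi> t\<bar> \<le> B'" using test_on_bounded[OF test_on_deriv[OF \<psi>]] by auto
  note m' = test_on_L2(3)[OF test_on_deriv[OF \<psi>]]
  have trJ: "J (\<lambda>x t. s x t *\<^sub>R mat 1) (gradv v) \<psi> = J s (divv v) \<psi>" for s
    unfolding J_def ipD_trG[symmetric] trG_gradv ..
  have uz: "J (\<lambda>x t. \<rho>0 *\<^sub>R u x t) v (deriv \<psi>) = J (\<lambda>x t. \<rho>0 *\<^sub>R w x t) v (deriv \<psi>) + \<rho>0 * J z v (deriv \<psi>)"
    using J_add[OF L2Q_scaleR[OF w, of \<rho>0] L2Q_scaleR[OF z, of \<rho>0] L(1) m' B']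
    by (simp add: J_scaleR z_def[abs_def] scaleR_add_right[symmetric] del: scaleR_right_diff_distrib)
  define H where "H x t = (\<alpha> *\<^sub>R (p x t *\<^sub>R f x t), \<pi> x t *\<^sub>R mat 1 + ((- \<mu>) *\<^sub>R Gz x t + (- \<eta>) *\<^sub>R (trG (Gu x t) *\<^sub>R (mat 1 :: real^'n^'n))))" for x t
  have H2: "L2Q D T (\<lambda>x t. (- \<mu>) *\<^sub>R Gz x t + (- \<eta>) *\<^sub>R (trG (Gu x t) *\<^sub>R (mat 1 :: real^'n^'n)))"
    by (intro L2Q_add L2Q_scaleR Gz I_L2Q divu)
  have HL: "L2Q D T H" unfolding H_def[abs_def] by (intro L2Q_Pair L2Q_scaleR pf L2Q_add I_L2Q \<pi> Gz divu)
  have "Fu = (\<lambda>x t. Fw x t + H x t)"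
    using Ef_eq by (intro ext) (simp add: Ef_def H_def algebra_simps)
  then have "J Fu (\<lambda>x. (v x, gradv v x)) \<psi> = J Fw (\<lambda>x. (v x, gradv v x)) \<psi> + J H (\<lambda>x. (v x, gradv v x)) \<psi>"
    using J_add[OF Fw HL L2D_Pair[OF L] m B] by simp
  moreover have "J H (\<lambda>x. (v x, gradv v x)) \<psi> = \<alpha> * J (\<lambda>x t. p x t *\<^sub>R f x t) v \<psi> +
     (J \<pi> (divv v) \<psi> + ((- \<mu>) * J Gz (gradv v) \<psi> + (- \<eta>) * J (\<lambda>x t. trG (Gu x t)) (divv v) \<psi>))"
    unfolding H_def[abs_def]
    by (simp only: J_Pair[OF L2Q_scaleR[OF pf] L2Q_add[OF I_L2Q[OF \<pi>] H2] L m B]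
        J_add[OF I_L2Q[OF \<pi>] H2 L(2) m B] J_add[OF L2Q_scaleR[OF Gz] L2Q_scaleR[OF I_L2Q[OF divu]] L(2) m B] J_scaleR trJ)
  \<comment> \<open>Because w is divergence free, div u is the trace of \<open>Gz\<close>; the term
    is thus controlled by the small gradient.\<close>
  moreover have "J (\<lambda>x t. trG (Gu x t)) (divv v) \<psi> = J Gz (\<lambda>x. divv v x *\<^sub>R mat 1) \<psi>"
    unfolding J_def set_lebesgue_integral_def real_scaleR_def
  proof (rule integral_cong_AE)
    show "AE t in lborel. indicator {0<..<T} t * (ipD D (\<lambda>x. trG (Gu x t)) (divv v) * \<psi> t) =
       indicator {0<..<T} t * (ipD D (sl Gz t) (\<lambda>x. divv v x *\<^sub>R mat 1) * \<psi> t)"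
      using L2Q_slice[OF divu] w_Vsp L2Q_slice[OF Gw]
    proof eventually_elim
      case (elim t)
      show ?case
      proof (cases "t \<in> {0<..<T}")
        case True
        then have S: "L2D D (\<lambda>x. trG (Gu x t))" "L2D D (sl Gw t)" "Vsp D (sl w t) (sl Gw t)"
          using elim by auto
        have "trG (Gz x t) = trG (Gu x t) - trG (Gw x t)" for x
          unfolding Gz_def by (rule linear_diff[OF bounded_linear.linear[OF trG_linear]])
        then have "ipD D (divv v) (\<lambda>x. trG (Gu x t)) = ipD D (divv v) (\<lambda>x. trG (Gz x t))"
          using ipD_diff_right[OF dv S(1) L2D_bounded_linear[OF trG_linear S(2)]] Vsp_div[OF S(3) dv] by simp
        then show ?thesis
          unfolding ipD_trG ipD_commute[of "\<lambda>x. trG (Gu x t)"] ipD_commute[of "sl Gz t"] by simp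
      qed simp
    qed
  qed (use J_pairing(4)[OF divu dv m B] J_pairing(4)[OF Gz dvI m B] in auto)
  ultimately show ?thesis
    using u_test[OF test_on_test0T(1)[OF \<psi>] v0] w_H01_test[OF \<psi> v0] uz test_on_test0T(2)[OF \<psi>] by simp
qed

text \<open>Inertia is small because z is, both viscous terms because \<open>Gz\<close> is, and the
  force because of its explicit factor \<alpha> in front of a bounded quantity.\<close>

lemma pressure_bound:
  assumes \<psi>: "test_on {0<..<T} \<psi>" and v: "test_on D v"
    and B: "\<And>t. \<bar>\<psi> t\<bar> \<le> B" "\<And>t. \<bar>deriv \<psi> t\<bar> \<le> B"
  shows "\<bar>J \<pi> (divv v) \<psi>\<bar> \<le> sqrt \<alpha> * pC q0 B v"
proof -
  note L = test_on_L2D(1)[OF v] gradv_test(1)[OF v]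
  have dvI: "L2D D (\<lambda>x. divv v x *\<^sub>R (mat 1 :: real^'n^'n))"
    using L2D_bounded_linear[OF bounded_linear_scaleR_left L2D_bounded_linear[OF trG_linear L(2)]] by (simp add: trG_gradv)
  note m = test_on_L2(3)[OF \<psi>] and m' = test_on_L2(3)[OF test_on_deriv[OF \<psi>]]
  define S where "S g = sqrt (B\<^sup>2 * T * ipD D g g)" for g :: "real^'n \<Rightarrow> real^'n"
  define S' where "S' g = sqrt (B\<^sup>2 * T * ipD D g g)" for g :: "real^'n \<Rightarrow> real^'n^'n"
  have S0: "S g \<ge> 0" "S' g' \<ge> 0" for g g' using T by (simp_all add: S_def S'_def ipD_self_nonneg)
  \<comment> \<open>Brings the force term to the common order.\<close>
  have a: "\<alpha> \<le> sqrt \<alpha>" using \<alpha> by (intro real_le_rsqrt) (simp add: power2_eq_square)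
  have z': "sqrt (nsq lborel (exQ z)) \<le> sqrt \<alpha> * sqrt (T * (gB q0 / \<rho>0))"
    using nsq_exQ_le[OF z z_bound] by (simp add: real_sqrt_mult[symmetric] mult_ac)
  have Gz': "sqrt (nsq lborel (exQ Gz)) \<le> sqrt \<alpha> * sqrt (gG q0)"
    using Gz_bound pairing_eq(1)[OF Gz Gz] by (simp add: nsq_inner set_lebesgue_integral_def real_sqrt_mult[symmetric])
  have pf': "sqrt (nsq lborel (exQ (\<lambda>x t. p x t *\<^sub>R f x t))) \<le>
      sqrt (T * M\<^sup>2 * (2 * (\<rho>0 * gB q0)) + M\<^sup>2 * (2 * nsq lborel (exQ q)))"
  proof (rule real_sqrt_le_mono)
    have pL: "L2 lborel (exQ \<pi>)" "L2 lborel (exQ q)" using \<pi> q by (auto simp: L2Q_iff)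
    have "exQ p = (\<lambda>x. exQ \<pi> x + exQ q x)" by (auto simp: exQ_def \<pi>_def split: split_indicator)
    then have "nsq lborel (exQ p) \<le> 2 * nsq lborel (exQ \<pi>) + 2 * nsq lborel (exQ q)"
      using nsq_add_le[OF pL] by simp
    also have "\<dots> \<le> 2 * (T * (\<rho>0 * gB q0)) + 2 * nsq lborel (exQ q)"
      using nsq_exQ_le[OF \<pi> \<pi>_bound] by simp
    finally have np: "M\<^sup>2 * nsq lborel (exQ p) \<le> M\<^sup>2 * (2 * (T * (\<rho>0 * gB q0)) + 2 * nsq lborel (exQ q))"
      by (rule mult_left_mono) simp
    have "nsq lborel (exQ (\<lambda>x t. p x t *\<^sub>R f x t)) =
       (LBINT t. indicator {0<..<T} t * ipD D (\<lambda>x. p x t *\<^sub>R f x t) (\<lambda>x. p x t *\<^sub>R f x t))"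
      using pairing_eq(1)[OF pf pf] by (simp add: nsq_inner set_lebesgue_integral_def)
    also have "\<dots> \<le> (LBINT t. M\<^sup>2 * (indicator {0<..<T} t * ipDt p p t))"
    proof (rule integral_mono_AE[OF pairing_eq(2)[OF pf pf] integrable_mult_right[OF pairing_eq(2)[OF p p]]])
      show "AE t in lborel. indicator {0<..<T} t * ipD D (\<lambda>x. p x t *\<^sub>R f x t) (\<lambda>x. p x t *\<^sub>R f x t) \<le>
         M\<^sup>2 * (indicator {0<..<T} t * ipDt p p t)"
        using L2Q_mult_Linf(2)[OF p f_meas f_bound] by eventually_elim (auto split: split_indicator)
    qed
    also have "\<dots> = M\<^sup>2 * nsq lborel (exQ p)"
      using pairing_eq(1)[OF p p] by (simp add: nsq_inner set_lebesgue_integral_def)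
    finally show "nsq lborel (exQ (\<lambda>x t. p x t *\<^sub>R f x t)) \<le> T * M\<^sup>2 * (2 * (\<rho>0 * gB q0)) + M\<^sup>2 * (2 * nsq lborel (exQ q))"
      using np by (simp add: algebra_simps)
  qed
  define c1 c2 c3 where "c1 = sqrt (T * (gB q0 / \<rho>0))" and "c2 = sqrt (gG q0)"
    and "c3 = sqrt (T * M\<^sup>2 * (2 * (\<rho>0 * gB q0)) + M\<^sup>2 * (2 * nsq lborel (exQ q)))"
  have c3: "c3 \<ge> 0" using T \<rho>0 gB by (simp add: c3_def nsq_nonneg)
  have 1: "\<bar>J z v (deriv \<psi>)\<bar> \<le> sqrt \<alpha> * c1 * S v"
    using order_trans[OF J_bound[OF z L(1) m' B(2)] mult_right_mono[OF z' S0(1)[of v], unfolded S_def]] by (simp add: S_def c1_def)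
  have 2: "\<bar>J (\<lambda>x t. p x t *\<^sub>R f x t) v \<psi>\<bar> \<le> c3 * S v"
    using order_trans[OF J_bound[OF pf L(1) m B(1)] mult_right_mono[OF pf' S0(1)[of v], unfolded S_def]] by (simp add: S_def c3_def)
  have 3: "\<bar>J Gz (gradv v) \<psi>\<bar> \<le> sqrt \<alpha> * c2 * S' (gradv v)"
    using order_trans[OF J_bound[OF Gz L(2) m B(1)] mult_right_mono[OF Gz' S0(2)[of "gradv v"], unfolded S'_def]] by (simp add: S'_def c2_def)
  have 4: "\<bar>J Gz (\<lambda>x. divv v x *\<^sub>R mat 1) \<psi>\<bar> \<le> sqrt \<alpha> * c2 * S' (\<lambda>x. divv v x *\<^sub>R mat 1)"
    using order_trans[OF J_bound[OF Gz dvI m B(1)] mult_right_mono[OF Gz' S0(2)[of "\<lambda>x. divv v x *\<^sub>R mat 1"], unfolded S'_def]] by (simp add: S'_def c2_def)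
  have "\<bar>J \<pi> (divv v) \<psi>\<bar> \<le> \<rho>0 * \<bar>J z v (deriv \<psi>)\<bar> + \<alpha> * \<bar>J (\<lambda>x t. p x t *\<^sub>R f x t) v \<psi>\<bar>
      + \<mu> * \<bar>J Gz (gradv v) \<psi>\<bar> + \<eta> * \<bar>J Gz (\<lambda>x. divv v x *\<^sub>R mat 1) \<psi>\<bar>"
  proof -
    have e: "c * \<bar>x\<bar> = \<bar>c * x\<bar>" if "c \<ge> 0" for c x :: real using that by (simp add: abs_mult)
    show ?thesis
      unfolding pressure_identity[OF \<psi> v] e[OF less_imp_le[OF \<rho>0]] e[OF less_imp_le[OF \<alpha>(1)]] e[OF less_imp_le[OF \<mu>]] e[OF \<eta>]
      by linarith
  qed
  also have "\<dots> \<le> \<rho>0 * (sqrt \<alpha> * c1 * S v) + sqrt \<alpha> * (c3 * S v) + \<mu> * (sqrt \<alpha> * c2 * S' (gradv v)) + \<eta> * (sqrt \<alpha> * c2 * S' (\<lambda>x. divv v x *\<^sub>R mat 1))"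
    using \<rho>0 \<mu> \<eta> \<alpha> a S0 c3 by (intro add_mono mult_mono 1 2 3 4 mult_nonneg_nonneg order_refl) auto
  also have "\<dots> = sqrt \<alpha> * pC q0 B v"
    by (simp add: pC_def S_def S'_def c1_def c2_def c3_def algebra_simps)
  finally show ?thesis .
qed

end

lemma (in space_time) LinfL2I:
  fixes g :: "real^'n \<Rightarrow> real \<Rightarrow> real"
  assumes g: "L2Q D T g" and B: "AE t\<in>{0<..<T} in lborel. ipDt g g t \<le> B"
  shows "LinfL2 D T g"
proof -
  have "AE t\<in>{0<..<T} in lborel. L2D D (sl g t) \<and> (LINT x:D|lborel. (g x t)\<^sup>2) \<le> B"
    using L2Q_slice[OF g] B by eventually_elim (auto simp: ipD_def power2_eq_square)
  then show ?thesis using g by (auto simp: LinfL2_def L2Q_def)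
qed

text \<open>The estimates for a single \<alpha>, with the witness \<open>Gu\<close> hidden again,
  stated where the constants \<open>gB\<close> and \<open>pC\<close> are fixed before \<alpha> is
  chosen.\<close>

lemma (in limit_problem) compressible_pressure:
  assumes \<alpha>: "0 < \<alpha>" "\<alpha> < 1" and C: "C_weak D T \<rho>0 \<mu> \<eta> f u0 p0 \<alpha> u p"
    and q0: "L2D D q0" and q_eq: "\<forall>r. L2D D r \<longrightarrow> (AE t\<in>{0<..<T} in lborel. ipD D (sl q t) r =
      ipD D q0 r + (LBINT s. indicator {0<..<t} s * ipD D (sl qt s) r))"
  shows "L2Q D T p" "L2Q D T (\<lambda>x t. p x t - q x t)" "gB q0 \<ge> 0"
    and "AE t\<in>{0<..<T} in lborel. ipD D (\<lambda>x. p x t - q x t) (\<lambda>x. p x t - q x t) \<le> \<rho>0 * gB q0"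
    and "AE t\<in>{0<..<T} in lborel. ipD D (\<lambda>x. p x t - q x t) (\<lambda>x. 1) = 0"
    and "\<And>\<psi> v B. test_on {0<..<T} \<psi> \<Longrightarrow> test_on D v \<Longrightarrow> (\<And>t. \<bar>\<psi> t\<bar> \<le> B) \<Longrightarrow> (\<And>t. \<bar>deriv \<psi> t\<bar> \<le> B) \<Longrightarrow>
      \<bar>J (\<lambda>x t. p x t - q x t) (divv v) \<psi>\<bar> \<le> sqrt \<alpha> * pC q0 B v"
proof -
  obtain Gu where Gu: "compressible D T \<rho>0 \<mu> \<eta> f u0 p0 w q Gw qt M \<alpha> u p Gu q0"
    using C unfolding C_weak_def
    by (elim exE) (rule that, unfold_locales, use \<alpha> q0 q_eq in \<open>simp_all\<close>)
  interpret compressible D T \<rho>0 \<mu> \<eta> f u0 p0 w q Gw qt M \<alpha> u p Gu q0 by (rule Gu)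
  show "L2Q D T p" "L2Q D T (\<lambda>x t. p x t - q x t)" "gB q0 \<ge> 0" using p \<pi> gB by (simp_all add: \<pi>_def[abs_def])
  show "AE t\<in>{0<..<T} in lborel. ipD D (\<lambda>x. p x t - q x t) (\<lambda>x. p x t - q x t) \<le> \<rho>0 * gB q0"
    using \<pi>_bound by (simp add: \<pi>_def)
  show "AE t\<in>{0<..<T} in lborel. ipD D (\<lambda>x. p x t - q x t) (\<lambda>x. 1) = 0"
    using \<pi>_mean by (simp add: \<pi>_def)
  show "\<bar>J (\<lambda>x t. p x t - q x t) (divv v) \<psi>\<bar> \<le> sqrt \<alpha> * pC q0 B v"
    if "test_on {0<..<T} \<psi>" "test_on D v" "\<And>t. \<bar>\<psi> t\<bar> \<le> B" "\<And>t. \<bar>deriv \<psi> t\<bar> \<le> B" for \<psi> v B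
    using pressure_bound[OF that] by (simp add: \<pi>_def[abs_def])
qed

theorem mainTheorem9:
  fixes D :: "(real^'n::finite) set" and T \<rho>0 \<mu> \<eta> :: real
    and f :: "real^'n \<Rightarrow> real \<Rightarrow> real^'n"
    and u0 :: "real^'n \<Rightarrow> real^'n" and p0 :: "real^'n \<Rightarrow> real"
    and w :: "real^'n \<Rightarrow> real \<Rightarrow> real^'n" and q :: "real^'n \<Rightarrow> real \<Rightarrow> real"
    and u :: "real \<Rightarrow> real^'n \<Rightarrow> real \<Rightarrow> real^'n"
    and p :: "real \<Rightarrow> real^'n \<Rightarrow> real \<Rightarrow> real"
  assumes "CARD('n) \<ge> 2"
    and "pw_smooth_domain D"
    and "T > 0" and "\<rho>0 > 0" and "\<mu> > 0" and "\<eta> \<ge> 0"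
    and "LinfQ D T f" and "L2D D u0" and "L2D D p0"
    and "Jsp D u0"
    and "S_weak D T \<rho>0 \<mu> f u0 w q"
    and "dt_L2Hm1 D T w"
    and "W12L2 D T q"
    and "AE t in lborel. t \<in> {0..T} \<longrightarrow> (LINT x:D|lborel. q x t) = (LINT x:D|lborel. p0 x)"
    and "\<forall>\<alpha>. 0 < \<alpha> \<and> \<alpha> < 1 \<longrightarrow> C_weak D T \<rho>0 \<mu> \<eta> f u0 p0 \<alpha> (u \<alpha>) (p \<alpha>)"
  shows "weak_star_LinfL2 D T p q (at_right 0)"
proof -
  have D: "open D" "bounded D" "connected D" "D \<noteq> {}" using assms(2) by (auto simp: pw_smooth_domain_def)
  obtain M where M: "AE z in mQ. z \<in> QT D T \<longrightarrow> norm (case_prod f z) \<le> M"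
    using assms(7) by (auto simp: LinfQ_def)
  obtain qt where qt: "L2Q D T qt" "\<And>\<psi> r. test_on {0<..<T} \<psi> \<Longrightarrow> L2D D r \<Longrightarrow>
        (LINT t:{0<..<T}|lborel. ipD D (\<lambda>x. q x t) r * deriv \<psi> t)
      = - (LINT t:{0<..<T}|lborel. ipD D (\<lambda>x. qt x t) r * \<psi> t)"
    using assms(13) by (auto simp: W12L2_def)
  obtain Gw where "limit_problem D T \<rho>0 \<mu> \<eta> f u0 p0 w q Gw qt M"
    using assms(11) unfolding S_weak_def
    by (elim exE) (rule that, unfold_locales, use assms D M qt in \<open>simp_all add: LinfQ_def W12L2_def\<close>)
  then interpret limit_problem D T \<rho>0 \<mu> \<eta> f u0 p0 w q Gw qt M .
  obtain q0 where q0: "L2D D q0" and q_eq: "\<forall>r. L2D D r \<longrightarrow> (AE t in lborel. t \<in> {0<..<T} \<longrightarrow> ipD D (\<lambda>x. q x t) r =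
      ipD D q0 r + (\<integral>s. indicator {0<..<t} s * ipD D (\<lambda>x. qt x s) r \<partial>lborel))"
    using q_initial by blast
  obtain B where B: "AE t in lborel. t \<in> {0<..<T} \<longrightarrow> ipD D (\<lambda>x. q x t) (\<lambda>x. q x t) \<le> B"
    using q_bounded[OF q0 q_eq] by blast
  have ev: "\<forall>\<^sub>F \<alpha> in at_right 0. 0 < \<alpha> \<and> \<alpha> < (1::real)"
    by (rule eventually_at_rightI[of 0 1]) auto
  note cp = compressible_pressure[OF _ _ _ q0 q_eq]
  have Cw: "C_weak D T \<rho>0 \<mu> \<eta> f u0 p0 \<alpha> (u \<alpha>) (p \<alpha>)" if "0 < \<alpha>" "\<alpha> < 1" for \<alpha> using assms(15) that by blast
  interpret bounded_pressures D T "\<lambda>\<alpha> x t. p \<alpha> x t - q x t" "at_right 0" "\<rho>0 * gB q0"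
  proof
    show "\<forall>\<^sub>F \<alpha> in at_right 0. L2Q D T (\<lambda>x t. p \<alpha> x t - q x t) \<and>
      (AE t in lborel. t \<in> {0<..<T} \<longrightarrow> ipD D (\<lambda>x. p \<alpha> x t - q x t) (\<lambda>x. p \<alpha> x t - q x t) \<le> \<rho>0 * gB q0) \<and>
      (AE t in lborel. t \<in> {0<..<T} \<longrightarrow> ipD D (\<lambda>x. p \<alpha> x t - q x t) (\<lambda>x. 1) = 0)"
      using ev by (rule eventually_mono) (blast intro: cp(2,4,5) Cw)
    show "0 \<le> \<rho>0 * gB q0" using cp(3)[OF _ _ Cw, of "1/2"] \<rho>0 by simp
    fix \<psi> :: "real \<Rightarrow> real" and v :: "real^'n \<Rightarrow> real^'n"
    assume \<psi>: "test_on {0<..<T} \<psi>" and v: "test_on D v"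
    obtain B1 where B1: "\<And>t. \<bar>\<psi> t\<bar> \<le> B1" using test_on_bounded[OF \<psi>] by auto
    obtain B2 where B2: "\<And>t. \<bar>deriv \<psi> t\<bar> \<le> B2" using test_on_bounded[OF test_on_deriv[OF \<psi>]] by auto
    \<comment> \<open>One number has to bound both \<psi> and its derivative.\<close>
    define K where "K = pC q0 (max B1 B2) v"
    have "\<forall>\<^sub>F \<alpha> in at_right 0. norm (J (\<lambda>x t. p \<alpha> x t - q x t) (divv v) \<psi>) \<le> sqrt \<alpha> * K"
      using ev
    proof eventually_elim
      case (elim \<alpha>)
      then have "0 < \<alpha>" "\<alpha> < 1" by auto
      from cp(6)[OF this Cw[OF this] \<psi> v, of "max B1 B2"] show ?case
        by (simp add: K_def B1 B2 le_max_iff_disj)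
    qed
    moreover have "((\<lambda>\<alpha>. sqrt \<alpha> * K) \<longlongrightarrow> 0) (at_right 0)"
      using tendsto_mult_left_zero[OF tendsto_real_sqrt[OF tendsto_ident_at[of 0 "{0<..}"], simplified], of K] .
    ultimately show "((\<lambda>\<alpha>. J (\<lambda>x t. p \<alpha> x t - q x t) (divv v) \<psi>) \<longlongrightarrow> 0) (at_right 0)"
      by (rule Lim_null_comparison)
  qed (use D in auto)
  \<comment> \<open>The bounds on q and on the difference give one on p itself, as needed both for
    membership in the space and for splitting the pairing.\<close>
  have pb: "AE t in lborel. t \<in> {0<..<T} \<longrightarrow> ipD D (\<lambda>x. p \<alpha> x t) (\<lambda>x. p \<alpha> x t) \<le> 2 * (\<rho>0 * gB q0) + 2 * B"
    if "0 < \<alpha>" "\<alpha> < 1" for \<alpha>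
    using cp(4)[OF that Cw[OF that]] B L2Q_slice[OF cp(2)[OF that Cw[OF that]]] L2Q_slice[OF q]
  proof eventually_elim
    case (elim t)
    then show ?case using ipD_add_self_le[of "\<lambda>x. p \<alpha> x t - q x t" "\<lambda>x. q x t"] by auto
  qed
  show ?thesis
    unfolding weak_star_LinfL2_def
  proof (intro conjI allI impI)
    show "\<forall>\<^sub>F \<alpha> in at_right 0. LinfL2 D T (p \<alpha>)"
      using ev by (rule eventually_mono) (auto intro!: LinfL2I[OF cp(1) pb] Cw)
    show "LinfL2 D T q" by (rule LinfL2I[OF q B])
    fix g assume g: "L1L2 D T g"
    have "((\<lambda>\<alpha>. pairT D T (\<lambda>x t. p \<alpha> x t - q x t) g + pairT D T q g) \<longlongrightarrow> pairT D T q g) (at_right 0)"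
      using tendsto_add[OF L1L2_zero[OF g] tendsto_const] by simp
    moreover have "\<forall>\<^sub>F \<alpha> in at_right 0. pairT D T (\<lambda>x t. p \<alpha> x t - q x t) g + pairT D T q g = pairT D T (p \<alpha>) g"
      using ev
    proof eventually_elim
      case (elim \<alpha>)
      then have a: "0 < \<alpha>" "\<alpha> < 1" by auto
      from pairT_diff_left[OF cp(1)[OF this Cw[OF this]] pb[OF this] q B g] show ?case by simp
    qed
    ultimately show "((\<lambda>\<alpha>. pairT D T (p \<alpha>) g) \<longlongrightarrow> pairT D T q g) (at_right 0)"
      by (rule Lim_transform_eventually)
  qed
qed

end
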